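(* Let $m\ge 1$ and $N\ge 1$ be integers, $h=\frac1N$, let $p(x)$ be a weight function on $[0,1]$, and consider quadrature formulas $\int_0^1 p(x)\varphi(x)\,dx\cong\sum_{\beta=0}^N C_\beta\varphi(h\beta)$ on the space $W_2^{(m,m-1)}(0,1)$. Then the optimal coefficients (those minimizing the norm of the error functional) have the form $$ C_{\beta}=\begin{cases} (D_m*f_m)(0)+a+\sum\limits_{k=1}^{m-1}\left(a_k+b_k\lambda_k^N\right), & \beta=0,\\ (D_m*f_m)(h\beta)+\sum\limits_{k=1}^{m-1}\left(a_k\lambda_k^{\beta}+b_k\lambda_k^{N-\beta}\right), & \beta=1,\dots,N-1,\\ (D_m*f_m)(hN)+b+\sum\limits_{k=1}^{m-1}\left(a_k\lambda_k^N+b_k\right), & \beta=N, \end{cases} $$ where, with $q_{m-1}$, $Q^{(2m-3)}$, $Q^{(-)}_{m-2}$, $Q^{(+)}_{m-2}$, $a^-$, $a^+$, $f_m$, $D_m$, $A_k$, $\lambda_k$, $p_{2m-2}^{(2m-2)}$ as defined in the context, $$ a_k=\frac{A_k}{\lambda_k\,p_{2m-2}^{(2m-2)}}\sum_{\gamma=1}^\infty\lambda_k^\gamma\left[-\frac{e^{-h\gamma}}{4}q_{m-1}+Q^{(2m-3)}(-h\gamma)+Q^{(-)}_{m-2}(-h\gamma)+a^-e^{h\gamma}-f_m(-h\gamma)\right], $$ $$ b_k=\frac{A_k}{\lambda_k\,p_{2m-2}^{(2m-2)}}\sum_{\gamma=1}^\infty\lambda_k^\gamma\left[\frac{e^{1+h\gamma}}{4}q_{m-1}-Q^{(2m-3)}(1+h\gamma)+Q^{(+)}_{m-2}(1+h\gamma)+a^+e^{-1-h\gamma}-f_m(1+h\gamma)\right],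 $$ $$ a=-\frac{2e^h}{p_{2m-2}^{(2m-2)}}\left[-\frac{e^{-h}}{4}q_{m-1}+Q^{(2m-3)}(-h)+Q_{m-2}^{(-)}(-h)+a^-e^h-f_m(-h)\right], $$ $$ b=-\frac{2e^h}{p_{2m-2}^{(2m-2)}}\left[\frac{e^{1+h}}{4}q_{m-1}-Q^{(2m-3)}(1+h)+Q_{m-2}^{(+)}(1+h)+a^+e^{-1-h}-f_m(1+h)\right]. $$
   Context: **Space and optimality.** $W_2^{(m,m-1)}(0,1)$ is the space of functions $\varphi$ on $[0,1]$ with $\varphi^{(m-1)}$ absolutely continuous and $\varphi^{(m)}\in L_2(0,1)$, with (semi)norm $\|\varphi\|=\left\{\int_0^1(\varphi^{(m)}(x)+\varphi^{(m-1)}(x))^2dx\right\}^{1/2}$ (functions differing by an element of the kernel $\mathrm{span}\{1,x,\dots,x^{m-2},e^{-x}\}$ are identified). The error functional is $(\ell_N,\varphi)=\int_0^1p(x)\varphi(x)dx-\sum_{\beta=0}^NC_\beta\varphi(h\beta)$, with norm $\|\ell_N\|=\sup_{\|\varphi\|=1}|(\ell_N,\varphi)|$. The optimal coefficients are the $C_\beta$ at which $\inf_{C_\beta}\|\ell_N\|$ is attained. (In particular the functional annihilates $x^\alpha$, $0\le\alpha\le m-2$, and $e^{-x}$.) **The system for the optimal coefficients.** Put $$\psi_m(x)=\frac{\mathrm{sign}\,x}{2}\left(\frac{e^x-e^{-x}}{2}-\sum_{k=1}^{m-1}\frac{x^{2k-1}}{(2k-1)!}\right),\qquad f_m(h\beta)=\int_0^1p(x)\psi_m(x-h\beta)\,dx\quad(\beta\in\mathbb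 Z),$$ $q_\alpha=\int_0^1p(x)x^\alpha dx$ for $0\le\alpha\le m-2$, and $q_{m-1}=\int_0^1p(x)e^{-x}dx$. The optimal coefficients $C_\beta$, together with a polynomial $R_{m-2}$ of degree $m-2$ ($R_{-1}=0$) and a constant $d$ (Lagrange multipliers), are the solution of $$\sum_{\gamma=0}^NC_\gamma\psi_m(h\beta-h\gamma)+R_{m-2}(h\beta)+de^{-h\beta}=f_m(h\beta),\ \beta=0,\dots,N,$$ $$\sum_{\gamma=0}^NC_\gamma(h\gamma)^\alpha=q_\alpha,\ \alpha=0,\dots,m-2,\qquad \sum_{\gamma=0}^NC_\gamma e^{-h\gamma}=q_{m-1}.$$ **Auxiliary quantities.** ($[\cdot]$ is the integer part; empty sums are $0$.) $$Q^{(2m-3)}(t)=\frac12\left[\sum_{k=1}^{[\frac{m+1}{2}]-1}\sum_{\alpha=0}^{2k-1}\frac{t^{2k-1-\alpha}(-1)^\alpha}{(2k-1-\alpha)!\,\alpha!}q_\alpha+\sum_{k=[\frac{m+1}{2}]}^{m-1}\sum_{\alpha=0}^{m-2}\frac{t^{2k-1-\alpha}(-1)^\alpha}{(2k-1-\alpha)!\,\alpha!}q_\alpha\right],$$ $$Q_{m-2}(t)=\frac12\sum_{k=[\frac{m+1}{2}]}^{m-1}\sum_{\alpha=m-1}^{2k-1}\frac{t^{2k-1-\alpha}(-1)^\alpha}{(2k-1-\alpha)!\,\alpha!}\sum_{\gamma=0}^NC_\gamma(h\gamma)^\alpha,\qquad D=\frac14\sum_{\gamma=0}^NC_\gamma e^{h\gamma},$$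 $$Q^{(-)}_{m-2}=R_{m-2}+Q_{m-2},\quad a^-=d+D,\qquad Q^{(+)}_{m-2}=R_{m-2}-Q_{m-2},\quad a^+=d-D.$$ **The discrete operator $D_m$.** Let $E_k(\lambda)$ be the Euler(–Frobenius) polynomial of degree $k$: $E_0=1$, $E_k(\lambda)=\frac{(1-\lambda)^{k+2}}{\lambda}\left(\lambda\frac{d}{d\lambda}\right)^k\frac{\lambda}{(1-\lambda)^2}$. Let $$P_{2m-2}(\lambda)=\sum_{s=0}^{2m-2}p_s^{(2m-2)}\lambda^s=(1-e^{2h})(1-\lambda)^{2m-2}-2\left(\lambda(e^{2h}+1)-e^h(\lambda^2+1)\right)\sum_{j=1}^{m-1}\frac{h^{2j-1}(1-\lambda)^{2m-2-2j}}{(2j-1)!}E_{2j-2}(\lambda),$$ let $\lambda_1,\dots,\lambda_{m-1}$ be the roots of $P_{2m-2}$ with $|\lambda_k|<1$, and $$A_k=\frac{2(1-\lambda_k)^{2m-2}\left[\lambda_k(e^{2h}+1)-e^h(\lambda_k^2+1)\right]p_{2m-2}^{(2m-2)}}{\lambda_kP_{2m-2}'(\lambda_k)},\qquad C=1+(2m-2)e^h+e^{2h}+\frac{e^h\,p_{2m-3}^{(2m-2)}}{p_{2m-2}^{(2m-2)}}$$ (with $p_{-1}^{(0)}=0$ if $m=1$). Then $$D_m(h\beta)=\frac{1}{p_{2m-2}^{(2m-2)}}\begin{cases}\sum_{k=1}^{m-1}A_k\lambda_k^{|\beta|-1},&|\beta|\ge2,\\-2e^h+\sum_{k=1}^{m-1}A_k,&|\beta|=1,\\2C+\sum_{k=1}^{m-1}\frac{A_k}{\lambda_k},&\beta=0.\end{cases}$$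 Convolution of discrete functions: $(D_m*f_m)(h\beta)=\sum_{\gamma=-\infty}^{\infty}D_m(h\beta-h\gamma)f_m(h\gamma)$. The operator $D_m$ satisfies $(D_m*\psi_m)(h\beta)=1$ if $\beta=0$ and $0$ otherwise. *)

theory Defs
  imports
    "HOL-Analysis.Analysis"
    "HOL-Computational_Algebra.Polynomial"
begin

section \<open>The function space and optimal quadrature\<close>

definition AC_on :: "real \<Rightarrow> real \<Rightarrow> (real \<Rightarrow> real) \<Rightarrow> bool" where
  "AC_on a b f \<longleftrightarrow>
    (\<forall>\<epsilon>>0. \<exists>\<delta>>0. \<forall>(n::nat) (u::nat \<Rightarrow> real) (v::nat \<Rightarrow> real).
       (\<forall>i<n. a \<le> u i \<and> u i \<le> v i \<and> v i \<le> b) \<longrightarrow>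
       disjoint_family_on (\<lambda>i. {u i<..<v i}) {..<n} \<longrightarrow>
       (\<Sum>i<n. v i - u i) < \<delta> \<longrightarrow>
       (\<Sum>i<n. \<bar>f (v i) - f (u i)\<bar>) < \<epsilon>)"

(* Derivatives are one-sided at the end points; values outside [0,1] never matter. *)
definition D01 :: "(real \<Rightarrow> real) \<Rightarrow> real \<Rightarrow> real" where
  "D01 f = (\<lambda>x. vector_derivative f (at x within {0..1}))"

definition L2_01 :: "(real \<Rightarrow> real) \<Rightarrow> bool" where
  "L2_01 g \<longleftrightarrow> g \<in> borel_measurable (lebesgue_on {0..1}) \<and>
     integrable (lebesgue_on {0..1}) (\<lambda>x. (g x)\<^sup>2)"

(* The AE clause says that the m-th derivative exists almost everywhere, which is
   implied by absolute continuity; D01 has unspecified values on the exceptional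
   null set. *)
definition W_space :: "nat \<Rightarrow> (real \<Rightarrow> real) set" where
  "W_space m = {\<phi>.
     (\<forall>i<m-1. \<forall>x\<in>{0..1}. (D01 ^^ i) \<phi> differentiable (at x within {0..1})) \<and>
     AC_on 0 1 ((D01 ^^ (m-1)) \<phi>) \<and>
     (AE x in lebesgue_on {0..1}. (D01 ^^ (m-1)) \<phi> differentiable (at x within {0..1})) \<and>
     L2_01 ((D01 ^^ m) \<phi>)}"

definition W_norm :: "nat \<Rightarrow> (real \<Rightarrow> real) \<Rightarrow> real" where
  "W_norm m \<phi> =
     sqrt (LINT x|lebesgue_on {0..1}. ((D01 ^^ m) \<phi> x + (D01 ^^ (m-1)) \<phi> x)\<^sup>2)"

definition weight_function :: "(real \<Rightarrow> real) \<Rightarrow> bool" where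
  "weight_function p \<longleftrightarrow> integrable (lebesgue_on {0..1}) p \<and>
     (\<forall>x\<in>{0..1}. 0 \<le> p x) \<and> 0 < (LINT x|lebesgue_on {0..1}. p x)"

definition error_functional ::
    "real \<Rightarrow> nat \<Rightarrow> (real \<Rightarrow> real) \<Rightarrow> (nat \<Rightarrow> real) \<Rightarrow> (real \<Rightarrow> real) \<Rightarrow> real" where
  "error_functional h N p C \<phi> =
     (LINT x|lebesgue_on {0..1}. p x * \<phi> x) - (\<Sum>\<beta>=0..N. C \<beta> * \<phi> (h * real \<beta>))"

(* The supremum is infinite unless the functional annihilates the kernel of W_norm,
   i.e. unless it is well defined modulo that kernel. *)
definition error_norm ::
    "nat \<Rightarrow> real \<Rightarrow> nat \<Rightarrow> (real \<Rightarrow> real) \<Rightarrow> (nat \<Rightarrow> real) \<Rightarrow> ereal" where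
  "error_norm m h N p C =
     (SUP \<phi>\<in>{\<phi> \<in> W_space m. W_norm m \<phi> = 1}. ereal \<bar>error_functional h N p C \<phi>\<bar>)"

definition optimal_coefficients ::
    "nat \<Rightarrow> real \<Rightarrow> nat \<Rightarrow> (real \<Rightarrow> real) \<Rightarrow> (nat \<Rightarrow> real) \<Rightarrow> bool" where
  "optimal_coefficients m h N p C \<longleftrightarrow>
     error_norm m h N p C < \<infinity> \<and> (\<forall>C'. error_norm m h N p C \<le> error_norm m h N p C')"


section \<open>The system for the optimal coefficients\<close>

definition \<psi> :: "nat \<Rightarrow> real \<Rightarrow> real" where
  "\<psi> m x = sgn x / 2 *
     ((exp x - exp (- x)) / 2 - (\<Sum>k=1..m-1. x ^ (2*k-1) / fact (2*k-1)))"

definition fm :: "nat \<Rightarrow> (real \<Rightarrow> real) \<Rightarrow> real \<Rightarrow> real" where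
  "fm m p t = (LINT x|lebesgue_on {0..1}. p x * \<psi> m (x - t))"

definition q :: "nat \<Rightarrow> (real \<Rightarrow> real) \<Rightarrow> nat \<Rightarrow> real" where
  "q m p \<alpha> = (if \<alpha> = m-1 then LINT x|lebesgue_on {0..1}. p x * exp (- x)
              else LINT x|lebesgue_on {0..1}. p x * x ^ \<alpha>)"

(* The condition on R says that its degree is at most m-2, and R = 0 if m = 1. *)
definition optimality_system ::
    "nat \<Rightarrow> real \<Rightarrow> nat \<Rightarrow> (real \<Rightarrow> real) \<Rightarrow> (nat \<Rightarrow> real) \<Rightarrow> real poly \<Rightarrow> real \<Rightarrow> bool" where
  "optimality_system m h N p C R d \<longleftrightarrow>
     (\<forall>i\<ge>m-1. coeff R i = 0) \<and>
     (\<forall>\<beta>\<le>N. (\<Sum>\<gamma>=0..N. C \<gamma> * \<psi> m (h * real \<beta> - h * real \<gamma>))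
              + poly R (h * real \<beta>) + d * exp (- h * real \<beta>) = fm m p (h * real \<beta>)) \<and>
     (\<forall>\<alpha><m-1. (\<Sum>\<gamma>=0..N. C \<gamma> * (h * real \<gamma>) ^ \<alpha>) = q m p \<alpha>) \<and>
     (\<Sum>\<gamma>=0..N. C \<gamma> * exp (- h * real \<gamma>)) = q m p (m-1)"


section \<open>Auxiliary quantities\<close>

definition Q_high :: "nat \<Rightarrow> (real \<Rightarrow> real) \<Rightarrow> real \<Rightarrow> real" where
  "Q_high m p t = 1/2 *
     ((\<Sum>k\<in>{1..<(m+1) div 2}. \<Sum>\<alpha>=0..2*k-1.
         t ^ (2*k-1-\<alpha>) * (-1) ^ \<alpha> / (fact (2*k-1-\<alpha>) * fact \<alpha>) * q m p \<alpha>)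
      + (\<Sum>k\<in>{(m+1) div 2..m-1}. \<Sum>\<alpha><m-1.
         t ^ (2*k-1-\<alpha>) * (-1) ^ \<alpha> / (fact (2*k-1-\<alpha>) * fact \<alpha>) * q m p \<alpha>))"

definition Q_low :: "nat \<Rightarrow> real \<Rightarrow> nat \<Rightarrow> (nat \<Rightarrow> real) \<Rightarrow> real \<Rightarrow> real" where
  "Q_low m h N C t = 1/2 *
     (\<Sum>k\<in>{(m+1) div 2..m-1}. \<Sum>\<alpha>=m-1..2*k-1.
         t ^ (2*k-1-\<alpha>) * (-1) ^ \<alpha> / (fact (2*k-1-\<alpha>) * fact \<alpha>)
         * (\<Sum>\<gamma>=0..N. C \<gamma> * (h * real \<gamma>) ^ \<alpha>))"

definition D_const :: "real \<Rightarrow> nat \<Rightarrow> (nat \<Rightarrow> real) \<Rightarrow> real" where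
  "D_const h N C = 1/4 * (\<Sum>\<gamma>=0..N. C \<gamma> * exp (h * real \<gamma>))"

definition Q_minus :: "nat \<Rightarrow> real \<Rightarrow> nat \<Rightarrow> (nat \<Rightarrow> real) \<Rightarrow> real poly \<Rightarrow> real \<Rightarrow> real" where
  "Q_minus m h N C R t = poly R t + Q_low m h N C t"

definition Q_plus :: "nat \<Rightarrow> real \<Rightarrow> nat \<Rightarrow> (nat \<Rightarrow> real) \<Rightarrow> real poly \<Rightarrow> real \<Rightarrow> real" where
  "Q_plus m h N C R t = poly R t - Q_low m h N C t"

definition a_minus :: "real \<Rightarrow> nat \<Rightarrow> (nat \<Rightarrow> real) \<Rightarrow> real \<Rightarrow> real" where
  "a_minus h N C d = d + D_const h N C"

definition a_plus :: "real \<Rightarrow> nat \<Rightarrow> (nat \<Rightarrow> real) \<Rightarrow> real \<Rightarrow> real" where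
  "a_plus h N C d = d - D_const h N C"


section \<open>The discrete operator\<close>

definition theta_op :: "(complex \<Rightarrow> complex) \<Rightarrow> complex \<Rightarrow> complex" where
  "theta_op f = (\<lambda>z. z * deriv f z)"

definition euler_frobenius :: "nat \<Rightarrow> complex poly" where
  "euler_frobenius k = (THE E. \<forall>z. z \<noteq> 0 \<longrightarrow> z \<noteq> 1 \<longrightarrow>
     poly E z = (1 - z) ^ (k+2) / z * (theta_op ^^ k) (\<lambda>z. z / (1 - z)\<^sup>2) z)"

fun euler_frobenius_rec :: "nat \<Rightarrow> complex poly" where
  "euler_frobenius_rec 0 = 1"
| "euler_frobenius_rec (Suc k) =
     [:1, of_nat (k+1):] * euler_frobenius_rec k + [:0, 1, -1:] * pderiv (euler_frobenius_rec k)"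

lemma theta_op_iterate:
  assumes "z \<noteq> 1"
  shows "(theta_op ^^ k) (\<lambda>z. z / (1 - z)\<^sup>2) z
           = z * poly (euler_frobenius_rec k) z / (1 - z) ^ (k+2)"
  using assms
proof (induction k arbitrary: z)
  case 0
  then show ?case by (simp add: power2_eq_square)
next
  case (Suc k)
  let ?E = "poly (euler_frobenius_rec k)" and ?E' = "poly (pderiv (euler_frobenius_rec k))"
  let ?g = "\<lambda>z. z * ?E z / (1 - z) ^ (k+2)"
  have nz: "1 - z \<noteq> 0" using Suc.prems by simp
  have ev: "\<forall>\<^sub>F w in nhds z. (theta_op ^^ k) (\<lambda>z. z / (1 - z)\<^sup>2) w = ?g w"
  proof (rule eventually_mono)
    show "\<forall>\<^sub>F w in nhds z. w \<in> - {1}"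
      using Suc.prems by (intro eventually_nhds_in_open) auto
  qed (use Suc.IH in auto)
  have d1: "((\<lambda>z. (1 - z) ^ (k+2)) has_field_derivative - (of_nat (k+2) * (1 - z) ^ (k+1))) (at z)"
    by (rule derivative_eq_intros refl)+ simp
  have d2: "((\<lambda>z. z * ?E z) has_field_derivative ?E z + z * ?E' z) (at z)"
    by (rule derivative_eq_intros refl)+ simp
  have "(?g has_field_derivative
      (((?E z + z * ?E' z) * (1 - z) ^ (k+2) + z * ?E z * (of_nat (k+2) * (1 - z) ^ (k+1)))
       / ((1 - z) ^ (k+2) * (1 - z) ^ (k+2)))) (at z)"
    using DERIV_divide[OF d2 d1] nz by simp
  also have "((?E z + z * ?E' z) * (1 - z) ^ (k+2) + z * ?E z * (of_nat (k+2) * (1 - z) ^ (k+1)))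
       / ((1 - z) ^ (k+2) * (1 - z) ^ (k+2))
     = poly (euler_frobenius_rec (Suc k)) z / (1 - z) ^ (Suc k + 2)"
  proof -
    have "(?E z + z * ?E' z) * (1 - z) ^ (k+2) + z * ?E z * (of_nat (k+2) * (1 - z) ^ (k+1))
       = (1 - z) ^ (k+1) * poly (euler_frobenius_rec (Suc k)) z"
      by (simp add: algebra_simps)
    moreover have "c ^ (k+1) * X / (c ^ (k+2) * c ^ (k+2)) = X / c ^ (Suc k + 2)"
      if "c \<noteq> 0" for c X :: complex
      using that by (simp add: divide_simps)
    ultimately show ?thesis using nz by simp
  qed
  finally have "deriv ?g z = poly (euler_frobenius_rec (Suc k)) z / (1 - z) ^ (Suc k + 2)"
    by (rule DERIV_imp_deriv)
  moreover have "(theta_op ^^ Suc k) f z = z * deriv ((theta_op ^^ k) f) z" for f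
    by (simp add: theta_op_def[of "(theta_op ^^ k) f"])
  ultimately show ?case
    using deriv_cong_ev[OF ev refl] by simp
qed

text \<open>The formula defining \<open>euler_frobenius\<close> does determine a polynomial:\<close>

lemma euler_frobenius_eq_rec: "euler_frobenius k = euler_frobenius_rec k"
  unfolding euler_frobenius_def
proof (rule the_equality)
  show "\<forall>z. z \<noteq> 0 \<longrightarrow> z \<noteq> 1 \<longrightarrow> poly (euler_frobenius_rec k) z =
      (1 - z) ^ (k+2) / z * (theta_op ^^ k) (\<lambda>z. z / (1 - z)\<^sup>2) z"
    by (auto simp: theta_op_iterate)
next
  fix E assume E: "\<forall>z. z \<noteq> 0 \<longrightarrow> z \<noteq> 1 \<longrightarrow>
      poly E z = (1 - z) ^ (k+2) / z * (theta_op ^^ k) (\<lambda>z. z / (1 - z)\<^sup>2) z"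
  have "infinite (- {0, 1 :: complex})"
    by (simp add: infinite_UNIV_char_0 finite_compl)
  moreover have "- {0, 1} \<subseteq> {z. poly (E - euler_frobenius_rec k) z = 0}"
    using E by (auto simp: theta_op_iterate)
  ultimately have "infinite {z. poly (E - euler_frobenius_rec k) z = 0}"
    using finite_subset by blast
  then have "E - euler_frobenius_rec k = 0"
    using poly_roots_finite by blast
  then show "E = euler_frobenius_rec k" by simp
qed

definition P_poly :: "nat \<Rightarrow> real \<Rightarrow> complex poly" where
  "P_poly m h =
     smult (of_real (1 - exp (2*h))) ([:1, -1:] ^ (2*m-2))
     - 2 * [: - of_real (exp h), of_real (exp (2*h) + 1), - of_real (exp h) :]
         * (\<Sum>j=1..m-1. smult (of_real (h ^ (2*j-1) / fact (2*j-1)))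
              ([:1, -1:] ^ (2*m-2-2*j) * euler_frobenius (2*j-2)))"

definition p_lead :: "nat \<Rightarrow> real \<Rightarrow> complex" where
  "p_lead m h = coeff (P_poly m h) (2*m-2)"

definition A_coeff :: "nat \<Rightarrow> real \<Rightarrow> complex \<Rightarrow> complex" where
  "A_coeff m h z =
     2 * (1 - z) ^ (2*m-2)
       * (z * of_real (exp (2*h) + 1) - of_real (exp h) * (z\<^sup>2 + 1)) * p_lead m h
     / (z * poly (pderiv (P_poly m h)) z)"

(* For m = 1 the coefficient of index 2m-3 = -1 is read as 0. *)
definition C_const :: "nat \<Rightarrow> real \<Rightarrow> complex" where
  "C_const m h = 1 + of_nat (2*m-2) * of_real (exp h) + of_real (exp (2*h))
     + of_real (exp h) * (if m = 1 then 0 else coeff (P_poly m h) (2*m-3)) / p_lead m h"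

(* Discrete functions are indexed by \<beta> :: int, standing for the point h\<beta>;
   lam 1, ..., lam (m-1) are the roots of P_poly m h in the open unit disc. *)
definition D_op :: "nat \<Rightarrow> real \<Rightarrow> (nat \<Rightarrow> complex) \<Rightarrow> int \<Rightarrow> complex" where
  "D_op m h lam \<beta> = 1 / p_lead m h *
     (if \<bar>\<beta>\<bar> \<ge> 2 then \<Sum>k=1..m-1. A_coeff m h (lam k) * lam k ^ (nat \<bar>\<beta>\<bar> - 1)
      else if \<bar>\<beta>\<bar> = 1 then - 2 * of_real (exp h) + (\<Sum>k=1..m-1. A_coeff m h (lam k))
      else 2 * C_const m h + (\<Sum>k=1..m-1. A_coeff m h (lam k) / lam k))"

definition fm_disc :: "nat \<Rightarrow> real \<Rightarrow> (real \<Rightarrow> real) \<Rightarrow> int \<Rightarrow> complex" where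
  "fm_disc m h p \<beta> = of_real (fm m p (h * of_int \<beta>))"

definition disc_conv :: "(int \<Rightarrow> complex) \<Rightarrow> (int \<Rightarrow> complex) \<Rightarrow> int \<Rightarrow> complex" where
  "disc_conv F G \<beta> = (\<Sum>\<^sub>\<infinity>\<gamma>\<in>UNIV. F (\<beta> - \<gamma>) * G \<gamma>)"


section \<open>The coefficients of the closed form\<close>

definition left_term ::
    "nat \<Rightarrow> real \<Rightarrow> nat \<Rightarrow> (real \<Rightarrow> real) \<Rightarrow> (nat \<Rightarrow> real) \<Rightarrow> real poly \<Rightarrow> real \<Rightarrow> nat \<Rightarrow> real" where
  "left_term m h N p C R d \<gamma> =
     - (exp (- h * real \<gamma>) / 4) * q m p (m-1) + Q_high m p (- h * real \<gamma>)
     + Q_minus m h N C R (- h * real \<gamma>) + a_minus h N C d * exp (h * real \<gamma>)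
     - fm m p (- h * real \<gamma>)"

definition right_term ::
    "nat \<Rightarrow> real \<Rightarrow> nat \<Rightarrow> (real \<Rightarrow> real) \<Rightarrow> (nat \<Rightarrow> real) \<Rightarrow> real poly \<Rightarrow> real \<Rightarrow> nat \<Rightarrow> real" where
  "right_term m h N p C R d \<gamma> =
     exp (1 + h * real \<gamma>) / 4 * q m p (m-1) - Q_high m p (1 + h * real \<gamma>)
     + Q_plus m h N C R (1 + h * real \<gamma>) + a_plus h N C d * exp (- 1 - h * real \<gamma>)
     - fm m p (1 + h * real \<gamma>)"

(* The common shape of a_k, b_k (with z = lam k) and of a, b, where B is left_term or
   right_term; the series over \<gamma> \<ge> 1 is shifted to start at 0. *)
definition series_coeff :: "nat \<Rightarrow> real \<Rightarrow> (nat \<Rightarrow> real) \<Rightarrow> complex \<Rightarrow> complex" where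
  "series_coeff m h B z =
     A_coeff m h z / (z * p_lead m h) * (\<Sum>\<gamma>. z ^ Suc \<gamma> * of_real (B (Suc \<gamma>)))"

definition end_coeff :: "nat \<Rightarrow> real \<Rightarrow> (nat \<Rightarrow> real) \<Rightarrow> complex" where
  "end_coeff m h B = - (2 * of_real (exp h) / p_lead m h) * of_real (B 1)"

end

theory Submission
  imports Defs
begin

text \<open>The operator \<open>D_m\<close> inverts the convolution with \<open>\<psi>_m\<close> and annihilates \<open>exp x\<close>, \<open>exp (- x)\<close> and the
  polynomials of degree at most \<open>2 m - 3\<close>. Let \<open>u\<close> be the left-hand side of the optimality system,
  extended to all of \<open>h \<int>\<close>; then \<open>C = D_m * u\<close>. On the nodes \<open>u = f_m\<close>, and outside \<open>[0, 1]\<close> the sum defining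
  \<open>u\<close> is a combination of exponentials and polynomials determined by the moments. Splitting
  \<open>u = f_m + (u - f_m)\<close>, the second part is supported on the two tails and yields the coefficients
  \<open>a, b, a_k, b_k\<close>.

  The tails grow like \<open>exp (h \<gamma>)\<close>, so their convergence requires \<open>|\<lambda>_k| < exp (- h)\<close> and not merely
  \<open>|\<lambda>_k| < 1\<close>. A root of modulus at least \<open>exp (- h)\<close> would produce a nonzero quasi-periodic null
  spline, which an energy argument excludes as long as \<open>m h \<le> 2\<close>. This inequality, \<open>m \<le> 2 N\<close>, holds
  because a rule with finite error norm is exact on \<open>1, x, \<dots>, x^(m-2), exp (- x)\<close>, and for a
  nonnegative weight exactness is limited as in the Lobatto rule.

  The optimality system itself is the vanishing of the optimal error functional on the Riesz
  representers of the nodal functionals that annihilate the kernel of the seminorm.\<close>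

section \<open>The kernel and its one-sided branches\<close>

text \<open>Let s(z) be the power series whose coefficients are the values of \<psi>_m at the points
  h n, n \<ge> 0. Up to the factors (1 - z)^(2m-2), 1 - z e^h and 1 - z e^(-h), the polynomial P is
  the numerator of s, so an inner root \<lambda>_k is a zero of s as soon as the series converges
  there. This gives the inversion of \<psi>_m: seen from a point \<beta> \<le> 0, every geometric
  part of D_m sums over the positive lattice to a multiple of s(\<lambda>_k) = 0, and only the
  correction at distance 1 survives. What D_m annihilates is read off from the zeros of its symbol:
  order 2m-2 at 1, simple ones at e^h and e^(-h). In the energy argument a factor e^(cx) with |c|
  \<le> 1 makes the multiplier of the null spline unimodular and turns its equation into (d -
  c)^(2m) w = (d - c)^(2m-2) w, with d = d/dx. Tested with w, the two sides have opposite signs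
  provided that the leading term dominates each alternating binomial sum. The Poincare constant
  9/h^2 (3 in place of pi) and m h \<le> 2 make successive terms shrink by the factor 8/9, which is
  where the bound 2 on m h comes from.\<close>

definition exp_tail :: "nat \<Rightarrow> real \<Rightarrow> real" where
  "exp_tail n x = exp x - (\<Sum>k<n. x ^ k / fact k)"

lemma exp_tail_0 [simp]: "exp_tail 0 x = exp x"
  by (simp add: exp_tail_def)

lemma exp_tail_Suc: "exp_tail n x = exp_tail (Suc n) x + x ^ n / fact n"
  by (simp add: exp_tail_def)

lemma exp_tail_at_0: "exp_tail n 0 = (if n = 0 then 1 else 0)"
proof (cases n)
  case (Suc k)
  have "(\<Sum>i<Suc k. (0::real) ^ i / fact i) = 1"
    by (simp add: sum.lessThan_Suc_shift del: sum.lessThan_Suc)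
  then show ?thesis by (simp add: exp_tail_def Suc del: sum.lessThan_Suc)
qed simp

lemma sum_power_fact_deriv:
  "((\<lambda>x. \<Sum>k<n. x ^ k / fact k) has_real_derivative (\<Sum>k<n-1. x ^ k / fact k)) (at x)"
proof (cases n)
  case (Suc k)
  have "((\<lambda>x. \<Sum>k<n. x ^ k / fact k) has_real_derivative
      (\<Sum>k<n. real k * x ^ (k - 1) / fact k)) (at x)"
    by (intro derivative_eq_intros refl | simp add: sum_distrib_left)+
  also have "(\<Sum>k<n. real k * x ^ (k - 1) / fact k) = (\<Sum>k<n-1. x ^ k / fact k)"
    unfolding Suc
    by (simp add: sum.lessThan_Suc_shift del: sum.lessThan_Suc of_nat_Suc fact_Suc)
       (simp add: fact_Suc del: of_nat_Suc)
  finally show ?thesis .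
qed simp

text \<open>Truncated subtraction is intended: \<open>exp_tail 0\<close> is \<open>exp\<close>, its
  own derivative, so the index \<open>n - 1\<close> is also right for \<open>n = 0\<close>.\<close>

lemma exp_tail_deriv: "(exp_tail n has_real_derivative exp_tail (n - 1) x) (at x)"
  unfolding exp_tail_def[abs_def]
  by (intro DERIV_diff DERIV_exp sum_power_fact_deriv)

lemma exp_tail_deriv_minus:
  "((\<lambda>x. exp_tail n (- x)) has_real_derivative - exp_tail (n - 1) (- x)) (at x)"
  by (rule DERIV_chain'[OF _ exp_tail_deriv, THEN DERIV_cong]) (auto intro!: derivative_eq_intros)

text \<open>The branch of \<open>\<psi> m\<close> to the right of 0, continued analytically to the
  whole line (\<open>j = 0\<close>), and its \<open>j\<close>-th derivative. Once \<open>j\<close>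
  exceeds \<open>2*m-2\<close> the index of the tail stays 0 and only the hyperbolic functions
  remain.\<close>

definition psi_branch :: "nat \<Rightarrow> nat \<Rightarrow> real \<Rightarrow> real" where
  "psi_branch m j x = (exp_tail (2*m-2-j) x - (-1) ^ j * exp_tail (2*m-2-j) (- x)) / 4"

lemma psi_branch_deriv: "(psi_branch m j has_real_derivative psi_branch m (Suc j) x) (at x)"
  unfolding psi_branch_def[abs_def]
  by (rule DERIV_cong[OF DERIV_cdivide[OF DERIV_diff[OF exp_tail_deriv DERIV_cmult[OF exp_tail_deriv_minus]]]])
     (simp add: diff_Suc split: nat.split)

lemma psi_branch_minus: "psi_branch m j (- x) = - ((-1) ^ j) * psi_branch m j x"
  by (cases "even j") (simp_all add: psi_branch_def)

lemma psi_branch_at_0: "j \<le> 2*m-2 \<Longrightarrow> psi_branch m j 0 = 0"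
proof -
  assume j: "j \<le> 2*m-2"
  show ?thesis
  proof (cases "j = 2*m-2")
    case True
    then have "even j" by simp
    then show ?thesis by (simp add: psi_branch_def exp_tail_at_0)
  qed (use j in \<open>simp add: psi_branch_def exp_tail_at_0\<close>)
qed

lemma continuous_on_psi_branch [continuous_intros]: "continuous_on A (psi_branch m j)"
  using psi_branch_deriv by (meson DERIV_isCont continuous_at_imp_continuous_on)

lemma odd_exp_sum:
  "(\<Sum>k=1..m-1. x ^ (2*k-1) / fact (2*k-1)) = (\<Sum>k<2*m-2. (x ^ k - (-x) ^ k) / fact k) / (2::real)"
proof (induction m)
  case (Suc m)
  show ?case
  proof (cases m)
    case (Suc l)
    have *: "2 * Suc m - 2 = Suc (Suc (2*m-2))" "Suc m - 1 = Suc (m-1)" using Suc by auto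
    have e: "2*m-2 = 2*l" "Suc (m-1) = Suc l" "m - 1 = l" using Suc by auto
    have "(\<Sum>k=1..Suc l. x ^ (2*k-1) / fact (2*k-1))
        = (\<Sum>k<2*l. (x ^ k - (-x) ^ k) / fact k) / (2::real) + x ^ (2*l+1) / fact (2*l+1)"
      using Suc.IH unfolding e by (simp del: fact_Suc)
    also have "\<dots> = (\<Sum>k<Suc (Suc (2*l)). (x ^ k - (-x) ^ k) / fact k) / 2"
      by (simp add: add_divide_distrib del: fact_Suc)
    finally show ?thesis unfolding * e .
  qed simp
qed simp

lemma psi_branch_0:
  "psi_branch m 0 x = ((exp x - exp (- x)) / 2 - (\<Sum>k=1..m-1. x ^ (2*k-1) / fact (2*k-1))) / 2"
proof -
  define a b where "a = (\<Sum>k<2*m-2. x ^ k / fact k)" and "b = (\<Sum>k<2*m-2. (- x) ^ k / fact k)"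
  have "(\<Sum>k<2*m-2. (x ^ k - (-x) ^ k) / fact k) = a - b"
    by (simp add: a_def b_def diff_divide_distrib sum_subtractf)
  moreover have "psi_branch m 0 x = ((exp x - a) - (exp (- x) - b)) / 4"
    by (simp add: psi_branch_def exp_tail_def a_def b_def)
  ultimately show ?thesis unfolding odd_exp_sum by (simp add: field_simps)
qed

lemma psi_eq: "\<psi> m x = sgn x * psi_branch m 0 x"
  unfolding \<psi>_def psi_branch_0 by simp

text \<open>Differentiation leads from \<open>Suc n\<close> to \<open>n\<close>, and for a positive
  index the function vanishes at 0; so positivity propagates upwards from
  \<open>exp x - exp (- x)\<close>.\<close>

lemma exp_tail_odd_part_pos: "x > 0 \<Longrightarrow> exp_tail n x - (-1) ^ n * exp_tail n (- x) > 0"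
proof (induction n arbitrary: x)
  case (Suc n)
  let ?A = "\<lambda>n x. exp_tail n x - (-1) ^ n * exp_tail n (- x)"
  have d: "(?A (Suc n) has_real_derivative ?A n x) (at x)" for x
    by (rule DERIV_cong[OF DERIV_diff[OF exp_tail_deriv DERIV_cmult[OF exp_tail_deriv_minus]]]) simp
  have "?A (Suc n) 0 < ?A (Suc n) x"
  proof (rule DERIV_pos_imp_increasing_open[OF Suc.prems])
    show "\<exists>y. (?A (Suc n) has_real_derivative y) (at z) \<and> y > 0" if "0 < z" "z < x" for z
      using d Suc.IH that by blast
    show "continuous_on {0..x} (?A (Suc n))"
      using d by (meson DERIV_isCont continuous_at_imp_continuous_on)
  qed
  then show ?case by (simp add: exp_tail_at_0)
qed simp

lemma psi_branch_pos: "x > 0 \<Longrightarrow> psi_branch m 0 x > 0"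
  using exp_tail_odd_part_pos[of x "2*m-2"] by (simp add: psi_branch_def)

lemma psi_minus: "\<psi> m (- x) = \<psi> m x"
  by (simp add: psi_eq psi_branch_minus sgn_minus)

lemma psi_abs: "\<psi> m \<bar>x\<bar> = \<psi> m x"
  by (simp add: abs_if psi_minus)

lemma psi_bound: "\<bar>\<psi> m x\<bar> \<le> exp \<bar>x\<bar>"
proof (cases "x = 0")
  case False
  have p: "psi_branch m 0 \<bar>x\<bar> > 0" using False psi_branch_pos by simp
  have "(\<Sum>k=1..m-1. \<bar>x\<bar> ^ (2*k-1) / fact (2*k-1)) \<ge> 0" by (intro sum_nonneg) auto
  moreover have "exp (- \<bar>x\<bar>) > 0" "exp \<bar>x\<bar> > 0" by auto
  ultimately have "psi_branch m 0 \<bar>x\<bar> \<le> exp \<bar>x\<bar>"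
    unfolding psi_branch_0 by (simp add: field_simps)
  moreover have "\<psi> m x = psi_branch m 0 \<bar>x\<bar>"
    using False by (subst psi_abs[symmetric]) (simp add: psi_eq)
  ultimately show ?thesis using p by simp
qed (simp add: psi_eq)

text \<open>The \<open>j\<close>-th derivative of \<open>\<psi> m\<close> away from 0. At 0 the
  factor \<open>sgn\<close> produces the value 0, which is the correct derivative up to order
  \<open>2*m-2\<close>.\<close>

definition psi_deriv :: "nat \<Rightarrow> nat \<Rightarrow> real \<Rightarrow> real" where
  "psi_deriv m j x = sgn x * psi_branch m j x"

text \<open>Crossing 0 is harmless while the branches of orders \<open>j\<close> and
  \<open>j + 1\<close> both vanish there: the difference quotient of the branch tends to 0, and a
  sign does not change that. The first jump occurs in order \<open>2*m-1\<close>.\<close>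

lemma psi_deriv_has_derivative:
  assumes "x \<noteq> 0 \<or> Suc j \<le> 2*m-2"
  shows "(psi_deriv m j has_real_derivative psi_deriv m (Suc j) x) (at x)"
proof (cases "x = 0")
  case False
  then have s: "(sgn has_real_derivative 0) (at x)"
  proof -
    have "eventually (\<lambda>y. y \<in> (if x > 0 then {0<..} else {..<0})) (nhds x)"
      using False by (intro eventually_nhds_in_open) auto
    then have "eventually (\<lambda>y. sgn y = sgn x) (nhds x)"
      by eventually_elim (use False in \<open>auto split: if_splits\<close>)
    then show ?thesis
      by (subst DERIV_cong_ev[OF refl _ refl, of _ "\<lambda>_. sgn x"]) auto
  qed
  show ?thesis unfolding psi_deriv_def[abs_def]
    by (rule DERIV_cong[OF DERIV_mult[OF s psi_branch_deriv]]) simp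
next
  case True
  then have j: "Suc j \<le> 2*m-2" using assms by simp
  have "((\<lambda>y. psi_branch m j y / y) \<longlongrightarrow> 0) (at 0)"
    using psi_branch_deriv[of m j 0] psi_branch_at_0[of j m] psi_branch_at_0[of "Suc j" m] j
    by (simp add: has_field_derivative_iff)
  then have "((\<lambda>y. sgn y * psi_branch m j y / y) \<longlongrightarrow> 0) (at 0)"
    by (rule Lim_null_comparison[rotated, OF tendsto_rabs_zero])
       (auto simp: abs_mult abs_sgn_eq)
  then show ?thesis using True by (simp add: has_field_derivative_iff psi_deriv_def)
qed

lemma psi_deriv_0: "psi_deriv m 0 = \<psi> m"
  by (auto simp: psi_deriv_def psi_eq)

lemma isCont_psi_deriv:
  assumes "j \<le> 2*m-2"
  shows "isCont (psi_deriv m j) x"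
proof (cases "x = 0")
  case True
  have "isCont (psi_branch m j) 0" using psi_branch_deriv DERIV_isCont by blast
  then have "(psi_branch m j \<longlongrightarrow> 0) (at 0)"
    using psi_branch_at_0[OF assms] by (simp add: isCont_def)
  then have "(psi_deriv m j \<longlongrightarrow> 0) (at 0)"
    by (rule Lim_null_comparison[rotated, OF tendsto_rabs_zero])
       (auto simp: psi_deriv_def abs_mult abs_sgn_eq)
  then show ?thesis using True by (simp add: isCont_def psi_deriv_def)
next
  case False
  then show ?thesis using psi_deriv_has_derivative DERIV_isCont by blast
qed

lemma continuous_on_psi: "continuous_on A (\<psi> m)"
  using isCont_psi_deriv[of 0 m] by (auto simp: psi_deriv_0 intro: continuous_at_imp_continuous_on)

text \<open>The operator \<open>d^m + d^(m-1)\<close> of the seminorm annihilates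
  \<open>exp (- x)\<close>, and the two leftover monomials of degree \<open>m-2\<close> cancel. The
  result is half the Green-type kernel from which the representers are built.\<close>

lemma psi_branch_operator:
  assumes "m \<ge> 1"
  shows "psi_branch m m x + psi_branch m (m-1) x = exp_tail (m-1) x / 2"
proof (cases "m = 1")
  case False
  then obtain l where l: "m = Suc (Suc l)" using assms
    by (metis One_nat_def not0_implies_Suc not_one_le_zero)
  have e: "2*m-2-m = l" "2*m-2-(m-1) = Suc l" "m-1 = Suc l" "m = Suc (Suc l)" using l by auto
  have s: "(-1::real) ^ l * (- x) ^ l = x ^ l"
    by (simp add: power_mult_distrib[symmetric])
  have "psi_branch m m x + psi_branch m (m-1) x =
     (2 * exp_tail (Suc l) x + x ^ l / fact l - ((-1) ^ l * (- x) ^ l) / fact l) / 4"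
    unfolding psi_branch_def e(1,2) unfolding e(3,4) exp_tail_Suc[of l]
    by (simp add: algebra_simps add_divide_distrib diff_divide_distrib)
  also have "\<dots> = exp_tail (Suc l) x / 2" unfolding s by simp
  finally show ?thesis using e(3) by simp
qed (simp add: psi_branch_def field_simps)

section \<open>Euler--Frobenius polynomials and the symbol of the kernel\<close>

text \<open>The quotient rule reproduces the recursion: the derivative of one generating function is
  the next one without its factor \<open>z\<close>.\<close>

lemma euler_frobenius_has_derivative:
  fixes z :: complex
  assumes "z \<noteq> 1"
  shows "((\<lambda>z. z * poly (euler_frobenius_rec k) z / (1 - z) ^ (k+2)) has_field_derivative
     poly (euler_frobenius_rec (Suc k)) z / (1 - z) ^ (k+3)) (at z)"
proof -
  let ?E = "poly (euler_frobenius_rec k)" and ?E' = "poly (pderiv (euler_frobenius_rec k))"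
  have nz: "1 - z \<noteq> 0" using assms by simp
  have d1: "((\<lambda>z. (1 - z) ^ (k+2)) has_field_derivative - (of_nat (k+2) * (1 - z) ^ (k+1))) (at z)"
    by (rule derivative_eq_intros refl)+ simp
  have d2: "((\<lambda>z. z * ?E z) has_field_derivative ?E z + z * ?E' z) (at z)"
    by (rule derivative_eq_intros refl)+ simp
  have num: "(?E z + z * ?E' z) * (1 - z) ^ (k+2) + z * ?E z * (of_nat (k+2) * (1 - z) ^ (k+1))
       = (1 - z) ^ (k+1) * poly (euler_frobenius_rec (Suc k)) z"
    by (simp add: algebra_simps)
  have c: "c ^ (k+1) * X / (c ^ (k+2) * c ^ (k+2)) = X / c ^ (k + 3)" if "c \<noteq> 0" for c X :: complex
    using that by (simp add: divide_simps numeral_3_eq_3)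
  have "((\<lambda>z. z * ?E z / (1 - z) ^ (k+2)) has_field_derivative
      (((?E z + z * ?E' z) * (1 - z) ^ (k+2) + z * ?E z * (of_nat (k+2) * (1 - z) ^ (k+1)))
       / ((1 - z) ^ (k+2) * (1 - z) ^ (k+2)))) (at z)"
    using DERIV_divide[OF d2 d1] nz by simp
  then show ?thesis unfolding num c[OF nz] .
qed

text \<open>Each step applies \<open>z d/dz\<close>, which multiplies the \<open>n\<close>-th
  coefficient by \<open>n\<close>; termwise differentiation is legitimate inside the unit
  disc.\<close>

lemma sums_power_euler_frobenius:
  fixes z :: complex
  assumes "norm z < 1"
  shows "(\<lambda>n. of_nat n ^ Suc k * z ^ n) sums (z * poly (euler_frobenius_rec k) z / (1 - z) ^ (k+2))"
  using assms
proof (induction k arbitrary: z)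
  case 0
  have "(\<lambda>n. z * (of_nat (Suc n) * z ^ n)) sums (z * (1 / (1 - z)\<^sup>2))"
    by (intro sums_mult geometric_deriv_sums 0)
  then have "(\<lambda>n. of_nat (Suc n) ^ Suc 0 * z ^ Suc n) sums (z / (1 - z)\<^sup>2)"
    by (simp add: mult_ac del: of_nat_Suc)
  from sums_Suc[OF this] show ?case by (simp add: power2_eq_square)
next
  case (Suc k)
  have "z \<noteq> 1" using Suc.prems by auto
  from termdiffs_sums_strong[of 1, OF Suc.IH euler_frobenius_has_derivative[OF this] Suc.prems]
  have "(\<lambda>n. diffs (\<lambda>n. of_nat n ^ Suc k) n * z ^ n) sums (poly (euler_frobenius_rec (Suc k)) z / (1 - z) ^ (k+3))"
    by simp
  from sums_mult[OF this, of z]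
  have "(\<lambda>n. of_nat (Suc n) ^ Suc (Suc k) * z ^ Suc n) sums
     (z * poly (euler_frobenius_rec (Suc k)) z / (1 - z) ^ (k+3))"
    by (simp add: diffs_def mult_ac del: of_nat_Suc euler_frobenius_rec.simps)
  from sums_Suc[OF this] show ?case by (simp add: numeral_3_eq_3 del: euler_frobenius_rec.simps)
qed

text \<open>The recursion contains the derivative of the preceding polynomial. The induction step
  therefore differentiates the reciprocity for \<open>k\<close> and solves for the reflected
  derivative.\<close>

lemma euler_frobenius_palindromic:
  assumes "z \<noteq> 0"
  shows "z ^ k * poly (euler_frobenius_rec k) (inverse z) = poly (euler_frobenius_rec k) z"
  using assms
proof (induction k arbitrary: z)
  case (Suc k)
  let ?E = "poly (euler_frobenius_rec k)" and ?E' = "poly (pderiv (euler_frobenius_rec k))"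
  have D: "((\<lambda>z. z ^ k * ?E (inverse z)) has_field_derivative
     (of_nat k * z ^ (k-1) * ?E (inverse z) - z ^ k * (?E' (inverse z) * (inverse z)\<^sup>2))) (at z)"
    by (rule derivative_eq_intros refl Suc.prems poly_DERIV[THEN DERIV_chain2] | simp add: power2_eq_square mult_ac)+
  have ev: "eventually (\<lambda>w. w ^ k * ?E (inverse w) = ?E w) (nhds z)"
  proof (rule eventually_mono)
    show "\<forall>\<^sub>F w in nhds z. w \<in> - {0}"
      using Suc.prems by (intro eventually_nhds_in_open) auto
  qed (use Suc.IH in auto)
  have "(?E has_field_derivative
     (of_nat k * z ^ (k-1) * ?E (inverse z) - z ^ k * (?E' (inverse z) * (inverse z)\<^sup>2))) (at z)"
    by (rule DERIV_cong_ev[OF refl ev refl, THEN iffD1, OF D])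
  then have "of_nat k * z ^ (k-1) * ?E (inverse z) - z ^ k * (?E' (inverse z) * (inverse z)\<^sup>2) = ?E' z"
    using DERIV_unique poly_DERIV by blast
  then have "z * (of_nat k * z ^ (k-1) * ?E (inverse z)) - z * (z ^ k * (?E' (inverse z) * (inverse z)\<^sup>2)) = z * ?E' z"
    by (metis right_diff_distrib)
  moreover have "z * (of_nat k * z ^ (k-1) * ?E (inverse z)) = of_nat k * ?E z"
    using Suc.IH[OF Suc.prems] by (cases k) (auto simp: mult_ac)
  moreover have "z * (z ^ k * (?E' (inverse z) * (inverse z)\<^sup>2)) = z ^ k * ?E' (inverse z) * inverse z"
    using Suc.prems by (simp add: power2_eq_square)
  ultimately have b: "z ^ k * ?E' (inverse z) * inverse z = of_nat k * ?E z - z * ?E' z"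
    by (simp add: algebra_simps)
  have "z ^ Suc k * poly (euler_frobenius_rec (Suc k)) (inverse z)
     = (z + of_nat (k+1)) * (z ^ k * ?E (inverse z)) + (z - 1) * (z ^ k * ?E' (inverse z) * inverse z)"
    using Suc.prems by (simp add: field_simps power2_eq_square)
  also have "\<dots> = poly (euler_frobenius_rec (Suc k)) z"
    unfolding b Suc.IH[OF Suc.prems] by (simp add: algebra_simps)
  finally show ?case .
qed simp

lemma degree_euler_frobenius: "degree (euler_frobenius_rec k) \<le> k"
proof (induction k)
  case (Suc k)
  have a: "degree ([:1, of_nat (k+1):] * euler_frobenius_rec k) \<le> Suc k"
    using degree_mult_le[of "[:1, of_nat (k+1):]" "euler_frobenius_rec k"] Suc.IH
    by (simp del: mult_pCons_left of_nat_Suc)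
  have b: "degree ([:0, 1, -1:] * pderiv (euler_frobenius_rec k)) \<le> Suc k"
  proof (cases "degree (euler_frobenius_rec k) = 0")
    case True
    then have "pderiv (euler_frobenius_rec k) = 0" by (simp add: pderiv_eq_0_iff)
    then show ?thesis by simp
  next
    case False
    then show ?thesis
      using degree_mult_le[of "[:0, 1, -1:]" "pderiv (euler_frobenius_rec k)"] Suc.IH
      by (simp add: degree_pderiv del: mult_pCons_left)
  qed
  show ?case unfolding euler_frobenius_rec.simps by (rule degree_add_le[OF a b])
qed simp

lemma euler_frobenius_at_0: "poly (euler_frobenius_rec k) 0 = 1"
  by (induction k) auto

text \<open>The reversed polynomial \<open>R\<close> takes the values of \<open>P\<close> away from
  0, and infinitely many coincidences force equal coefficients.\<close>

lemma palindromic_coeff: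
  fixes P :: "complex poly"
  assumes deg: "degree P \<le> n" and pal: "\<And>z. z \<noteq> 0 \<Longrightarrow> z ^ n * poly P (inverse z) = poly P z"
    and i: "i \<le> n"
  shows "coeff P (n - i) = coeff P i"
proof -
  define R where "R = (\<Sum>i\<le>n. monom (coeff P (n - i)) i)"
  have "poly R z = poly P z" if "z \<noteq> 0" for z
  proof -
    have "poly P (inverse z) = (\<Sum>i\<le>n. coeff P i * inverse z ^ i)"
      unfolding poly_altdef
      by (rule sum.mono_neutral_left) (use deg in \<open>auto intro: le_degree\<close>)
    then have "poly P z = (\<Sum>i\<le>n. coeff P i * (z ^ n * inverse z ^ i))"
      using pal[OF that] by (simp add: sum_distrib_left mult_ac)
    also have "\<dots> = (\<Sum>i\<le>n. coeff P i * z ^ (n - i))"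
      using that by (intro sum.cong refl) (simp add: power_diff power_inverse divide_inverse)
    also have "\<dots> = (\<Sum>i\<le>n. coeff P (n - i) * z ^ i)"
      by (rule sum.reindex_bij_witness[of _ "\<lambda>i. n - i" "\<lambda>i. n - i"]) auto
    finally show ?thesis by (simp add: R_def poly_sum poly_monom)
  qed
  then have "- {0} \<subseteq> {z. poly (R - P) z = 0}" by auto
  moreover have "infinite (- {0 :: complex})"
    by (simp add: infinite_UNIV_char_0 finite_compl)
  ultimately have "R - P = 0"
    using poly_roots_finite finite_subset by blast
  then have "coeff R i = coeff P i" by simp
  then show ?thesis using i by (simp add: R_def coeff_sum)
qed

section \<open>The polynomial P: palindromy, degree and leading coefficient\<close>

lemma poly_P_poly:
  "poly (P_poly m h) z = of_real (1 - exp (2*h)) * (1 - z) ^ (2*m-2)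
     - 2 * (z * of_real (exp (2*h) + 1) - of_real (exp h) * (z\<^sup>2 + 1))
       * (\<Sum>j=1..m-1. of_real (h ^ (2*j-1) / fact (2*j-1)) * ((1 - z) ^ (2*m-2-2*j) * poly (euler_frobenius_rec (2*j-2)) z))"
  unfolding P_poly_def
  by (simp add: poly_sum euler_frobenius_eq_rec algebra_simps power2_eq_square)

text \<open>Every summand is built from self-reciprocal factors: an even power of
  \<open>1 - z\<close>, the quadratic with equal outer coefficients, an Euler-Frobenius polynomial.
  Their degrees add up to \<open>2*m-2\<close> in each case.\<close>

lemma P_poly_palindromic:
  assumes z: "z \<noteq> 0"
  shows "z ^ (2*m-2) * poly (P_poly m h) (inverse z) = poly (P_poly m h) z"
proof -
  define Q where "Q z = z * of_real (exp (2*h) + 1) - of_real (exp h) * (z\<^sup>2 + 1)" for z :: complex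
  have PQ: "poly (P_poly m h) z = of_real (1 - exp (2*h)) * (1 - z) ^ (2*m-2)
     - 2 * Q z * (\<Sum>j=1..m-1. of_real (h ^ (2*j-1) / fact (2*j-1)) *
         ((1 - z) ^ (2*m-2-2*j) * poly (euler_frobenius_rec (2*j-2)) z))" for z
    unfolding Q_def by (rule poly_P_poly)
  have e: "z * (1 - inverse z) = - (1 - z)" using z by (simp add: algebra_simps)
  have pw: "z ^ (2*n) * (1 - inverse z) ^ (2*n) = (1 - z) ^ (2*n)" for n
    unfolding power_mult_distrib[symmetric] e by (rule power_minus_even) simp
  have quad: "z\<^sup>2 * Q (inverse z) = Q z" using z by (simp add: Q_def field_simps power2_eq_square)
  have summand: "z ^ (2*m-2) * (Q (inverse z) * ((1 - inverse z) ^ (2*m-2-2*j) * poly (euler_frobenius_rec (2*j-2)) (inverse z)))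
     = Q z * ((1 - z) ^ (2*m-2-2*j) * poly (euler_frobenius_rec (2*j-2)) z)"
    if j: "j \<in> {1..m-1}" for j
  proof -
    have n: "2*m-2-2*j = 2*(m-1-j)" by (simp add: diff_mult_distrib2)
    have "2*m-2 = 2 + (2*(m-1-j) + (2*j-2))" using j by auto
    then have "z ^ (2*m-2) = z\<^sup>2 * (z ^ (2*(m-1-j)) * z ^ (2*j-2))" by (simp only: power_add)
    then have "z ^ (2*m-2) * (Q (inverse z) * ((1 - inverse z) ^ (2*m-2-2*j) * poly (euler_frobenius_rec (2*j-2)) (inverse z)))
      = (z\<^sup>2 * Q (inverse z)) * ((z ^ (2*(m-1-j)) * (1 - inverse z) ^ (2*(m-1-j)))
        * (z ^ (2*j-2) * poly (euler_frobenius_rec (2*j-2)) (inverse z)))"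
      unfolding n by (simp only: mult_ac)
    then show ?thesis unfolding quad pw euler_frobenius_palindromic[OF z] n .
  qed
  have m2: "2*m-2 = 2*(m-1)" by simp
  have "z ^ (2*m-2) * poly (P_poly m h) (inverse z)
     = of_real (1 - exp (2*h)) * (z ^ (2*m-2) * (1 - inverse z) ^ (2*m-2))
     - 2 * (\<Sum>j=1..m-1. of_real (h ^ (2*j-1) / fact (2*j-1)) *
        (z ^ (2*m-2) * (Q (inverse z) * ((1 - inverse z) ^ (2*m-2-2*j) * poly (euler_frobenius_rec (2*j-2)) (inverse z)))))"
    unfolding PQ right_diff_distrib sum_distrib_left
    by (intro arg_cong2[where f="(-)"] sum.cong refl) (simp_all only: mult_ac)
  also have "\<dots> = of_real (1 - exp (2*h)) * (1 - z) ^ (2*m-2)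
     - 2 * (\<Sum>j=1..m-1. of_real (h ^ (2*j-1) / fact (2*j-1)) *
        (Q z * ((1 - z) ^ (2*m-2-2*j) * poly (euler_frobenius_rec (2*j-2)) z)))"
    using summand pw[of "m-1"] unfolding m2 by simp
  also have "\<dots> = poly (P_poly m h) z"
    unfolding PQ sum_distrib_left
    by (intro arg_cong2[where f="(-)"] sum.cong refl) (simp_all only: mult_ac)
  finally show ?thesis .
qed

lemma degree_P_poly_le: "degree (P_poly m h) \<le> 2*m-2"
proof -
  have lin: "degree ([:1, -1:] ^ n :: complex poly) \<le> n" for n
    using degree_power_le[of "[:1, -1:] :: complex poly" n] by simp
  have "degree (smult (of_real (h ^ (2*j-1) / fact (2*j-1)))
              ([:1, -1:] ^ (2*m-2-2*j) * euler_frobenius (2*j-2)) :: complex poly) \<le> 2*m-4" if "j \<in> {1..m-1}" for j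
  proof -
    have "degree ([:1, -1:] ^ (2*m-2-2*j) * euler_frobenius (2*j-2)) \<le> (2*m-2-2*j) + (2*j-2)"
      by (rule order_trans[OF degree_mult_le add_mono])
         (use lin degree_euler_frobenius in \<open>auto simp: euler_frobenius_eq_rec\<close>)
    also have "\<dots> = 2*m-4" using that by auto
    finally show ?thesis using degree_smult_le order_trans by blast
  qed
  then have s: "degree (\<Sum>j=1..m-1. smult (of_real (h ^ (2*j-1) / fact (2*j-1)))
              ([:1, -1:] ^ (2*m-2-2*j) * euler_frobenius (2*j-2)) :: complex poly) \<le> 2*m-4"
    by (intro degree_sum_le) auto
  show ?thesis
  proof (cases "m \<le> 1")
    case True
    then have "m = 0 \<or> m = 1" by auto
    then show ?thesis by (auto simp: P_poly_def degree_smult_le)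
  next
    case False
    have "degree (2 * [: - of_real (exp h), of_real (exp (2*h) + 1), - of_real (exp h) :] :: complex poly) \<le> 2"
      by (rule order_trans[OF degree_mult_le]) simp
    then have "degree (2 * [: - of_real (exp h), of_real (exp (2*h) + 1), - of_real (exp h) :] *
       (\<Sum>j=1..m-1. smult (of_real (h ^ (2*j-1) / fact (2*j-1)))
              ([:1, -1:] ^ (2*m-2-2*j) * euler_frobenius (2*j-2)) :: complex poly)) \<le> 2 + (2*m-4)"
      using s by (intro order_trans[OF degree_mult_le add_mono]) auto
    also have "\<dots> = 2*m-2" using False by auto
    finally show ?thesis unfolding P_poly_def
      by (intro degree_diff_le) (use lin degree_smult_le order_trans in blast)
  qed
qed

lemma P_poly_coeff_reflect: "i \<le> 2*m-2 \<Longrightarrow> coeff (P_poly m h) (2*m-2-i) = coeff (P_poly m h) i"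
  using palindromic_coeff[OF degree_P_poly_le P_poly_palindromic] by blast

text \<open>By palindromy the leading coefficient is the value at 0, where every Euler-Frobenius
  polynomial equals 1. Positivity of the branch at \<open>h\<close> then makes it nonzero, and the
  same formula later yields the constant 1/2 in \<open>has_sum_positive_part\<close>.\<close>

lemma p_lead_eq: "p_lead m h = - of_real (4 * exp h * psi_branch m 0 h)"
proof -
  have "p_lead m h = coeff (P_poly m h) 0"
    unfolding p_lead_def using P_poly_coeff_reflect[of 0 m h] by simp
  also have "\<dots> = poly (P_poly m h) 0" by (simp add: poly_0_coeff_0)
  also have "\<dots> = of_real (1 - exp (2*h) + 2 * exp h * (\<Sum>j=1..m-1. h ^ (2*j-1) / fact (2*j-1)))"
    by (simp add: poly_P_poly euler_frobenius_at_0)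
  also have "1 - exp (2*h) + 2 * exp h * (\<Sum>j=1..m-1. h ^ (2*j-1) / fact (2*j-1)) = - (4 * exp h * psi_branch m 0 h)"
  proof -
    define G where "G = (\<Sum>j=1..m-1. h ^ (2*j-1) / fact (2*j-1))"
    have "exp (2*h) = exp h * exp h" by (simp flip: exp_add)
    moreover have "exp h * exp (-h) = 1" by (simp flip: exp_add)
    moreover have "4 * exp h * (((exp h - exp (- h)) / 2 - G) / 2) = exp h * exp h - exp h * exp (- h) - 2 * exp h * G"
      by (simp add: right_diff_distrib)
    ultimately show ?thesis unfolding psi_branch_0 G_def[symmetric] by linarith
  qed
  finally show ?thesis by (simp only: of_real_minus)
qed

lemma p_lead_nonzero: "h > 0 \<Longrightarrow> p_lead m h \<noteq> 0"
  using psi_branch_pos[of h m] by (simp add: p_lead_eq)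

lemma degree_P_poly: "h > 0 \<Longrightarrow> degree (P_poly m h) = 2*m-2"
  using p_lead_nonzero[of h m] degree_P_poly_le[of m h] le_degree[of "P_poly m h" "2*m-2"]
  by (simp add: p_lead_def)

text \<open>Closed form of the power series with coefficients \<open>psi_branch m 0 (h * n)\<close>:
  geometric series for the exponentials, Euler-Frobenius quotients for the odd powers. The formula
  retains a meaning beyond the disc of convergence, where roots of modulus at least
  \<open>exp (- h)\<close> have to be examined.\<close>

definition psi_series :: "nat \<Rightarrow> real \<Rightarrow> complex \<Rightarrow> complex" where
  "psi_series m h z = ((1 / (1 - z * of_real (exp h)) - 1 / (1 - z * of_real (exp (- h)))) / 2
     - (\<Sum>k=1..m-1. of_real (h ^ (2*k-1) / fact (2*k-1)) *
         (z * poly (euler_frobenius_rec (2*k-2)) z / (1 - z) ^ (2*k)))) / 2"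

lemma psi_series_sums:
  assumes h: "h > 0" and z: "cmod z < exp (- h)"
  shows "(\<lambda>n. of_real (psi_branch m 0 (h * real n)) * z ^ n) sums psi_series m h z"
proof -
  have "exp (- h) < 1" using h by simp
  then have z1: "cmod z < 1" using z by linarith
  have "cmod z * exp h < exp (- h) * exp h" using z by (intro mult_strict_right_mono) auto
  then have zp: "cmod (z * of_real (exp h)) < 1" by (simp add: norm_mult flip: exp_add)
  have "cmod z * exp (- h) \<le> cmod z * 1" using h by (intro mult_left_mono) auto
  then have zm: "cmod (z * of_real (exp (- h))) < 1" using z1 by (simp add: norm_mult)
  have a: "(\<lambda>n. ((z * of_real (exp h)) ^ n - (z * of_real (exp (- h))) ^ n) / 2) sums
     ((1 / (1 - z * of_real (exp h)) - 1 / (1 - z * of_real (exp (- h)))) / 2)"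
    by (intro sums_divide sums_diff geometric_sums zp zm)
  have b: "(\<lambda>n. \<Sum>k=1..m-1. of_real (h ^ (2*k-1) / fact (2*k-1)) * (of_nat n ^ (2*k-1) * z ^ n)) sums
     (\<Sum>k=1..m-1. of_real (h ^ (2*k-1) / fact (2*k-1)) *
         (z * poly (euler_frobenius_rec (2*k-2)) z / (1 - z) ^ (2*k)))"
  proof (intro sums_sum sums_mult)
    fix k assume "k \<in> {1..m-1}"
    then have "Suc (2*k-2) = 2*k-1" "2*k-2+2 = 2*k" by auto
    then show "(\<lambda>n. of_nat n ^ (2*k-1) * z ^ n) sums (z * poly (euler_frobenius_rec (2*k-2)) z / (1 - z) ^ (2*k))"
      using sums_power_euler_frobenius[OF z1, of "2*k-2"] by simp
  qed
  have summand: "of_real (psi_branch m 0 (h * real n)) * z ^ n =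
     (((z * of_real (exp h)) ^ n - (z * of_real (exp (- h))) ^ n) / 2 -
      (\<Sum>k=1..m-1. of_real (h ^ (2*k-1) / fact (2*k-1)) * (of_nat n ^ (2*k-1) * z ^ n))) / 2" for n
  proof -
    have e: "exp (h * real n) = exp h ^ n" "exp (- (h * real n)) = exp (- h) ^ n"
      by (simp_all add: exp_of_nat_mult[symmetric] mult.commute)
    show ?thesis unfolding psi_branch_0 e
      by (simp add: sum_distrib_right sum_distrib_left power_mult_distrib algebra_simps diff_divide_distrib)
  qed
  show ?thesis unfolding psi_series_def summand
    by (rule sums_divide[OF sums_diff[OF a b]])
qed

text \<open>Clearing the denominators of \<open>psi_series\<close> leaves a constant times
  \<open>z * P\<close>. Hence every root of \<open>P\<close> other than \<open>1\<close>,
  \<open>exp h\<close> and \<open>exp (- h)\<close> is a zero of the generating function.\<close>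

lemma P_poly_psi_series:
  assumes z: "z \<noteq> 1" "z * of_real (exp h) \<noteq> 1" "z * of_real (exp (- h)) \<noteq> 1"
  shows "z * poly (P_poly m h) z = - 4 * of_real (exp h) * (1 - z) ^ (2*m-2)
     * ((1 - z * of_real (exp h)) * (1 - z * of_real (exp (- h)))) * psi_series m h z"
proof -
  define e e' where "e = complex_of_real (exp h)" and "e' = complex_of_real (exp (- h))"
  have ee: "e * e' = 1" by (simp add: e_def e'_def flip: of_real_mult exp_add)
  have e2: "complex_of_real (exp (2*h)) = e * e"
    by (simp add: e_def flip: of_real_mult exp_add)
  define G where "G = (\<Sum>j=1..m-1. of_real (h ^ (2*j-1) / fact (2*j-1)) *
         (z * poly (euler_frobenius_rec (2*j-2)) z / (1 - z) ^ (2*j)))"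
  have nz: "1 - z * e \<noteq> 0" "1 - z * e' \<noteq> 0" "1 - z \<noteq> 0" using z by (auto simp: e_def e'_def)
  have S: "z * (\<Sum>j=1..m-1. of_real (h ^ (2*j-1) / fact (2*j-1)) *
      ((1 - z) ^ (2*m-2-2*j) * poly (euler_frobenius_rec (2*j-2)) z)) = (1 - z) ^ (2*m-2) * G"
    unfolding G_def sum_distrib_left
  proof (intro sum.cong refl)
    fix j assume j: "j \<in> {1..m-1}"
    have "2*m-2 = (2*m-2-2*j) + 2*j" using j by auto
    then have "(1 - z) ^ (2*m-2) = (1 - z) ^ (2*m-2-2*j) * (1 - z) ^ (2*j)"
      by (metis power_add)
    then show "z * (of_real (h ^ (2*j-1) / fact (2*j-1)) *
      ((1 - z) ^ (2*m-2-2*j) * poly (euler_frobenius_rec (2*j-2)) z)) =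
      (1 - z) ^ (2*m-2) * (of_real (h ^ (2*j-1) / fact (2*j-1)) *
         (z * poly (euler_frobenius_rec (2*j-2)) z / (1 - z) ^ (2*j)))"
      using nz(3) by simp
  qed
  have quad: "z * of_real (exp (2*h) + 1) - of_real (exp h) * (z\<^sup>2 + 1) = - (e * ((1 - z * e) * (1 - z * e')))"
  proof -
    have "e * ((1 - z * e) * (1 - z * e')) = e - z * (e * e) - z * (e * e') + z\<^sup>2 * e * (e * e')"
      by (simp add: algebra_simps power2_eq_square)
    then show ?thesis unfolding ee of_real_add e2 by (simp add: e_def algebra_simps)
  qed
  have "z * poly (P_poly m h) z = z * (1 - e * e) * (1 - z) ^ (2*m-2)
     + 2 * (e * ((1 - z * e) * (1 - z * e'))) * ((1 - z) ^ (2*m-2) * G)"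
    unfolding S[symmetric] poly_P_poly quad of_real_diff e2 of_real_1
    by (simp add: algebra_simps)
  also have "z * (1 - e * e) = - e * (z * e - z * e')"
    using ee by (simp add: algebra_simps)
  also have "z * e - z * e' = (1 - z * e) * (1 - z * e') * (1 / (1 - z * e) - 1 / (1 - z * e'))"
  proof -
    have "A * B * (1 / A - 1 / B) = B - A" if "A \<noteq> 0" "B \<noteq> 0" for A B :: complex
      using that by (simp add: field_simps)
    from this[OF nz(1,2)] show ?thesis by simp
  qed
  finally have "z * poly (P_poly m h) z = - 4 * e * (1 - z) ^ (2*m-2) * ((1 - z * e) * (1 - z * e'))
     * (((1 / (1 - z * e) - 1 / (1 - z * e')) / 2 - G) / 2)"
  proof -
    have "- e * (U * X) * W + 2 * (e * U) * (W * G) = - 4 * e * W * U * ((X / 2 - G) / 2)"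
      for U X W :: complex by (simp add: field_simps)
    moreover assume "z * poly (P_poly m h) z = - e * ((1 - z * e) * (1 - z * e') *
         (1 / (1 - z * e) - 1 / (1 - z * e'))) * (1 - z) ^ (2*m-2) +
        2 * (e * ((1 - z * e) * (1 - z * e'))) * ((1 - z) ^ (2*m-2) * G)"
    ultimately show ?thesis by simp
  qed
  then show ?thesis by (simp add: psi_series_def G_def e_def e'_def)
qed

text \<open>The quadratic factor vanishes at \<open>exp (- h)\<close>, so only the first summand of
  \<open>P\<close> is left there.\<close>

lemma P_poly_nonzero_at_exp:
  assumes "h > 0"
  shows "poly (P_poly m h) (of_real (exp (- h))) \<noteq> 0"
proof -
  define e e' where "e = complex_of_real (exp h)" and "e' = complex_of_real (exp (- h))"
  have ee: "e * e' = 1" by (simp add: e_def e'_def flip: of_real_mult exp_add)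
  have e2: "complex_of_real (exp (2*h)) = e * e" by (simp add: e_def flip: of_real_mult exp_add)
  have "e' * (e * e + 1) - e * (e'\<^sup>2 + 1) = 0" using ee by algebra
  then have q: "of_real (exp (- h)) * of_real (exp (2*h) + 1) - of_real (exp h) * ((of_real (exp (- h)))\<^sup>2 + 1) = (0::complex)"
    by (simp only: of_real_add of_real_1 e2 e_def[symmetric] e'_def[symmetric])
  have r: "1 - exp (- h) \<noteq> 0" "1 - exp (2*h) \<noteq> 0" using assms by auto
  have "complex_of_real (1 - exp (2*h)) * complex_of_real (1 - exp (- h)) ^ (2*m-2) \<noteq> 0"
    using r by (simp only: mult_eq_0_iff power_eq_0_iff of_real_eq_0_iff, simp)
  then show ?thesis unfolding poly_P_poly q by simp
qed

text \<open>The symbol of \<open>D_m\<close>, its two-sided generating function in \<open>z\<close>,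
  is this polynomial divided by \<open>z * P\<close>. The zero of order \<open>2*m-2\<close> at 1
  encodes the annihilation of polynomials, the zeros at \<open>exp h\<close> and
  \<open>exp (- h)\<close> that of the exponentials.\<close>

definition D_numerator :: "nat \<Rightarrow> real \<Rightarrow> complex poly" where
  "D_numerator m h = smult 2 ([:1, -1:] ^ (2*m-2)
     * [: - of_real (exp h), of_real (exp (2*h) + 1), - of_real (exp h) :])"

lemma poly_D_numerator:
  "poly (D_numerator m h) z = 2 * (1 - z) ^ (2*m-2) * (z * of_real (exp (2*h) + 1) - of_real (exp h) * (z\<^sup>2 + 1))"
  by (simp add: D_numerator_def algebra_simps power2_eq_square)

lemma D_numerator_reflect:
  assumes "z \<noteq> 0" "m \<ge> 1"
  shows "z ^ (2*m) * poly (D_numerator m h) (inverse z) = poly (D_numerator m h) z"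
proof -
  have e: "z * (1 - inverse z) = - (1 - z)" using assms by (simp add: algebra_simps)
  have p1: "z ^ (2*m-2) * (1 - inverse z) ^ (2*m-2) = (1 - z) ^ (2*m-2)"
    unfolding power_mult_distrib[symmetric] e by (rule power_minus_even) simp
  have p2: "z\<^sup>2 * (inverse z * of_real (exp (2*h) + 1) - of_real (exp h) * ((inverse z)\<^sup>2 + 1))
      = z * of_real (exp (2*h) + 1) - of_real (exp h) * (z\<^sup>2 + 1)"
    using assms by (simp add: field_simps power2_eq_square)
  have "2*m = (2*m-2) + 2" using assms(2) by simp
  then have p3: "z ^ (2*m) = z ^ (2*m-2) * z\<^sup>2" by (metis power_add)
  have p4: "z ^ (2*m-2) * z\<^sup>2 * (2 * a * b) = 2 * (z ^ (2*m-2) * a) * (z\<^sup>2 * b)" for a b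
    by (simp only: mult_ac)
  show ?thesis unfolding poly_D_numerator p3 p4 p1 p2 ..
qed

lemma coeff_quadratic_mult:
  "coeff ([:a, b, c:] * p) (Suc (Suc i)) = a * coeff p (Suc (Suc i)) + b * coeff p (Suc i) + c * coeff p (i::nat)"
  by (simp add: coeff_pCons add.assoc)

text \<open>In \<open>symbol_identity\<close> the two top coefficients are compared directly; they
  correspond to the corrections in \<open>D_m\<close> at distances 1 and 0.\<close>

lemma D_numerator_coeffs:
  assumes m: "m \<ge> 1"
  shows "coeff (D_numerator m h) (2*m) = - 2 * of_real (exp h)"
    and "coeff (D_numerator m h) (2*m-1) = 2 * (of_real (exp (2*h) + 1) + of_nat (2*m-2) * of_real (exp h))"
proof -
  have c: "coeff ([:1, -1:] ^ n :: complex poly) i = of_nat (n choose i) * (-1) ^ i" for n i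
  proof (cases "i \<le> n")
    case False
    then show ?thesis
      using degree_power_le[of "[:1, -1:] :: complex poly" n] by (simp add: coeff_eq_0)
  qed (simp add: coeff_linear_poly_power)
  have comm: "D_numerator m h = smult 2 ([: - of_real (exp h), of_real (exp (2*h) + 1), - of_real (exp h) :] * [:1, -1:] ^ (2*m-2))"
    by (simp only: D_numerator_def mult.commute)
  have e: "2*m = Suc (Suc (2*m-2))" using m by simp
  have "coeff (D_numerator m h) (Suc (Suc (2*m-2))) = - 2 * of_real (exp h)"
    unfolding comm coeff_smult coeff_quadratic_mult c by (simp add: binomial_eq_0)
  then show "coeff (D_numerator m h) (2*m) = - 2 * of_real (exp h)"
    by (simp only: e[symmetric])
  show "coeff (D_numerator m h) (2*m-1) = 2 * (of_real (exp (2*h) + 1) + of_nat (2*m-2) * of_real (exp h))"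
  proof (cases "m = 1")
    case True
    then show ?thesis by (simp add: D_numerator_def)
  next
    case False
    then have e: "2*m-1 = Suc (Suc (2*m-3))" "Suc (2*m-3) = 2*m-2" using m by auto
    have "(2*m-2) choose (2*m-3) = 2*m-2"
      using binomial_symmetric[of "2*m-3" "2*m-2"] False m by (simp add: e(2)[symmetric] del: e(2))
    moreover have "(-1::complex) ^ (2*m-3) = -1"
      using False m by (simp add: minus_one_power_iff)
    ultimately show ?thesis
      unfolding comm e(1) coeff_smult coeff_quadratic_mult c unfolding e(2)
      by (simp add: binomial_eq_0)
  qed
qed

lemma degree_D_numerator: "degree (D_numerator m h) \<le> 2*m" if "m \<ge> 1"
proof -
  have "degree ([:1, -1:] ^ (2*m-2) * [: - of_real (exp h), of_real (exp (2*h) + 1), - of_real (exp h) :] :: complex poly) \<le> (2*m-2) + 2"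
    using degree_power_le[of "[:1, -1:] :: complex poly" "2*m-2"]
    by (intro order_trans[OF degree_mult_le add_mono]) auto
  also have "\<dots> = 2*m" using that by simp
  finally show ?thesis unfolding D_numerator_def using degree_smult_le order_trans by blast
qed

section \<open>Quasi-periodic functions annihilated by the operator\<close>

text \<open>The function \<open>k * tan (k * (x - h/2)) * |f|^2\<close> is 0 at both ends because
  \<open>f\<close> is; integrating its derivative shows that the integral of
  \<open>|f' + k * tan * f|^2\<close>, which is nonnegative, equals that of
  \<open>|f'|^2 - k^2 * |f|^2\<close>. The choice \<open>k * h = 3\<close> keeps the tangent finite
  up to the end points, since \<open>3/2 < pi/2\<close>; the sharp constant would be
  \<open>pi^2 / h^2\<close>.\<close>

lemma poincare_on_interval:
  fixes f f' :: "real \<Rightarrow> complex"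
  assumes h: "h > 0" and d: "\<And>x. (f has_vector_derivative f' x) (at x)"
    and c: "continuous_on UNIV f'" and f0: "f 0 = 0" "f h = 0"
  shows "9 / h\<^sup>2 * integral {0..h} (\<lambda>x. (cmod (f x))\<^sup>2) \<le> integral {0..h} (\<lambda>x. (cmod (f' x))\<^sup>2)"
proof -
  define k where "k = 3 / h"
  have k: "k > 0" "k * h = 3" using h by (auto simp: k_def)
  let ?t = "\<lambda>x. tan (k * (x - h/2))"
  have cosnz: "cos (k * (x - h/2)) \<noteq> 0" if "x \<in> {0..h}" for x
  proof -
    have "k * x \<le> 3" using mult_left_mono[of x h k] that k by simp
    moreover have "0 \<le> k * x" using that k by auto
    moreover have "k * (x - h/2) = k * x - 3/2" using k(2) by (simp add: right_diff_distrib)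
    ultimately have "\<bar>k * (x - h/2)\<bar> \<le> 3/2" by (simp only: abs_le_iff) linarith
    moreover have "3/2 < pi/2" using pi_gt3 by simp
    ultimately have "cos (k * (x - h/2)) > 0" by (intro cos_gt_zero_pi) linarith+
    then show ?thesis by simp
  qed
  have cf: "continuous_on UNIV f" using d
    by (meson continuous_at_imp_continuous_on has_vector_derivative_continuous)
  have cont: "continuous_on {0..h} f" "continuous_on {0..h} f'"
    using continuous_on_subset[OF cf] continuous_on_subset[OF c] by auto
  have tcont: "continuous_on {0..h} ?t"
    by (intro continuous_intros) (use cosnz in auto)
  let ?dn = "\<lambda>x. 2 * Re (cnj (f x) * f' x)"
  have dn: "((\<lambda>x. (cmod (f x))\<^sup>2) has_real_derivative ?dn x) (at x within S)" for x S
  proof -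
    have "((\<lambda>x. f x \<bullet> f x) has_vector_derivative (f x \<bullet> f' x + f' x \<bullet> f x)) (at x within S)"
      by (rule bounded_bilinear.has_vector_derivative[OF bounded_bilinear_inner])
         (use has_vector_derivative_at_within[OF d] in auto)
    moreover have "f x \<bullet> f' x + f' x \<bullet> f x = ?dn x"
      by (simp add: inner_complex_def)
    ultimately show ?thesis
      by (simp add: has_real_derivative_iff_has_vector_derivative power2_norm_eq_inner)
  qed
  let ?G = "\<lambda>x. k * ?t x * (cmod (f x))\<^sup>2"
  have Gd: "(?G has_vector_derivative (k\<^sup>2 * (1 + (?t x)\<^sup>2) * (cmod (f x))\<^sup>2 + k * ?t x * ?dn x)) (at x within {0..h})"
    if x: "x \<in> {0..h}" for x
  proof -
    have "(?t has_real_derivative inverse ((cos (k * (x - h/2)))\<^sup>2) * k) (at x within {0..h})"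
      by (rule derivative_eq_intros refl cosnz[OF x] | simp)+
    also have "inverse ((cos (k * (x - h/2)))\<^sup>2) = 1 + (?t x)\<^sup>2"
      using cosnz[OF x] by (simp add: tan_sec power_inverse)
    finally have t: "(?t has_real_derivative (1 + (?t x)\<^sup>2) * k) (at x within {0..h})" .
    show ?thesis
      unfolding has_real_derivative_iff_has_vector_derivative[symmetric]
      by (rule DERIV_cong[OF DERIV_mult[OF DERIV_cmult[OF t] dn]])
         (simp add: algebra_simps power2_eq_square)
  qed
  have "((\<lambda>x. k\<^sup>2 * (1 + (?t x)\<^sup>2) * (cmod (f x))\<^sup>2 + k * ?t x * ?dn x) has_integral (?G h - ?G 0)) {0..h}"
    by (rule fundamental_theorem_of_calculus) (use h Gd in auto)
  then have I0: "((\<lambda>x. k\<^sup>2 * (1 + (?t x)\<^sup>2) * (cmod (f x))\<^sup>2 + k * ?t x * ?dn x) has_integral 0) {0..h}"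
    using f0 by simp
  have sq: "(cmod (f' x + of_real (k * ?t x) * f x))\<^sup>2
      = (cmod (f' x))\<^sup>2 - k\<^sup>2 * (cmod (f x))\<^sup>2 + (k\<^sup>2 * (1 + (?t x)\<^sup>2) * (cmod (f x))\<^sup>2 + k * ?t x * ?dn x)" for x
    unfolding cmod_power2 by (simp add: power2_eq_square algebra_simps)
  have int: "(\<lambda>x. (cmod (f' x))\<^sup>2) integrable_on {0..h}" "(\<lambda>x. (cmod (f x))\<^sup>2) integrable_on {0..h}"
    by (intro integrable_continuous_real continuous_intros cont)+
  have "((\<lambda>x. (cmod (f' x + of_real (k * ?t x) * f x))\<^sup>2) has_integral
      (integral {0..h} (\<lambda>x. (cmod (f' x))\<^sup>2) - k\<^sup>2 * integral {0..h} (\<lambda>x. (cmod (f x))\<^sup>2) + 0)) {0..h}"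
    unfolding sq
    by (intro has_integral_add has_integral_diff has_integral_mult_right integrable_integral int I0)
  then have "integral {0..h} (\<lambda>x. (cmod (f' x))\<^sup>2) - k\<^sup>2 * integral {0..h} (\<lambda>x. (cmod (f x))\<^sup>2) + 0 \<ge> 0"
    by (rule has_integral_nonneg) simp
  then show ?thesis by (simp add: k_def power_divide)
qed

lemma alternating_sum_bounds:
  fixes a :: "nat \<Rightarrow> real"
  assumes "\<And>i. i \<le> n \<Longrightarrow> a i \<ge> 0" "\<And>i. i < n \<Longrightarrow> a (Suc i) \<le> a i"
  shows "0 \<le> (\<Sum>i\<le>n. (-1) ^ i * a i) \<and> (\<Sum>i\<le>n. (-1) ^ i * a i) \<le> a 0"
  using assms
proof (induction n arbitrary: a)
  case (Suc n)
  have IH: "0 \<le> (\<Sum>i\<le>n. (-1) ^ i * a (Suc i)) \<and> (\<Sum>i\<le>n. (-1) ^ i * a (Suc i)) \<le> a (Suc 0)"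
    by (rule Suc.IH) (use Suc.prems in auto)
  have "(\<Sum>i\<le>Suc n. (-1) ^ i * a i) = a 0 - (\<Sum>i\<le>n. (-1) ^ i * a (Suc i))"
    by (subst sum.atMost_Suc_shift) (simp add: sum_negf)
  then show ?case using IH Suc.prems(2)[of 0] by simp
qed simp

lemma sum_even_odd_split:
  fixes f :: "nat \<Rightarrow> 'a::comm_monoid_add"
  shows "(\<Sum>n\<le>2*m. f n) = (\<Sum>j\<le>m. f (2*j)) + (\<Sum>j<m. f (2*j+1))"
proof (induction m)
  case (Suc m)
  have "(\<Sum>n\<le>2 * Suc m. f n) = (\<Sum>n\<le>2*m. f n) + f (2*m+1) + f (2 * Suc m)" by simp
  then show ?case by (simp add: Suc.IH add_ac)
qed simp

text \<open>The exact ratio of the two coefficients is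
  \<open>(n-2i)(n-2i-1) / ((2i+1)(2i+2))\<close>, which is largest at \<open>i = 0\<close>.\<close>

lemma binomial_step:
  assumes "2 * i < n"
  shows "real (n choose (2*i+2)) \<le> real n * (real n - 1) / 2 * real (n choose (2*i))"
proof -
  have 1: "real (Suc k) * real (n choose Suc k) = (real n - real k) * real (n choose k)" if "k \<le> n" for k
  proof -
    have "Suc k * (n choose Suc k) = (n - k) * (n choose k)"
      using binomial_absorb_comp[of n k] binomial_absorption[of k n] by simp
    then have "real (Suc k * (n choose Suc k)) = real ((n - k) * (n choose k))" by simp
    then show ?thesis using that by (simp add: of_nat_diff algebra_simps)
  qed
  have a: "real (2*i+2) * real (n choose (2*i+2)) = (real n - real (2*i+1)) * real (n choose (2*i+1))"
    using 1[of "2*i+1"] assms by simp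
  have b: "real (2*i+1) * real (n choose (2*i+1)) = (real n - real (2*i)) * real (n choose (2*i))"
    using 1[of "2*i"] assms by simp
  have "2 * real (n choose (2*i+2)) \<le> real (2*i+2) * real (n choose (2*i+2))" by (intro mult_right_mono) auto
  also have "\<dots> \<le> (real n - 1) * real (n choose (2*i+1))" unfolding a by (intro mult_right_mono) auto
  also have "\<dots> \<le> (real n - 1) * (real n * real (n choose (2*i)))"
  proof (rule mult_left_mono)
    have "real (n choose (2*i+1)) \<le> real (2*i+1) * real (n choose (2*i+1))" by (simp add: mult_le_cancel_right1)
    also have "\<dots> \<le> real n * real (n choose (2*i))" unfolding b by (intro mult_right_mono) auto
    finally show "real (n choose (2*i+1)) \<le> real n * real (n choose (2*i))" .
  qed (use assms in auto)
  finally show ?thesis by (simp add: field_simps)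
qed

text \<open>Here \<open>w n\<close> is the \<open>n\<close>-th derivative of a single function and
  \<open>\<mu>\<close> is its multiplier over a period of length \<open>h\<close>. Quasi-periodicity
  is assumed up to order \<open>2*m-2\<close>, because the derivative of order \<open>2*m-1\<close>
  of a null spline may jump at the nodes.\<close>

locale quasi_periodic =
  fixes w :: "nat \<Rightarrow> real \<Rightarrow> complex" and h :: real and \<mu> :: complex and m :: nat
  assumes w_deriv: "\<And>n x. (w n has_vector_derivative w (Suc n) x) (at x)"
    and h_pos: "h > 0" and mu: "cmod \<mu> = 1" and m_pos: "m \<ge> 1"
    and w_period: "\<And>n. n \<le> 2*m-2 \<Longrightarrow> w n h = \<mu> * w n 0"
    and w_zero: "w 0 0 = 0"
begin

lemma w_continuous: "continuous_on A (w n)"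
  using w_deriv by (meson continuous_at_imp_continuous_on has_vector_derivative_continuous)

definition ip :: "nat \<Rightarrow> nat \<Rightarrow> complex" where
  "ip i j = integral {0..h} (\<lambda>x. cnj (w i x) * w j x)"

definition T :: "nat \<Rightarrow> real" where "T j = integral {0..h} (\<lambda>x. (cmod (w j x))\<^sup>2)"

lemma ip_integral: "((\<lambda>x. cnj (w i x) * w j x) has_integral ip i j) {0..h}"
  unfolding ip_def
  by (intro integrable_integral integrable_continuous_real continuous_intros w_continuous)

lemma T_integral: "((\<lambda>x. (cmod (w j x))\<^sup>2) has_integral T j) {0..h}"
  unfolding T_def
  by (intro integrable_integral integrable_continuous_real continuous_intros w_continuous)

lemma T_nonneg: "T j \<ge> 0"
  using T_integral by (rule has_integral_nonneg) simp

lemma ip_self: "ip j j = of_real (T j)"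
proof -
  have "((\<lambda>x. complex_of_real ((cmod (w j x))\<^sup>2)) has_integral of_real (T j)) {0..h}"
    using T_integral by (rule has_integral_of_real)
  moreover have "complex_of_real ((cmod (w j x))\<^sup>2) = cnj (w j x) * w j x" for x
    by (simp add: complex_norm_square mult.commute del: of_real_power)
  ultimately show ?thesis using ip_integral[of j j] has_integral_unique by auto
qed

lemma ip_cnj: "cnj (ip i j) = ip j i"
proof -
  have "((\<lambda>x. cnj (cnj (w i x) * w j x)) has_integral cnj (ip i j)) {0..h}"
    using has_integral_linear[OF ip_integral bounded_linear_cnj, of i j] by (simp add: o_def)
  moreover have "cnj (cnj (w i x) * w j x) = cnj (w j x) * w i x" for x by simp
  ultimately have "((\<lambda>x. cnj (w j x) * w i x) has_integral cnj (ip i j)) {0..h}" by (simp only:)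
  then show ?thesis using ip_integral[of j i] by (rule has_integral_unique)
qed

lemma ip_swap:
  assumes "i = 0 \<or> (i \<le> 2*m-2 \<and> j \<le> 2*m-2)"
  shows "ip i (Suc j) = - ip (Suc i) j"
proof -
  have d: "((\<lambda>x. cnj (w i x) * w j x) has_vector_derivative
      (cnj (w i x) * w (Suc j) x + cnj (w (Suc i) x) * w j x)) (at x within {0..h})" for x
    by (intro has_vector_derivative_mult has_vector_derivative_cnj
          has_vector_derivative_at_within[OF w_deriv])
  have "((\<lambda>x. cnj (w i x) * w (Suc j) x + cnj (w (Suc i) x) * w j x) has_integral
      (cnj (w i h) * w j h - cnj (w i 0) * w j 0)) {0..h}"
    by (rule fundamental_theorem_of_calculus) (use h_pos d in auto)
  moreover have "cnj (w i h) * w j h - cnj (w i 0) * w j 0 = 0"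
  proof (cases "i = 0")
    case True
    then show ?thesis using w_period[of 0] w_zero by simp
  next
    case False
    have "cnj \<mu> * \<mu> = 1" using mu by (simp add: complex_norm_square[symmetric] mult.commute)
    then have "cnj (\<mu> * w i 0) * (\<mu> * w j 0) = cnj (w i 0) * w j 0"
      by (simp add: mult.assoc[symmetric] mult.commute[of _ \<mu>] mult.left_commute)
    then show ?thesis using False assms w_period[of i] w_period[of j] by simp
  qed
  ultimately have "((\<lambda>x. cnj (w i x) * w (Suc j) x + cnj (w (Suc i) x) * w j x) has_integral 0) {0..h}"
    by simp
  moreover have "((\<lambda>x. cnj (w i x) * w (Suc j) x + cnj (w (Suc i) x) * w j x) has_integral
      (ip i (Suc j) + ip (Suc i) j)) {0..h}"
    by (intro has_integral_add ip_integral)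
  ultimately have "ip i (Suc j) + ip (Suc i) j = 0" using has_integral_unique by blast
  then show ?thesis by (simp add: add_eq_0_iff2)
qed

lemma ip_even: "k \<le> j \<Longrightarrow> j \<le> m \<Longrightarrow> ip 0 (2*j) = (-1) ^ k * ip k (2*j - k)"
proof (induction k)
  case (Suc k)
  have e: "2*j - k = Suc (2*j - Suc k)" using Suc.prems by simp
  have "ip k (2*j - k) = - ip (Suc k) (2*j - Suc k)"
    unfolding e by (rule ip_swap) (use Suc.prems in auto)
  then show ?case using Suc by simp
qed simp

lemma ip_odd: "k \<le> j \<Longrightarrow> j < m \<Longrightarrow> ip 0 (2*j+1) = (-1) ^ k * ip k (2*j + 1 - k)"
proof (induction k)
  case (Suc k)
  have e: "2*j + 1 - k = Suc (2*j + 1 - Suc k)" using Suc.prems by simp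
  have "ip k (2*j + 1 - k) = - ip (Suc k) (2*j + 1 - Suc k)"
    unfolding e by (rule ip_swap) (use Suc.prems in auto)
  then show ?case using Suc by simp
qed simp

lemma ip_even_eq: "j \<le> m \<Longrightarrow> ip 0 (2*j) = of_real ((-1) ^ j * T j)"
  using ip_even[of j j] by (simp add: ip_self mult_2)

text \<open>Moving half of the derivatives across leads to \<open>ip j (Suc j)\<close>, which one
  further integration by parts sends to minus its own conjugate.\<close>

lemma Re_ip_odd: "j < m \<Longrightarrow> Re (ip 0 (2*j+1)) = 0"
proof -
  assume j: "j < m"
  have "ip j (Suc j) = - ip (Suc j) j" by (rule ip_swap) (use j in auto)
  also have "\<dots> = - cnj (ip j (Suc j))" by (simp add: ip_cnj)
  finally have "Re (ip j (Suc j)) = 0" by (simp add: complex_eq_iff)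
  moreover have "2*j + 1 - j = Suc j" by simp
  ultimately show ?thesis using ip_odd[of j j] j
    by (cases "even j") simp_all
qed

text \<open>The start is the Poincare inequality. The derivatives need not vanish at the nodes; for
  them, integrating \<open>|w^(j+2) + k w^(j)|^2\<close> with \<open>k = 9/h^2\<close> gives
  \<open>T (j+2) \<ge> 2 k T (j+1) - k^2 T j\<close>, and the preceding step bounds the last term by
  \<open>k T (j+1)\<close>.\<close>

lemma T_step: "j < m \<Longrightarrow> 9 / h\<^sup>2 * T j \<le> T (Suc j)"
proof (induction j)
  case 0
  show ?case unfolding T_def
    by (rule poincare_on_interval) (use h_pos w_deriv w_continuous w_zero w_period[of 0] in auto)
next
  case (Suc j)
  let ?k = "9 / h\<^sup>2"
  have IH: "?k * T j \<le> T (Suc j)" using Suc by simp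
  have "ip j (Suc (Suc j)) = - ip (Suc j) (Suc j)" by (rule ip_swap) (use Suc.prems in auto)
  then have r: "Re (ip j (Suc (Suc j))) = - T (Suc j)" by (simp add: ip_self)
  have "((\<lambda>x. Re (cnj (w j x) * w (Suc (Suc j)) x)) has_integral Re (ip j (Suc (Suc j)))) {0..h}"
    using has_integral_linear[OF ip_integral bounded_linear_Re] by (simp add: o_def)
  then have i: "((\<lambda>x. (cmod (w (Suc (Suc j)) x))\<^sup>2 + ?k\<^sup>2 * (cmod (w j x))\<^sup>2
      + 2 * ?k * Re (cnj (w j x) * w (Suc (Suc j)) x)) has_integral
      (T (Suc (Suc j)) + ?k\<^sup>2 * T j + 2 * ?k * - T (Suc j))) {0..h}"
    unfolding r by (intro has_integral_add has_integral_mult_right T_integral)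
  have sq: "(cmod (w (Suc (Suc j)) x))\<^sup>2 + ?k\<^sup>2 * (cmod (w j x))\<^sup>2
      + 2 * ?k * Re (cnj (w j x) * w (Suc (Suc j)) x)
      = (cmod (w (Suc (Suc j)) x + of_real ?k * w j x))\<^sup>2" for x
    unfolding cmod_power2 by (simp add: power2_eq_square algebra_simps del: of_real_divide)
  have "T (Suc (Suc j)) + ?k\<^sup>2 * T j + 2 * ?k * - T (Suc j) \<ge> 0"
    using i unfolding sq by (rule has_integral_nonneg) simp
  moreover have "?k\<^sup>2 * T j \<le> ?k * T (Suc j)"
    using mult_left_mono[OF IH, of ?k] by (simp add: power2_eq_square)
  ultimately show ?case by linarith
qed

text \<open>Each term is at most \<open>2 (m h)^2 / 9\<close> times the one before, hence at most
  8/9 of it when \<open>m h \<le> 2\<close>. An alternating sum of such terms retains at least a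
  ninth of its first term, which is \<open>T n\<close>.\<close>

lemma weighted_alternating_sum:
  assumes c: "\<bar>c\<bar> \<le> 1" and n: "n \<le> m" and mh: "real m * h \<le> 2"
  shows "T n / 9 \<le> (\<Sum>i\<le>n. (-1) ^ i * (real (2*n choose (2*i)) * c ^ (2*i) * T (n - i))) "
proof -
  define a where "a i = real (2*n choose (2*i)) * c ^ (2*i) * T (n - i)" for i
  have a0: "a i \<ge> 0" for i using c T_nonneg by (simp add: a_def)
  have step: "a (Suc i) \<le> 8/9 * a i" if i: "i < n" for i
  proof -
    have e: "n - i = Suc (n - Suc i)" using i by simp
    have "9 / h\<^sup>2 * T (n - Suc i) \<le> T (n - i)" unfolding e by (rule T_step) (use i n in auto)
    then have t: "T (n - Suc i) \<le> h\<^sup>2 / 9 * T (n - i)" using h_pos by (simp add: field_simps)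
    have b: "real (2*n choose (2*i+2)) \<le> real (2*n) * (real (2*n) - 1) / 2 * real (2*n choose (2*i))"
      by (rule binomial_step) (use i in auto)
    also have "\<dots> \<le> 2 * (real m)\<^sup>2 * real (2*n choose (2*i))"
    proof (rule mult_right_mono)
      have "real (2*n) * (real (2*n) - 1) / 2 \<le> 2 * (real n)\<^sup>2" by (simp add: power2_eq_square algebra_simps)
      also have "\<dots> \<le> 2 * (real m)\<^sup>2" using n by simp
      finally show "real (2*n) * (real (2*n) - 1) / 2 \<le> 2 * (real m)\<^sup>2" .
    qed simp
    finally have b: "real (2*n choose (2*i+2)) \<le> 2 * (real m)\<^sup>2 * real (2*n choose (2*i))" .
    have "c\<^sup>2 \<le> 1" using c by (simp add: abs_square_le_1)
    then have cc: "c ^ (2*i+2) \<le> c ^ (2*i)"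
      using mult_left_mono[of "c\<^sup>2" 1 "c ^ (2*i)"] zero_le_even_power[of "2*i" c]
      by (simp add: power2_eq_square mult_ac)
    have "a (Suc i) = real (2*n choose (2*i+2)) * c ^ (2*i+2) * T (n - Suc i)" by (simp add: a_def)
    also have "\<dots> \<le> (2 * (real m)\<^sup>2 * real (2*n choose (2*i))) * c ^ (2*i) * (h\<^sup>2 / 9 * T (n - i))"
      using b cc t T_nonneg zero_le_even_power[of "2*i+2" c] by (intro mult_mono) auto
    also have "\<dots> = 2 * (real m * h)\<^sup>2 / 9 * a i" by (simp add: a_def power_mult_distrib)
    also have "\<dots> \<le> 8/9 * a i"
    proof (rule mult_right_mono)
      have "(real m * h)\<^sup>2 \<le> 2\<^sup>2" using mh h_pos by (intro power_mono) auto
      then show "2 * (real m * h)\<^sup>2 / 9 \<le> 8/9" by simp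
    qed (rule a0)
    finally show ?thesis .
  qed
  have "(\<Sum>i\<le>n. (-1) ^ i * a i) \<ge> a 0 / 9"
  proof (cases n)
    case (Suc k)
    have "(\<Sum>i\<le>k. (-1) ^ i * a (Suc i)) \<le> a (Suc 0)"
    proof (rule alternating_sum_bounds[THEN conjunct2])
      show "a (Suc (Suc i)) \<le> a (Suc i)" if "i < k" for i
        using step[of "Suc i"] a0[of "Suc i"] that Suc by simp
    qed (rule a0)
    moreover have "(\<Sum>i\<le>n. (-1) ^ i * a i) = a 0 - (\<Sum>i\<le>k. (-1) ^ i * a (Suc i))"
      unfolding Suc by (subst sum.atMost_Suc_shift) (simp add: sum_negf)
    ultimately show ?thesis using step[of 0] Suc by simp
  qed (use a0 in auto)
  then show ?thesis by (simp add: a_def)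
qed

text \<open>The hypothesis \<open>ode\<close> reads
  \<open>(d - c)^(2m) w = (d - c)^(2m-2) w\<close>. Tested with \<open>w\<close>, odd orders
  contribute no real part, and the sides become \<open>(-1)^m\<close> and \<open>(-1)^(m-1)\<close>
  times sums bounded below by \<open>T m / 9\<close> and \<open>T (m-1) / 9\<close>. Opposite signs
  force \<open>T m = 0\<close>, and \<open>T_step\<close> carries this down to
  \<open>T 0\<close>.\<close>

theorem vanishes:
  assumes c: "\<bar>c\<bar> \<le> 1" and mh: "real m * h \<le> 2"
    and ode: "\<And>x. (\<Sum>j\<le>2*m. of_real (real (2*m choose j) * (-c) ^ (2*m-j)) * w j x)
       = (\<Sum>j\<le>2*m-2. of_real (real ((2*m-2) choose j) * (-c) ^ (2*m-2-j)) * w j x)"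
    and x: "x \<in> {0..h}"
  shows "w 0 x = 0"
proof -
  have comb: "Re (\<Sum>j\<le>2*n. of_real (real (2*n choose j) * (-c) ^ (2*n-j)) * ip 0 j)
      = (-1) ^ n * (\<Sum>i\<le>n. (-1) ^ i * (real (2*n choose (2*i)) * c ^ (2*i) * T (n - i)))"
    if n: "n \<le> m" for n
  proof -
    have "Re (\<Sum>j\<le>2*n. of_real (real (2*n choose j) * (-c) ^ (2*n-j)) * ip 0 j)
       = (\<Sum>j\<le>2*n. real (2*n choose j) * (-c) ^ (2*n-j) * Re (ip 0 j))"
      by (simp add: Re_sum del: of_real_mult of_real_power)
    also have "\<dots> = (\<Sum>j\<le>n. real (2*n choose (2*j)) * c ^ (2*n-2*j) * ((-1) ^ j * T j))"
      unfolding sum_even_odd_split using n Re_ip_odd ip_even_eq by (simp add: power_even_abs)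
    also have "\<dots> = (\<Sum>i\<le>n. real (2*n choose (2*(n-i))) * c ^ (2*n-2*(n-i)) * ((-1) ^ (n-i) * T (n-i)))"
      by (rule sum.nat_diff_reindex[symmetric, of _ "Suc n", simplified lessThan_Suc_atMost, simplified])
    also have "\<dots> = (\<Sum>i\<le>n. (-1) ^ n * ((-1) ^ i * (real (2*n choose (2*i)) * c ^ (2*i) * T (n - i))))"
    proof (intro sum.cong refl)
      fix i assume "i \<in> {..n}"
      then have i: "i \<le> n" by simp
      have "(2*n choose (2*(n-i))) = (2*n choose (2*i))"
        using binomial_symmetric[of "2*i" "2*n"] i by (simp add: diff_mult_distrib2)
      moreover have "2*n-2*(n-i) = 2*i" using i by simp
      moreover have "(-1::real) ^ (n-i) = (-1) ^ n * (-1) ^ i"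
      proof -
        have "(-1::real) ^ n = (-1) ^ (n-i) * (-1) ^ i" using i by (simp add: power_add[symmetric])
        then show ?thesis by (cases "even i") simp_all
      qed
      ultimately show "real (2*n choose (2*(n-i))) * c ^ (2*n-2*(n-i)) * ((-1) ^ (n-i) * T (n-i))
        = (-1) ^ n * ((-1) ^ i * (real (2*n choose (2*i)) * c ^ (2*i) * T (n - i)))" by simp
    qed
    finally show ?thesis by (simp add: sum_distrib_left)
  qed
  have lin: "((\<lambda>x. cnj (w 0 x) * (\<Sum>j\<le>k. of_real (b j) * w j x)) has_integral (\<Sum>j\<le>k. of_real (b j) * ip 0 j)) {0..h}"
    for k and b :: "nat \<Rightarrow> real"
  proof -
    have "((\<lambda>x. \<Sum>j\<le>k. of_real (b j) * (cnj (w 0 x) * w j x)) has_integral (\<Sum>j\<le>k. of_real (b j) * ip 0 j)) {0..h}"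
      by (intro has_integral_sum has_integral_mult_right ip_integral) auto
    then show ?thesis by (simp add: sum_distrib_left mult.left_commute)
  qed
  have "(\<Sum>j\<le>2*m. of_real (real (2*m choose j) * (-c) ^ (2*m-j)) * ip 0 j)
      = (\<Sum>j\<le>2*m-2. of_real (real ((2*m-2) choose j) * (-c) ^ (2*m-2-j)) * ip 0 j)"
    using lin[where k="2*m" and b="\<lambda>j. real (2*m choose j) * (-c) ^ (2*m-j)"]
      lin[where k="2*m-2" and b="\<lambda>j. real ((2*m-2) choose j) * (-c) ^ (2*m-2-j)"]
    unfolding ode by (rule has_integral_unique)
  moreover have "2*m-2 = 2*(m-1)" by simp
  ultimately have "(-1) ^ m * (\<Sum>i\<le>m. (-1) ^ i * (real (2*m choose (2*i)) * c ^ (2*i) * T (m - i)))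
     = (-1) ^ (m-1) * (\<Sum>i\<le>m-1. (-1) ^ i * (real (2*(m-1) choose (2*i)) * c ^ (2*i) * T (m-1 - i)))"
    using comb[of m] comb[of "m-1"] by simp
  moreover have "(-1::real) ^ m = - ((-1) ^ (m-1))" using m_pos by (cases m) auto
  ultimately have "(\<Sum>i\<le>m. (-1) ^ i * (real (2*m choose (2*i)) * c ^ (2*i) * T (m - i)))
     = - (\<Sum>i\<le>m-1. (-1) ^ i * (real (2*(m-1) choose (2*i)) * c ^ (2*i) * T (m-1 - i)))"
    by (cases "even (m-1)") auto
  moreover have "T m / 9 \<le> (\<Sum>i\<le>m. (-1) ^ i * (real (2*m choose (2*i)) * c ^ (2*i) * T (m - i)))"
    by (rule weighted_alternating_sum[OF c _ mh]) simp
  moreover have "T (m-1) / 9 \<le> (\<Sum>i\<le>m-1. (-1) ^ i * (real (2*(m-1) choose (2*i)) * c ^ (2*i) * T (m-1 - i)))"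
    by (rule weighted_alternating_sum[OF c _ mh]) simp
  ultimately have Tm: "T m = 0" using T_nonneg[of m] T_nonneg[of "m-1"] by linarith
  have "T (m - k) = 0" if "k \<le> m" for k
    using that
  proof (induction k)
    case (Suc k)
    have "9 / h\<^sup>2 * T (m - Suc k) \<le> T (Suc (m - Suc k))" by (rule T_step) (use Suc.prems in auto)
    also have "Suc (m - Suc k) = m - k" using Suc.prems by simp
    finally have "9 / h\<^sup>2 * T (m - Suc k) \<le> 0" using Suc by simp
    then have "T (m - Suc k) \<le> 0" using h_pos by (simp add: mult_le_0_iff divide_le_0_iff)
    then show ?case using T_nonneg[of "m - Suc k"] by linarith
  qed (use Tm in simp)
  from this[of m] have "T 0 = 0" by simp
  then have "integral {0..h} (\<lambda>x. (cmod (w 0 x))\<^sup>2) = 0" by (simp add: T_def)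
  then have "\<forall>x\<in>{0..h}. (cmod (w 0 x))\<^sup>2 = 0"
    by (subst (asm) integral_eq_0_iff) (use h_pos in \<open>auto intro!: continuous_intros w_continuous\<close>)
  then show ?thesis using x by simp
qed

end

section \<open>Location of the inner roots\<close>

text \<open>If \<open>u j\<close> is the \<open>j\<close>-th derivative of a function, this is the
  operator \<open>(d/dx + a)^n\<close> applied to that function.\<close>

definition binomial_transform :: "real \<Rightarrow> (nat \<Rightarrow> complex) \<Rightarrow> nat \<Rightarrow> complex" where
  "binomial_transform a u n = (\<Sum>j\<le>n. of_real (real (n choose j) * a ^ (n-j)) * u j)"

lemma binomial_transform_Suc:
  "binomial_transform a u (Suc n) = binomial_transform a (\<lambda>j. u (Suc j)) n + of_real a * binomial_transform a u n"
proof -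
  let ?c = "\<lambda>n j. complex_of_real (real (n choose j) * a ^ (n-j))"
  have 0: "binomial_transform a u (Suc n) = of_real (a ^ Suc n) * u 0 + (\<Sum>j\<le>n. ?c (Suc n) (Suc j) * u (Suc j))"
    unfolding binomial_transform_def by (subst sum.atMost_Suc_shift) simp
  have "(\<Sum>j\<le>n. ?c (Suc n) (Suc j) * u (Suc j))
     = (\<Sum>j\<le>n. ?c n j * u (Suc j)) + (\<Sum>j\<le>n. of_real (real (n choose Suc j) * a ^ (n-j)) * u (Suc j))"
    by (simp add: sum.distrib[symmetric] algebra_simps)
  also have "(\<Sum>j\<le>n. of_real (real (n choose Suc j) * a ^ (n-j)) * u (Suc j))
     = of_real a * (\<Sum>j<n. ?c n (Suc j) * u (Suc j))"
  proof -
    have "of_real (real (n choose Suc j) * a ^ (n-j)) * u (Suc j) = of_real a * (?c n (Suc j) * u (Suc j))" if "j < n" for j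
    proof -
      have "n - j = Suc (n - Suc j)" using that by simp
      then have "a ^ (n - j) = a * a ^ (n - Suc j)" by simp
      then show ?thesis by (simp add: mult_ac)
    qed
    then have "(\<Sum>j<n. of_real (real (n choose Suc j) * a ^ (n-j)) * u (Suc j)) = of_real a * (\<Sum>j<n. ?c n (Suc j) * u (Suc j))"
      unfolding sum_distrib_left by (intro sum.cong refl) auto
    moreover have "(\<Sum>j\<le>n. of_real (real (n choose Suc j) * a ^ (n-j)) * u (Suc j))
        = (\<Sum>j<n. of_real (real (n choose Suc j) * a ^ (n-j)) * u (Suc j))"
      by (simp add: lessThan_Suc_atMost[symmetric] binomial_eq_0)
    ultimately show ?thesis by simp
  qed
  also have "(\<Sum>j<n. ?c n (Suc j) * u (Suc j)) = binomial_transform a u n - of_real (a ^ n) * u 0"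
    unfolding binomial_transform_def
    by (cases n) (simp_all add: sum.atMost_Suc_shift lessThan_Suc_atMost del: sum.atMost_Suc)
  finally show ?thesis unfolding 0 binomial_transform_def[of a "\<lambda>j. u (Suc j)"]
    by (simp add: algebra_simps)
qed

lemma binomial_transform_deriv:
  assumes "\<And>j x. (u j has_vector_derivative u (Suc j) x) (at x)"
  shows "((\<lambda>x. binomial_transform a (\<lambda>j. u j x) n) has_vector_derivative
     (binomial_transform a (\<lambda>j. u j x) (Suc n) - of_real a * binomial_transform a (\<lambda>j. u j x) n)) (at x)"
proof -
  have "((\<lambda>x. binomial_transform a (\<lambda>j. u j x) n) has_vector_derivative
     binomial_transform a (\<lambda>j. u (Suc j) x) n) (at x)"
    unfolding binomial_transform_def
    by (intro has_vector_derivative_sum has_vector_derivative_mult_right assms)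
  then show ?thesis by (simp add: binomial_transform_Suc)
qed

lemma exp_has_vector_derivative:
  "((\<lambda>x. complex_of_real (exp (a * x))) has_vector_derivative of_real (a * exp (a * x))) (at x)"
  unfolding has_real_derivative_iff_has_vector_derivative[symmetric]
  by (rule has_vector_derivative_of_real) (auto intro!: derivative_eq_intros simp: has_real_derivative_iff_has_vector_derivative[symmetric])

text \<open>The conjugation rule \<open>d^n (e^(cx) s) = e^(cx) (d + c)^n s\<close> and its inverse.
  It transfers a differential equation with constant coefficients from \<open>s\<close> to
  \<open>e^(cx) s\<close>.\<close>

lemma exponential_shift:
  fixes s :: "nat \<Rightarrow> real \<Rightarrow> complex" and c :: real
  assumes s: "\<And>j x. (s j has_vector_derivative s (Suc j) x) (at x)"
  defines "w \<equiv> (\<lambda>n x. of_real (exp (c * x)) * binomial_transform c (\<lambda>j. s j x) n)"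
  shows "(w n has_vector_derivative w (Suc n) x) (at x)"
    and "binomial_transform (- c) (\<lambda>j. w j x) n = of_real (exp (c * x)) * s n x"
proof -
  show w: "(w n has_vector_derivative w (Suc n) x) (at x)" for n x
  proof -
    have "(w n has_vector_derivative
       (of_real (exp (c * x)) * (binomial_transform c (\<lambda>j. s j x) (Suc n) - of_real c * binomial_transform c (\<lambda>j. s j x) n)
        + of_real (c * exp (c * x)) * binomial_transform c (\<lambda>j. s j x) n)) (at x)"
      unfolding w_def
      by (intro has_vector_derivative_mult exp_has_vector_derivative binomial_transform_deriv s)
    then show ?thesis by (simp add: w_def algebra_simps)
  qed
  show "binomial_transform (- c) (\<lambda>j. w j x) n = of_real (exp (c * x)) * s n x"
  proof (induction n arbitrary: x)
    case 0
    show ?case by (simp add: binomial_transform_def w_def)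
  next
    case (Suc n)
    have a: "((\<lambda>x. binomial_transform (- c) (\<lambda>j. w j x) n) has_vector_derivative
       (binomial_transform (- c) (\<lambda>j. w j x) (Suc n) + of_real c * binomial_transform (- c) (\<lambda>j. w j x) n)) (at x)"
      using binomial_transform_deriv[of w "- c" n x, OF w] by simp
    have "((\<lambda>x. of_real (exp (c * x)) * s n x) has_vector_derivative
       (of_real (exp (c * x)) * s (Suc n) x + of_real (c * exp (c * x)) * s n x)) (at x)"
      by (intro has_vector_derivative_mult exp_has_vector_derivative s)
    then have "((\<lambda>x. binomial_transform (- c) (\<lambda>j. w j x) n) has_vector_derivative
       (of_real (exp (c * x)) * s (Suc n) x + of_real (c * exp (c * x)) * s n x)) (at x)"
      by (simp add: Suc.IH)
    from vector_derivative_unique_at[OF a this] show ?case by (simp add: Suc.IH)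
  qed
qed

section \<open>Quasi-periodic sums of powers and exponentials\<close>

definition power_series_moment :: "complex \<Rightarrow> nat \<Rightarrow> complex" where
  "power_series_moment z n = (\<Sum>\<beta>. of_nat \<beta> ^ n * z ^ \<beta>)"

lemma power_series_moment_sums:
  assumes z: "cmod z < 1"
  shows "(\<lambda>\<beta>. of_nat \<beta> ^ n * z ^ \<beta>) sums power_series_moment z n"
proof (cases n)
  case 0
  show ?thesis unfolding power_series_moment_def 0
    by (rule summable_sums) (use geometric_sums[OF z] in \<open>simp add: sums_iff\<close>)
next
  case (Suc k)
  show ?thesis unfolding power_series_moment_def Suc
    by (rule summable_sums[OF sums_summable[OF sums_power_euler_frobenius[OF z]]])
qed

lemma power_series_moment_Suc:
  "cmod z < 1 \<Longrightarrow> power_series_moment z (Suc k) = z * poly (euler_frobenius_rec k) z / (1 - z) ^ (k+2)"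
  using sums_unique2[OF power_series_moment_sums sums_power_euler_frobenius] by blast

text \<open>The sum of the series \<open>\<Sum>\<beta>. z ^ \<beta> * (x + h * \<beta>) ^ n / n!\<close>.\<close>

definition appell :: "real \<Rightarrow> complex \<Rightarrow> nat \<Rightarrow> real \<Rightarrow> complex" where
  "appell h z n x = (\<Sum>j\<le>n. of_real (x ^ (n-j) / fact (n-j)) * (of_real (h ^ j / fact j) * power_series_moment z j))"

lemma appell_sums:
  assumes z: "cmod z < 1"
  shows "(\<lambda>\<beta>. z ^ \<beta> * of_real ((x + h * real \<beta>) ^ n / fact n)) sums appell h z n x"
proof -
  have "(\<lambda>\<beta>. \<Sum>j\<le>n. of_real (x ^ (n-j) / fact (n-j)) * (of_real (h ^ j / fact j) * (of_nat \<beta> ^ j * z ^ \<beta>))) sums appell h z n x"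
    unfolding appell_def by (intro sums_sum sums_mult power_series_moment_sums z)
  moreover have "(\<Sum>j\<le>n. of_real (x ^ (n-j) / fact (n-j)) * (of_real (h ^ j / fact j) * (of_nat \<beta> ^ j * z ^ \<beta>)))
     = z ^ \<beta> * of_real ((x + h * real \<beta>) ^ n / fact n)" for \<beta>
  proof -
    have "(h * real \<beta> + x) ^ n / fact n = (\<Sum>j\<le>n. (x ^ (n-j) / fact (n-j)) * ((h ^ j / fact j) * real \<beta> ^ j))"
      unfolding binomial_ring sum_divide_distrib
      by (intro sum.cong refl) (simp add: binomial_fact power_mult_distrib mult_ac)
    then show ?thesis by (simp add: add.commute sum_distrib_left mult_ac)
  qed
  ultimately show ?thesis by simp
qed

text \<open>Shifting the argument by \<open>h\<close> and multiplying by \<open>z\<close> removes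
  the first term of the series.\<close>

lemma appell_shift:
  assumes z: "cmod z < 1"
  shows "appell h z n x - z * appell h z n (x + h) = of_real (x ^ n / fact n)"
proof -
  have "(\<lambda>\<beta>. z * (z ^ \<beta> * of_real ((x + h + h * real \<beta>) ^ n / fact n))) sums (z * appell h z n (x + h))"
    by (intro sums_mult appell_sums z)
  moreover have "z * (z ^ \<beta> * of_real ((x + h + h * real \<beta>) ^ n / fact n)) = z ^ Suc \<beta> * of_real ((x + h * real (Suc \<beta>)) ^ n / fact n)" for \<beta>
  proof -
    have "x + h + h * real \<beta> = x + h * real (Suc \<beta>)" by (simp add: algebra_simps)
    then show ?thesis by (simp only: power_Suc mult.assoc)
  qed
  ultimately have "(\<lambda>\<beta>. z ^ Suc \<beta> * of_real ((x + h * real (Suc \<beta>)) ^ n / fact n)) sums (z * appell h z n (x + h))"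
    by (simp only:)
  from sums_Suc[OF this] have "(\<lambda>\<beta>. z ^ \<beta> * of_real ((x + h * real \<beta>) ^ n / fact n)) sums (z * appell h z n (x + h) + of_real (x ^ n / fact n))"
    by simp
  from sums_unique2[OF this appell_sums[OF z]]
  have "appell h z n x = z * appell h z n (x + h) + of_real (x ^ n / fact n)" by (rule sym)
  then show ?thesis by (simp only: add_diff_cancel_left')
qed

lemma appell_deriv:
  "(appell h z n has_vector_derivative (if n = 0 then 0 else appell h z (n-1) x)) (at x)"
proof -
  have mono: "((\<lambda>x. complex_of_real (x ^ k / fact k)) has_vector_derivative (if k = 0 then 0 else of_real (x ^ (k-1) / fact (k-1)))) (at x)" for k
  proof (cases k)
    case (Suc l)
    have "((\<lambda>x. x ^ k / fact k) has_real_derivative (x ^ l / fact l)) (at x)"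
      unfolding Suc by (rule derivative_eq_intros refl | simp add: fact_Suc del: of_nat_Suc)+
    then have "((\<lambda>x. complex_of_real (x ^ k / fact k)) has_vector_derivative of_real (x ^ l / fact l)) (at x)"
      by (rule has_vector_derivative_of_real)
    with Suc show ?thesis by (simp only: nat.distinct diff_Suc_1 if_False)
  qed simp
  have "(appell h z n has_vector_derivative
     (\<Sum>j\<le>n. (if n-j = 0 then 0 else of_real (x ^ (n-j-1) / fact (n-j-1))) * (of_real (h ^ j / fact j) * power_series_moment z j))) (at x)"
    unfolding appell_def[abs_def]
    by (intro has_vector_derivative_sum has_vector_derivative_mult_left mono)
  also have "(\<Sum>j\<le>n. (if n-j = 0 then 0 else of_real (x ^ (n-j-1) / fact (n-j-1))) * (of_real (h ^ j / fact j) * power_series_moment z j))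
     = (if n = 0 then 0 else appell h z (n-1) x)"
  proof (cases n)
    case (Suc l)
    have "(\<Sum>j\<le>l. (if Suc l-j = 0 then 0 else of_real (x ^ (Suc l-j-1) / fact (Suc l-j-1))) * (of_real (h ^ j / fact j) * power_series_moment z j))
       = appell h z l x"
      unfolding appell_def by (intro sum.cong refl) (auto simp: Suc_diff_le)
    then show ?thesis using Suc by simp
  qed simp
  finally show ?thesis .
qed

text \<open>The \<open>j\<close>-th derivative in \<open>x\<close> of the sum over \<beta> of
  \<open>z ^ \<beta> * psi_branch m 0 (x + h * \<beta>)\<close>, continued in \<open>z\<close> from
  \<open>|z| < exp (- h)\<close> to the unit disc without the pole \<open>exp (- h)\<close>.
  Exponentials are summed as geometric series, powers by \<open>appell\<close>; the parity of
  \<open>n + j\<close> selects the powers present in the \<open>j\<close>-th derivative.\<close>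

definition null_spline :: "nat \<Rightarrow> real \<Rightarrow> complex \<Rightarrow> nat \<Rightarrow> real \<Rightarrow> complex" where
  "null_spline m h z j x = ((of_real (exp x) / (1 - z * of_real (exp h))
      - (-1) ^ j * of_real (exp (- x)) / (1 - z * of_real (exp (- h)))) / 2
     - (\<Sum>n<2*m-2-j. if odd (n + j) then appell h z n x else 0)) / 2"

lemma null_spline_deriv:
  "(null_spline m h z j has_vector_derivative null_spline m h z (Suc j) x) (at x)"
proof -
  have e: "((\<lambda>x. complex_of_real (exp x)) has_vector_derivative of_real (exp x)) (at x)"
    "((\<lambda>x. complex_of_real (exp (- x))) has_vector_derivative - of_real (exp (- x))) (at x)"
    using exp_has_vector_derivative[of 1 x] exp_has_vector_derivative[of "-1" x] by simp_all
  have "((\<lambda>x. \<Sum>n<2*m-2-j. if odd (n + j) then appell h z n x else 0) has_vector_derivative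
     (\<Sum>n<2*m-2-j. if odd (n + j) then (if n = 0 then 0 else appell h z (n-1) x) else 0)) (at x)"
  proof (rule has_vector_derivative_sum)
    fix n
    show "((\<lambda>x. if odd (n + j) then appell h z n x else 0) has_vector_derivative
      (if odd (n + j) then (if n = 0 then 0 else appell h z (n-1) x) else 0)) (at x)"
      using appell_deriv[of h z n x] by (cases "odd (n + j)") (simp_all only: if_True if_False not_False_eq_True has_vector_derivative_const)
  qed
  also have "(\<Sum>n<2*m-2-j. if odd (n + j) then (if n = 0 then 0 else appell h z (n-1) x) else 0)
     = (\<Sum>n<2*m-2-Suc j. if odd (n + Suc j) then appell h z n x else 0)"
  proof (cases "2*m-2-j")
    case (Suc l)
    then have "2*m-2-Suc j = l" by simp
    then show ?thesis unfolding Suc by (simp add: sum.lessThan_Suc_shift del: sum.lessThan_Suc cong: if_cong)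
  qed simp
  finally have p: "((\<lambda>x. \<Sum>n<2*m-2-j. if odd (n + j) then appell h z n x else 0) has_vector_derivative
     (\<Sum>n<2*m-2-Suc j. if odd (n + Suc j) then appell h z n x else 0)) (at x)" .
  have "((\<lambda>x. (of_real (exp x) / (1 - z * of_real (exp h))
      - (-1) ^ j * of_real (exp (- x)) / (1 - z * of_real (exp (- h)))) / 2
     - (\<Sum>n<2*m-2-j. if odd (n + j) then appell h z n x else 0)) has_vector_derivative
     ((of_real (exp x) / (1 - z * of_real (exp h))
      - (-1) ^ j * - of_real (exp (- x)) / (1 - z * of_real (exp (- h)))) / 2
     - (\<Sum>n<2*m-2-Suc j. if odd (n + Suc j) then appell h z n x else 0))) (at x)"
    by (intro has_vector_derivative_diff has_vector_derivative_divide has_vector_derivative_mult_right p e)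
  from has_vector_derivative_divide[OF this, of 2]
  show ?thesis unfolding null_spline_def[abs_def] by simp
qed

text \<open>The telescoping of the series persists under the continuation in \<open>z\<close>,
  because it holds for each closed form separately.\<close>

lemma null_spline_shift:
  assumes z: "cmod z < 1" and nz: "z * of_real (exp h) \<noteq> 1" "z * of_real (exp (- h)) \<noteq> 1"
  shows "null_spline m h z j x - z * null_spline m h z j (x + h) = of_real (psi_branch m j x)"
proof -
  let ?S = "\<lambda>x. \<Sum>n<2*m-2-j. if odd (n + j) then appell h z n x else 0"
  have "?S x - z * ?S (x + h) = (\<Sum>n<2*m-2-j. if odd (n + j) then of_real (x ^ n / fact n) else 0)"
    unfolding sum_distrib_left sum_subtractf[symmetric]
  proof (intro sum.cong refl)
    fix n
    show "(if odd (n + j) then appell h z n x else 0) - z * (if odd (n + j) then appell h z n (x + h) else 0)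
      = (if odd (n + j) then of_real (x ^ n / fact n) else 0)"
      using appell_shift[OF z, of h n x] by (cases "odd (n + j)") simp_all
  qed
  also have "\<dots> = of_real ((\<Sum>n<2*m-2-j. x ^ n / fact n) - (-1) ^ j * (\<Sum>n<2*m-2-j. (- x) ^ n / fact n)) / 2"
  proof -
    have "(\<Sum>n<2*m-2-j. x ^ n / fact n) - (-1) ^ j * (\<Sum>n<2*m-2-j. (- x) ^ n / fact n)
       = (\<Sum>n<2*m-2-j. if odd (n + j) then 2 * (x ^ n / fact n) else 0)"
      unfolding sum_distrib_left sum_subtractf[symmetric]
    proof (intro sum.cong refl)
      fix n
      have "(- x) ^ n = (-1) ^ n * x ^ n" by (rule power_minus)
      then show "x ^ n / fact n - (-1) ^ j * ((- x) ^ n / fact n) = (if odd (n + j) then 2 * (x ^ n / fact n) else 0)"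
        by (cases "even n"; cases "even j") simp_all
    qed
    then show ?thesis by (simp add: sum_divide_distrib if_distrib[of "\<lambda>x. x / 2"] if_distrib[of complex_of_real] cong: if_cong)
  qed
  finally have S: "?S x - z * ?S (x + h) = of_real ((\<Sum>n<2*m-2-j. x ^ n / fact n) - (-1) ^ j * (\<Sum>n<2*m-2-j. (- x) ^ n / fact n)) / 2" .
  have e1: "of_real (exp x) / (1 - z * of_real (exp h)) - z * (of_real (exp (x + h)) / (1 - z * of_real (exp h))) = complex_of_real (exp x)"
  proof -
    have "of_real (exp x) / (1 - z * of_real (exp h)) - z * (of_real (exp (x + h)) / (1 - z * of_real (exp h)))
       = of_real (exp x) * (1 - z * of_real (exp h)) / (1 - z * of_real (exp h))"
      by (simp add: exp_add algebra_simps diff_divide_distrib)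
    then show ?thesis using nz(1) by simp
  qed
  have e2: "of_real (exp (- x)) / (1 - z * of_real (exp (- h))) - z * (of_real (exp (- (x + h))) / (1 - z * of_real (exp (- h)))) = complex_of_real (exp (- x))"
  proof -
    have "exp (- (x + h)) = exp (- x) * exp (- h)" by (simp flip: exp_add)
    then have "of_real (exp (- x)) / (1 - z * of_real (exp (- h))) - z * (of_real (exp (- (x + h))) / (1 - z * of_real (exp (- h))))
       = of_real (exp (- x)) * (1 - z * of_real (exp (- h))) / (1 - z * of_real (exp (- h)))"
      by (simp add: algebra_simps diff_divide_distrib)
    then show ?thesis using nz(2) by simp
  qed
  have gen: "((a - \<sigma> * b) / 2 - s) / 2 - z * (((a' - \<sigma> * b') / 2 - s') / 2)
     = (((a - z * a') - \<sigma> * (b - z * b')) / 2 - (s - z * s')) / 2" for a b s a' b' s' \<sigma> :: complex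
    by (simp add: algebra_simps diff_divide_distrib add_divide_distrib)
  have "null_spline m h z j x - z * null_spline m h z j (x + h)
    = ((of_real (exp x) - (-1) ^ j * of_real (exp (- x))) / 2
      - of_real ((\<Sum>n<2*m-2-j. x ^ n / fact n) - (-1) ^ j * (\<Sum>n<2*m-2-j. (- x) ^ n / fact n)) / 2) / 2"
    unfolding null_spline_def times_divide_eq_right[symmetric] gen e1 e2 S ..
  also have "\<dots> = of_real (psi_branch m j x)"
  proof -
    define p r where "p = (\<Sum>n<2*m-2-j. x ^ n / fact n)" and "r = (\<Sum>n<2*m-2-j. (- x) ^ n / fact n)"
    have "psi_branch m j x = ((exp x - p) - (-1) ^ j * (exp (- x) - r)) / 4"
      by (simp add: psi_branch_def exp_tail_def p_def r_def)
    then have "complex_of_real (psi_branch m j x) =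
       of_real (((exp x - p) - (-1) ^ j * (exp (- x) - r)) / 4)" by (simp only:)
    then have "complex_of_real (psi_branch m j x) =
       ((of_real (exp x) - of_real p) - (-1) ^ j * (of_real (exp (- x)) - of_real r)) / 4" by simp
    then show ?thesis unfolding p_def[symmetric] r_def[symmetric]
      by (simp add: algebra_simps diff_divide_distrib add_divide_distrib)
  qed
  finally show ?thesis .
qed

lemma null_spline_at_0:
  assumes z: "cmod z < 1"
  shows "null_spline m h z 0 0 = psi_series m h z"
proof -
  have ap: "appell h z n 0 = of_real (h ^ n / fact n) * power_series_moment z n" for n
  proof -
    have "appell h z n 0 = (\<Sum>j\<le>n. if j = n then of_real (h ^ n / fact n) * power_series_moment z n else 0)"
      unfolding appell_def by (intro sum.cong refl) (auto simp: power_0_left)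
    then show ?thesis by simp
  qed
  have odd_sum: "(\<Sum>n<2*l. if odd n then F n else 0) = (\<Sum>k=1..l. F (2*k-1))" for F :: "nat \<Rightarrow> complex" and l
    by (induction l) auto
  have "2*m-2 = 2*(m-1)" by simp
  then have "(\<Sum>n<2*m-2-0. if odd (n + 0) then appell h z n 0 else 0) = (\<Sum>k=1..m-1. appell h z (2*k-1) 0)"
    using odd_sum[of "\<lambda>n. appell h z n 0" "m-1"] by simp
  also have "\<dots> = (\<Sum>k=1..m-1. of_real (h ^ (2*k-1) / fact (2*k-1)) *
         (z * poly (euler_frobenius_rec (2*k-2)) z / (1 - z) ^ (2*k)))"
  proof (intro sum.cong refl)
    fix k assume "k \<in> {1..m-1}"
    then have "2*k-1 = Suc (2*k-2)" "2*k-2+2 = 2*k" by auto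
    then show "appell h z (2*k-1) 0 = of_real (h ^ (2*k-1) / fact (2*k-1)) *
         (z * poly (euler_frobenius_rec (2*k-2)) z / (1 - z) ^ (2*k))"
      unfolding ap using power_series_moment_Suc[OF z, of "2*k-2"] by simp
  qed
  finally show ?thesis unfolding null_spline_def psi_series_def by simp
qed

text \<open>For a root with \<open>exp (- h) \<le> |z| < 1\<close> the function
  \<open>null_spline\<close> vanishes at 0 and its derivatives up to order \<open>2*m-2\<close> are
  multiplied by \<open>1/z\<close> over a period. The energy argument then makes it vanish on
  \<open>[0, h]\<close>, which contradicts the term 1/2 in the shift identity of order
  \<open>2*m-1\<close>.\<close>

theorem P_poly_inner_roots:
  assumes m: "m \<ge> 1" and h: "h > 0" and mh: "real m * h \<le> 2"
    and root: "poly (P_poly m h) z = 0" and z: "cmod z < 1"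
  shows "cmod z < exp (- h)"
proof (rule ccontr)
  assume "\<not> cmod z < exp (- h)"
  then have ge: "exp (- h) \<le> cmod z" by simp
  have zpos: "cmod z > 0" using less_le_trans[OF exp_gt_zero ge] .
  then have z0: "z \<noteq> 0" by auto
  have zne: "z \<noteq> of_real (exp (- h))" using P_poly_nonzero_at_exp[OF h, of m] root by auto
  have ee: "complex_of_real (exp (- h)) * of_real (exp h) = 1" by (simp flip: of_real_mult exp_add)
  have nz1: "z * of_real (exp h) \<noteq> 1"
  proof
    assume "z * of_real (exp h) = 1"
    then have "z * of_real (exp h) = of_real (exp (- h)) * of_real (exp h)" using ee by simp
    then show False using zne by simp
  qed
  have nz2: "z * of_real (exp (- h)) \<noteq> 1"
  proof
    assume "z * of_real (exp (- h)) = 1"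
    then have "cmod z * exp (- h) = 1" by (metis norm_mult norm_of_real norm_one abs_exp_cancel)
    moreover have "cmod z * exp (- h) < 1 * 1" using z h zpos by (intro mult_strict_mono) auto
    ultimately show False by simp
  qed
  have z1: "z \<noteq> 1" using z by auto
  have "psi_series m h z = 0"
    using P_poly_psi_series[OF z1 nz1 nz2, of m] root nz1 nz2 z1 by auto
  then have s00: "null_spline m h z 0 0 = 0" using null_spline_at_0[OF z] by simp
  define s where "s = null_spline m h z"
  have sd: "(s j has_vector_derivative s (Suc j) x) (at x)" for j x
    unfolding s_def by (rule null_spline_deriv)
  have shift: "s j x - z * s j (x + h) = of_real (psi_branch m j x)" for j x
    unfolding s_def by (rule null_spline_shift[OF z nz1 nz2])
  \<comment> \<open>The factor \<open>exp (c * x)\<close> is multiplied by \<open>|z|\<close> over a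
    period and so compensates the modulus of \<open>1/z\<close>. The assumption
    \<open>exp (- h) \<le> |z|\<close> is what gives \<open>|c| \<le> 1\<close>.\<close>
  define c where "c = ln (cmod z) / h"
  have c1: "\<bar>c\<bar> \<le> 1"
  proof -
    have "ln (exp (- h)) \<le> ln (cmod z)" using ge zpos by (subst ln_le_cancel_iff) auto
    moreover have "ln (cmod z) < 0" using z zpos by simp
    ultimately show ?thesis using h by (simp add: c_def field_simps)
  qed
  have "c * h = ln (cmod z)" using h by (simp add: c_def)
  then have ch: "exp (c * h) = cmod z" using zpos by simp
  define w where "w = (\<lambda>n x. of_real (exp (c * x)) * binomial_transform c (\<lambda>j. s j x) n)"
  have wd: "(w n has_vector_derivative w (Suc n) x) (at x)" for n x
    unfolding w_def by (rule exponential_shift(1)) (rule sd)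
  have wback: "binomial_transform (- c) (\<lambda>j. w j x) n = of_real (exp (c * x)) * s n x" for n x
    unfolding w_def by (rule exponential_shift(2)) (rule sd)
  have per: "s j h = s j 0 / z" if "j \<le> 2*m-2" for j
    using shift[of j 0] psi_branch_at_0[OF that] z0 by (simp add: field_simps)
  have Tw: "quasi_periodic w h (of_real (exp (c * h)) / z) m"
  proof
    show "(w n has_vector_derivative w (Suc n) x) (at x)" for n x by (rule wd)
    show "h > 0" "m \<ge> 1" by fact+
    show "cmod (of_real (exp (c * h)) / z) = 1" using zpos by (simp add: norm_divide ch)
    show "w 0 0 = 0" using s00 by (simp add: w_def binomial_transform_def s_def)
    show "w n h = of_real (exp (c * h)) / z * w n 0" if n: "n \<le> 2*m-2" for n
    proof -
      have "binomial_transform c (\<lambda>j. s j h) n = binomial_transform c (\<lambda>j. s j 0) n / z"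
        unfolding binomial_transform_def sum_divide_distrib
        by (intro sum.cong refl) (use n per in auto)
      then show ?thesis by (simp add: w_def)
    qed
  qed
  interpret quasi_periodic w h "of_real (exp (c * h)) / z" m by (rule Tw)
  have w0: "w 0 x = 0" if "x \<in> {0..h}" for x
  proof (rule vanishes[OF c1 mh _ that])
    fix x
    \<comment> \<open>From order \<open>2*m-2\<close> on the polynomial part has been differentiated
      away, and a combination of \<open>exp x\<close> and \<open>exp (- x)\<close> equals its second
      derivative.\<close>
    have "s (2*m) x = s (2*m-2) x"
      using m by (simp add: s_def null_spline_def minus_one_power_iff)
    then have "binomial_transform (- c) (\<lambda>j. w j x) (2*m) = binomial_transform (- c) (\<lambda>j. w j x) (2*m-2)"
      by (simp add: wback)
    then show "(\<Sum>j\<le>2*m. of_real (real (2*m choose j) * (-c) ^ (2*m-j)) * w j x)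
       = (\<Sum>j\<le>2*m-2. of_real (real ((2*m-2) choose j) * (-c) ^ (2*m-2-j)) * w j x)"
      by (simp only: binomial_transform_def)
  qed
  have s_zero: "s j x = 0" if "x \<in> {0..h}" for j x
    using that
  proof (induction j arbitrary: x)
    case 0
    then show ?case using w0[of x] by (simp add: w_def binomial_transform_def)
  next
    case (Suc j)
    have "(s j has_vector_derivative s (Suc j) x) (at x within {0..h})"
      by (rule has_vector_derivative_at_within[OF sd])
    from has_vector_derivative_transform[OF Suc.prems _ this, of "\<lambda>_. 0"]
    have "((\<lambda>_. 0) has_vector_derivative s (Suc j) x) (at x within {0..h})" using Suc.IH by simp
    moreover have "((\<lambda>_. 0) has_vector_derivative (0::complex)) (at x within {0..h})" by simp
    moreover have "at x within {0..h} \<noteq> bot"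
      using Suc.prems h by (simp add: trivial_limit_within islimpt_Icc)
    ultimately show ?case by (metis vector_derivative_unique_within)
  qed
  \<comment> \<open>Order \<open>2*m-1\<close> is the first at which the shift identity at 0 has a
    nonzero right-hand side.\<close>
  have "of_real (psi_branch m (2*m-1) 0) = (0::complex)"
    using shift[of "2*m-1" 0] s_zero[of 0 "2*m-1"] s_zero[of h "2*m-1"] h by simp
  moreover have "psi_branch m (2*m-1) 0 = 1/2"
  proof -
    have "2*m-2-(2*m-1) = 0" "odd (2*m-1)" using m by auto
    then show ?thesis by (simp add: psi_branch_def)
  qed
  ultimately show False by simp
qed

section \<open>Symbol calculus for the discrete operator\<close>

lemma has_sum_int_split:
  fixes f :: "int \<Rightarrow> complex"
  assumes a: "((\<lambda>n. f (int n)) has_sum a) UNIV" and b: "((\<lambda>n. f (- int (Suc n))) has_sum b) UNIV"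
  shows "(f has_sum (a + b)) UNIV"
proof -
  have 1: "(f has_sum a) {0..}"
  proof -
    have "bij_betw int UNIV {0..}"
      by (rule bij_betw_byWitness[where f' = nat]) auto
    from has_sum_reindex_bij_betw[OF this, of f a] a show ?thesis by simp
  qed
  have 2: "(f has_sum b) {..<0}"
  proof -
    have "bij_betw (\<lambda>n. - int (Suc n)) UNIV {..<0}"
      by (rule bij_betw_byWitness[where f' = "\<lambda>i. nat (- i) - 1"]) auto
    from has_sum_reindex_bij_betw[OF this, of f b] b show ?thesis by simp
  qed
  have "(f has_sum (a + b)) ({0..} \<union> {..<0})"
    by (rule has_sum_Un_disjoint[OF 1 2]) auto
  moreover have "{0..} \<union> {..<0} = (UNIV :: int set)" by auto
  ultimately show ?thesis by simp
qed

lemma has_sum_geometric_nat: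
  fixes x :: complex
  assumes "cmod x < 1"
  shows "((\<lambda>n. x ^ n) has_sum (1 / (1 - x))) UNIV"
  using assms
  by (intro norm_summable_imp_has_sum geometric_sums) (auto simp: norm_power summable_geometric)

lemma has_sum_two_sided_geometric:
  fixes z l :: complex
  assumes z: "z \<noteq> 0" and 1: "cmod (l * z) < 1" and 2: "cmod (l / z) < 1"
  shows "((\<lambda>\<beta>. l ^ nat \<bar>\<beta>\<bar> * z powi \<beta>) has_sum (1 / (1 - l * z) + (l / z) / (1 - l / z))) UNIV"
proof (rule has_sum_int_split)
  show "((\<lambda>n. l ^ nat \<bar>int n\<bar> * z powi int n) has_sum (1 / (1 - l * z))) UNIV"
    using has_sum_geometric_nat[OF 1] by (simp add: power_mult_distrib)
  have "((\<lambda>n. (l / z) * (l / z) ^ n) has_sum ((l / z) * (1 / (1 - l / z)))) UNIV"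
    by (intro has_sum_cmult_right has_sum_geometric_nat 2)
  moreover have "l ^ nat \<bar>- int (Suc n)\<bar> * z powi (- int (Suc n)) = (l / z) * (l / z) ^ n" for n
  proof -
    have "nat \<bar>- int (Suc n)\<bar> = Suc n" by simp
    moreover have "z powi (- int (Suc n)) = inverse z ^ Suc n"
      by (simp only: power_int_minus power_int_of_nat power_inverse)
    ultimately show ?thesis by (simp only: power_mult_distrib[symmetric] divide_inverse power_Suc[symmetric])
  qed
  ultimately show "((\<lambda>n. l ^ nat \<bar>- int (Suc n)\<bar> * z powi (- int (Suc n))) has_sum ((l / z) / (1 - l / z))) UNIV"
    by simp
qed

lemma has_sum_finite_sum:
  fixes f :: "'a \<Rightarrow> 'b \<Rightarrow> complex"
  assumes "finite I" "\<And>i. i \<in> I \<Longrightarrow> (f i has_sum s i) A"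
  shows "((\<lambda>x. \<Sum>i\<in>I. f i x) has_sum (\<Sum>i\<in>I. s i)) A"
  using assms
proof (induction I rule: finite_induct)
  case (insert i I)
  then show ?case by (simp add: has_sum_add)
qed simp

lemma has_sum_int_shift:
  fixes f :: "int \<Rightarrow> complex"
  shows "((\<lambda>\<gamma>. f (\<beta> - \<gamma>)) has_sum s) UNIV \<longleftrightarrow> (f has_sum s) UNIV"
proof -
  have "bij_betw (\<lambda>\<gamma>. \<beta> - \<gamma>) UNIV (UNIV :: int set)"
    by (rule bij_betw_byWitness[where f' = "\<lambda>\<gamma>. \<beta> - \<gamma>"]) auto
  from has_sum_reindex_bij_betw[OF this, of f s] show ?thesis by simp
qed

text \<open>The bound \<open>inner\<close> is stronger than membership in the unit disc; it allows
  \<open>D_m\<close> to act on functions that grow like \<open>exp (h * |\<gamma>|)\<close>.\<close>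

locale discrete_operator =
  fixes m :: nat and h :: real and lam :: "nat \<Rightarrow> complex"
  assumes m_pos: "m \<ge> 1" and h_pos: "h > 0"
    and bij: "bij_betw lam {1..m-1} {z. poly (P_poly m h) z = 0 \<and> cmod z < 1}"
    and inner: "\<And>k. k \<in> {1..m-1} \<Longrightarrow> cmod (lam k) < exp (- h)"
begin

abbreviation "P \<equiv> P_poly m h"
abbreviation "pl \<equiv> p_lead m h"
abbreviation "A k \<equiv> A_coeff m h (lam k)"
abbreviation "D \<equiv> D_op m h lam"

lemma pl_nz: "pl \<noteq> 0" using h_pos by (rule p_lead_nonzero)

lemma P_nz: "P \<noteq> 0" using pl_nz by (auto simp: p_lead_def)

lemma P_at_0: "poly P 0 = pl"
  using P_poly_coeff_reflect[of 0 m h] by (simp add: p_lead_def poly_0_coeff_0)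

lemma lam_root: "k \<in> {1..m-1} \<Longrightarrow> poly P (lam k) = 0"
  and lam_norm: "k \<in> {1..m-1} \<Longrightarrow> cmod (lam k) < 1"
  using bij by (auto simp: bij_betw_def)

lemma lam_nz: "k \<in> {1..m-1} \<Longrightarrow> lam k \<noteq> 0"
  using lam_root[of k] P_at_0 pl_nz by auto

lemma lam_inj: "inj_on lam {1..m-1}"
  using bij by (simp add: bij_betw_def)

definition roots :: "complex set" where
  "roots = lam ` {1..m-1} \<union> (\<lambda>k. inverse (lam k)) ` {1..m-1}"

lemma inverse_lam_norm: "k \<in> {1..m-1} \<Longrightarrow> cmod (inverse (lam k)) > 1"
  using lam_norm[of k] lam_nz[of k] by (simp add: norm_inverse one_less_inverse)

lemma inverse_lam_root: "k \<in> {1..m-1} \<Longrightarrow> poly P (inverse (lam k)) = 0"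
  using P_poly_palindromic[of "lam k" m h] lam_root[of k] lam_nz[of k] by simp

lemma finite_roots: "finite roots" by (simp add: roots_def)

lemma card_roots: "card roots = 2*m-2"
proof -
  have "card (lam ` {1..m-1}) = m-1" using card_image[OF lam_inj] by simp
  moreover have "inj_on (\<lambda>k. inverse (lam k)) {1..m-1}"
    using lam_inj by (auto simp: inj_on_def)
  then have "card ((\<lambda>k. inverse (lam k)) ` {1..m-1}) = m-1" by (simp add: card_image)
  moreover have "lam ` {1..m-1} \<inter> (\<lambda>k. inverse (lam k)) ` {1..m-1} = {}"
  proof -
    have "lam i \<noteq> inverse (lam j)" if "i \<in> {1..m-1}" "j \<in> {1..m-1}" for i j
      using lam_norm[OF that(1)] inverse_lam_norm[OF that(2)] by auto
    then show ?thesis by blast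
  qed
  ultimately show ?thesis unfolding roots_def
    by (subst card_Un_disjoint) auto
qed

text \<open>Palindromy pairs each inner root with its inverse. These \<open>2*m-2\<close> distinct
  numbers exhaust the degree, so no root lies on the unit circle.\<close>

lemma P_roots: "{z. poly P z = 0} = roots"
proof (rule sym, rule card_subset_eq)
  show "finite {z. poly P z = 0}" using P_nz by (rule poly_roots_finite)
  show sub: "roots \<subseteq> {z. poly P z = 0}" using lam_root inverse_lam_root by (auto simp: roots_def)
  have "card {z. poly P z = 0} \<le> 2*m-2"
    using card_poly_roots_bound[OF P_nz] degree_P_poly[OF h_pos, of m] by simp
  moreover have "card roots \<le> card {z. poly P z = 0}"
    by (rule card_mono) (use sub P_nz poly_roots_finite in auto)
  ultimately show "card roots = card {z. poly P z = 0}" using card_roots by simp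
qed

text \<open>A double root would leave a quotient of degree \<open>2*m-3\<close> with
  \<open>2*m-2\<close> zeros. Simplicity is what makes the denominator of \<open>A_coeff\<close>
  nonzero.\<close>

lemma pderiv_nz:
  assumes k: "k \<in> {1..m-1}"
  shows "poly (pderiv P) (lam k) \<noteq> 0"
proof
  assume d: "poly (pderiv P) (lam k) = 0"
  obtain U where U: "P = [:- lam k, 1:] * U" using lam_root[OF k] by (auto simp: poly_eq_0_iff_dvd)
  have "poly U (lam k) = 0" using d unfolding U by (simp add: pderiv_mult pderiv_pCons del: mult_pCons_left)
  have Unz: "U \<noteq> 0" using P_nz U by auto
  have "degree P = Suc (degree U)" unfolding U using Unz by (subst degree_mult_eq) auto
  then have degU: "Suc (degree U) = 2*m-2" using degree_P_poly[OF h_pos, of m] by simp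
  have "roots \<subseteq> {z. poly U z = 0}"
  proof
    fix z assume z: "z \<in> roots"
    show "z \<in> {z. poly U z = 0}"
    proof (cases "z = lam k")
      case False
      have "poly P z = 0" using z P_roots by auto
      then show ?thesis using False unfolding U by simp
    qed (use \<open>poly U (lam k) = 0\<close> in simp)
  qed
  then have "card roots \<le> degree U"
    using card_mono[OF poly_roots_finite[OF Unz]] card_poly_roots_bound[OF Unz] by (meson order_trans)
  then show False using degU card_roots by simp
qed

text \<open>Dividing \<open>A k\<close> by \<open>lam k\<close> extends the geometric pattern to
  distances 1 and 0, so that \<open>D_m\<close> becomes a sum of two-sided geometric sequences plus
  finitely many corrections, the form in which generating functions can be summed.\<close>

lemma D_formula:
  "D \<beta> = 1 / pl * (- 2 * of_real (exp h) * (if \<bar>\<beta>\<bar> = 1 then 1 else 0) + 2 * C_const m h * (if \<beta> = 0 then 1 else 0)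
     + (\<Sum>k=1..m-1. A k / lam k * lam k ^ nat \<bar>\<beta>\<bar>))"
proof -
  have p: "A k / lam k * lam k ^ n = A k * lam k ^ (n - 1)" if "k \<in> {1..m-1}" "n \<ge> 1" for k n
  proof -
    have "lam k ^ n = lam k * lam k ^ (n - 1)" using that(2) by (cases n) auto
    then show ?thesis using lam_nz[OF that(1)] by simp
  qed
  consider "\<bar>\<beta>\<bar> \<ge> 2" | "\<bar>\<beta>\<bar> = 1" | "\<beta> = 0" by linarith
  then show ?thesis
  proof cases
    case 1
    then have "nat \<bar>\<beta>\<bar> \<ge> 1" "\<bar>\<beta>\<bar> \<noteq> 1" "\<beta> \<noteq> 0" by auto
    then show ?thesis using 1 p by (simp add: D_op_def)
  next
    case 2
    then have "nat \<bar>\<beta>\<bar> = 1" "\<beta> \<noteq> 0" by auto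
    then show ?thesis using 2 lam_nz by (simp add: D_op_def)
  qed (simp add: D_op_def)
qed

lemma D_even: "D (- \<beta>) = D \<beta>"
  unfolding D_formula by simp

text \<open>A partial fraction decomposition. After multiplication by \<open>z * P\<close> both
  sides are polynomials of degree at most \<open>2*m\<close>. Their difference \<open>W\<close>
  loses its two top coefficients by the choice of \<open>- 2 * exp h\<close> and
  \<open>C_const\<close>, and it vanishes at 0 and at all \<open>2*m-2\<close> roots by the choice
  of \<open>A_coeff\<close>; that is one zero too many for its degree.\<close>

lemma symbol_identity:
  assumes z: "z \<noteq> 0" "\<And>k. k \<in> {1..m-1} \<Longrightarrow> 1 - lam k * z \<noteq> 0 \<and> z - lam k \<noteq> 0"
  shows "z * poly P z * (- 2 * of_real (exp h) * (z + inverse z) + 2 * C_const m h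
     + (\<Sum>k=1..m-1. A k / lam k * (1 / (1 - lam k * z) + lam k / (z - lam k))))
     = pl * poly (D_numerator m h) z"
proof -
  \<comment> \<open>Cofactors of \<open>P\<close> at \<open>lam k\<close> and at its inverse; they
    turn the two halves of a two-sided geometric series into polynomials.\<close>
  define U where "U k = P div [:- lam k, 1:]" for k
  define V where "V k = P div [:1, - lam k:]" for k
  have U: "P = [:- lam k, 1:] * U k" if "k \<in> {1..m-1}" for k
    unfolding U_def using lam_root[OF that]
    by (intro dvd_mult_div_cancel[symmetric]) (simp add: poly_eq_0_iff_dvd)
  have V: "P = [:1, - lam k:] * V k" if k: "k \<in> {1..m-1}" for k
  proof -
    have "[:- inverse (lam k), 1:] dvd P"
      using inverse_lam_root[OF k] by (simp add: poly_eq_0_iff_dvd)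
    then have "smult (- lam k) [:- inverse (lam k), 1:] dvd P"
      by (rule smult_dvd) (use lam_nz[OF k] in simp)
    moreover have "[:1, - lam k:] = smult (- lam k) [:- inverse (lam k), 1:]"
      using lam_nz[OF k] by simp
    ultimately have "[:1, - lam k:] dvd P" by (simp only:)
    then show ?thesis unfolding V_def by (rule dvd_mult_div_cancel[symmetric])
  qed
  have Unz: "U k \<noteq> 0" "V k \<noteq> 0" if "k \<in> {1..m-1}" for k
    using U[OF that] V[OF that] P_nz by auto
  have degU: "Suc (degree (U k)) = 2*m-2" if k: "k \<in> {1..m-1}" for k
  proof -
    have "degree P = Suc (degree (U k))"
      by (subst U[OF k]) (use Unz[OF k] in \<open>simp add: degree_mult_eq del: mult_pCons_left\<close>)
    then show ?thesis using degree_P_poly[OF h_pos, of m] by simp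
  qed
  have degV: "Suc (degree (V k)) = 2*m-2" if k: "k \<in> {1..m-1}" for k
  proof -
    have "degree P = Suc (degree (V k))"
      by (subst V[OF k]) (use Unz[OF k] lam_nz[OF k] in \<open>simp add: degree_mult_eq del: mult_pCons_left\<close>)
    then show ?thesis using degree_P_poly[OF h_pos, of m] by simp
  qed
  define E where "E = (\<Sum>k=1..m-1. smult (A k) ([:0, 1:] * (smult (1 / lam k) (V k) + U k)))"
  define W where "W = smult pl (D_numerator m h)
     - ([:- 2 * of_real (exp h), 0, - 2 * of_real (exp h):] * P + [:0, 2 * C_const m h, 0:] * P + E)"
  have degE: "degree E \<le> 2*m-2"
    unfolding E_def
  proof (rule degree_sum_le)
    fix k assume k: "k \<in> {1..m-1}"
    have "degree (smult (1 / lam k) (V k) + U k) \<le> 2*m-3"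
      using degU[OF k] degV[OF k] by (intro degree_add_le) (auto intro: order_trans[OF degree_smult_le])
    then have "degree ([:0, 1:] * (smult (1 / lam k) (V k) + U k)) \<le> 1 + (2*m-3)"
      by (intro order_trans[OF degree_mult_le add_mono]) auto
    also have "\<dots> = 2*m-2" using degU[OF k] by simp
    finally show "degree (smult (A k) ([:0, 1:] * (smult (1 / lam k) (V k) + U k))) \<le> 2*m-2"
      using degree_smult_le order_trans by blast
  qed simp
  have coeffE: "coeff E (2*m) = 0" "coeff E (2*m-1) = 0"
    using degE m_pos by (auto intro!: coeff_eq_0)
  have cP: "coeff P (2*m) = 0" "coeff P (2*m-1) = 0" "coeff P (2*m-2) = pl"
    using degree_P_poly_le[of m h] m_pos by (auto intro!: coeff_eq_0 simp: p_lead_def)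
  have e1: "2*m = Suc (Suc (2*m-2))" "Suc (2*m-2) = 2*m-1" "Suc (2*m-1) = 2*m" using m_pos by auto
  have q0: "coeff ([:a, b, c:] * P) (2*m) = c * pl" for a b c
  proof -
    have "coeff ([:a, b, c:] * P) (Suc (Suc (2*m-2))) = c * pl"
      unfolding coeff_quadratic_mult unfolding e1(2,3) cP by simp
    then show ?thesis by (simp only: e1(1)[symmetric])
  qed
  have W0: "coeff W (2*m) = 0"
    unfolding W_def coeff_diff coeff_add coeff_smult q0 D_numerator_coeffs(1)[OF m_pos] coeffE by simp
  \<comment> \<open>This coefficient dictates the value of \<open>C_const\<close>. For
    \<open>m = 1\<close> truncated subtraction would turn the index \<open>2*m-3\<close> into 0, so
    that case is separate.\<close>
  have W1: "coeff W (2*m-1) = 0"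
  proof (cases "m = 1")
    case True
    then have "degree P = 0" using degree_P_poly_le[of m h] by simp
    then obtain c where c: "P = [:c:]" by (rule degree_eq_zeroE)
    moreover have "pl = c" unfolding p_lead_def c using True by simp
    ultimately have "P = [:pl:]" by simp
    then have a: "coeff ([:a, b, c:] * P) (2*m-1) = b * pl" for a b c
      using True by (simp add: coeff_pCons)
    show ?thesis
      unfolding W_def coeff_diff coeff_add coeff_smult a D_numerator_coeffs(2)[OF m_pos] coeffE
      using True by (simp add: C_const_def algebra_simps)
  next
    case False
    then have e: "2*m-1 = Suc (Suc (2*m-3))" "Suc (2*m-3) = 2*m-2" using m_pos by auto
    have a: "coeff ([:a, b, c:] * P) (2*m-1) = b * pl + c * coeff P (2*m-3)" for a b c
    proof -
      have "coeff ([:a, b, c:] * P) (Suc (Suc (2*m-3))) = b * pl + c * coeff P (2*m-3)"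
        unfolding coeff_quadratic_mult unfolding e(2) e1(2) cP by simp
      then show ?thesis by (simp only: e(1))
    qed
    have "pl * (of_real (exp h) * coeff P (2*m-3) / pl) = of_real (exp h) * coeff P (2*m-3)" using pl_nz by simp
    then show ?thesis
      unfolding W_def coeff_diff coeff_add coeff_smult a D_numerator_coeffs(2)[OF m_pos] coeffE
      using False pl_nz by (simp add: C_const_def algebra_simps)
  qed
  have degW: "degree W \<le> 2*m-2"
  proof -
    have "degree W \<le> 2*m"
      unfolding W_def
    proof (intro degree_diff_le degree_add_le)
      show "degree (smult pl (D_numerator m h)) \<le> 2*m"
        using degree_D_numerator[OF m_pos] degree_smult_le order_trans by blast
      show "degree ([:- 2 * of_real (exp h), 0, - 2 * of_real (exp h):] * P) \<le> 2*m"
      proof (rule order_trans[OF degree_mult_le])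
        show "degree [:- 2 * complex_of_real (exp h), 0, - 2 * of_real (exp h):] + degree P \<le> 2*m"
          using degree_P_poly_le[of m h] m_pos by simp
      qed
      show "degree ([:0, 2 * C_const m h, 0:] * P) \<le> 2*m"
      proof (rule order_trans[OF degree_mult_le])
        show "degree [:0, 2 * C_const m h, 0:] + degree P \<le> 2*m"
          using degree_P_poly_le[of m h] m_pos by (auto simp: le_diff_conv split: if_splits)
      qed
      show "degree E \<le> 2*m" using degE by simp
    qed
    moreover have "coeff W i = 0" if "i > 2*m-2" for i
    proof -
      consider "i = 2*m-1" | "i = 2*m" | "i > 2*m" using \<open>i > 2*m-2\<close> by linarith
      then show ?thesis using W0 W1 \<open>degree W \<le> 2*m\<close> by cases (auto intro: coeff_eq_0)
    qed
    ultimately show ?thesis by (intro degree_le) auto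
  qed
  have An: "A k * (lam k * poly (pderiv P) (lam k)) = poly (D_numerator m h) (lam k) * pl" if k: "k \<in> {1..m-1}" for k
    using lam_nz[OF k] pderiv_nz[OF k] by (simp add: A_coeff_def poly_D_numerator)
  have polyW: "poly W z = pl * poly (D_numerator m h) z
     - (- 2 * of_real (exp h) * (1 + z\<^sup>2) * poly P z + 2 * C_const m h * z * poly P z + poly E z)" for z
    unfolding W_def by (simp add: algebra_simps power2_eq_square)
  have polyE: "poly E z = (\<Sum>k=1..m-1. A k * (z * (poly (V k) z / lam k + poly (U k) z)))" for z
    unfolding E_def by (simp add: poly_sum mult.left_commute)
  have W_lam: "poly W (lam k) = 0" if k: "k \<in> {1..m-1}" for k
  proof -
    have "poly (V j) (lam k) = 0" if j: "j \<in> {1..m-1}" for j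
    proof -
      have "cmod (lam j * lam k) < 1"
        using mult_strict_mono[OF lam_norm[OF j] lam_norm[OF k]] lam_nz[OF j] by (simp add: norm_mult)
      then have "1 - lam j * lam k \<noteq> 0" by auto
      moreover have "poly ([:1, - lam j:] * V j) (lam k) = 0" using V[OF j] lam_root[OF k] by metis
      ultimately show ?thesis by (simp add: mult.commute)
    qed
    moreover have "poly (U j) (lam k) = (if j = k then poly (pderiv P) (lam k) else 0)" if j: "j \<in> {1..m-1}" for j
    proof (cases "j = k")
      case True
      have "pderiv P = pderiv ([:- lam k, 1:] * U k)" using U[OF k] by metis
      then have "poly (pderiv P) (lam k) = poly (U k) (lam k)"
        by (simp add: pderiv_mult pderiv_pCons del: mult_pCons_left)
      then show ?thesis using True by simp
    next
      case False
      then have "lam k - lam j \<noteq> 0" using lam_inj j k by (auto simp: inj_on_def)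
      moreover have "poly ([:- lam j, 1:] * U j) (lam k) = 0" using U[OF j] lam_root[OF k] by metis
      ultimately show ?thesis using False by simp
    qed
    ultimately have "poly E (lam k) = (\<Sum>j=1..m-1. if j = k then A k * (lam k * poly (pderiv P) (lam k)) else 0)"
      unfolding polyE by (intro sum.cong refl) auto
    also have "\<dots> = pl * poly (D_numerator m h) (lam k)" using k An[OF k] by (simp add: mult.commute)
    finally show ?thesis unfolding polyW by (simp add: lam_root[OF k])
  qed
  \<comment> \<open>The mirror image of the evaluation at \<open>lam k\<close>: now
    \<open>V k\<close> is the cofactor that survives, and palindromy carries over both
    \<open>D_numerator\<close> and the derivative of \<open>P\<close>.\<close>
  have W_inv: "poly W (inverse (lam k)) = 0" if k: "k \<in> {1..m-1}" for k
  proof -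
    define z where "z = inverse (lam k)"
    have z: "z \<noteq> 0" "inverse z = lam k" "lam k * z = 1" using lam_nz[OF k] by (auto simp: z_def)
    have Pz: "poly P z = 0" unfolding z_def by (rule inverse_lam_root[OF k])
    have "poly (U j) z = 0" if j: "j \<in> {1..m-1}" for j
    proof -
      have "z - lam j \<noteq> 0" using lam_norm[OF j] inverse_lam_norm[OF k] by (auto simp: z_def)
      moreover have "poly ([:- lam j, 1:] * U j) z = 0" using U[OF j] Pz by metis
      ultimately show ?thesis by simp
    qed
    moreover have "poly (V j) z = (if j = k then - poly (pderiv P) z / lam k else 0)" if j: "j \<in> {1..m-1}" for j
    proof (cases "j = k")
      case True
      have "pderiv P = pderiv ([:1, - lam k:] * V k)" by (subst V[OF k]) (rule refl)
      then have "poly (pderiv P) z = poly (pderiv ([:1, - lam k:] * V k)) z" by (simp only:)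
      also have "\<dots> = - lam k * poly (V k) z"
        using z unfolding pderiv_mult poly_add poly_mult by (simp add: pderiv_pCons mult.commute)
      finally have "poly (pderiv P) z = - lam k * poly (V k) z" .
      then show ?thesis using True lam_nz[OF k] by simp
    next
      case False
      then have "1 - lam j * z \<noteq> 0" using lam_inj j k lam_nz[OF k] by (auto simp: inj_on_def z_def field_simps)
      moreover have "poly ([:1, - lam j:] * V j) z = 0" using V[OF j] Pz by metis
      ultimately show ?thesis using False by (simp add: mult.commute)
    qed
    ultimately have "poly E z = (\<Sum>j=1..m-1. if j = k then A k * (z * (- poly (pderiv P) z / lam k / lam k)) else 0)"
      unfolding polyE by (intro sum.cong refl) auto
    then have Ez: "poly E z = A k * (z * (- poly (pderiv P) z / lam k / lam k))" using k by simp
    have "poly (D_numerator m h) z = z ^ (2*m) * poly (D_numerator m h) (lam k)"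
      using D_numerator_reflect[OF z(1) m_pos] z(2) by metis
    \<comment> \<open>Differentiating the palindromic identity relates the two derivatives; the term
      containing \<open>P\<close> itself drops out at a root.\<close>
    moreover have Pd: "poly (pderiv P) z = - (z ^ (2*m-4) * poly (pderiv P) (lam k)) "
    proof -
      have "((\<lambda>z. z ^ (2*m-2) * poly P (inverse z)) has_field_derivative
        (of_nat (2*m-2) * z ^ (2*m-3) * poly P (inverse z) - z ^ (2*m-2) * (poly (pderiv P) (inverse z) * (inverse z)\<^sup>2))) (at z)"
        by (rule derivative_eq_intros refl z(1) poly_DERIV[THEN DERIV_chain2] | simp add: power2_eq_square mult_ac)+
      moreover have ev: "eventually (\<lambda>w. w ^ (2*m-2) * poly P (inverse w) = poly P w) (nhds z)"
      proof (rule eventually_mono)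
        show "\<forall>\<^sub>F w in nhds z. w \<in> - {0}" using z by (intro eventually_nhds_in_open) auto
      qed (use P_poly_palindromic in auto)
      ultimately have "(poly P has_field_derivative (- (z ^ (2*m-2) * (poly (pderiv P) (lam k) * (inverse z)\<^sup>2)))) (at z)"
        using DERIV_cong_ev[OF refl ev refl, THEN iffD1] z(2) lam_root[OF k] by simp
      then have "poly (pderiv P) z = - (z ^ (2*m-2) * (poly (pderiv P) (lam k) * (inverse z)\<^sup>2))"
        using DERIV_unique poly_DERIV by blast
      moreover have "2*m-2 = (2*m-4) + 2" using k by auto
      then have "z ^ (2*m-2) = z ^ (2*m-4) * z\<^sup>2" by (metis power_add)
      moreover have "z\<^sup>2 * (inverse z)\<^sup>2 = 1" using z(1) by (simp flip: power_mult_distrib)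
      moreover have "u * v * (p * w) = u * (v * w) * p" for u v p w :: complex by simp
      ultimately show ?thesis by (simp only: mult_1_right)
    qed
    moreover have "2*m = (2*m-4) + 4" using k by auto
    then have "z ^ (2*m) = z ^ (2*m-4) * z ^ 4" by (metis power_add)
    moreover have "poly E z = z ^ (2*m-4) * z ^ 4 * (A k * (lam k * poly (pderiv P) (lam k)))"
    proof -
      define w p where "w = z ^ (2*m-4)" and "p = poly (pderiv P) (lam k)"
      have "x / lam k = x * z" for x by (simp add: z_def divide_inverse)
      then have "poly E z = A k * (z * (w * p * z * z))" unfolding Ez Pd w_def p_def by simp
      also have "\<dots> = w * z ^ 4 * (A k * (lam k * p))" using z(3) by algebra
      finally show ?thesis by (simp only: w_def p_def)
    qed
    ultimately have "poly E z = pl * poly (D_numerator m h) z" using An[OF k] by (simp add: mult_ac)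
    then show ?thesis unfolding z_def[symmetric] polyW by (simp add: Pz)
  qed
  have W00: "poly W 0 = 0"
    unfolding polyW polyE by (simp add: P_at_0 poly_D_numerator)
  have "W = 0"
  proof (rule ccontr)
    assume W: "W \<noteq> 0"
    have "insert 0 roots \<subseteq> {z. poly W z = 0}" using W00 W_lam W_inv by (auto simp: roots_def)
    then have "card (insert 0 roots) \<le> degree W"
      using card_mono[OF poly_roots_finite[OF W]] card_poly_roots_bound[OF W] by (meson order_trans)
    moreover have "0 \<notin> roots" using lam_nz by (auto simp: roots_def)
    ultimately show False using degW card_roots finite_roots m_pos by simp
  qed
  then have id: "pl * poly (D_numerator m h) z
     = - 2 * of_real (exp h) * (1 + z\<^sup>2) * poly P z + 2 * C_const m h * z * poly P z + poly E z"
    using polyW[of z] by simp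
  have "poly E z = (\<Sum>k=1..m-1. z * poly P z * (A k / lam k * (1 / (1 - lam k * z) + lam k / (z - lam k))))"
    unfolding polyE
  proof (intro sum.cong refl)
    fix k assume k: "k \<in> {1..m-1}"
    have "poly P z = (z - lam k) * poly (U k) z"
      by (subst U[OF k]) (simp add: algebra_simps)
    then have "poly (U k) z = poly P z / (z - lam k)"
      using z(2)[OF k] by simp
    moreover have "poly P z = (1 - lam k * z) * poly (V k) z"
      by (subst V[OF k]) (simp add: algebra_simps)
    then have "poly (V k) z = poly P z / (1 - lam k * z)"
      using z(2)[OF k] by simp
    ultimately
    show "A k * (z * (poly (V k) z / lam k + poly (U k) z))
       = z * poly P z * (A k / lam k * (1 / (1 - lam k * z) + lam k / (z - lam k)))"
      using lam_nz[OF k] by (simp add: distrib_left mult_ac)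
  qed
  then have E': "poly E z = z * poly P z * (\<Sum>k=1..m-1. A k / lam k * (1 / (1 - lam k * z) + lam k / (z - lam k)))"
    by (simp only: sum_distrib_left)
  have zz: "z * (z + inverse z) = 1 + z\<^sup>2" using z(1) by (simp add: power2_eq_square distrib_left)
  have "z * p * (- 2 * e * w + 2 * c + S) = - 2 * e * (z * w) * p + 2 * c * z * p + z * p * S"
    for p e w c S :: complex by (simp add: algebra_simps)
  then show ?thesis unfolding id E' zz[symmetric] .
qed

text \<open>The symbol at \<open>z = exp t\<close>. Its zeros at \<open>t = h\<close> and
  \<open>t = - h\<close> and its order of vanishing at \<open>t = 0\<close> are what the
  annihilation statements rest on.\<close>

definition S :: "real \<Rightarrow> complex" where
  "S t = poly (D_numerator m h) (of_real (exp t)) / (of_real (exp t) * poly P (of_real (exp t)))"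

text \<open>Since \<open>inner\<close> is strict, the closed range \<open>|t| \<le> h\<close> is
  admissible, and its end points are exactly the exponents that \<open>D_m\<close> has to
  annihilate.\<close>

lemma P_nz_near_circle:
  assumes "\<bar>t\<bar> \<le> h"
  shows "poly P (of_real (exp t)) \<noteq> 0"
    and "k \<in> {1..m-1} \<Longrightarrow> cmod (lam k * of_real (exp t)) < 1 \<and> cmod (lam k / of_real (exp t)) < 1"
proof -
  show 2: "cmod (lam k * of_real (exp t)) < 1 \<and> cmod (lam k / of_real (exp t)) < 1" if k: "k \<in> {1..m-1}" for k
  proof -
    have "cmod (lam k) * exp t < exp (- h) * exp t" "cmod (lam k) * exp (- t) < exp (- h) * exp (- t)"
      using inner[OF k] by simp_all
    moreover have "exp (- h) * exp t \<le> 1" "exp (- h) * exp (- t) \<le> 1"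
      using assms by (simp_all flip: exp_add)
    moreover have "cmod (lam k * of_real (exp t)) = cmod (lam k) * exp t"
      "cmod (lam k / of_real (exp t)) = cmod (lam k) * exp (- t)"
      by (simp_all add: norm_mult norm_divide exp_minus field_simps)
    ultimately show ?thesis by linarith
  qed
  show "poly P (of_real (exp t)) \<noteq> 0"
  proof
    assume "poly P (of_real (exp t)) = 0"
    then have "complex_of_real (exp t) \<in> roots" using P_roots by auto
    then obtain k where k: "k \<in> {1..m-1}" and "complex_of_real (exp t) = lam k \<or> complex_of_real (exp t) = inverse (lam k)"
      by (auto simp: roots_def)
    then have "lam k / of_real (exp t) = 1 \<or> lam k * of_real (exp t) = 1"
      using lam_nz[OF k] by auto
    then show False using 2[OF k] by (metis less_irrefl norm_one)
  qed
qed

lemma symbol_has_sum: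
  assumes t: "\<bar>t\<bar> \<le> h"
  shows "((\<lambda>\<beta>. D \<beta> * of_real (exp (t * of_int \<beta>))) has_sum S t) UNIV"
proof -
  define z where "z = complex_of_real (exp t)"
  have z: "z \<noteq> 0" by (simp add: z_def)
  have nz: "1 - lam k * z \<noteq> 0 \<and> z - lam k \<noteq> 0" "cmod (lam k * z) < 1" "cmod (lam k / z) < 1"
    if k: "k \<in> {1..m-1}" for k
    using P_nz_near_circle(2)[OF t k] z by (auto simp: z_def[symmetric])
  have zp: "complex_of_real (exp (t * of_int \<beta>)) = z powi \<beta>" for \<beta>
    by (cases "\<beta> \<ge> 0") (simp_all add: z_def power_int_def exp_of_nat_mult[symmetric] mult.commute exp_minus
        power_inverse flip: of_real_power of_real_inverse)
  have a: "((\<lambda>\<beta>. (if \<bar>\<beta>\<bar> = 1 then 1 else 0) * z powi \<beta>) has_sum (z + inverse z)) UNIV"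
  proof -
    have "((\<lambda>\<beta>. (if \<bar>\<beta>\<bar> = 1 then 1 else 0) * z powi \<beta>) has_sum (\<Sum>\<beta>\<in>{-1,1}. (if \<bar>\<beta>\<bar> = 1 then 1 else 0) * z powi \<beta>)) {-1, 1::int}"
      by (rule has_sum_finite) simp
    then have "((\<lambda>\<beta>. (if \<bar>\<beta>\<bar> = 1 then 1 else 0) * z powi \<beta>) has_sum (z + inverse z)) {-1, 1::int}"
      by (simp add: add.commute)
    then show ?thesis
      by (rule has_sum_cong_neutral[THEN iffD1, rotated -1]) auto
  qed
  have b: "((\<lambda>\<beta>. (if \<beta> = 0 then 1 else 0) * z powi \<beta>) has_sum 1) (UNIV :: int set)"
  proof -
    have "((\<lambda>\<beta>. (if \<beta> = 0 then 1 else 0) * z powi \<beta>) has_sum (\<Sum>\<beta>\<in>{0}. (if \<beta> = 0 then 1 else 0) * z powi \<beta>)) {0::int}"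
      by (rule has_sum_finite) simp
    then have "((\<lambda>\<beta>. (if \<beta> = 0 then 1 else 0) * z powi \<beta>) has_sum 1) {0::int}" by simp
    then show ?thesis
      by (rule has_sum_cong_neutral[THEN iffD1, rotated -1]) auto
  qed
  have c: "((\<lambda>\<beta>. \<Sum>k=1..m-1. A k / lam k * (lam k ^ nat \<bar>\<beta>\<bar> * z powi \<beta>)) has_sum
      (\<Sum>k=1..m-1. A k / lam k * (1 / (1 - lam k * z) + lam k / (z - lam k)))) UNIV"
  proof (intro has_sum_finite_sum has_sum_cmult_right finite_atLeastAtMost)
    fix k assume k: "k \<in> {1..m-1}"
    have "z * (1 - lam k / z) = z - lam k" using z by (simp add: right_diff_distrib)
    then have "(lam k / z) / (1 - lam k / z) = lam k / (z - lam k)" by simp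
    then show "((\<lambda>\<beta>. lam k ^ nat \<bar>\<beta>\<bar> * z powi \<beta>) has_sum (1 / (1 - lam k * z) + lam k / (z - lam k))) UNIV"
      using has_sum_two_sided_geometric[OF z nz(2,3)[OF k]] by (simp only:)
  qed
  have "((\<lambda>\<beta>. 1 / pl * (- 2 * of_real (exp h) * ((if \<bar>\<beta>\<bar> = 1 then 1 else 0) * z powi \<beta>)
        + 2 * C_const m h * ((if \<beta> = 0 then 1 else 0) * z powi \<beta>)
        + (\<Sum>k=1..m-1. A k / lam k * (lam k ^ nat \<bar>\<beta>\<bar> * z powi \<beta>)))) has_sum
      (1 / pl * (- 2 * of_real (exp h) * (z + inverse z) + 2 * C_const m h * 1
        + (\<Sum>k=1..m-1. A k / lam k * (1 / (1 - lam k * z) + lam k / (z - lam k)))))) UNIV"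
    by (intro has_sum_cmult_right has_sum_add a b c)
  moreover have "1 / pl * (- 2 * of_real (exp h) * ((if \<bar>\<beta>\<bar> = 1 then 1 else 0) * z powi \<beta>)
        + 2 * C_const m h * ((if \<beta> = 0 then 1 else 0) * z powi \<beta>)
        + (\<Sum>k=1..m-1. A k / lam k * (lam k ^ nat \<bar>\<beta>\<bar> * z powi \<beta>))) = D \<beta> * z powi \<beta>" for \<beta>
    unfolding D_formula by (simp only: distrib_right sum_distrib_right mult.assoc)
  moreover have "1 / pl * (- 2 * of_real (exp h) * (z + inverse z) + 2 * C_const m h * 1
        + (\<Sum>k=1..m-1. A k / lam k * (1 / (1 - lam k * z) + lam k / (z - lam k)))) = S t"
  proof -
    have P: "poly P z \<noteq> 0" using P_nz_near_circle(1)[OF t] by (simp add: z_def)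
    have "X = Y / (z * poly P z) * pl" if "z * poly P z * X = pl * Y" for X Y
      using that P z by (simp add: field_simps)
    from this[OF symbol_identity[OF z nz(1)]] show ?thesis
      unfolding S_def z_def[symmetric] using pl_nz by simp
  qed
  ultimately show ?thesis unfolding zp by simp
qed

lemma D_bound:
  obtains K r where "0 < r" "r < exp (- h)" "\<And>\<beta>. cmod (D \<beta>) \<le> K * r ^ nat \<bar>\<beta>\<bar>" "K \<ge> 0"
proof -
  \<comment> \<open>The entry \<open>exp (- h) / 2\<close> keeps the set nonempty when
    \<open>m = 1\<close> and makes the rate positive.\<close>
  define r where "r = Max (insert (exp (- h) / 2) (cmod ` lam ` {1..m-1}))"
  have r0: "r > 0" "r < exp (- h)"
  proof -
    have "exp (- h) / 2 \<le> r" unfolding r_def by (rule Max_ge) auto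
    moreover have "exp (- h) / 2 > 0" by simp
    ultimately show "r > 0" by linarith
    show "r < exp (- h)" unfolding r_def using inner by (subst Max_less_iff) auto
  qed
  have rk: "cmod (lam k) \<le> r" if "k \<in> {1..m-1}" for k unfolding r_def by (rule Max_ge) (use that in auto)
  define K where "K = cmod (1 / pl) * (cmod (- 2 * of_real (exp h)) * (1 / r) + cmod (2 * C_const m h)
     + (\<Sum>k=1..m-1. cmod (A k / lam k)))"
  have "cmod (D \<beta>) \<le> K * r ^ nat \<bar>\<beta>\<bar>" for \<beta>
  proof -
    have 1: "cmod (- 2 * of_real (exp h) * (if \<bar>\<beta>\<bar> = 1 then 1 else 0)) \<le> cmod (- 2 * of_real (exp h)) * (1 / r) * r ^ nat \<bar>\<beta>\<bar>"
    proof (cases "\<bar>\<beta>\<bar> = 1")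
      case True
      then have "nat \<bar>\<beta>\<bar> = 1" by simp
      then show ?thesis using True r0 by simp
    qed (use r0 in simp)
    have 2: "cmod (2 * C_const m h * (if \<beta> = 0 then 1 else 0)) \<le> cmod (2 * C_const m h) * r ^ nat \<bar>\<beta>\<bar>"
      using r0 by simp
    have 3: "cmod (\<Sum>k=1..m-1. A k / lam k * lam k ^ nat \<bar>\<beta>\<bar>) \<le> (\<Sum>k=1..m-1. cmod (A k / lam k)) * r ^ nat \<bar>\<beta>\<bar>"
      unfolding sum_distrib_right
      by (rule order_trans[OF norm_sum sum_mono])
         (simp only: norm_mult norm_power, intro mult_left_mono power_mono rk norm_ge_zero)
    have "cmod (D \<beta>) \<le> cmod (1 / pl) * (cmod (- 2 * of_real (exp h)) * (1 / r) * r ^ nat \<bar>\<beta>\<bar>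
        + cmod (2 * C_const m h) * r ^ nat \<bar>\<beta>\<bar> + (\<Sum>k=1..m-1. cmod (A k / lam k)) * r ^ nat \<bar>\<beta>\<bar>)"
      unfolding D_formula norm_mult[of "1 / pl"]
      by (intro mult_left_mono norm_triangle_le add_mono order_trans[OF norm_triangle_ineq] 1 2 3) simp
    also have "\<dots> = K * r ^ nat \<bar>\<beta>\<bar>" by (simp only: K_def distrib_right mult.assoc)
    finally show ?thesis .
  qed
  moreover have "K \<ge> 0" unfolding K_def using r0
    by (intro mult_nonneg_nonneg add_nonneg_nonneg sum_nonneg) auto
  ultimately show thesis using that r0 by blast
qed

text \<open>\<open>D_m\<close> decays at a geometric rate \<open>r < exp (- h)\<close>; against
  growth \<open>exp (h * |\<gamma>|)\<close> the effective ratio \<open>r * exp h\<close> is still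
  below 1.\<close>

lemma growth_summable:
  assumes "\<And>\<gamma>. cmod (\<phi> \<gamma>) \<le> K' * exp (h * \<bar>of_int \<gamma>\<bar>)"
  shows "(\<lambda>\<gamma>. cmod (D (\<beta> - \<gamma>) * \<phi> \<gamma>)) summable_on UNIV"
proof -
  obtain K r where r: "0 < r" "r < exp (- h)" and D: "\<And>\<beta>. cmod (D \<beta>) \<le> K * r ^ nat \<bar>\<beta>\<bar>" and K: "K \<ge> 0"
    by (rule D_bound) (rule that)
  define q where "q = r * exp h"
  have "r * exp h < exp (- h) * exp h" using r by simp
  then have q: "0 < q" "q < 1" using r by (simp_all add: q_def flip: exp_add)
  have K': "K' \<ge> 0" using order_trans[OF norm_ge_zero assms[of 0]] by simp
  have "((\<lambda>\<delta>. complex_of_real q ^ nat \<bar>\<delta>\<bar> * 1 powi \<delta>) has_sum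
      (1 / (1 - of_real q * 1) + (of_real q / 1) / (1 - of_real q / 1))) UNIV"
    by (rule has_sum_two_sided_geometric) (use q in auto)
  then have "((\<lambda>\<gamma>. complex_of_real q ^ nat \<bar>\<beta> - \<gamma>\<bar> * 1 powi (\<beta> - \<gamma>)) has_sum
      (1 / (1 - of_real q * 1) + (of_real q / 1) / (1 - of_real q / 1))) UNIV"
    by (simp only: has_sum_int_shift[of "\<lambda>\<delta>. complex_of_real q ^ nat \<bar>\<delta>\<bar> * 1 powi \<delta>"])
  then have "(\<lambda>\<gamma>. complex_of_real (q ^ nat \<bar>\<beta> - \<gamma>\<bar>)) summable_on UNIV"
    by (auto simp: summable_on_def)
  then have "(\<lambda>\<gamma>. q ^ nat \<bar>\<beta> - \<gamma>\<bar>) summable_on UNIV"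
    using summable_on_Re by fastforce
  then have s: "(\<lambda>\<gamma>. (K * K' * exp (h * \<bar>of_int \<beta>\<bar>)) * q ^ nat \<bar>\<beta> - \<gamma>\<bar>) summable_on UNIV"
    by (rule summable_on_cmult_right)
  show ?thesis
  proof (rule summable_on_comparison_test[OF s])
    fix \<gamma> :: int
    have e: "exp (h * \<bar>of_int \<gamma>\<bar>) \<le> exp (h * \<bar>of_int \<beta>\<bar>) * exp h ^ nat \<bar>\<beta> - \<gamma>\<bar>"
    proof -
      have "real_of_int \<bar>\<gamma>\<bar> \<le> real_of_int (\<bar>\<beta>\<bar> + \<bar>\<beta> - \<gamma>\<bar>)" by simp
      then have "h * \<bar>of_int \<gamma>\<bar> \<le> h * \<bar>of_int \<beta>\<bar> + h * real (nat \<bar>\<beta> - \<gamma>\<bar>)"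
        using h_pos by (simp flip: distrib_left)
      then show ?thesis by (simp flip: exp_of_nat_mult exp_add add: mult.commute)
    qed
    have "cmod (D (\<beta> - \<gamma>) * \<phi> \<gamma>) \<le> (K * r ^ nat \<bar>\<beta> - \<gamma>\<bar>) * (K' * (exp (h * \<bar>of_int \<beta>\<bar>) * exp h ^ nat \<bar>\<beta> - \<gamma>\<bar>))"
      unfolding norm_mult using D assms K K' r e
      by (intro mult_mono order_trans[OF assms mult_left_mono[OF e]]) auto
    also have "\<dots> = (K * K' * exp (h * \<bar>of_int \<beta>\<bar>)) * q ^ nat \<bar>\<beta> - \<gamma>\<bar>"
      by (simp add: q_def power_mult_distrib)
    finally show "cmod (D (\<beta> - \<gamma>) * \<phi> \<gamma>) \<le> (K * K' * exp (h * \<bar>of_int \<beta>\<bar>)) * q ^ nat \<bar>\<beta> - \<gamma>\<bar>" .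
  qed simp
qed

end

section \<open>The discrete operator on exponentials and polynomials\<close>

lemma has_sum_norm_le:
  fixes f :: "'a \<Rightarrow> complex" and g :: "'a \<Rightarrow> real"
  assumes f: "(f has_sum a) A" and g: "(g has_sum b) A" and le: "\<And>x. x \<in> A \<Longrightarrow> norm (f x) \<le> g x"
  shows "norm a \<le> b"
proof (rule tendsto_le[OF _ _ tendsto_norm])
  show "(sum g \<longlongrightarrow> b) (finite_subsets_at_top A)" "(sum f \<longlongrightarrow> a) (finite_subsets_at_top A)"
    using f g by (simp_all add: has_sum_def)
  show "\<forall>\<^sub>F X in finite_subsets_at_top A. norm (sum f X) \<le> sum g X"
    by (intro eventually_finite_subsets_at_top_weakI order_trans[OF norm_sum sum_mono] le) auto
qed simp

lemma has_sum_diff: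
  fixes f g :: "'a \<Rightarrow> complex"
  assumes "(f has_sum a) A" "(g has_sum b) A"
  shows "((\<lambda>x. f x - g x) has_sum (a - b)) A"
  using has_sum_add[OF assms(1) has_sum_cmult_right[OF assms(2), of "-1"]] by simp

context discrete_operator begin

text \<open>Up to a nonzero factor the sum is the symbol at \<open>t = - s * h\<close>, a zero of
  the quadratic factor of \<open>D_numerator\<close>.\<close>

lemma has_sum_exp:
  assumes "s \<in> {1, - 1}"
  shows "((\<lambda>\<gamma>. D (\<beta> - \<gamma>) * of_real (exp (s * (h * of_int \<gamma>)))) has_sum 0) UNIV"
proof -
  define e e' where "e = complex_of_real (exp h)" and "e' = complex_of_real (exp (- h))"
  have ee: "e * e' = 1" by (simp add: e_def e'_def flip: of_real_mult exp_add)
  have e2: "complex_of_real (exp (2*h)) = e * e" by (simp add: e_def flip: of_real_mult exp_add)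
  have "e' * (e * e + 1) - e * (e'\<^sup>2 + 1) = 0" using ee by algebra
  moreover have "e * (e * e + 1) - e * (e\<^sup>2 + 1) = 0" by (simp add: power2_eq_square)
  ultimately have "poly (D_numerator m h) e = 0" "poly (D_numerator m h) e' = 0"
    unfolding poly_D_numerator of_real_add e2 e_def[symmetric] by simp_all
  then have "S h = 0" "S (- h) = 0" by (simp_all add: S_def e_def e'_def)
  then have S0: "S (- s * h) = 0" using assms by auto
  have "((\<lambda>\<delta>. D \<delta> * of_real (exp ((- s * h) * of_int \<delta>))) has_sum 0) UNIV"
    using symbol_has_sum[of "- s * h"] S0 assms h_pos by auto
  then have "((\<lambda>\<gamma>. D (\<beta> - \<gamma>) * of_real (exp ((- s * h) * of_int (\<beta> - \<gamma>)))) has_sum 0) UNIV"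
    by (simp only: has_sum_int_shift[of "\<lambda>\<delta>. D \<delta> * of_real (exp ((- s * h) * of_int \<delta>))"])
  then have "((\<lambda>\<gamma>. of_real (exp (s * (h * of_int \<beta>))) * (D (\<beta> - \<gamma>) * of_real (exp ((- s * h) * of_int (\<beta> - \<gamma>))))) has_sum
     (of_real (exp (s * (h * of_int \<beta>))) * 0)) UNIV"
    by (rule has_sum_cmult_right)
  moreover have eq: "of_real (exp (s * (h * of_int \<beta>))) * (D (\<beta> - \<gamma>) * of_real (exp ((- s * h) * of_int (\<beta> - \<gamma>))))
     = D (\<beta> - \<gamma>) * of_real (exp (s * (h * of_int \<gamma>)))" for \<gamma>
  proof -
    have "exp (s * (h * of_int \<beta>)) * exp ((- s * h) * of_int (\<beta> - \<gamma>)) = exp (s * (h * of_int \<gamma>))"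
      by (simp add: algebra_simps flip: exp_add)
    then show ?thesis
      by (metis (no_types, lifting) mult.left_commute of_real_mult)
  qed
  ultimately show ?thesis unfolding eq mult_zero_right by simp
qed

text \<open>The factor \<open>(1 - z) ^ (2*m-2)\<close> vanishes at \<open>z = exp t\<close> to
  order \<open>2*m-2\<close> as \<open>t\<close> tends to 0, so a power of \<open>t\<close> is left
  over after division by \<open>t ^ j\<close>.\<close>

lemma S_tendsto:
  assumes j: "j < 2*m-2"
  shows "((\<lambda>t. S t / of_real (t ^ j)) \<longlongrightarrow> 0) (at 0)"
proof -
  have P1: "poly P 1 \<noteq> 0" using P_nz_near_circle(1)[of 0] h_pos by simp
  have q: "((\<lambda>t. (1 - complex_of_real (exp t)) / of_real t) \<longlongrightarrow> - 1) (at 0)"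
  proof -
    have "((\<lambda>t. (exp t - exp 0) / (t - 0)) \<longlongrightarrow> exp 0) (at (0::real))"
      using DERIV_exp[of 0] by (simp add: has_field_derivative_iff)
    then have "((\<lambda>t. complex_of_real (- ((exp t - 1) / t))) \<longlongrightarrow> of_real (- 1)) (at 0)"
      by (intro tendsto_of_real tendsto_minus) simp
    then show ?thesis by (simp add: minus_divide_left)
  qed
  have c: "((\<lambda>t. complex_of_real (exp t)) \<longlongrightarrow> 1) (at 0)"
    using tendsto_of_real[OF tendsto_exp[OF tendsto_ident_at[of "0::real" UNIV]]] by simp
  have "((\<lambda>t. 2 * ((1 - complex_of_real (exp t)) / of_real t) ^ j * (1 - of_real (exp t)) ^ (2*m-2-j)
      * (of_real (exp t) * of_real (exp (2*h) + 1) - of_real (exp h) * ((of_real (exp t))\<^sup>2 + 1))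
      / (of_real (exp t) * poly P (of_real (exp t)))) \<longlongrightarrow>
     (2 * (- 1) ^ j * (1 - 1) ^ (2*m-2-j) * (1 * of_real (exp (2*h) + 1) - of_real (exp h) * (1\<^sup>2 + 1)) / (1 * poly P 1))) (at 0)"
    by (intro tendsto_intros q c) (use P1 in auto)
  moreover have "(1 - 1 :: complex) ^ (2*m-2-j) = 0" using j by simp
  moreover have "2 * ((1 - complex_of_real (exp t)) / of_real t) ^ j * (1 - of_real (exp t)) ^ (2*m-2-j)
      * (of_real (exp t) * of_real (exp (2*h) + 1) - of_real (exp h) * ((of_real (exp t))\<^sup>2 + 1))
      / (of_real (exp t) * poly P (of_real (exp t))) = S t / of_real (t ^ j)" for t
  proof -
    have "2*m-2 = j + (2*m-2-j)" using j by simp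
    then have "(1 - complex_of_real (exp t)) ^ (2*m-2) = (1 - of_real (exp t)) ^ j * (1 - of_real (exp t)) ^ (2*m-2-j)"
      by (metis power_add)
    then show ?thesis unfolding S_def poly_D_numerator by (simp add: power_divide mult_ac)
  qed
  ultimately show ?thesis by (simp only: mult_zero_right mult_zero_left div_0)
qed

text \<open>The \<open>j\<close>-th moment is \<open>j!\<close> times the coefficient of
  \<open>t ^ j\<close> in the expansion of \<open>S\<close> at 0. Lower moments vanish by induction,
  so \<open>S t\<close> is \<open>M * t ^ j / j!\<close> up to a remainder of order
  \<open>t ^ (j+1)\<close>, and \<open>S_tendsto\<close> forces \<open>M = 0\<close>.\<close>

lemma moment_zero:
  assumes "j < 2*m-2"
  shows "((\<lambda>\<delta>. D \<delta> * of_int \<delta> ^ j) has_sum 0) UNIV"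
  using assms
proof (induction j rule: less_induct)
  case (less j)
  let ?f = "\<lambda>i \<delta>. D \<delta> * of_int \<delta> ^ i"
  \<comment> \<open>Half of the growth that \<open>D_m\<close> tolerates is spent on the power here;
    the other half is kept for the exponential in the Taylor remainder, which explains the range
    \<open>|t| \<le> h/2\<close> below.\<close>
  have power_bound: "\<bar>real_of_int \<delta>\<bar> ^ i \<le> fact i * (2/h) ^ i * exp (h/2 * \<bar>of_int \<delta>\<bar>)" for i \<delta>
  proof -
    have "(h/2 * \<bar>of_int \<delta>\<bar>) ^ i / fact i \<le> exp (h/2 * \<bar>of_int \<delta>\<bar>)"
    proof -
      have "(\<Sum>k<Suc i. (h/2 * \<bar>of_int \<delta>\<bar>) ^ k / fact k) \<le> exp (h/2 * \<bar>of_int \<delta>\<bar>)"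
      proof -
        obtain u where "exp (h/2 * \<bar>of_int \<delta>\<bar>) = (\<Sum>k<Suc i. (h/2 * \<bar>of_int \<delta>\<bar>) ^ k / fact k)
            + exp u / fact (Suc i) * (h/2 * \<bar>of_int \<delta>\<bar>) ^ Suc i"
          using Maclaurin_exp_le[of "h/2 * \<bar>of_int \<delta>\<bar>" "Suc i"] by blast
        moreover have "exp u / fact (Suc i) * (h/2 * \<bar>real_of_int \<delta>\<bar>) ^ Suc i \<ge> 0"
          using h_pos by (intro mult_nonneg_nonneg zero_le_power) auto
        ultimately show ?thesis by linarith
      qed
      moreover have "(\<Sum>k<Suc i. (h/2 * \<bar>of_int \<delta>\<bar>) ^ k / fact k) \<ge> (h/2 * \<bar>of_int \<delta>\<bar>) ^ i / fact i"
        using h_pos by (simp add: sum_nonneg)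
      ultimately show ?thesis by linarith
    qed
    then show ?thesis using h_pos by (simp add: power_mult_distrib power_divide field_simps)
  qed
  have "(\<lambda>\<delta>. cmod (D (0 - \<delta>) * of_int \<delta> ^ j)) summable_on UNIV"
  proof (rule growth_summable)
    fix \<delta> :: int
    have "cmod (of_int \<delta> ^ j) = \<bar>real_of_int \<delta>\<bar> ^ j" by (simp add: norm_power)
    also have "\<dots> \<le> (fact j * (2/h) ^ j) * exp (h/2 * \<bar>of_int \<delta>\<bar>)" using power_bound[of \<delta> j] by simp
    also have "\<dots> \<le> (fact j * (2/h) ^ j) * exp (h * \<bar>of_int \<delta>\<bar>)"
      using h_pos by (intro mult_left_mono) (auto simp: mult_right_mono)
    finally show "cmod (of_int \<delta> ^ j) \<le> (fact j * (2/h) ^ j) * exp (h * \<bar>of_int \<delta>\<bar>)" .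
  qed
  then have "(\<lambda>\<delta>. D (0 - \<delta>) * of_int \<delta> ^ j) summable_on UNIV" by (rule abs_summable_summable)
  then have "?f j summable_on UNIV" by (simp only: diff_0 D_even)
  then obtain M where M: "(?f j has_sum M) UNIV" by (auto simp: summable_on_def)
  define B where "B = (\<Sum>\<^sub>\<infinity>\<delta>. cmod (D \<delta>) * ((2/h) ^ Suc j * exp (h * \<bar>of_int \<delta>\<bar>)))"
  have "(\<lambda>\<delta>. cmod (D (0 - \<delta>) * of_real ((2/h) ^ Suc j * exp (h * \<bar>of_int \<delta>\<bar>)))) summable_on UNIV"
    by (rule growth_summable[of _ "(2/h) ^ Suc j"]) (use h_pos in \<open>simp only: norm_of_real, simp add: abs_mult\<close>)
  then have "(\<lambda>\<delta>. cmod (D \<delta>) * ((2/h) ^ Suc j * exp (h * \<bar>of_int \<delta>\<bar>))) summable_on UNIV"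
    using h_pos by (simp only: diff_0 D_even norm_mult norm_of_real abs_mult power_abs abs_exp_cancel abs_divide abs_numeral abs_of_pos)
  then have B: "((\<lambda>\<delta>. cmod (D \<delta>) * ((2/h) ^ Suc j * exp (h * \<bar>of_int \<delta>\<bar>))) has_sum B) UNIV"
    unfolding B_def by (rule has_sum_infsum)
  have key: "cmod (S t - M * of_real (t ^ j / fact j)) \<le> \<bar>t\<bar> ^ Suc j * B" if t: "\<bar>t\<bar> \<le> h/2" for t
  proof -
    have "((\<lambda>\<delta>. \<Sum>i<Suc j. of_real (t ^ i / fact i) * ?f i \<delta>) has_sum
        (\<Sum>i<Suc j. of_real (t ^ i / fact i) * (if i = j then M else 0))) UNIV"
    proof (intro has_sum_finite_sum has_sum_cmult_right)
      fix i assume "i \<in> {..<Suc j}"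
      then show "(?f i has_sum (if i = j then M else 0)) UNIV"
        using M less.IH[of i] less.prems by (cases "i = j") auto
    qed simp
    then have 1: "((\<lambda>\<delta>. \<Sum>i<Suc j. of_real (t ^ i / fact i) * ?f i \<delta>) has_sum (M * of_real (t ^ j / fact j))) UNIV"
      by (simp add: mult.commute)
    have 2: "((\<lambda>\<delta>. D \<delta> * of_real (exp (t * of_int \<delta>))) has_sum S t) UNIV"
      by (rule symbol_has_sum) (use t h_pos in auto)
    have 3: "((\<lambda>\<delta>. D \<delta> * of_real (exp_tail (Suc j) (t * of_int \<delta>))) has_sum (S t - M * of_real (t ^ j / fact j))) UNIV"
    proof -
      have "D \<delta> * of_real (exp (t * of_int \<delta>)) - (\<Sum>i<Suc j. of_real (t ^ i / fact i) * ?f i \<delta>)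
         = D \<delta> * of_real (exp_tail (Suc j) (t * of_int \<delta>))" for \<delta>
        unfolding exp_tail_def of_real_diff right_diff_distrib of_real_sum sum_distrib_left
        by (intro arg_cong2[where f="(-)"] sum.cong refl) (simp add: power_mult_distrib)
      with has_sum_diff[OF 2 1] show ?thesis by simp
    qed
    have "((\<lambda>\<delta>. \<bar>t\<bar> ^ Suc j * (cmod (D \<delta>) * ((2/h) ^ Suc j * exp (h * \<bar>of_int \<delta>\<bar>)))) has_sum (\<bar>t\<bar> ^ Suc j * B)) UNIV"
      by (rule has_sum_cmult_right[OF B])
    with 3 show ?thesis
    proof (rule has_sum_norm_le)
      fix \<delta> :: int
      obtain \<theta> where \<theta>: "\<bar>\<theta>\<bar> \<le> \<bar>t * of_int \<delta>\<bar>"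
        and T: "exp (t * of_int \<delta>) = (\<Sum>k<Suc j. (t * of_int \<delta>) ^ k / fact k) + exp \<theta> / fact (Suc j) * (t * of_int \<delta>) ^ Suc j"
        using Maclaurin_exp_le[of "t * of_int \<delta>" "Suc j"] by blast
      have "\<bar>exp_tail (Suc j) (t * of_int \<delta>)\<bar> = exp \<theta> / fact (Suc j) * (\<bar>t\<bar> ^ Suc j * \<bar>of_int \<delta>\<bar> ^ Suc j)"
        unfolding exp_tail_def T by (simp add: abs_mult power_abs power_mult_distrib del: power_Suc fact_Suc)
      also have "\<dots> \<le> exp (h/2 * \<bar>of_int \<delta>\<bar>) / fact (Suc j) * (\<bar>t\<bar> ^ Suc j * (fact (Suc j) * (2/h) ^ Suc j * exp (h/2 * \<bar>of_int \<delta>\<bar>)))"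
      proof (intro mult_mono divide_right_mono power_bound)
        have "\<theta> \<le> \<bar>t\<bar> * \<bar>of_int \<delta>\<bar>" using \<theta> by (simp add: abs_mult)
        also have "\<dots> \<le> h/2 * \<bar>of_int \<delta>\<bar>" using t by (intro mult_right_mono) auto
        finally show "exp \<theta> \<le> exp (h/2 * \<bar>of_int \<delta>\<bar>)" by simp
      qed (use h_pos in auto)
      also have "\<dots> = \<bar>t\<bar> ^ Suc j * ((2/h) ^ Suc j * (exp (h/2 * \<bar>of_int \<delta>\<bar>) * exp (h/2 * \<bar>of_int \<delta>\<bar>)))"
        by (simp del: power_Suc fact_Suc)
      also have "exp (h/2 * \<bar>of_int \<delta>\<bar>) * exp (h/2 * \<bar>of_int \<delta>\<bar>) = exp (h * \<bar>of_int \<delta>\<bar>)"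
        by (simp flip: exp_add)
      finally have "cmod (D \<delta>) * \<bar>exp_tail (Suc j) (t * of_int \<delta>)\<bar> \<le>
         cmod (D \<delta>) * (\<bar>t\<bar> ^ Suc j * ((2/h) ^ Suc j * exp (h * \<bar>of_int \<delta>\<bar>)))"
        by (rule mult_left_mono) simp
      then show "cmod (D \<delta> * of_real (exp_tail (Suc j) (t * of_int \<delta>))) \<le>
         \<bar>t\<bar> ^ Suc j * (cmod (D \<delta>) * ((2/h) ^ Suc j * exp (h * \<bar>of_int \<delta>\<bar>)))"
        by (simp add: norm_mult mult.left_commute del: power_Suc)
    qed
  qed
  have "((\<lambda>t. (S t - M * of_real (t ^ j / fact j)) / of_real (t ^ j)) \<longlongrightarrow> 0) (at 0)"
  proof (rule Lim_null_comparison)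
    have "eventually (\<lambda>t. t \<in> {- (h/2)<..<h/2} - {0}) (at (0::real))"
      using h_pos eventually_at_in_open[of "{- (h/2)<..<h/2}" "0::real"] by simp
    then show "eventually (\<lambda>t. norm ((S t - M * of_real (t ^ j / fact j)) / of_real (t ^ j)) \<le> \<bar>t\<bar> * B) (at 0)"
    proof eventually_elim
      case (elim t)
      then have "\<bar>t\<bar> \<le> h/2" "t \<noteq> 0" by auto
      then have "cmod (S t - M * of_real (t ^ j / fact j)) \<le> \<bar>t\<bar> * B * \<bar>t\<bar> ^ j" "\<bar>t\<bar> ^ j > 0"
        using key[of t] by (simp_all add: mult_ac)
      then show ?case
        by (simp only: norm_divide norm_of_real power_abs pos_divide_le_eq)
    qed
    show "((\<lambda>t. \<bar>t\<bar> * B) \<longlongrightarrow> 0) (at 0)" by (rule tendsto_eq_intros refl | simp)+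
  qed
  from tendsto_diff[OF S_tendsto[OF less.prems] this]
  have "((\<lambda>t. S t / of_real (t ^ j) - (S t - M * of_real (t ^ j / fact j)) / of_real (t ^ j)) \<longlongrightarrow> 0) (at 0)" by simp
  moreover have "eventually (\<lambda>t. S t / of_real (t ^ j) - (S t - M * of_real (t ^ j / fact j)) / of_real (t ^ j) = M / fact j) (at (0::real))"
    using eventually_at_in_open[of "UNIV" "0::real"] 
    by (auto elim!: eventually_mono simp: field_simps)
  ultimately have "((\<lambda>t::real. M / fact j) \<longlongrightarrow> 0) (at 0)"
    by (rule Lim_transform_eventually)
  then have "M / fact j = 0" using tendsto_unique[OF _ tendsto_const] trivial_limit_at by blast
  then show ?case using M by simp
qed

end

section \<open>The discrete operator inverts the kernel\<close>

text \<open>The coefficients are nonnegative, so convergence at the real point \<open>|z|\<close> is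
  absolute convergence at \<open>z\<close>.\<close>

lemma psi_series_has_sum:
  assumes h: "h > 0" and z: "cmod z < exp (- h)"
  shows "((\<lambda>n. of_real (psi_branch m 0 (h * real n)) * z ^ n) has_sum psi_series m h z) UNIV"
proof (rule norm_summable_imp_has_sum)
  show "(\<lambda>n. of_real (psi_branch m 0 (h * real n)) * z ^ n) sums psi_series m h z"
    by (rule psi_series_sums[OF assms])
  have "summable (\<lambda>n. of_real (psi_branch m 0 (h * real n)) * complex_of_real (cmod z) ^ n)"
    by (rule sums_summable[OF psi_series_sums[OF h]]) (use z in simp)
  then have "summable (\<lambda>n. complex_of_real (psi_branch m 0 (h * real n) * cmod z ^ n))" by simp
  then have "summable (\<lambda>n. psi_branch m 0 (h * real n) * cmod z ^ n)"
    by (simp only: summable_of_real_iff)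
  moreover have "psi_branch m 0 (h * real n) \<ge> 0" for n
    using psi_branch_pos[of "h * real n" m] psi_branch_at_0[of 0 m] h by (cases "n = 0") auto
  ultimately show "summable (\<lambda>n. norm (of_real (psi_branch m 0 (h * real n)) * z ^ n))"
    by (simp add: norm_mult norm_power)
qed

context discrete_operator begin

lemma has_sum_power:
  assumes "i < 2*m-2"
  shows "((\<lambda>\<gamma>. D (\<beta> - \<gamma>) * of_int \<gamma> ^ i) has_sum 0) UNIV"
proof -
  have "((\<lambda>\<delta>. \<Sum>k\<le>i. (of_nat (i choose k) * of_int \<beta> ^ k * (-1) ^ (i-k)) * (D \<delta> * of_int \<delta> ^ (i-k))) has_sum
      (\<Sum>k\<le>i. (of_nat (i choose k) * of_int \<beta> ^ k * (-1) ^ (i-k)) * 0)) UNIV"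
    by (intro has_sum_finite_sum has_sum_cmult_right moment_zero) (use assms in auto)
  moreover have "(\<Sum>k\<le>i. (of_nat (i choose k) * of_int \<beta> ^ k * (-1) ^ (i-k)) * (D \<delta> * of_int \<delta> ^ (i-k)))
     = D \<delta> * of_int (\<beta> - \<delta>) ^ i" for \<delta>
  proof -
    have "(of_int \<beta> + - of_int \<delta> :: complex) ^ i = (\<Sum>k\<le>i. of_nat (i choose k) * of_int \<beta> ^ k * (- of_int \<delta>) ^ (i-k))"
      by (rule binomial_ring)
    moreover have "(- of_int \<delta> :: complex) ^ n = (-1) ^ n * of_int \<delta> ^ n" for n by (rule power_minus)
    ultimately show ?thesis by (simp add: sum_distrib_left mult_ac)
  qed
  ultimately have "((\<lambda>\<delta>. D \<delta> * of_int (\<beta> - \<delta>) ^ i) has_sum 0) UNIV" by simp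
  then have "((\<lambda>\<gamma>. D (\<beta> - \<gamma>) * of_int (\<beta> - (\<beta> - \<gamma>)) ^ i) has_sum 0) UNIV"
    by (simp only: has_sum_int_shift[of "\<lambda>\<delta>. D \<delta> * of_int (\<beta> - \<delta>) ^ i"])
  then show ?thesis by simp
qed

lemma has_sum_psi_branch:
  "((\<lambda>\<gamma>. D (\<beta> - \<gamma>) * of_real (psi_branch m 0 (h * of_int \<gamma>))) has_sum 0) UNIV"
proof -
  have "((\<lambda>\<gamma>. (1/2) * ((1/2) * (D (\<beta> - \<gamma>) * of_real (exp (1 * (h * of_int \<gamma>))) - D (\<beta> - \<gamma>) * of_real (exp (- 1 * (h * of_int \<gamma>))))
      - (\<Sum>k=1..m-1. of_real (h ^ (2*k-1) / fact (2*k-1)) * (D (\<beta> - \<gamma>) * of_int \<gamma> ^ (2*k-1))))) has_sum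
      ((1/2) * ((1/2) * (0 - 0) - (\<Sum>k=1..m-1. of_real (h ^ (2*k-1) / fact (2*k-1)) * 0)))) UNIV"
    by (intro has_sum_cmult_right has_sum_diff has_sum_finite_sum has_sum_exp has_sum_power) auto
  moreover have "(1/2) * ((1/2) * (D (\<beta> - \<gamma>) * of_real (exp (1 * (h * of_int \<gamma>))) - D (\<beta> - \<gamma>) * of_real (exp (- 1 * (h * of_int \<gamma>))))
      - (\<Sum>k=1..m-1. of_real (h ^ (2*k-1) / fact (2*k-1)) * (D (\<beta> - \<gamma>) * of_int \<gamma> ^ (2*k-1))))
    = D (\<beta> - \<gamma>) * of_real (psi_branch m 0 (h * of_int \<gamma>))" for \<gamma>
  proof -
    define d where "d = D (\<beta> - \<gamma>)"
    define G where "G = (\<Sum>k=1..m-1. complex_of_real ((h * of_int \<gamma>) ^ (2*k-1) / fact (2*k-1)))"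
    have "(\<Sum>k=1..m-1. of_real (h ^ (2*k-1) / fact (2*k-1)) * (d * of_int \<gamma> ^ (2*k-1))) = d * G"
      unfolding G_def sum_distrib_left by (intro sum.cong refl) (simp add: power_mult_distrib)
    moreover have "complex_of_real (psi_branch m 0 (h * of_int \<gamma>))
       = ((of_real (exp (1 * (h * of_int \<gamma>))) - of_real (exp (- 1 * (h * of_int \<gamma>)))) / 2 - G) / 2"
      unfolding psi_branch_0 G_def by simp
    ultimately show ?thesis unfolding d_def[symmetric] by (simp only: ring_distribs) (simp add: field_simps)
  qed
  ultimately show ?thesis by simp
qed

text \<open>The bound \<open>inner\<close> keeps \<open>lam k\<close> away from the points excluded
  in \<open>P_poly_psi_series\<close>, and places it inside the disc of convergence, so this value
  is later the actual sum of the series.\<close>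

lemma psi_series_lam:
  assumes k: "k \<in> {1..m-1}"
  shows "psi_series m h (lam k) = 0"
proof -
  have 1: "cmod (lam k * of_real (exp h)) < 1" "cmod (lam k * of_real (exp (- h))) < 1" "cmod (lam k) < 1"
    using P_nz_near_circle(2)[of h k] P_nz_near_circle(2)[of "- h" k] lam_norm[OF k] k h_pos by auto
  then have nz: "lam k \<noteq> 1" "lam k * of_real (exp h) \<noteq> 1" "lam k * of_real (exp (- h)) \<noteq> 1"
    by (metis less_irrefl norm_one)+
  show ?thesis
    using P_poly_psi_series[OF nz, of m] lam_root[OF k] nz by auto
qed

text \<open>For \<open>\<beta> \<le> 0 < \<gamma>\<close> the distance is
  \<open>\<gamma> + |\<beta>|\<close>, so each geometric part factors into
  \<open>lam k ^ |\<beta>|\<close> and the generating function at \<open>lam k\<close>, which is 0.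
  The correction at distance 0 meets the value 0 of the branch. The correction at distance 1 occurs
  only for \<open>\<beta> = 0\<close>, \<open>\<gamma> = 1\<close>, where \<open>p_lead_eq\<close>
  turns it into 1/2.\<close>

lemma has_sum_positive_part:
  assumes "\<beta> \<le> 0"
  shows "((\<lambda>\<gamma>. D (\<beta> - \<gamma>) * of_real (if \<gamma> > 0 then psi_branch m 0 (h * of_int \<gamma>) else 0)) has_sum (if \<beta> = 0 then 1/2 else 0)) UNIV"
proof -
  define g where "g n = complex_of_real (psi_branch m 0 (h * real n))" for n
  define b where "b = nat (- \<beta>)"
  have g0: "g 0 = 0" using psi_branch_at_0[of 0 m] by (simp add: g_def)
  have Dn: "D (\<beta> - int n) = 1 / pl * (- 2 * of_real (exp h) * (if n + b = 1 then 1 else 0)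
     + 2 * C_const m h * (if n + b = 0 then 1 else 0) + (\<Sum>k=1..m-1. A k / lam k * lam k ^ (n + b)))" for n
  proof -
    have "\<bar>\<beta> - int n\<bar> = int (n + b)" using assms by (simp add: b_def)
    moreover have "\<beta> - int n = 0 \<longleftrightarrow> n + b = 0" using assms by (auto simp: b_def)
    moreover have "int (n + b) = 1 \<longleftrightarrow> n + b = 1" by linarith
    ultimately show ?thesis unfolding D_formula by (simp only: nat_int)
  qed
  have 1: "((\<lambda>n. if n + b = 1 then g n else 0) has_sum (if b = 0 then g 1 else 0)) UNIV"
  proof -
    have "((\<lambda>n. if n + b = 1 then g n else 0) has_sum (\<Sum>n\<in>{0,1}. if n + b = 1 then g n else 0)) {0,1}"
      by (rule has_sum_finite) simp
    moreover have "(\<Sum>n\<in>{0,1}. if n + b = 1 then g n else 0) = (if b = 0 then g 1 else 0)"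
      using g0 by auto
    ultimately have "((\<lambda>n. if n + b = 1 then g n else 0) has_sum (if b = 0 then g 1 else 0)) {0,1}" by simp
    then show ?thesis by (rule has_sum_cong_neutral[THEN iffD1, rotated -1]) auto
  qed
  have 2: "((\<lambda>n. \<Sum>k=1..m-1. A k / lam k * lam k ^ b * (g n * lam k ^ n)) has_sum
     (\<Sum>k=1..m-1. A k / lam k * lam k ^ b * 0)) UNIV"
  proof (intro has_sum_finite_sum has_sum_cmult_right finite_atLeastAtMost)
    fix k assume k: "k \<in> {1..m-1}"
    show "((\<lambda>n. g n * lam k ^ n) has_sum 0) UNIV"
      using psi_series_has_sum[OF h_pos inner[OF k], of m] unfolding psi_series_lam[OF k] g_def .
  qed
  have nonneg: "((\<lambda>n. D (\<beta> - int n) * of_real (if int n > 0 then psi_branch m 0 (h * of_int (int n)) else 0)) has_sum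
     (if \<beta> = 0 then 1/2 else 0)) UNIV"
  proof -
    have "((\<lambda>n. 1 / pl * (- 2 * of_real (exp h) * (if n + b = 1 then g n else 0) + (\<Sum>k=1..m-1. A k / lam k * lam k ^ b * (g n * lam k ^ n)))) has_sum
      (1 / pl * (- 2 * of_real (exp h) * (if b = 0 then g 1 else 0) + (\<Sum>k=1..m-1. A k / lam k * lam k ^ b * 0)))) UNIV"
      by (intro has_sum_cmult_right has_sum_add 1 2)
    moreover have "1 / pl * (- 2 * of_real (exp h) * (if b = 0 then g 1 else 0) + (\<Sum>k=1..m-1. A k / lam k * lam k ^ b * 0))
       = (if \<beta> = 0 then 1/2 else 0)"
    proof -
      have "pl = - 4 * of_real (exp h) * g 1" by (simp add: p_lead_eq g_def)
      then have "1 / pl * (- 2 * of_real (exp h) * g 1) = 1/2" using pl_nz by (simp add: field_simps)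
      then show ?thesis using assms by (auto simp: b_def)
    qed
    moreover have "1 / pl * (- 2 * of_real (exp h) * (if n + b = 1 then g n else 0) + (\<Sum>k=1..m-1. A k / lam k * lam k ^ b * (g n * lam k ^ n)))
       = D (\<beta> - int n) * of_real (if int n > 0 then psi_branch m 0 (h * of_int (int n)) else 0)" for n
    proof -
      have "complex_of_real (if int n > 0 then psi_branch m 0 (h * of_int (int n)) else 0) = g n"
        using g0 by (auto simp: g_def)
      moreover have "(if n + b = 0 then 1 else 0) * g n = 0" using g0 by auto
      moreover have "(\<Sum>k=1..m-1. A k / lam k * lam k ^ b * (g n * lam k ^ n)) = (\<Sum>k=1..m-1. A k / lam k * lam k ^ (n + b)) * g n"
        unfolding sum_distrib_right by (intro sum.cong refl) (simp add: power_add mult_ac)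
      moreover have "(if n + b = 1 then g n else 0) = (if n + b = 1 then 1 else 0) * g n" by simp
      ultimately show ?thesis unfolding Dn by (simp only: ring_distribs mult.assoc mult_zero_right add_0_right)
    qed
    ultimately show ?thesis by (simp only:)
  qed
  have neg: "((\<lambda>n. D (\<beta> - - int (Suc n)) * of_real (if - int (Suc n) > 0 then psi_branch m 0 (h * of_int (- int (Suc n))) else 0)) has_sum 0) UNIV"
    by simp
  show ?thesis using has_sum_int_split[OF nonneg neg] by simp
qed

text \<open>On the lattice \<open>\<psi> m\<close> is twice the branch cut off to the positive side
  minus the whole branch, and the whole branch is annihilated. For \<open>\<beta> > 0\<close> the
  evenness of \<open>D_m\<close> and \<open>\<psi> m\<close> reflects the statement.\<close>

lemma has_sum_psi:
  "((\<lambda>\<gamma>. D (\<beta> - \<gamma>) * of_real (\<psi> m (h * of_int \<gamma>))) has_sum (if \<beta> = 0 then 1 else 0)) UNIV"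
proof -
  have nonpos: "((\<lambda>\<gamma>. D (\<beta> - \<gamma>) * of_real (\<psi> m (h * of_int \<gamma>))) has_sum (if \<beta> = 0 then 1 else 0)) UNIV"
    if "\<beta> \<le> 0" for \<beta>
  proof -
    have "((\<lambda>\<gamma>. 2 * (D (\<beta> - \<gamma>) * of_real (if \<gamma> > 0 then psi_branch m 0 (h * of_int \<gamma>) else 0))
        - D (\<beta> - \<gamma>) * of_real (psi_branch m 0 (h * of_int \<gamma>))) has_sum (2 * (if \<beta> = 0 then 1/2 else 0) - 0)) UNIV"
      by (intro has_sum_diff has_sum_cmult_right has_sum_positive_part has_sum_psi_branch that)
    moreover have "2 * (D (\<beta> - \<gamma>) * of_real (if \<gamma> > 0 then psi_branch m 0 (h * of_int \<gamma>) else 0))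
        - D (\<beta> - \<gamma>) * of_real (psi_branch m 0 (h * of_int \<gamma>)) = D (\<beta> - \<gamma>) * of_real (\<psi> m (h * of_int \<gamma>))" for \<gamma>
    proof -
      consider "\<gamma> > 0" | "\<gamma> = 0" | "\<gamma> < 0" by linarith
      then show ?thesis
        using h_pos psi_branch_at_0[of 0 m]
        by cases (auto simp: psi_eq sgn_mult)
    qed
    moreover have "2 * (if \<beta> = 0 then 1/2 else 0) - 0 = (if \<beta> = 0 then 1 else (0::complex))" by simp
    ultimately show ?thesis by (simp only:)
  qed
  show ?thesis
  proof (cases "\<beta> \<le> 0")
    case False
    then have "((\<lambda>\<gamma>. D (- \<beta> - \<gamma>) * of_real (\<psi> m (h * of_int \<gamma>))) has_sum 0) UNIV"
      using nonpos[of "- \<beta>"] by simp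
    moreover have "bij_betw uminus (UNIV :: int set) UNIV"
      by (rule bij_betw_byWitness[where f' = uminus]) auto
    ultimately have "((\<lambda>\<gamma>. D (- \<beta> - (- \<gamma>)) * of_real (\<psi> m (h * of_int (- \<gamma>)))) has_sum 0) UNIV"
      using has_sum_reindex_bij_betw[of uminus UNIV UNIV "\<lambda>\<gamma>. D (- \<beta> - \<gamma>) * of_real (\<psi> m (h * of_int \<gamma>))" 0] by simp
    moreover have "D (- \<beta> - (- \<gamma>)) = D (\<beta> - \<gamma>)" for \<gamma>
      using D_even[of "\<beta> - \<gamma>"] by simp
    moreover have "\<psi> m (h * of_int (- \<gamma>)) = \<psi> m (h * of_int \<gamma>)" for \<gamma>
      using psi_minus[of m "h * of_int \<gamma>"] by simp
    ultimately show ?thesis using False by simp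
  qed (rule nonpos)
qed

lemma has_sum_psi_shift:
  "((\<lambda>\<gamma>. D (\<beta> - \<gamma>) * of_real (\<psi> m (h * of_int \<gamma> - h * of_int \<delta>))) has_sum (if \<beta> = \<delta> then 1 else 0)) UNIV"
proof -
  let ?f = "\<lambda>x. D x * of_real (\<psi> m (h * of_int (\<beta> - \<delta> - x)))"
  have "((\<lambda>\<gamma>. ?f (\<beta> - \<delta> - \<gamma>)) has_sum (if \<beta> - \<delta> = 0 then 1 else 0)) UNIV"
    using has_sum_psi[of "\<beta> - \<delta>"] by simp
  then have "((\<lambda>\<gamma>. ?f (\<beta> - \<gamma>)) has_sum (if \<beta> - \<delta> = 0 then 1 else 0)) UNIV"
    by (simp only: has_sum_int_shift[of ?f])
  moreover have "h * of_int (\<beta> - \<delta> - (\<beta> - \<gamma>)) = h * of_int \<gamma> - h * of_int \<delta>" for \<gamma>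
    by (simp add: algebra_simps)
  ultimately show ?thesis by simp
qed

end

section \<open>The Lobatto bound on the degree of exactness\<close>

lemma weight_integrable:
  assumes p: "weight_function p" and c: "continuous_on {0..1} f"
  shows "integrable (lebesgue_on {0..1}) (\<lambda>x. p x * f x)"
proof -
  have "bounded (f ` {0..1})"
    using c compact_continuous_image compact_imp_bounded compact_Icc by blast
  then obtain B where B: "\<And>x. x \<in> {0..1} \<Longrightarrow> \<bar>f x\<bar> \<le> B"
    unfolding bounded_iff by fastforce
  have m: "f \<in> borel_measurable (lebesgue_on {0..1})"
    by (rule continuous_imp_measurable_on_sets_lebesgue[OF c]) simp
  have ip: "integrable (lebesgue_on {0..1}) p" using p by (simp add: weight_function_def)
  show ?thesis
  proof (rule Bochner_Integration.integrable_bound[where f = "\<lambda>x. B * p x"])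
    show "integrable (lebesgue_on {0..1}) (\<lambda>x. B * p x)" using ip by simp
    show "(\<lambda>x. p x * f x) \<in> borel_measurable (lebesgue_on {0..1})"
      using ip m by (intro borel_measurable_times) auto
    show "AE x in lebesgue_on {0..1}. norm (p x * f x) \<le> norm (B * p x)"
    proof (rule AE_I2)
      fix x :: real assume "x \<in> space (lebesgue_on {0..1})"
      then have x: "x \<in> {0..1}" by simp
      then have "\<bar>p x\<bar> * \<bar>f x\<bar> \<le> \<bar>p x\<bar> * B" using B by (intro mult_left_mono) auto
      also have "\<dots> \<le> \<bar>B\<bar> * \<bar>p x\<bar>" by (simp add: mult.commute mult_right_mono)
      finally show "norm (p x * f x) \<le> norm (B * p x)" by (simp add: abs_mult)
    qed
  qed
qed

lemma error_functional_add:
  assumes "weight_function p" "continuous_on {0..1} f" "continuous_on {0..1} g"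
  shows "error_functional h N p C (\<lambda>x. f x + g x) = error_functional h N p C f + error_functional h N p C g"
  unfolding error_functional_def
  using weight_integrable[OF assms(1,2)] weight_integrable[OF assms(1,3)]
  by (simp add: distrib_left sum.distrib)

lemma error_functional_cmult:
  "error_functional h N p C (\<lambda>x. c * f x) = c * error_functional h N p C f"
  unfolding error_functional_def
  by (simp add: mult.left_commute[of _ c] right_diff_distrib sum_distrib_left)

lemma error_functional_sum:
  assumes p: "weight_function p" and "finite I" "\<And>i. i \<in> I \<Longrightarrow> continuous_on {0..1} (f i)"
  shows "error_functional h N p C (\<lambda>x. \<Sum>i\<in>I. f i x) = (\<Sum>i\<in>I. error_functional h N p C (f i))"
  using assms(2,3)
proof (induction I rule: finite_induct)
  case empty
  then show ?case by (simp add: error_functional_def)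
next
  case (insert i I)
  then have "error_functional h N p C (\<lambda>x. f i x + (\<Sum>i\<in>I. f i x))
      = error_functional h N p C (f i) + error_functional h N p C (\<lambda>x. \<Sum>i\<in>I. f i x)"
    by (intro error_functional_add[OF p] continuous_intros) auto
  then show ?case using insert by simp
qed

lemma error_functional_poly:
  assumes p: "weight_function p"
    and ex: "\<And>\<alpha>. \<alpha> < n \<Longrightarrow> error_functional h N p C (\<lambda>x. x ^ \<alpha>) = 0"
    and deg: "\<And>i. i \<ge> n \<Longrightarrow> coeff H i = 0"
  shows "error_functional h N p C (poly H) = 0"
proof -
  have "poly H x = (\<Sum>i<n. coeff H i * x ^ i)" for x
  proof -
    have "poly H x = (\<Sum>i\<le>degree H. coeff H i * x ^ i)" by (rule poly_altdef)
    also have "\<dots> = (\<Sum>i<n. coeff H i * x ^ i)"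
      by (rule sum.mono_neutral_cong) (use deg in \<open>auto simp: not_less coeff_eq_0 le_degree\<close>)
    finally show ?thesis .
  qed
  then have "error_functional h N p C (poly H) = error_functional h N p C (\<lambda>x. \<Sum>i<n. coeff H i * x ^ i)"
    by presburger
  also have "\<dots> = (\<Sum>i<n. error_functional h N p C (\<lambda>x. coeff H i * x ^ i))"
    by (rule error_functional_sum[OF p]) (auto intro!: continuous_intros)
  also have "\<dots> = 0" by (simp add: error_functional_cmult ex)
  finally show ?thesis .
qed

text \<open>Horner's scheme uses only additions and multiplications by \<open>t \<ge> 0\<close>, so
  division by a factor \<open>y - t\<close> preserves nonnegativity of the coefficients. Iterating
  over \<open>ts\<close> collects the remainders in \<open>H\<close>, of degree below
  \<open>length ts\<close>.\<close>

lemma nonneg_quotient: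
  fixes f :: "real poly"
  assumes "\<And>i. coeff f i \<ge> 0" "\<forall>t\<in>set ts. t \<ge> 0"
  obtains H r where "f = H + (\<Prod>t\<leftarrow>ts. [:-t, 1:]) * r" "\<And>i. coeff r i \<ge> 0"
    "\<And>i. i \<ge> length ts \<Longrightarrow> coeff H i = 0"
  using assms
proof (induction ts arbitrary: f thesis)
  case Nil
  then show ?case using Nil(1)[of 0 f] by simp
next
  case (Cons t ts)
  define s where "s = synthetic_div f t"
  have f: "f = [:poly f t:] + [:-t, 1:] * s"
    using synthetic_div_correct'[of t f] by (simp add: s_def add.commute)
  have snn: "coeff s i \<ge> 0" for i
  proof -
    have "\<forall>i. coeff (synthetic_div g t) i \<ge> 0" if "\<forall>i. coeff g i \<ge> 0" for g
      using that
    proof (induction g)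
      case (pCons a g)
      have g: "\<forall>i. coeff g i \<ge> 0" using pCons.prems by (metis coeff_pCons_Suc)
      have "poly g t \<ge> 0" unfolding poly_altdef
        using g Cons.prems(3) by (intro sum_nonneg mult_nonneg_nonneg zero_le_power) auto
      then show ?case using pCons.IH[OF g] by (auto simp: coeff_pCons split: nat.split)
    qed simp
    then show ?thesis using Cons.prems(2) by (auto simp: s_def)
  qed
  obtain H' r where H': "s = H' + (\<Prod>t\<leftarrow>ts. [:-t, 1:]) * r" "\<And>i. coeff r i \<ge> 0"
    "\<And>i. i \<ge> length ts \<Longrightarrow> coeff H' i = 0"
    using Cons.IH[of s] snn Cons.prems(3) by auto
  show ?case
  proof (rule Cons.prems(1))
    show "f = ([:poly f t:] + [:-t, 1:] * H') + (\<Prod>t\<leftarrow>t # ts. [:-t, 1:]) * r"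
      by (subst f, subst H'(1)) (simp add: algebra_simps)
    show "coeff ([:poly f t:] + [:-t, 1:] * H') i = 0" if "i \<ge> length (t # ts)" for i
      using H'(3) that by (cases i) (auto simp: coeff_pCons)
  qed (rule H'(2))
qed

lemma prod_list_linear_monic:
  "coeff (\<Prod>t\<leftarrow>ts. [:-t, 1 :: real:]) (length ts) = 1 \<and> degree (\<Prod>t\<leftarrow>ts. [:-t, 1 :: real:]) = length ts"
proof (induction ts)
  case (Cons t ts)
  let ?P = "\<Prod>t\<leftarrow>ts. [:-t, 1 :: real:]"
  have "?P \<noteq> 0" using Cons by auto
  then have "degree ([:-t, 1:] * ?P) = Suc (degree ?P)" by (subst degree_mult_eq) auto
  moreover have "coeff ([:-t, 1:] * ?P) (Suc (length ts)) = 1"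
    using Cons by (simp add: coeff_eq_0)
  ultimately show ?case using Cons by simp
qed simp

text \<open>In \<open>y = 1 - x\<close> the function \<open>exp (- x)\<close> is \<open>exp (-1)\<close> times a power series with positive
  coefficients. Modulo the polynomial \<open>\<omega> \<le> 0\<close> of degree \<open>2 N\<close> that vanishes at the end points and
  doubly at the inner nodes, \<open>y ^ n\<close> with \<open>n \<ge> 2 N\<close> leaves a quotient with nonnegative coefficients.\<close>

theorem exactness_bound:
  assumes p: "weight_function p" and N: "N \<ge> 1" and h: "h = 1 / real N"
    and pol: "\<And>\<alpha>. \<alpha> < m - 1 \<Longrightarrow> error_functional h N p C (\<lambda>x. x ^ \<alpha>) = 0"
    and ex: "error_functional h N p C (\<lambda>x. exp (- x)) = 0"
  shows "m \<le> 2 * N"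
proof (rule ccontr)
  assume "\<not> m \<le> 2 * N"
  then have m: "2 * N \<le> m - 1" by simp
  let ?l = "error_functional h N p C"
  define us where "us = map (\<lambda>i. h * real i) [1..<N]"
  define ts where "ts = 0 # 1 # us @ us"
  define om where "om = (\<Prod>t\<leftarrow>ts. [:-t, 1:])"
  define om' where "om' y = (y * (y - 1)) * (\<Prod>t\<leftarrow>us. (y - t))\<^sup>2" for y
  have h0: "h > 0" "h * real N = 1" using N h by auto
  have us0: "\<forall>t\<in>set us. t \<ge> 0" using h0 by (auto simp: us_def)
  have ts0: "\<forall>t\<in>set ts. t \<ge> 0" using us0 by (auto simp: ts_def)
  have len: "length ts = 2 * N" using N by (simp add: ts_def us_def)
  have om: "poly om y = om' y" for y
  proof -
    define X where "X = (\<Prod>t\<leftarrow>us. (y - t))"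
    have "poly (\<Prod>t\<leftarrow>zs. [:-t, 1:]) y = (\<Prod>t\<leftarrow>zs. (y - t))" for zs :: "real list"
      by (induction zs) (auto simp: algebra_simps)
    then have "poly om y = (\<Prod>t\<leftarrow>ts. (y - t))" by (simp only: om_def)
    also have "\<dots> = y * ((y - 1) * (X * X))" by (simp add: ts_def X_def)
    finally show ?thesis by (simp add: om'_def X_def[symmetric] power2_eq_square)
  qed
  have om_le: "om' y \<le> 0" if "y \<in> {0..1}" for y
  proof -
    have "y * (y - 1) \<le> 0" using that by (intro mult_nonneg_nonpos) auto
    then show ?thesis unfolding om'_def by (rule mult_nonpos_nonneg[OF _ zero_le_power2])
  qed
  have om_node: "om' (1 - h * real \<gamma>) = 0" if "\<gamma> \<le> N" for \<gamma>
  proof (cases "\<gamma> = 0 \<or> \<gamma> = N")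
    case True
    then show ?thesis using h0 by (auto simp: om'_def)
  next
    case False
    have "1 - h * real \<gamma> = h * real (N - \<gamma>)" using that h0 by (simp add: of_nat_diff algebra_simps)
    moreover have "N - \<gamma> \<in> {1..<N}" using False that by auto
    ultimately have "1 - h * real \<gamma> \<in> set us" by (auto simp: us_def)
    then have "(\<Prod>t\<leftarrow>us. (1 - h * real \<gamma> - t)) = 0" by (auto simp: prod_list_zero_iff)
    then show ?thesis by (simp add: om'_def)
  qed
  have om_zero: "finite {x. om' (1 - x) = 0}"
  proof -
    have "om \<noteq> 0" using prod_list_linear_monic[of ts] by (auto simp: om_def)
    then have "finite {y. om' y = 0}" using poly_roots_finite[of om] by (simp add: om)
    then have "finite ((\<lambda>y. 1 - y) ` {y. om' y = 0})" by simp
    moreover have "{x. om' (1 - x) = 0} \<subseteq> (\<lambda>y. 1 - y) ` {y. om' y = 0}"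
      by (auto intro!: image_eqI[of _ _ "1 - _"])
    ultimately show ?thesis using finite_subset by blast
  qed
  have cont_om: "continuous_on A (\<lambda>x. om' (1 - x))" for A
    unfolding om[symmetric] by (intro continuous_intros)
  \<comment> \<open>Replacing the variable by \<open>1 - x\<close> preserves the degree, and the
    negated claim \<open>2 * N \<le> m - 1\<close> places every degree below \<open>2 * N\<close>
    within the assumed exactness.\<close>
  have l_poly: "?l (\<lambda>x. poly H (1 - x)) = 0" if H: "\<And>i. i \<ge> 2 * N \<Longrightarrow> coeff H i = 0" for H
  proof -
    have "?l (poly (pcompose H [:1, -1:])) = 0"
    proof (rule error_functional_poly[OF p pol])
      fix i assume i: "m - 1 \<le> i"
      have "degree H < 2 * N"
      proof (cases "H = 0")
        case False
        then have "coeff H (degree H) \<noteq> 0" by simp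
        then show ?thesis using H by (meson not_le)
      qed (use N in simp)
      then have "degree (pcompose H [:1, -1:]) < 2 * N" by (simp add: degree_pcompose)
      then show "coeff (pcompose H [:1, -1:]) i = 0" using i m by (intro coeff_eq_0) linarith
    qed
    then show ?thesis by (simp add: poly_pcompose[abs_def] o_def)
  qed
  have l_om: "?l (\<lambda>x. om' (1 - x) * poly r (1 - x)) = (LINT x|lebesgue_on {0..1}. p x * (om' (1 - x) * poly r (1 - x)))" for r
  proof -
    have "(\<Sum>\<gamma>=0..N. C \<gamma> * (om' (1 - h * real \<gamma>) * poly r (1 - h * real \<gamma>))) = 0"
      by (intro sum.neutral) (simp add: om_node)
    then show ?thesis by (simp add: error_functional_def)
  qed
  have pnn: "p x \<ge> 0" if "x \<in> {0..1}" for x using p that by (simp add: weight_function_def)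
  \<comment> \<open>The nodal sum does not see the multiple of \<open>om'\<close>, which vanishes at
    the nodes, whereas its integral is at most 0: \<open>p \<ge> 0\<close>,
    \<open>om' \<le> 0\<close>, and the quotient has nonnegative coefficients.\<close>
  have pow_le: "?l (\<lambda>x. (1 - x) ^ n) \<le> 0" for n
  proof -
    have mono: "\<And>i. coeff (monom 1 n :: real poly) i \<ge> 0" by (simp add: coeff_monom)
    obtain H r where Hr: "monom 1 n = H + om * r" "\<And>i. coeff r i \<ge> 0" "\<And>i. i \<ge> 2 * N \<Longrightarrow> coeff H i = 0"
      using nonneg_quotient[OF mono ts0] unfolding om_def[symmetric] len by metis
    have e: "(1 - x) ^ n = poly H (1 - x) + om' (1 - x) * poly r (1 - x)" for x :: real
      using arg_cong[OF Hr(1), of "\<lambda>q. poly q (1 - x)"] by (simp add: poly_monom om)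
    have "?l (\<lambda>x. (1 - x) ^ n) = ?l (\<lambda>x. poly H (1 - x)) + ?l (\<lambda>x. om' (1 - x) * poly r (1 - x))"
      unfolding e by (intro error_functional_add[OF p] continuous_intros cont_om)
    also have "\<dots> = (LINT x|lebesgue_on {0..1}. p x * (om' (1 - x) * poly r (1 - x)))"
      by (simp add: l_poly[OF Hr(3)] l_om)
    also have "\<dots> \<le> (LINT x|lebesgue_on {0..1::real}. (0::real))"
    proof (rule Bochner_Integration.integral_mono)
      show "integrable (lebesgue_on {0..1}) (\<lambda>x. p x * (om' (1 - x) * poly r (1 - x)))"
        by (intro weight_integrable[OF p] continuous_intros cont_om)
      fix x assume "x \<in> space (lebesgue_on {0..1::real})"
      then have x: "x \<in> {0..1}" "1 - x \<in> {0..1}" by auto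
      have "poly r (1 - x) \<ge> 0" unfolding poly_altdef using Hr(2) x by (intro sum_nonneg mult_nonneg_nonneg) auto
      then have "om' (1 - x) * poly r (1 - x) \<le> 0" using om_le[OF x(2)] by (simp add: mult_nonpos_nonneg)
      then show "p x * (om' (1 - x) * poly r (1 - x)) \<le> 0" using pnn[OF x(1)] by (simp add: mult_nonneg_nonpos)
    qed simp
    finally show ?thesis by simp
  qed
  \<comment> \<open>The error on the power \<open>2 * N\<close>, for which the quotient is the
    constant 1. It is strictly negative because \<open>p\<close> has positive integral and
    \<open>om'\<close> only finitely many zeros.\<close>
  define \<eta> where "\<eta> = (LINT x|lebesgue_on {0..1}. p x * om' (1 - x))"
  have l2N: "?l (\<lambda>x. (1 - x) ^ (2 * N)) = \<eta>"
  proof -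
    define H where "H = monom 1 (2 * N) - om"
    have "coeff H i = 0" if "i \<ge> 2 * N" for i
    proof (cases "i = 2 * N")
      case True
      then show ?thesis using prod_list_linear_monic[of ts] len by (simp add: H_def om_def)
    next
      case False
      then have "i > degree om" using that prod_list_linear_monic[of ts] len by (simp add: om_def)
      then show ?thesis using False by (simp add: H_def coeff_eq_0)
    qed
    then have "?l (\<lambda>x. poly H (1 - x)) = 0" by (rule l_poly)
    moreover have "?l (\<lambda>x. poly H (1 - x) + om' (1 - x) * poly 1 (1 - x)) = ?l (\<lambda>x. poly H (1 - x)) + ?l (\<lambda>x. om' (1 - x) * poly 1 (1 - x))"
      by (intro error_functional_add[OF p] continuous_intros cont_om)
    ultimately show ?thesis unfolding l_om by (simp add: H_def om poly_monom \<eta>_def)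
  qed
  have eta: "\<eta> < 0"
  proof -
    have int: "integrable (lebesgue_on {0..1}) (\<lambda>x. - (p x * om' (1 - x)))"
      by (intro integrable_minus weight_integrable[OF p] cont_om)
    have nn: "AE x in lebesgue_on {0..1}. 0 \<le> - (p x * om' (1 - x))"
      by (rule AE_I2) (use pnn om_le in \<open>auto simp: mult_nonneg_nonpos\<close>)
    have "(LINT x|lebesgue_on {0..1}. - (p x * om' (1 - x))) \<noteq> 0"
    proof
      assume "(LINT x|lebesgue_on {0..1}. - (p x * om' (1 - x))) = 0"
      then have 1: "AE x in lebesgue_on {0..1}. - (p x * om' (1 - x)) = 0"
        using integral_nonneg_eq_0_iff_AE[OF int nn] by simp
      have 2: "AE x in lebesgue_on {0..1}. x \<notin> {x. om' (1 - x) = 0}"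
      proof -
        have "{x. om' (1 - x) = 0} \<in> null_sets lebesgue"
          using om_zero by (simp add: negligible_finite negligible_iff_null_sets[symmetric])
        then have "AE x in lebesgue. x \<notin> {x. om' (1 - x) = 0}" by (rule AE_not_in)
        then show ?thesis by (subst AE_restrict_space_iff) auto
      qed
      from 1 2 have "AE x in lebesgue_on {0..1}. p x = 0" by eventually_elim auto
      then have "(LINT x|lebesgue_on {0..1}. p x) = 0"
        by (intro integral_eq_zero_AE)
      then show False using p by (simp add: weight_function_def)
    qed
    moreover have "(LINT x|lebesgue_on {0..1}. - (p x * om' (1 - x))) \<ge> 0"
      by (rule integral_nonneg_AE[OF nn])
    ultimately show ?thesis by (simp add: \<eta>_def)
  qed
  \<comment> \<open>Exactness on \<open>exp (- x)\<close> means exactness on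
    \<open>exp (1 - x)\<close>. The errors on its Taylor sums stay at most
    \<open>\<eta> / fact (2 * N) < 0\<close> for large \<open>n\<close>, although the uniform
    remainder estimate sends them to 0.\<close>
  define S where "S n x = (\<Sum>k<n. (1 - x) ^ k / fact k)" for n and x :: real
  define K where "K = (LINT x|lebesgue_on {0..1}. p x) + (\<Sum>\<gamma>=0..N. \<bar>C \<gamma>\<bar>)"
  have cS: "continuous_on A (S n)" for A n unfolding S_def by (intro continuous_intros) auto
  have rem: "\<bar>exp (1 - x) - S n x\<bar> \<le> exp 1 / fact n" if x: "x \<in> {0..1}" for n x
  proof -
    obtain t where t: "\<bar>t\<bar> \<le> \<bar>1 - x\<bar>" "exp (1 - x) = (\<Sum>k<n. (1 - x) ^ k / fact k) + exp t / fact n * (1 - x) ^ n"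
      using Maclaurin_exp_le[of "1 - x" n] by blast
    have "exp t * (1 - x) ^ n \<le> exp 1 * 1" using t(1) x by (intro mult_mono power_le_one) auto
    then show ?thesis using x t(2) by (simp add: S_def divide_right_mono abs_mult)
  qed
  have l_bound: "\<bar>?l f\<bar> \<le> K * B" if f: "continuous_on {0..1} f" and B: "\<And>x. x \<in> {0..1} \<Longrightarrow> \<bar>f x\<bar> \<le> B" for f B
  proof -
    have "B \<ge> 0" using B[of 0] by simp
    have "\<bar>LINT x|lebesgue_on {0..1}. p x * f x\<bar> \<le> (LINT x|lebesgue_on {0..1}. p x * B)"
    proof (rule integral_abs_bound_integral)
      show "integrable (lebesgue_on {0..1}) (\<lambda>x. p x * f x)" by (rule weight_integrable[OF p f])
      show "integrable (lebesgue_on {0..1}) (\<lambda>x. p x * B)" by (rule weight_integrable[OF p]) simp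
      fix x assume "x \<in> space (lebesgue_on {0..1::real})"
      then have x: "x \<in> {0..1}" by simp
      then show "\<bar>p x * f x\<bar> \<le> p x * B" using pnn[OF x] B[OF x] by (simp add: abs_mult mult_left_mono)
    qed
    moreover have "\<bar>\<Sum>\<gamma>=0..N. C \<gamma> * f (h * real \<gamma>)\<bar> \<le> (\<Sum>\<gamma>=0..N. \<bar>C \<gamma>\<bar> * B)"
    proof (rule order_trans[OF sum_abs sum_mono])
      fix \<gamma> assume "\<gamma> \<in> {0..N}"
      then have "h * real \<gamma> \<le> h * real N" "0 \<le> h * real \<gamma>"
        using h0(1) by (simp_all add: mult_left_mono)
      then have "h * real \<gamma> \<in> {0..1}" using h0 by simp
      then show "\<bar>C \<gamma> * f (h * real \<gamma>)\<bar> \<le> \<bar>C \<gamma>\<bar> * B" using B by (simp add: abs_mult mult_left_mono)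
    qed
    ultimately show ?thesis unfolding error_functional_def K_def
      by (simp add: distrib_right sum_distrib_right)
  qed
  have l_exp: "?l (\<lambda>x. exp (1 - x)) = 0"
    using error_functional_cmult[of h N p C "exp 1" "\<lambda>x. exp (- x)"] ex by (simp flip: exp_add)
  have l_S: "?l (S n) \<le> \<eta> / fact (2 * N)" if n: "n > 2 * N" for n
  proof -
    have "?l (S n) = (\<Sum>k<n. ?l (\<lambda>x. (1 / fact k) * (1 - x) ^ k))"
      unfolding S_def by (subst error_functional_sum[OF p, symmetric]) (auto intro!: continuous_intros)
    also have "\<dots> = (\<Sum>k<n. (1 / fact k) * ?l (\<lambda>x. (1 - x) ^ k))" by (simp only: error_functional_cmult)
    \<comment> \<open>All terms are at most 0, and every one except that of index
      \<open>2 * N\<close> is discarded.\<close>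
    also have "\<dots> \<le> (\<Sum>k<n. if k = 2 * N then \<eta> / fact (2 * N) else 0)"
      by (rule sum_mono) (use l2N pow_le in \<open>auto simp: mult_nonneg_nonpos divide_nonpos_pos\<close>)
    also have "\<dots> = \<eta> / fact (2 * N)" using n by simp
    finally show ?thesis .
  qed
  have "(\<lambda>n. K * (exp 1 / fact n)) \<longlonglongrightarrow> K * 0"
  proof (intro tendsto_mult_left)
    have "(\<lambda>n. inverse (fact n) *\<^sub>R (1::real) ^ n) \<longlonglongrightarrow> 0"
      by (rule summable_LIMSEQ_zero[OF summable_exp_generic])
    then have "(\<lambda>n. exp 1 * inverse (fact n :: real)) \<longlonglongrightarrow> exp 1 * 0"
      by (intro tendsto_mult_left) simp
    then show "(\<lambda>n. exp 1 / fact n :: real) \<longlonglongrightarrow> 0" by (simp add: divide_inverse)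
  qed
  then have "(\<lambda>n. K * (exp 1 / fact n)) \<longlonglongrightarrow> 0" by simp
  moreover have "- \<eta> / fact (2 * N) > 0" using eta by (simp add: divide_neg_pos)
  ultimately have "eventually (\<lambda>n. K * (exp 1 / fact n) < - \<eta> / fact (2 * N)) sequentially"
    by (rule order_tendstoD(2))
  moreover have "eventually (\<lambda>n. n > 2 * N) sequentially" by (rule eventually_gt_at_top)
  ultimately have "eventually (\<lambda>n::nat. False) sequentially"
  proof eventually_elim
    case (elim n)
    have "?l (\<lambda>x. exp (1 - x)) = ?l (\<lambda>x. (exp (1 - x) - S n x) + S n x)" by simp
    also have "\<dots> = ?l (\<lambda>x. exp (1 - x) - S n x) + ?l (S n)"
      by (intro error_functional_add[OF p] continuous_intros cS)
    finally have "- ?l (S n) = ?l (\<lambda>x. exp (1 - x) - S n x)" using l_exp by simp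
    also have "\<dots> \<le> \<bar>?l (\<lambda>x. exp (1 - x) - S n x)\<bar>" by (rule abs_ge_self)
    also have "\<dots> \<le> K * (exp 1 / fact n)"
      by (intro l_bound rem continuous_intros cS)
    finally show False using l_S[OF elim(2)] elim(1) by simp
  qed
  then show False by simp
qed

section \<open>Absolutely continuous functions\<close>

lemma AC_onE:
  assumes "AC_on a b f" "\<epsilon> > 0"
  obtains \<delta> where "\<delta> > 0" "\<And>(n::nat) (u::nat \<Rightarrow> real) (v::nat \<Rightarrow> real).
       (\<forall>i<n. a \<le> u i \<and> u i \<le> v i \<and> v i \<le> b) \<Longrightarrow>
       disjoint_family_on (\<lambda>i. {u i<..<v i}) {..<n} \<Longrightarrow>
       (\<Sum>i<n. v i - u i) < \<delta> \<Longrightarrow> (\<Sum>i<n. \<bar>f (v i) - f (u i)\<bar>) < \<epsilon>"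
proof -
  from assms(1)[unfolded AC_on_def, rule_format, OF assms(2)]
  obtain \<delta> where d: "\<delta> > 0" and D: "\<forall>(n::nat) (u::nat \<Rightarrow> real) (v::nat \<Rightarrow> real).
       (\<forall>i<n. a \<le> u i \<and> u i \<le> v i \<and> v i \<le> b) \<longrightarrow>
       disjoint_family_on (\<lambda>i. {u i<..<v i}) {..<n} \<longrightarrow>
       (\<Sum>i<n. v i - u i) < \<delta> \<longrightarrow> (\<Sum>i<n. \<bar>f (v i) - f (u i)\<bar>) < \<epsilon>"
    by (elim exE conjE)
  show thesis
    by (rule that[OF d D[THEN spec, THEN spec, THEN spec, THEN mp, THEN mp, THEN mp]])
qed

text \<open>Absolute continuity is stated for indexed families of intervals, while a gauge produces
  finite sets of tagged intervals with disjoint interiors. An enumeration of the set translates one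
  into the other.\<close>

lemma AC_on_finite_division:
  assumes "AC_on a b f" "\<epsilon> > 0"
  shows "\<exists>\<delta>>0. \<forall>D :: (real \<times> real set) set. finite D \<longrightarrow>
       (\<forall>(x, K)\<in>D. \<exists>u v. K = {u..v} \<and> u \<le> v \<and> a \<le> u \<and> v \<le> b) \<longrightarrow>
       pairwise (\<lambda>p r. interior (snd p) \<inter> interior (snd r) = {}) D \<longrightarrow>
       (\<Sum>(x, K)\<in>D. measure lborel K) < \<delta> \<longrightarrow>
       (\<Sum>(x, K)\<in>D. \<bar>f (Sup K) - f (Inf K)\<bar>) < \<epsilon>"
proof -
  obtain \<delta> where d: "\<delta> > 0" and D: "\<And>(n::nat) (u::nat \<Rightarrow> real) (v::nat \<Rightarrow> real).
       (\<forall>i<n. a \<le> u i \<and> u i \<le> v i \<and> v i \<le> b) \<Longrightarrow>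
       disjoint_family_on (\<lambda>i. {u i<..<v i}) {..<n} \<Longrightarrow>
       (\<Sum>i<n. v i - u i) < \<delta> \<Longrightarrow>
       (\<Sum>i<n. \<bar>f (v i) - f (u i)\<bar>) < \<epsilon>"
    by (rule AC_onE[OF assms]) (rule that)
  show ?thesis
  proof (intro exI[of _ \<delta>] conjI allI impI d)
    fix D :: "(real \<times> real set) set"
    assume fin: "finite D"
      and K: "\<forall>(x, K)\<in>D. \<exists>u v. K = {u..v} \<and> u \<le> v \<and> a \<le> u \<and> v \<le> b"
      and pw: "pairwise (\<lambda>p r. interior (snd p) \<inter> interior (snd r) = {}) D"
      and small: "(\<Sum>(x, K)\<in>D. measure lborel K) < \<delta>"
    obtain e where e: "bij_betw e {0..<card D} D"
      using ex_bij_betw_nat_finite[OF fin] by blast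
    define u where "u i = Inf (snd (e i))" for i
    define v where "v i = Sup (snd (e i))" for i
    have iv: "snd (e i) = {u i..v i} \<and> u i \<le> v i \<and> a \<le> u i \<and> v i \<le> b" if i: "i < card D" for i
    proof -
      have "e i \<in> D" using e i by (auto simp: bij_betw_def)
      then obtain u' v' where "snd (e i) = {u'..v'}" "u' \<le> v'" "a \<le> u'" "v' \<le> b"
        using K by (auto simp: case_prod_beta)
      then show ?thesis by (auto simp: u_def v_def)
    qed
    have dis: "disjoint_family_on (\<lambda>i. {u i<..<v i}) {..<card D}"
      unfolding disjoint_family_on_def
    proof (intro ballI impI)
      fix i j assume ij: "i \<in> {..<card D}" "j \<in> {..<card D}" "i \<noteq> j"
      have "e i \<noteq> e j" "e i \<in> D" "e j \<in> D"
        using bij_betwE[OF e] bij_betw_imp_inj_on[OF e] ij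
        by (simp_all add: inj_on_eq_iff atLeast0LessThan)
      then have "interior (snd (e i)) \<inter> interior (snd (e j)) = {}"
        using pw by (auto simp: pairwise_def)
      moreover have "interior (snd (e i)) = {u i<..<v i}" "interior (snd (e j)) = {u j<..<v j}"
        using iv[of i] iv[of j] ij by simp_all
      ultimately show "{u i<..<v i} \<inter> {u j<..<v j} = {}" by simp
    qed
    have reidx: "(\<Sum>p\<in>D. F p) = (\<Sum>i<card D. F (e i))" for F :: "real \<times> real set \<Rightarrow> real"
      using sum.reindex_bij_betw[OF e, of F] by (simp add: atLeast0LessThan)
    have "(\<Sum>i<card D. v i - u i) = (\<Sum>(x, K)\<in>D. measure lborel K)"
      unfolding reidx by (intro sum.cong refl) (simp add: case_prod_beta iv)
    then have sm: "(\<Sum>i<card D. v i - u i) < \<delta>" using small by simp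
    have "(\<Sum>i<card D. \<bar>f (v i) - f (u i)\<bar>) < \<epsilon>"
      by (rule D[OF _ dis sm]) (simp add: iv)
    then show "(\<Sum>(x, K)\<in>D. \<bar>f (Sup K) - f (Inf K)\<bar>) < \<epsilon>"
      unfolding reidx by (simp add: case_prod_beta u_def v_def)
  qed
qed

text \<open>A gauge argument. At a tag outside \<open>S\<close> the increment over a fine interval
  is close to the derivative times the length. At a tag in \<open>S\<close> the gauge confines the
  interval to an open set of small measure around \<open>S\<close>, where absolute continuity makes
  the increments small in total.\<close>

lemma AC_on_fundamental_theorem:
  fixes f :: "real \<Rightarrow> real"
  assumes ab: "a \<le> b" and AC: "AC_on a b f" and S: "negligible S"
    and deriv: "\<And>x. x \<in> {a..b} - S \<Longrightarrow> (f has_vector_derivative f' x) (at x within {a..b})"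
  shows "(f' has_integral (f b - f a)) {a..b}"
proof -
  \<comment> \<open>Redefining the integrand as 0 on \<open>S\<close> removes the uncontrolled
    values from the Riemann sums without changing the integral.\<close>
  define g where "g x = (if x \<in> S then 0 else f' x)" for x
  have "(g has_integral (f b - f a)) (cbox a b)"
    unfolding has_integral
  proof (intro allI impI)
    fix e :: real assume e: "e > 0"
    obtain \<delta> where \<delta>: "\<delta> > 0" and ACD: "\<forall>D :: (real \<times> real set) set. finite D \<longrightarrow>
       (\<forall>(x, K)\<in>D. \<exists>u v. K = {u..v} \<and> u \<le> v \<and> a \<le> u \<and> v \<le> b) \<longrightarrow>
       pairwise (\<lambda>p r. interior (snd p) \<inter> interior (snd r) = {}) D \<longrightarrow>
       (\<Sum>(x, K)\<in>D. measure lborel K) < \<delta> \<longrightarrow>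
       (\<Sum>(x, K)\<in>D. \<bar>f (Sup K) - f (Inf K)\<bar>) < e/2"
      using AC_on_finite_division[OF AC half_gt_zero[OF e]] by (elim exE conjE)
    have Sl: "S \<in> lmeasurable" "measure lebesgue S = 0" 
      using S negligible_imp_measurable negligible_imp_measure0 by auto
    obtain T where T: "open T" "S \<subseteq> T" "T - S \<in> lmeasurable" "emeasure lebesgue (T - S) < ennreal \<delta>"
      using sets_lebesgue_outer_open[of S \<delta>] Sl \<delta> by (auto dest: fmeasurableD)
    have TSS: "T = (T - S) \<union> S" using T by auto
    have Tm: "T \<in> lmeasurable"
      by (subst TSS) (intro fmeasurable.Un T Sl)
    have Tsmall: "measure lebesgue T < \<delta>"
    proof -
      have "measure lebesgue T = measure lebesgue (T - S)"
        using TSS S by (metis measure_Un_null_set T(3) fmeasurableD negligible_iff_null_sets)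
      also have "\<dots> < \<delta>" using T(3,4) \<delta>
        by (simp add: emeasure_eq_measure2 ennreal_less_iff)
      finally show ?thesis .
    qed
    \<comment> \<open>The summand 1 keeps the denominator positive when
      \<open>a = b\<close>.\<close>
    define \<eta> where "\<eta> = e / (2 * (b - a + 1))"
    have \<eta>: "\<eta> > 0" using e ab by (simp add: \<eta>_def)
    have "\<exists>d>0. (x \<in> S \<longrightarrow> ball x d \<subseteq> T) \<and> (x \<in> {a..b} - S \<longrightarrow>
        (\<forall>y\<in>{a..b}. \<bar>y - x\<bar> < d \<longrightarrow> \<bar>f y - f x - (y - x) * f' x\<bar> \<le> \<eta> * \<bar>y - x\<bar>))" for x
    proof (cases "x \<in> S")
      case True
      then show ?thesis using T open_contains_ball by blast
    next
      case False
      show ?thesis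
      proof (cases "x \<in> {a..b}")
        case True
        with deriv[of x] False have "(f has_derivative (\<lambda>y. y *\<^sub>R f' x)) (at x within {a..b})"
          by (simp add: has_vector_derivative_def)
        then have "\<exists>d>0. \<forall>y\<in>{a..b}. \<bar>y - x\<bar> < d \<longrightarrow> \<bar>f y - f x - (y - x) * f' x\<bar> \<le> \<eta> * \<bar>y - x\<bar>"
          using \<eta> unfolding has_derivative_within_alt by simp
        then show ?thesis using False by blast
      qed (use False in \<open>auto intro: exI[of _ 1]\<close>)
    qed
    then obtain d where d: "\<And>x. d x > 0" "\<And>x. x \<in> S \<Longrightarrow> ball x (d x) \<subseteq> T"
      "\<And>x y. x \<in> {a..b} - S \<Longrightarrow> y \<in> {a..b} \<Longrightarrow> \<bar>y - x\<bar> < d x \<Longrightarrow>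
          \<bar>f y - f x - (y - x) * f' x\<bar> \<le> \<eta> * \<bar>y - x\<bar>"
      by metis
    define \<gamma> where "\<gamma> x = ball x (d x)" for x
    have gauge: "gauge \<gamma>" using d by (auto simp: gauge_def \<gamma>_def)
    have bound: "norm ((\<Sum>(x, k)\<in>\<D>. measure lborel k *\<^sub>R g x) - (f b - f a)) < e"
      if D: "\<D> tagged_division_of cbox a b" and fine: "\<gamma> fine \<D>" for \<D>
    proof -
      note td = tagged_division_ofD[OF D]
      have fin: "finite \<D>" using td by simp
      have iv: "\<exists>u v. K = {u..v} \<and> u \<le> v \<and> a \<le> u \<and> v \<le> b \<and> u \<le> x \<and> x \<le> v \<and> K \<subseteq> ball x (d x)"
        if xK: "(x, K) \<in> \<D>" for x K
      proof -
        obtain u v where K: "K = cbox u v" using td(4)[OF xK] by blast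
        have "x \<in> K" "K \<subseteq> cbox a b" using td(2,3)[OF xK] by auto
        moreover have "K \<subseteq> ball x (d x)" using fine xK by (auto simp: fine_def \<gamma>_def)
        ultimately show ?thesis using K by (intro exI[of _ u] exI[of _ v]) auto
      qed
      have eq: "(\<Sum>(x, k)\<in>\<D>. measure lborel k *\<^sub>R g x) - (f b - f a)
          = (\<Sum>(x, k)\<in>\<D>. measure lborel k * g x - (f (Sup k) - f (Inf k)))"
        using additive_tagged_division_1[OF ab, of \<D> f] D
        by (simp add: sum_subtractf case_prod_beta)
      define D1 where "D1 = {p \<in> \<D>. fst p \<in> S}"
      define D2 where "D2 = {p \<in> \<D>. fst p \<notin> S}"
      have DD: "\<D> = D1 \<union> D2" "D1 \<inter> D2 = {}" "finite D1" "finite D2"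
        using fin by (auto simp: D1_def D2_def)
      let ?F = "\<lambda>(x, k). measure lborel k * g x - (f (Sup k) - f (Inf k))"
      have b2: "\<bar>\<Sum>p\<in>D2. ?F p\<bar> \<le> e/2"
      proof -
        have "\<bar>?F p\<bar> \<le> \<eta> * measure lborel (snd p)" if p: "p \<in> D2" for p
        proof -
          obtain x K where xK: "p = (x, K)" by (cases p)
          then obtain u v where uv: "K = {u..v}" "u \<le> v" "a \<le> u" "v \<le> b" "u \<le> x" "x \<le> v"
            "K \<subseteq> ball x (d x)" using iv[of x K] p by (auto simp: D2_def)
          have xS: "x \<in> {a..b} - S" using p xK uv by (auto simp: D2_def)
          have "u \<in> K" "v \<in> K" using uv(1,2) by auto
          then have uin: "u \<in> ball x (d x)" "v \<in> ball x (d x)" using uv(7) by blast+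
          have 1: "\<bar>f u - f x - (u - x) * f' x\<bar> \<le> \<eta> * (x - u)"
            using d(3)[OF xS, of u] uv uin by (auto simp: dist_real_def abs_minus_commute)
          have 2: "\<bar>f v - f x - (v - x) * f' x\<bar> \<le> \<eta> * (v - x)"
            using d(3)[OF xS, of v] uv uin by (auto simp: dist_real_def abs_minus_commute)
          have "?F p = (f u - f x - (u - x) * f' x) - (f v - f x - (v - x) * f' x)"
            using uv xS xK by (simp add: g_def algebra_simps)
          then have "\<bar>?F p\<bar> \<le> \<eta> * (x - u) + \<eta> * (v - x)" using 1 2 by linarith
          then show ?thesis using uv xK by (simp add: algebra_simps)
        qed
        then have "\<bar>\<Sum>p\<in>D2. ?F p\<bar> \<le> (\<Sum>p\<in>D2. \<eta> * measure lborel (snd p))"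
          by (intro order_trans[OF sum_abs] sum_mono)
        also have "\<dots> \<le> (\<Sum>p\<in>\<D>. \<eta> * measure lborel (snd p))"
          by (rule sum_mono2) (use fin \<eta> in \<open>auto simp: D2_def\<close>)
        also have "\<dots> = \<eta> * (b - a)"
          using additive_content_tagged_division[OF D] ab
          by (simp add: sum_distrib_left[symmetric] case_prod_beta)
        also have "\<dots> \<le> e/2" using e ab by (simp add: \<eta>_def field_simps)
        finally show ?thesis .
      qed
      have b1: "\<bar>\<Sum>p\<in>D1. ?F p\<bar> < e/2"
      proof -
        have pw: "pairwise (\<lambda>p r. interior (snd p) \<inter> interior (snd r) = {}) D1"
          unfolding pairwise_def D1_def using td(5) by fastforce
        have "(\<Sum>(x, K)\<in>D1. measure lborel K) = (\<Sum>p\<in>D1. measure lebesgue (interior (snd p)))"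
        proof (intro sum.cong refl, clarify)
          fix x K assume "(x, K) \<in> D1"
          then have "(x, K) \<in> \<D>" by (simp add: D1_def)
          then obtain u v where "K = {u..v}" "u \<le> v" using iv by blast
          then show "measure lborel K = measure lebesgue (interior (snd (x, K)))" by simp
        qed
        also have "\<dots> = measure lebesgue (\<Union>p\<in>D1. interior (snd p))"
        proof (rule measure_finite_Union[symmetric])
          show "disjoint_family_on (\<lambda>p. interior (snd p)) D1"
            using pw by (auto simp: disjoint_family_on_def pairwise_def)
          show "emeasure lebesgue (interior (snd p)) \<noteq> \<infinity>" if "p \<in> D1" for p
          proof -
            obtain x K where p: "p = (x, K)" by (cases p)
            then have "(x, K) \<in> \<D>" using that by (simp add: D1_def)
            then obtain u v where "K = {u..v}" "u \<le> v" using iv by blast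
            then show ?thesis using p by simp
          qed
        qed (use DD in auto)
        also have "\<dots> \<le> measure lebesgue T"
        proof (rule measure_mono_fmeasurable)
          show "(\<Union>p\<in>D1. interior (snd p)) \<subseteq> T"
          proof clarsimp
            fix y x K assume "(x, K) \<in> D1" "y \<in> interior K"
            then have "(x, K) \<in> \<D>" "x \<in> S" "y \<in> K" using interior_subset[of K] by (auto simp: D1_def)
            moreover from this have "y \<in> ball x (d x)" using iv by blast
            ultimately show "y \<in> T" using d(2)[of x] by blast
          qed
        qed (use Tm DD in \<open>auto intro!: sets.finite_UN borel_open\<close>)
        finally have sm: "(\<Sum>(x, K)\<in>D1. measure lborel K) < \<delta>" using Tsmall by simp
        have "(\<Sum>(x, K)\<in>D1. \<bar>f (Sup K) - f (Inf K)\<bar>) < e/2"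
        proof (rule ACD[THEN spec, THEN mp, THEN mp, THEN mp, THEN mp, OF DD(3) _ pw sm], clarify)
          fix x K assume "(x, K) \<in> D1"
          then have "(x, K) \<in> \<D>" by (simp add: D1_def)
          then show "\<exists>u v. K = {u..v} \<and> u \<le> v \<and> a \<le> u \<and> v \<le> b" using iv by blast
        qed
        moreover have "\<bar>\<Sum>p\<in>D1. ?F p\<bar> \<le> (\<Sum>(x, K)\<in>D1. \<bar>f (Sup K) - f (Inf K)\<bar>)"
          by (rule order_trans[OF sum_abs]) (intro sum_mono, auto simp: D1_def g_def)
        ultimately show ?thesis by simp
      qed
      have "(\<Sum>p\<in>\<D>. ?F p) = (\<Sum>p\<in>D1. ?F p) + (\<Sum>p\<in>D2. ?F p)"
        unfolding DD(1) by (rule sum.union_disjoint) (use DD in auto)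
      then show ?thesis using eq b1 b2 by simp
    qed
    show "\<exists>\<gamma>. gauge \<gamma> \<and> (\<forall>\<D>. \<D> tagged_division_of cbox a b \<and> \<gamma> fine \<D> \<longrightarrow>
        norm ((\<Sum>(x, k)\<in>\<D>. measure lborel k *\<^sub>R g x) - (f b - f a)) < e)"
      using gauge bound by (intro exI[of _ \<gamma>] conjI allI impI) auto
  qed
  then have "(g has_integral (f b - f a)) {a..b}" by simp
  then show ?thesis
    by (rule has_integral_spike[OF S, rotated]) (simp add: g_def)
qed

section \<open>Stability of absolute continuity under restriction, sums and Lipschitz
  factors\<close>

lemma AC_on_subinterval:
  assumes "AC_on a b f" "a \<le> a'" "b' \<le> b"
  shows "AC_on a' b' f"
  unfolding AC_on_def
proof (intro allI impI)
  fix \<epsilon> :: real assume \<epsilon>: "\<epsilon> > 0"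
  obtain \<delta> where d: "\<delta> > 0" and D: "\<And>(n::nat) (u::nat \<Rightarrow> real) (v::nat \<Rightarrow> real).
       (\<forall>i<n. a \<le> u i \<and> u i \<le> v i \<and> v i \<le> b) \<Longrightarrow>
       disjoint_family_on (\<lambda>i. {u i<..<v i}) {..<n} \<Longrightarrow>
       (\<Sum>i<n. v i - u i) < \<delta> \<Longrightarrow> (\<Sum>i<n. \<bar>f (v i) - f (u i)\<bar>) < \<epsilon>"
    by (rule AC_onE[OF assms(1) \<epsilon>]) (rule that)
  show "\<exists>\<delta>>0. \<forall>(n::nat) (u::nat \<Rightarrow> real) v. (\<forall>i<n. a' \<le> u i \<and> u i \<le> v i \<and> v i \<le> b') \<longrightarrow>
      disjoint_family_on (\<lambda>i. {u i<..<v i}) {..<n} \<longrightarrow> (\<Sum>i<n. v i - u i) < \<delta> \<longrightarrow>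
      (\<Sum>i<n. \<bar>f (v i) - f (u i)\<bar>) < \<epsilon>"
  proof (intro exI[of _ \<delta>] conjI allI impI)
    fix n :: nat and u v :: "nat \<Rightarrow> real"
    assume *: "\<forall>i<n. a' \<le> u i \<and> u i \<le> v i \<and> v i \<le> b'" "disjoint_family_on (\<lambda>i. {u i<..<v i}) {..<n}"
      "(\<Sum>i<n. v i - u i) < \<delta>"
    show "(\<Sum>i<n. \<bar>f (v i) - f (u i)\<bar>) < \<epsilon>"
      by (rule D[OF _ *(2,3)]) (use *(1) assms(2,3) in \<open>meson order_trans\<close>)
  qed (rule d)
qed

lemma AC_on_imp_continuous_on:
  assumes "AC_on a b f" shows "continuous_on {a..b} f"
  unfolding continuous_on_iff
proof (intro ballI allI impI)
  fix x e :: real assume x: "x \<in> {a..b}" and e: "e > 0"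
  obtain \<delta> where d: "\<delta> > 0" and D: "\<And>(n::nat) (u::nat \<Rightarrow> real) (v::nat \<Rightarrow> real).
       (\<forall>i<n. a \<le> u i \<and> u i \<le> v i \<and> v i \<le> b) \<Longrightarrow>
       disjoint_family_on (\<lambda>i. {u i<..<v i}) {..<n} \<Longrightarrow>
       (\<Sum>i<n. v i - u i) < \<delta> \<Longrightarrow> (\<Sum>i<n. \<bar>f (v i) - f (u i)\<bar>) < e"
    by (rule AC_onE[OF assms e]) (rule that)
  have "dist (f y) (f x) < e" if "y \<in> {a..b}" "dist y x < \<delta>" for y
  proof (cases "x \<le> y")
    case True
    then show ?thesis using D[of 1 "\<lambda>_. x" "\<lambda>_. y"] x that
      by (simp add: disjoint_family_on_def dist_real_def)
  next
    case False
    then show ?thesis using D[of 1 "\<lambda>_. y" "\<lambda>_. x"] x that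
      by (simp add: disjoint_family_on_def dist_real_def abs_minus_commute)
  qed
  then show "\<exists>d>0. \<forall>x'\<in>{a..b}. dist x' x < d \<longrightarrow> dist (f x') (f x) < e" using d by blast
qed

lemma AC_on_add:
  assumes "AC_on a b f" "AC_on a b g" shows "AC_on a b (\<lambda>x. f x + g x)"
  unfolding AC_on_def
proof (intro allI impI)
  fix e :: real assume "e > 0"
  then have e2: "e/2 > 0" by simp
  obtain d1 where d1: "d1 > 0" and D1: "\<And>(n::nat) (u::nat \<Rightarrow> real) (v::nat \<Rightarrow> real).
       (\<forall>i<n. a \<le> u i \<and> u i \<le> v i \<and> v i \<le> b) \<Longrightarrow> disjoint_family_on (\<lambda>i. {u i<..<v i}) {..<n} \<Longrightarrow>
       (\<Sum>i<n. v i - u i) < d1 \<Longrightarrow> (\<Sum>i<n. \<bar>f (v i) - f (u i)\<bar>) < e/2"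
    by (rule AC_onE[OF assms(1) e2]) (rule that)
  obtain d2 where d2: "d2 > 0" and D2: "\<And>(n::nat) (u::nat \<Rightarrow> real) (v::nat \<Rightarrow> real).
       (\<forall>i<n. a \<le> u i \<and> u i \<le> v i \<and> v i \<le> b) \<Longrightarrow> disjoint_family_on (\<lambda>i. {u i<..<v i}) {..<n} \<Longrightarrow>
       (\<Sum>i<n. v i - u i) < d2 \<Longrightarrow> (\<Sum>i<n. \<bar>g (v i) - g (u i)\<bar>) < e/2"
    by (rule AC_onE[OF assms(2) e2]) (rule that)
  show "\<exists>\<delta>>0. \<forall>(n::nat) (u::nat \<Rightarrow> real) v. (\<forall>i<n. a \<le> u i \<and> u i \<le> v i \<and> v i \<le> b) \<longrightarrow>
      disjoint_family_on (\<lambda>i. {u i<..<v i}) {..<n} \<longrightarrow> (\<Sum>i<n. v i - u i) < \<delta> \<longrightarrow>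
      (\<Sum>i<n. \<bar>(f (v i) + g (v i)) - (f (u i) + g (u i))\<bar>) < e"
  proof (intro exI[of _ "min d1 d2"] conjI allI impI)
    fix n :: nat and u v :: "nat \<Rightarrow> real"
    assume *: "\<forall>i<n. a \<le> u i \<and> u i \<le> v i \<and> v i \<le> b" "disjoint_family_on (\<lambda>i. {u i<..<v i}) {..<n}"
      "(\<Sum>i<n. v i - u i) < min d1 d2"
    have "(\<Sum>i<n. \<bar>(f (v i) + g (v i)) - (f (u i) + g (u i))\<bar>)
        \<le> (\<Sum>i<n. \<bar>f (v i) - f (u i)\<bar> + \<bar>g (v i) - g (u i)\<bar>)"
      by (intro sum_mono) linarith
    also have "\<dots> < e" using D1[OF *(1,2)] D2[OF *(1,2)] *(3) by (simp add: sum.distrib)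
    finally show "(\<Sum>i<n. \<bar>(f (v i) + g (v i)) - (f (u i) + g (u i))\<bar>) < e" .
  qed (use d1 d2 in auto)
qed

text \<open>With \<open>f\<close> and \<open>g\<close> bounded by \<open>F\<close> and
  \<open>G\<close> on the compact interval, an increment of the product is at most \<open>G\<close>
  times that of \<open>f\<close> plus \<open>F * M\<close> times the length of the interval.\<close>

lemma AC_on_mult_lipschitz:
  fixes f g :: "real \<Rightarrow> real"
  assumes f: "AC_on a b f" and g: "\<And>x y. x \<in> {a..b} \<Longrightarrow> y \<in> {a..b} \<Longrightarrow> \<bar>g x - g y\<bar> \<le> L * \<bar>x - y\<bar>"
    and cg: "continuous_on {a..b} g"
  shows "AC_on a b (\<lambda>x. f x * g x)"
  unfolding AC_on_def
proof (intro allI impI)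
  fix e :: real assume e: "e > 0"
  have "bounded (f ` {a..b})" "bounded (g ` {a..b})"
    using AC_on_imp_continuous_on[OF f] cg compact_continuous_image compact_imp_bounded by blast+
  then obtain F G where F: "\<And>x. x \<in> {a..b} \<Longrightarrow> \<bar>f x\<bar> \<le> F" "F > 0" and G: "\<And>x. x \<in> {a..b} \<Longrightarrow> \<bar>g x\<bar> \<le> G" "G > 0"
    unfolding bounded_pos by fastforce
  define M where "M = \<bar>L\<bar> + 1"
  have M: "M > 0" "\<And>x y. x \<in> {a..b} \<Longrightarrow> y \<in> {a..b} \<Longrightarrow> \<bar>g x - g y\<bar> \<le> M * \<bar>x - y\<bar>"
  proof -
    fix x y assume "x \<in> {a..b}" "y \<in> {a..b}"
    then have "\<bar>g x - g y\<bar> \<le> L * \<bar>x - y\<bar>" by (rule g)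
    also have "\<dots> \<le> M * \<bar>x - y\<bar>" by (rule mult_right_mono) (auto simp: M_def)
    finally show "\<bar>g x - g y\<bar> \<le> M * \<bar>x - y\<bar>" .
  qed (simp add: M_def)
  have eG: "e / (2*G) > 0" using e G by simp
  obtain d1 where d1: "d1 > 0" and D1: "\<And>(n::nat) (u::nat \<Rightarrow> real) (v::nat \<Rightarrow> real).
       (\<forall>i<n. a \<le> u i \<and> u i \<le> v i \<and> v i \<le> b) \<Longrightarrow> disjoint_family_on (\<lambda>i. {u i<..<v i}) {..<n} \<Longrightarrow>
       (\<Sum>i<n. v i - u i) < d1 \<Longrightarrow> (\<Sum>i<n. \<bar>f (v i) - f (u i)\<bar>) < e / (2*G)"
    by (rule AC_onE[OF f eG]) (rule that)
  define d where "d = min d1 (e / (2 * (F * M)))"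
  show "\<exists>\<delta>>0. \<forall>(n::nat) (u::nat \<Rightarrow> real) v. (\<forall>i<n. a \<le> u i \<and> u i \<le> v i \<and> v i \<le> b) \<longrightarrow>
      disjoint_family_on (\<lambda>i. {u i<..<v i}) {..<n} \<longrightarrow> (\<Sum>i<n. v i - u i) < \<delta> \<longrightarrow>
      (\<Sum>i<n. \<bar>f (v i) * g (v i) - f (u i) * g (u i)\<bar>) < e"
  proof (intro exI[of _ d] conjI allI impI)
    show "d > 0" using d1 e F M by (simp add: d_def)
    fix n :: nat and u v :: "nat \<Rightarrow> real"
    assume *: "\<forall>i<n. a \<le> u i \<and> u i \<le> v i \<and> v i \<le> b" "disjoint_family_on (\<lambda>i. {u i<..<v i}) {..<n}"
      "(\<Sum>i<n. v i - u i) < d"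
    have "(\<Sum>i<n. \<bar>f (v i) * g (v i) - f (u i) * g (u i)\<bar>)
        \<le> (\<Sum>i<n. G * \<bar>f (v i) - f (u i)\<bar> + F * M * (v i - u i))"
    proof (intro sum_mono)
      fix i assume "i \<in> {..<n}"
      then have i: "a \<le> u i" "u i \<le> v i" "v i \<le> b" using * by auto
      have "f (v i) * g (v i) - f (u i) * g (u i) = g (v i) * (f (v i) - f (u i)) + f (u i) * (g (v i) - g (u i))"
        by (simp add: algebra_simps)
      then have "\<bar>f (v i) * g (v i) - f (u i) * g (u i)\<bar> \<le> \<bar>g (v i)\<bar> * \<bar>f (v i) - f (u i)\<bar> + \<bar>f (u i)\<bar> * \<bar>g (v i) - g (u i)\<bar>"
        by (metis abs_mult abs_triangle_ineq)
      also have "\<dots> \<le> G * \<bar>f (v i) - f (u i)\<bar> + F * (M * (v i - u i))"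
        using i F G M(1) M(2)[of "v i" "u i"] by (intro add_mono mult_mono) auto
      finally show "\<bar>f (v i) * g (v i) - f (u i) * g (u i)\<bar> \<le> G * \<bar>f (v i) - f (u i)\<bar> + F * M * (v i - u i)"
        by (simp add: mult.assoc)
    qed
    also have "\<dots> = G * (\<Sum>i<n. \<bar>f (v i) - f (u i)\<bar>) + F * M * (\<Sum>i<n. v i - u i)"
      by (simp add: sum.distrib sum_distrib_left)
    also have "\<dots> < e/2 + e/2"
    proof (rule add_strict_mono)
      show "G * (\<Sum>i<n. \<bar>f (v i) - f (u i)\<bar>) < e/2"
        using D1[OF *(1,2)] *(3) G by (simp add: d_def field_simps)
      have "(\<Sum>i<n. v i - u i) < e / (2 * (F * M))" using *(3) by (simp add: d_def)
      then show "F * M * (\<Sum>i<n. v i - u i) < e/2"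
        using F M by (simp add: field_simps)
    qed
    finally show "(\<Sum>i<n. \<bar>f (v i) * g (v i) - f (u i) * g (u i)\<bar>) < e" by simp
  qed
qed

lemma lipschitz_imp_AC_on:
  fixes g :: "real \<Rightarrow> real"
  assumes g: "\<And>x y. x \<in> {a..b} \<Longrightarrow> y \<in> {a..b} \<Longrightarrow> \<bar>g x - g y\<bar> \<le> L * \<bar>x - y\<bar>"
  shows "AC_on a b g"
proof -
  have "AC_on a b (\<lambda>_. 1)" by (auto simp: AC_on_def intro: exI[of _ 1])
  moreover have "continuous_on {a..b} g"
  proof (rule lipschitz_on_continuous_on)
    show "(\<bar>L\<bar>)-lipschitz_on {a..b} g"
    proof (rule lipschitz_onI)
      fix x y assume "x \<in> {a..b}" "y \<in> {a..b}"
      then have "\<bar>g x - g y\<bar> \<le> L * \<bar>x - y\<bar>" by (rule g)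
      also have "\<dots> \<le> \<bar>L\<bar> * \<bar>x - y\<bar>" by (rule mult_right_mono) auto
      finally show "dist (g x) (g y) \<le> \<bar>L\<bar> * dist x y" by (simp add: dist_real_def)
    qed simp
  qed
  ultimately have "AC_on a b (\<lambda>x. 1 * g x)" using g by (intro AC_on_mult_lipschitz) auto
  then show ?thesis by simp
qed

lemma C1_imp_lipschitz:
  fixes g :: "real \<Rightarrow> real"
  assumes "\<And>x. x \<in> {a..b} \<Longrightarrow> (g has_vector_derivative g' x) (at x within {a..b})"
    and "continuous_on {a..b} g'"
  obtains L where "\<And>x y. x \<in> {a..b} \<Longrightarrow> y \<in> {a..b} \<Longrightarrow> \<bar>g x - g y\<bar> \<le> L * \<bar>x - y\<bar>"
proof -
  have "bounded (g' ` {a..b})" using assms(2) compact_continuous_image compact_imp_bounded by blast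
  then obtain L where L: "\<And>x. x \<in> {a..b} \<Longrightarrow> \<bar>g' x\<bar> \<le> L"
    unfolding bounded_pos by fastforce
  have "\<bar>g x - g y\<bar> \<le> L * \<bar>x - y\<bar>" if "x \<in> {a..b}" "y \<in> {a..b}" for x y
  proof -
    have "norm (g x - g y) \<le> L * norm (x - y)"
    proof (rule field_differentiable_bound[of "{a..b}" g g'])
      show "(g has_field_derivative g' z) (at z within {a..b})" if "z \<in> {a..b}" for z
        using assms(1)[OF that] by (simp add: has_real_derivative_iff_has_vector_derivative)
    qed (use L that in auto)
    then show ?thesis by simp
  qed
  then show thesis by (rule that)
qed

section \<open>The Sobolev space and its seminorm\<close>

lemma AE_lebesgue_on_iff_negligible:
  "(AE x in lebesgue_on {0..1::real}. P x) \<longleftrightarrow> negligible {x \<in> {0..1}. \<not> P x}"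
proof
  assume "negligible {x \<in> {0..1}. \<not> P x}"
  then have "{x \<in> {0..1}. \<not> P x} \<in> null_sets lebesgue" by (simp add: negligible_iff_null_sets)
  then have "AE x in lebesgue. x \<notin> {x \<in> {0..1}. \<not> P x}" by (rule AE_not_in)
  then show "AE x in lebesgue_on {0..1}. P x" by (subst AE_restrict_space_iff) auto
next
  assume "AE x in lebesgue_on {0..1}. P x"
  then have "AE x in lebesgue. x \<in> {0..1} \<longrightarrow> P x" by (subst (asm) AE_restrict_space_iff) auto
  then obtain N where N: "N \<in> null_sets lebesgue" "{x. \<not> (x \<in> {0..1} \<longrightarrow> P x)} \<subseteq> N"
    by (auto simp: eventually_ae_filter)
  then have "negligible N" by (simp add: negligible_iff_null_sets)
  then show "negligible {x \<in> {0..1}. \<not> P x}" by (rule negligible_subset) (use N in auto)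
qed

lemma D01_eq:
  assumes "x \<in> {0..1}" "(f has_vector_derivative d) (at x within {0..1})"
  shows "D01 f x = d"
  unfolding D01_def using assms by (intro vector_derivative_within_closed_interval) auto

text \<open>The sequence \<open>u\<close> lists explicit candidates for the derivatives. Agreement
  is claimed on \<open>[0, 1]\<close>, the set on which the iterates of \<open>D01\<close> are
  meaningful; one-sided derivatives at the end points depend on no other values.\<close>

lemma D01_iterate_eq:
  assumes d: "\<And>j x. j < n \<Longrightarrow> x \<in> {0..1} \<Longrightarrow> (u j has_vector_derivative u (Suc j) x) (at x within {0..1})"
    and "j \<le> n" "x \<in> {0..1}"
  shows "(D01 ^^ j) (u 0) x = u j x"
  using assms(2,3)
proof (induction j arbitrary: x)
  case (Suc j)
  have "((D01 ^^ j) (u 0) has_vector_derivative u (Suc j) x) (at x within {0..1})"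
    by (rule has_vector_derivative_transform[OF Suc.prems(2) _ d]) (use Suc in auto)
  then show ?case using D01_eq[OF Suc.prems(2)] by simp
qed simp

lemma AC_on_cong: "AC_on a b f \<Longrightarrow> (\<And>x. x \<in> {a..b} \<Longrightarrow> g x = f x) \<Longrightarrow> AC_on a b g"
proof -
  assume f: "AC_on a b f" and eq: "\<And>x. x \<in> {a..b} \<Longrightarrow> g x = f x"
  show "AC_on a b g" unfolding AC_on_def
  proof (intro allI impI)
    fix \<epsilon> :: real assume \<epsilon>: "\<epsilon> > 0"
    obtain \<delta> where d: "\<delta> > 0" and D: "\<And>(n::nat) (u::nat \<Rightarrow> real) (v::nat \<Rightarrow> real).
       (\<forall>i<n. a \<le> u i \<and> u i \<le> v i \<and> v i \<le> b) \<Longrightarrow>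
       disjoint_family_on (\<lambda>i. {u i<..<v i}) {..<n} \<Longrightarrow>
       (\<Sum>i<n. v i - u i) < \<delta> \<Longrightarrow> (\<Sum>i<n. \<bar>f (v i) - f (u i)\<bar>) < \<epsilon>"
      by (rule AC_onE[OF f \<epsilon>]) (rule that)
    show "\<exists>\<delta>>0. \<forall>(n::nat) (u::nat \<Rightarrow> real) v. (\<forall>i<n. a \<le> u i \<and> u i \<le> v i \<and> v i \<le> b) \<longrightarrow>
      disjoint_family_on (\<lambda>i. {u i<..<v i}) {..<n} \<longrightarrow> (\<Sum>i<n. v i - u i) < \<delta> \<longrightarrow>
      (\<Sum>i<n. \<bar>g (v i) - g (u i)\<bar>) < \<epsilon>"
    proof (intro exI[of _ \<delta>] conjI allI impI)
      fix n :: nat and u v :: "nat \<Rightarrow> real"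
      assume *: "\<forall>i<n. a \<le> u i \<and> u i \<le> v i \<and> v i \<le> b" "disjoint_family_on (\<lambda>i. {u i<..<v i}) {..<n}"
        "(\<Sum>i<n. v i - u i) < \<delta>"
      have "(\<Sum>i<n. \<bar>g (v i) - g (u i)\<bar>) = (\<Sum>i<n. \<bar>f (v i) - f (u i)\<bar>)"
      proof (intro sum.cong refl)
        fix i assume "i \<in> {..<n}"
        then have "a \<le> u i" "u i \<le> v i" "v i \<le> b" using *(1) by auto
        then show "\<bar>g (v i) - g (u i)\<bar> = \<bar>f (v i) - f (u i)\<bar>" using eq[of "u i"] eq[of "v i"] by simp
      qed
      then show "(\<Sum>i<n. \<bar>g (v i) - g (u i)\<bar>) < \<epsilon>" using D[OF *] by simp
    qed (rule d)
  qed
qed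

text \<open>Completeness of Lebesgue measure makes a function measurable if it agrees almost
  everywhere with a measurable one. This absorbs the unspecified values of the top derivative on the
  exceptional set.\<close>

lemma borel_measurable_L2_cong:
  assumes f: "L2_01 f" and ae: "AE x in lebesgue_on {0..1}. f x = g x"
  shows "L2_01 g"
proof -
  have m: "g \<in> borel_measurable (lebesgue_on {0..1})"
  proof -
    have "(\<lambda>x. if x \<in> {0..1} then f x else 0) \<in> borel_measurable lebesgue"
      using f by (subst borel_measurable_if) (auto simp: L2_01_def)
    moreover have "AE x in lebesgue. (if x \<in> {0..1} then f x else 0) = (if x \<in> {0..1} then g x else 0)"
      using ae by (subst (asm) AE_restrict_space_iff) (auto elim!: eventually_mono)
    ultimately have "(\<lambda>x. if x \<in> {0..1} then g x else 0) \<in> borel_measurable lebesgue"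
      by (rule borel_measurable_AE)
    then show ?thesis by (subst (asm) borel_measurable_if) auto
  qed
  have "integrable (lebesgue_on {0..1}) (\<lambda>x. (f x)\<^sup>2) \<longleftrightarrow> integrable (lebesgue_on {0..1}) (\<lambda>x. (g x)\<^sup>2)"
    by (rule integrable_cong_AE) (use f ae m in \<open>auto simp: L2_01_def elim!: eventually_mono\<close>)
  then show ?thesis using f m by (simp add: L2_01_def)
qed

lemma D01_top_AE:
  assumes m: "m \<ge> 1"
    and d: "\<And>j x. j < m-1 \<Longrightarrow> x \<in> {0..1} \<Longrightarrow> (u j has_vector_derivative u (Suc j) x) (at x within {0..1})"
    and S: "negligible S" and top: "\<And>x. x \<in> {0..1} - S \<Longrightarrow> (u (m-1) has_vector_derivative u m x) (at x within {0..1})"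
  shows "AE x in lebesgue_on {0..1}. ((D01 ^^ (m-1)) (u 0) has_vector_derivative u m x) (at x within {0..1}) \<and> (D01 ^^ m) (u 0) x = u m x"
proof -
  let ?P = "\<lambda>x. ((D01 ^^ (m-1)) (u 0) has_vector_derivative u m x) (at x within {0..1}) \<and> (D01 ^^ m) (u 0) x = u m x"
  have "?P x" if x: "x \<in> {0..1} - S" for x
  proof -
    have x': "x \<in> {0..1}" using x by simp
    have v: "((D01 ^^ (m-1)) (u 0) has_vector_derivative u m x) (at x within {0..1})"
      by (rule has_vector_derivative_transform[OF x' _ top[OF x]]) (use D01_iterate_eq[of "m-1" u, OF d] in auto)
    moreover have "(D01 ^^ m) (u 0) x = D01 ((D01 ^^ (m-1)) (u 0)) x" using m by (cases m) auto
    ultimately show ?thesis using D01_eq[OF x' v] by simp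
  qed
  then have "{x \<in> {0..1}. \<not> ?P x} \<subseteq> S" by blast
  then show ?thesis unfolding AE_lebesgue_on_iff_negligible
    using negligible_subset[OF S] by blast
qed

lemma W_spaceI:
  assumes m: "m \<ge> 1"
    and d: "\<And>j x. j < m-1 \<Longrightarrow> x \<in> {0..1} \<Longrightarrow> (u j has_vector_derivative u (Suc j) x) (at x within {0..1})"
    and S: "negligible S" and top: "\<And>x. x \<in> {0..1} - S \<Longrightarrow> (u (m-1) has_vector_derivative u m x) (at x within {0..1})"
    and AC: "AC_on 0 1 (u (m-1))" and L2: "L2_01 (u m)"
  shows "u 0 \<in> W_space m"
proof -
  note it = D01_iterate_eq[of "m-1" u, OF d]
  have AE: "AE x in lebesgue_on {0..1}. ((D01 ^^ (m-1)) (u 0) has_vector_derivative u m x) (at x within {0..1}) \<and> (D01 ^^ m) (u 0) x = u m x"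
    by (rule D01_top_AE[OF m d S top])
  have "(D01 ^^ i) (u 0) differentiable (at x within {0..1})" if i: "i < m-1" and x: "x \<in> {0..1}" for i x
  proof -
    have "((D01 ^^ i) (u 0) has_vector_derivative u (Suc i) x) (at x within {0..1})"
      by (rule has_vector_derivative_transform[OF x _ d[OF i x]]) (use it i in auto)
    then show ?thesis by (rule differentiableI_vector)
  qed
  moreover have "AC_on 0 1 ((D01 ^^ (m-1)) (u 0))"
    by (rule AC_on_cong[OF AC]) (use it in auto)
  moreover have "AE x in lebesgue_on {0..1}. (D01 ^^ (m-1)) (u 0) differentiable (at x within {0..1})"
    using AE by eventually_elim (auto intro: differentiableI_vector)
  moreover have "AE x in lebesgue_on {0..1}. u m x = (D01 ^^ m) (u 0) x"
    using AE by eventually_elim simp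
  then have "L2_01 ((D01 ^^ m) (u 0))" by (rule borel_measurable_L2_cong[OF L2])
  ultimately show ?thesis by (simp add: W_space_def)
qed

lemma W_spaceD:
  assumes \<phi>: "\<phi> \<in> W_space m" and m: "m \<ge> 1"
  shows "\<And>j x. j < m-1 \<Longrightarrow> x \<in> {0..1} \<Longrightarrow> ((D01 ^^ j) \<phi> has_vector_derivative (D01 ^^ Suc j) \<phi> x) (at x within {0..1})"
    and "AC_on 0 1 ((D01 ^^ (m-1)) \<phi>)" and "L2_01 ((D01 ^^ m) \<phi>)"
    and "\<exists>S. negligible S \<and> (\<forall>x\<in>{0..1}-S. ((D01 ^^ (m-1)) \<phi> has_vector_derivative (D01 ^^ m) \<phi> x) (at x within {0..1}))"
proof -
  show "((D01 ^^ j) \<phi> has_vector_derivative (D01 ^^ Suc j) \<phi> x) (at x within {0..1})"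
    if "j < m-1" "x \<in> {0..1}" for j x
    using \<phi> that unfolding W_space_def by (auto simp: D01_def vector_derivative_works[symmetric])
  show "AC_on 0 1 ((D01 ^^ (m-1)) \<phi>)" "L2_01 ((D01 ^^ m) \<phi>)" using \<phi> by (auto simp: W_space_def)
  have "AE x in lebesgue_on {0..1}. (D01 ^^ (m-1)) \<phi> differentiable (at x within {0..1})"
    using \<phi> by (simp add: W_space_def)
  then have n: "negligible {x \<in> {0..1}. \<not> (D01 ^^ (m-1)) \<phi> differentiable (at x within {0..1})}"
    by (simp only: AE_lebesgue_on_iff_negligible)
  have s: "(D01 ^^ m) \<phi> = D01 ((D01 ^^ (m-1)) \<phi>)" using m by (cases m) auto
  show "\<exists>S. negligible S \<and> (\<forall>x\<in>{0..1}-S. ((D01 ^^ (m-1)) \<phi> has_vector_derivative (D01 ^^ m) \<phi> x) (at x within {0..1}))"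
    by (intro exI[of _ "{x \<in> {0..1}. \<not> (D01 ^^ (m-1)) \<phi> differentiable (at x within {0..1})}"] conjI n)
       (auto simp: s D01_def vector_derivative_works[symmetric])
qed

lemma W_space_continuous:
  assumes \<phi>: "\<phi> \<in> W_space m" and m: "m \<ge> 1" and j: "j \<le> m-1"
  shows "continuous_on {0..1} ((D01 ^^ j) \<phi>)"
proof (cases "j = m-1")
  case True
  then show ?thesis using AC_on_imp_continuous_on[OF W_spaceD(2)[OF \<phi> m]] by simp
next
  case False
  then have "j < m-1" using j by simp
  from has_vector_derivative_continuous[OF W_spaceD(1)[OF \<phi> m this]]
  show ?thesis by (simp add: continuous_on_eq_continuous_within)
qed

section \<open>Square integrable functions on the unit interval\<close>

lemma L2_01_add: "L2_01 f \<Longrightarrow> L2_01 g \<Longrightarrow> L2_01 (\<lambda>x. f x + g x)"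
proof -
  assume f: "L2_01 f" and g: "L2_01 g"
  have m: "(\<lambda>x. f x + g x) \<in> borel_measurable (lebesgue_on {0..1})" using f g by (auto simp: L2_01_def)
  have "integrable (lebesgue_on {0..1}) (\<lambda>x. (f x + g x)\<^sup>2)"
  proof (rule Bochner_Integration.integrable_bound[where f = "\<lambda>x. 2 * (f x)\<^sup>2 + 2 * (g x)\<^sup>2"])
    show "integrable (lebesgue_on {0..1}) (\<lambda>x. 2 * (f x)\<^sup>2 + 2 * (g x)\<^sup>2)" using f g by (auto simp: L2_01_def)
    show "AE x in lebesgue_on {0..1}. norm ((f x + g x)\<^sup>2) \<le> norm (2 * (f x)\<^sup>2 + 2 * (g x)\<^sup>2)"
    proof (rule AE_I2)
      fix x
      have "0 \<le> (f x - g x)\<^sup>2" by simp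
      then have "(f x + g x)\<^sup>2 \<le> 2 * (f x)\<^sup>2 + 2 * (g x)\<^sup>2" by (simp add: power2_eq_square algebra_simps)
      then show "norm ((f x + g x)\<^sup>2) \<le> norm (2 * (f x)\<^sup>2 + 2 * (g x)\<^sup>2)" by simp
    qed
  qed (use m in simp)
  then show ?thesis using m by (simp add: L2_01_def)
qed

lemma L2_01_cmult: "L2_01 f \<Longrightarrow> L2_01 (\<lambda>x. c * f x)"
  by (auto simp: L2_01_def power_mult_distrib)

lemma L2_01_mult_integrable:
  assumes f: "L2_01 f" and g: "L2_01 g"
  shows "integrable (lebesgue_on {0..1}) (\<lambda>x. f x * g x)"
proof (rule Bochner_Integration.integrable_bound[where f = "\<lambda>x. (f x)\<^sup>2 + (g x)\<^sup>2"])
  show "integrable (lebesgue_on {0..1}) (\<lambda>x. (f x)\<^sup>2 + (g x)\<^sup>2)" using f g by (auto simp: L2_01_def)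
  show "(\<lambda>x. f x * g x) \<in> borel_measurable (lebesgue_on {0..1})" using f g by (auto simp: L2_01_def)
  show "AE x in lebesgue_on {0..1}. norm (f x * g x) \<le> norm ((f x)\<^sup>2 + (g x)\<^sup>2)"
  proof (rule AE_I2)
    fix x
    have "0 \<le> (\<bar>f x\<bar> - \<bar>g x\<bar>)\<^sup>2" by simp
    then have "2 * (\<bar>f x\<bar> * \<bar>g x\<bar>) \<le> (f x)\<^sup>2 + (g x)\<^sup>2" by (simp add: power2_eq_square algebra_simps)
    moreover have "0 \<le> \<bar>f x\<bar> * \<bar>g x\<bar>" by simp
    ultimately have "\<bar>f x\<bar> * \<bar>g x\<bar> \<le> (f x)\<^sup>2 + (g x)\<^sup>2" by linarith
    then show "norm (f x * g x) \<le> norm ((f x)\<^sup>2 + (g x)\<^sup>2)" by (simp add: abs_mult)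
  qed
qed

lemma L2_01_bounded:
  assumes m: "f \<in> borel_measurable (lebesgue_on {0..1})" and B: "\<And>x. x \<in> {0..1} \<Longrightarrow> \<bar>f x\<bar> \<le> B"
  shows "L2_01 f"
proof -
  have "integrable (lebesgue_on {0..1}) (\<lambda>x. (f x)\<^sup>2)"
  proof (rule Bochner_Integration.integrable_bound[where f = "\<lambda>_. B\<^sup>2"])
    show "integrable (lebesgue_on {0..1::real}) (\<lambda>_. B\<^sup>2)"
      by (rule finite_measure.integrable_const, rule finite_measureI) (simp add: emeasure_restrict_space)
    show "AE x in lebesgue_on {0..1}. norm ((f x)\<^sup>2) \<le> norm (B\<^sup>2)"
    proof (rule AE_I2)
      fix x :: real assume "x \<in> space (lebesgue_on {0..1})"
      then have "\<bar>f x\<bar>\<^sup>2 \<le> B\<^sup>2" using B by (intro power_mono) auto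
      then show "norm ((f x)\<^sup>2) \<le> norm (B\<^sup>2)" by simp
    qed
  qed (use m in simp)
  then show ?thesis using m by (simp add: L2_01_def)
qed

lemma L2_01_continuous: "continuous_on {0..1} f \<Longrightarrow> L2_01 f"
proof -
  assume c: "continuous_on {0..1} f"
  have "bounded (f ` {0..1})" using c compact_continuous_image compact_imp_bounded compact_Icc by blast
  then obtain B where "\<And>x. x \<in> {0..1} \<Longrightarrow> \<bar>f x\<bar> \<le> B" unfolding bounded_iff by fastforce
  moreover have "f \<in> borel_measurable (lebesgue_on {0..1})"
    by (rule continuous_imp_measurable_on_sets_lebesgue[OF c]) simp
  ultimately show ?thesis by (rule L2_01_bounded[rotated])
qed

section \<open>The bilinear form behind the seminorm\<close>

definition W_op :: "nat \<Rightarrow> (real \<Rightarrow> real) \<Rightarrow> real \<Rightarrow> real" where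
  "W_op m \<phi> x = (D01 ^^ m) \<phi> x + (D01 ^^ (m-1)) \<phi> x"

definition W_inner :: "nat \<Rightarrow> (real \<Rightarrow> real) \<Rightarrow> (real \<Rightarrow> real) \<Rightarrow> real" where
  "W_inner m \<phi> \<xi> = (LINT x|lebesgue_on {0..1}. W_op m \<phi> x * W_op m \<xi> x)"

lemma W_norm_eq: "W_norm m \<phi> = sqrt (W_inner m \<phi> \<phi>)"
  by (simp add: W_norm_def W_inner_def W_op_def power2_eq_square)

lemma W_inner_nonneg: "W_inner m \<phi> \<phi> \<ge> 0"
  unfolding W_inner_def by (rule integral_nonneg_AE) simp

lemma W_inner_commute: "W_inner m \<phi> \<xi> = W_inner m \<xi> \<phi>"
  by (simp add: W_inner_def mult.commute)

lemma W_op_L2: "\<phi> \<in> W_space m \<Longrightarrow> m \<ge> 1 \<Longrightarrow> L2_01 (W_op m \<phi>)"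
  unfolding W_op_def[abs_def]
  by (intro L2_01_add W_spaceD(3) L2_01_continuous W_space_continuous) auto

lemma W_op_AE:
  assumes m: "m \<ge> 1"
    and d: "\<And>j x. j < m-1 \<Longrightarrow> x \<in> {0..1} \<Longrightarrow> (u j has_vector_derivative u (Suc j) x) (at x within {0..1})"
    and S: "negligible S" and top: "\<And>x. x \<in> {0..1} - S \<Longrightarrow> (u (m-1) has_vector_derivative u m x) (at x within {0..1})"
  shows "AE x in lebesgue_on {0..1}. W_op m (u 0) x = u m x + u (m-1) x"
proof -
  have "AE x in lebesgue_on {0..1}. x \<in> {0..1::real}" by (rule AE_I2) simp
  moreover have "AE x in lebesgue_on {0..1}. ((D01 ^^ (m-1)) (u 0) has_vector_derivative u m x) (at x within {0..1}) \<and> (D01 ^^ m) (u 0) x = u m x"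
    by (rule D01_top_AE[OF m d S top])
  ultimately show ?thesis
  proof eventually_elim
    case (elim x)
    have "(D01 ^^ (m-1)) (u 0) x = u (m-1) x"
      using D01_iterate_eq[of "m-1" u, OF d, of "m-1" x] elim(1) by simp
    then show ?case using elim(2) by (simp add: W_op_def)
  qed
qed

text \<open>Iterated \<open>D01\<close> is linear only where the derivatives exist. Hence the
  combinations \<open>u j\<close> are differentiated directly, with the top order settled off the
  union of two negligible sets.\<close>

lemma W_space_lincomb:
  assumes \<phi>: "\<phi> \<in> W_space m" and \<xi>: "\<xi> \<in> W_space m" and m: "m \<ge> 1"
  shows "(\<lambda>x. \<phi> x + t * \<xi> x) \<in> W_space m"
    and "AE x in lebesgue_on {0..1}. W_op m (\<lambda>x. \<phi> x + t * \<xi> x) x = W_op m \<phi> x + t * W_op m \<xi> x"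
proof -
  define u where "u j x = (D01 ^^ j) \<phi> x + t * (D01 ^^ j) \<xi> x" for j x
  obtain S1 S2 where S: "negligible S1" "\<forall>x\<in>{0..1}-S1. ((D01 ^^ (m-1)) \<phi> has_vector_derivative (D01 ^^ m) \<phi> x) (at x within {0..1})"
    "negligible S2" "\<forall>x\<in>{0..1}-S2. ((D01 ^^ (m-1)) \<xi> has_vector_derivative (D01 ^^ m) \<xi> x) (at x within {0..1})"
    using W_spaceD(4)[OF \<phi> m] W_spaceD(4)[OF \<xi> m] by blast
  have u0: "u 0 = (\<lambda>x. \<phi> x + t * \<xi> x)" by (auto simp: u_def)
  have d: "(u j has_vector_derivative u (Suc j) x) (at x within {0..1})" if "j < m-1" "x \<in> {0..1}" for j x
    unfolding u_def
    by (intro has_vector_derivative_add has_vector_derivative_mult_right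
        W_spaceD(1)[OF \<phi> m that] W_spaceD(1)[OF \<xi> m that])
  have top: "(u (m-1) has_vector_derivative u m x) (at x within {0..1})" if "x \<in> {0..1} - (S1 \<union> S2)" for x
    unfolding u_def using S that
    by (intro has_vector_derivative_add has_vector_derivative_mult_right) auto
  have n: "negligible (S1 \<union> S2)" using S by (intro negligible_Un)
  have "AC_on 0 1 (\<lambda>x. (D01 ^^ (m-1)) \<xi> x * t)"
    by (rule AC_on_mult_lipschitz[of _ _ _ _ 0]) (use W_spaceD(2)[OF \<xi> m] in auto)
  then have AC: "AC_on 0 1 (u (m-1))"
    unfolding u_def by (intro AC_on_add W_spaceD(2)[OF \<phi> m]) (simp add: mult.commute)
  have L2: "L2_01 (u m)" unfolding u_def by (intro L2_01_add L2_01_cmult W_spaceD(3) \<phi> \<xi> m)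
  show "(\<lambda>x. \<phi> x + t * \<xi> x) \<in> W_space m"
    using W_spaceI[of m u, OF m d n top AC L2] by (simp add: u0)
  have "AE x in lebesgue_on {0..1}. W_op m (u 0) x = u m x + u (m-1) x"
    by (rule W_op_AE[OF m d n top])
  then show "AE x in lebesgue_on {0..1}. W_op m (\<lambda>x. \<phi> x + t * \<xi> x) x = W_op m \<phi> x + t * W_op m \<xi> x"
    unfolding u0 by eventually_elim (simp add: u_def W_op_def algebra_simps)
qed

lemma W_inner_lincomb:
  assumes \<phi>: "\<phi> \<in> W_space m" and \<xi>: "\<xi> \<in> W_space m" and \<eta>: "\<eta> \<in> W_space m" and m: "m \<ge> 1"
  shows "W_inner m (\<lambda>x. \<phi> x + t * \<xi> x) \<eta> = W_inner m \<phi> \<eta> + t * W_inner m \<xi> \<eta>"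
proof -
  note L2 = W_op_L2[OF _ m]
  have i: "integrable (lebesgue_on {0..1}) (\<lambda>x. W_op m \<phi> x * W_op m \<eta> x)"
    "integrable (lebesgue_on {0..1}) (\<lambda>x. W_op m \<xi> x * W_op m \<eta> x)"
    by (intro L2_01_mult_integrable L2 \<phi> \<xi> \<eta>)+
  have "W_inner m (\<lambda>x. \<phi> x + t * \<xi> x) \<eta> = (LINT x|lebesgue_on {0..1}. W_op m \<phi> x * W_op m \<eta> x + t * (W_op m \<xi> x * W_op m \<eta> x))"
    unfolding W_inner_def
  proof (rule integral_cong_AE)
    show "(\<lambda>x. W_op m (\<lambda>x. \<phi> x + t * \<xi> x) x * W_op m \<eta> x) \<in> borel_measurable (lebesgue_on {0..1})"
      using L2_01_mult_integrable[OF L2[OF W_space_lincomb(1)[OF \<phi> \<xi> m]] L2[OF \<eta>]] by auto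
    show "AE x in lebesgue_on {0..1}. W_op m (\<lambda>x. \<phi> x + t * \<xi> x) x * W_op m \<eta> x = W_op m \<phi> x * W_op m \<eta> x + t * (W_op m \<xi> x * W_op m \<eta> x)"
      using W_space_lincomb(2)[OF \<phi> \<xi> m, of t] by eventually_elim (simp add: algebra_simps)
  qed (use i in auto)
  also have "\<dots> = W_inner m \<phi> \<eta> + t * W_inner m \<xi> \<eta>" using i by (simp add: W_inner_def)
  finally show ?thesis .
qed

lemma W_inner_square:
  assumes \<phi>: "\<phi> \<in> W_space m" and \<xi>: "\<xi> \<in> W_space m" and m: "m \<ge> 1"
  shows "W_inner m (\<lambda>x. \<phi> x + t * \<xi> x) (\<lambda>x. \<phi> x + t * \<xi> x)
    = W_inner m \<phi> \<phi> + 2 * t * W_inner m \<phi> \<xi> + t\<^sup>2 * W_inner m \<xi> \<xi>"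
proof -
  let ?s = "\<lambda>x. \<phi> x + t * \<xi> x"
  have s: "?s \<in> W_space m" by (rule W_space_lincomb[OF assms])
  have "W_inner m ?s ?s = W_inner m \<phi> ?s + t * W_inner m \<xi> ?s" by (rule W_inner_lincomb[OF \<phi> \<xi> s m])
  also have "W_inner m \<phi> ?s = W_inner m \<phi> \<phi> + t * W_inner m \<xi> \<phi>"
    by (subst W_inner_commute) (rule W_inner_lincomb[OF \<phi> \<xi> \<phi> m])
  also have "W_inner m \<xi> ?s = W_inner m \<phi> \<xi> + t * W_inner m \<xi> \<xi>"
    by (subst W_inner_commute) (rule W_inner_lincomb[OF \<phi> \<xi> \<xi> m])
  finally show ?thesis by (simp add: W_inner_commute[of m \<xi> \<phi>] power2_eq_square algebra_simps)
qed

text \<open>If \<xi> has seminorm 0, the form at \<open>\<phi> + t \<xi>\<close> is affine in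
  \<open>t\<close> and stays nonnegative only if its slope is 0. The chosen \<open>t\<close> would
  give it the value -1.\<close>

lemma W_inner_null:
  assumes \<phi>: "\<phi> \<in> W_space m" and \<xi>: "\<xi> \<in> W_space m" and m: "m \<ge> 1" and 0: "W_inner m \<xi> \<xi> = 0"
  shows "W_inner m \<phi> \<xi> = 0"
proof (rule ccontr)
  assume nz: "W_inner m \<phi> \<xi> \<noteq> 0"
  define t where "t = - (W_inner m \<phi> \<phi> + 1) / (2 * W_inner m \<phi> \<xi>)"
  have "0 \<le> W_inner m \<phi> \<phi> + 2 * t * W_inner m \<phi> \<xi> + t\<^sup>2 * W_inner m \<xi> \<xi>"
    using W_inner_nonneg W_inner_square[OF \<phi> \<xi> m] by metis
  also have "\<dots> = - 1" using nz 0 by (simp add: t_def field_simps)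
  finally show False by simp
qed

section \<open>Smooth members of the space and the kernel of the seminorm\<close>

lemma W_space_smooth:
  fixes u :: "nat \<Rightarrow> real \<Rightarrow> real"
  assumes m: "m \<ge> 1" and d: "\<And>j x. (u j has_vector_derivative u (Suc j) x) (at x)"
  shows "u 0 \<in> W_space m"
    and "W_inner m (u 0) (u 0) = (LINT x|lebesgue_on {0..1}. (u m x + u (m-1) x)\<^sup>2)"
proof -
  have dw: "(u j has_vector_derivative u (Suc j) x) (at x within {0..1})" for j x
    by (rule has_vector_derivative_at_within[OF d])
  have top: "(u (m-1) has_vector_derivative u m x) (at x within {0..1})" for x
    using dw[of "m-1" x] m by simp
  have c: "continuous_on {0..1} (u j)" for j
    using dw by (auto simp: continuous_on_eq_continuous_within intro: has_vector_derivative_continuous)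
  obtain L where L: "\<And>x y. x \<in> {0..1} \<Longrightarrow> y \<in> {0..1} \<Longrightarrow> \<bar>u (m-1) x - u (m-1) y\<bar> \<le> L * \<bar>x - y\<bar>"
    by (rule C1_imp_lipschitz[of 0 1 "u (m-1)", OF top c]) (rule that)
  show W: "u 0 \<in> W_space m"
    by (rule W_spaceI[OF m dw negligible_empty top lipschitz_imp_AC_on[OF L] L2_01_continuous[OF c]])
  show "W_inner m (u 0) (u 0) = (LINT x|lebesgue_on {0..1}. (u m x + u (m-1) x)\<^sup>2)"
    unfolding W_inner_def
  proof (rule integral_cong_AE)
    show "(\<lambda>x. W_op m (u 0) x * W_op m (u 0) x) \<in> borel_measurable (lebesgue_on {0..1})"
      using L2_01_mult_integrable[OF W_op_L2[OF W m] W_op_L2[OF W m]] by auto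
    have "continuous_on {0..1} (\<lambda>x. (u m x + u (m-1) x)\<^sup>2)" by (intro continuous_intros c)
    then show "(\<lambda>x. (u m x + u (m-1) x)\<^sup>2) \<in> borel_measurable (lebesgue_on {0..1})"
      by (rule continuous_imp_measurable_on_sets_lebesgue) simp
    show "AE x in lebesgue_on {0..1}. W_op m (u 0) x * W_op m (u 0) x = (u m x + u (m-1) x)\<^sup>2"
      using W_op_AE[OF m dw negligible_empty top] by eventually_elim (simp add: power2_eq_square)
  qed
qed

text \<open>Powers below \<open>m - 1\<close> lie in the kernel of the seminorm. The power
  \<open>m - 1\<close> has positive seminorm; after scaling it shows that the supremum in
  \<open>error_norm\<close> is taken over a nonempty set.\<close>

lemma W_space_power:
  assumes m: "m \<ge> 1"
  shows "(\<lambda>x. x ^ \<alpha>) \<in> W_space m"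
    and "\<alpha> < m - 1 \<Longrightarrow> W_inner m (\<lambda>x. x ^ \<alpha>) (\<lambda>x. x ^ \<alpha>) = 0"
    and "W_inner m (\<lambda>x. x ^ (m-1)) (\<lambda>x. x ^ (m-1)) > 0"
proof -
  define u where "u \<alpha> j x = (if j \<le> \<alpha> then fact \<alpha> / fact (\<alpha> - j) * x ^ (\<alpha> - j) else 0)" for \<alpha> j and x :: real
  have d: "(u \<alpha> j has_vector_derivative u \<alpha> (Suc j) x) (at x)" for \<alpha> j x
  proof (cases "j < \<alpha>")
    case True
    then obtain l where l: "\<alpha> - j = Suc l" by (metis Suc_diff_Suc)
    then have l': "\<alpha> - Suc j = l" by simp
    have "((\<lambda>x. fact \<alpha> / fact (Suc l) * x ^ Suc l) has_real_derivative fact \<alpha> / fact l * x ^ l) (at x)"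
      by (rule derivative_eq_intros refl | simp add: fact_Suc del: of_nat_Suc)+
    then show ?thesis using True unfolding u_def[abs_def] l l'
      by (simp add: has_real_derivative_iff_has_vector_derivative del: fact_Suc power_Suc)
  next
    case False
    then have "u \<alpha> (Suc j) x = 0" by (simp add: u_def)
    moreover have "u \<alpha> j = (\<lambda>_. if j \<le> \<alpha> then fact \<alpha> else 0)" using False by (auto simp: u_def)
    ultimately show ?thesis by simp
  qed
  have u0: "u \<alpha> 0 = (\<lambda>x. x ^ \<alpha>)" for \<alpha> by (auto simp: u_def)
  show "(\<lambda>x. x ^ \<alpha>) \<in> W_space m" using W_space_smooth(1)[of m "u \<alpha>", OF m d] by (simp add: u0)
  have I: "W_inner m (\<lambda>x. x ^ \<alpha>) (\<lambda>x. x ^ \<alpha>) = (LINT x|lebesgue_on {0..1}. (u \<alpha> m x + u \<alpha> (m-1) x)\<^sup>2)" for \<alpha>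
    using W_space_smooth(2)[of m "u \<alpha>", OF m d] by (simp add: u0)
  show "W_inner m (\<lambda>x. x ^ \<alpha>) (\<lambda>x. x ^ \<alpha>) = 0" if "\<alpha> < m - 1"
  proof -
    have "\<not> m \<le> \<alpha>" "\<not> m - 1 \<le> \<alpha>" using that by auto
    then have "u \<alpha> m x + u \<alpha> (m-1) x = 0" for x by (simp add: u_def)
    then show ?thesis unfolding I by simp
  qed
  have "W_inner m (\<lambda>x. x ^ (m-1)) (\<lambda>x. x ^ (m-1)) = (LINT x|lebesgue_on {0..1::real}. (fact (m-1))\<^sup>2)"
  proof -
    have "\<not> m \<le> m - 1" using m by simp
    then have "u (m-1) m x + u (m-1) (m-1) x = fact (m-1)" for x by (simp add: u_def)
    then show ?thesis unfolding I by simp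
  qed
  also have "\<dots> = (fact (m-1))\<^sup>2" by (simp add: measure_restrict_space)
  finally show "W_inner m (\<lambda>x. x ^ (m-1)) (\<lambda>x. x ^ (m-1)) > 0" by simp
qed

lemma W_space_exp:
  assumes m: "m \<ge> 1"
  shows "(\<lambda>x. exp (- x)) \<in> W_space m" and "W_inner m (\<lambda>x. exp (- x)) (\<lambda>x. exp (- x)) = 0"
proof -
  define u where "u j x = (-1) ^ j * exp (- x)" for j and x :: real
  have d: "(u j has_vector_derivative u (Suc j) x) (at x)" for j x
    unfolding has_real_derivative_iff_has_vector_derivative[symmetric] u_def[abs_def]
    by (rule derivative_eq_intros refl | simp)+
  have u0: "u 0 = (\<lambda>x. exp (- x))" by (auto simp: u_def)
  show "(\<lambda>x. exp (- x)) \<in> W_space m" using W_space_smooth(1)[of m u, OF m d] by (simp add: u0)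
  obtain l where "m = Suc l" using m by (cases m) auto
  then have "u m x + u (m-1) x = 0" for x by (simp add: u_def)
  then show "W_inner m (\<lambda>x. exp (- x)) (\<lambda>x. exp (- x)) = 0"
    using W_space_smooth(2)[of m u, OF m d] by (simp add: u0)
qed

section \<open>Representers of functionals annihilating the kernel of the seminorm\<close>

text \<open>The Green function of \<open>d^m + d^(m-1)\<close> with zero initial data: a solution of
  the homogeneous equation whose derivatives at 0 vanish below order \<open>m-1\<close>, while the
  one of order \<open>m-1\<close> equals 1.\<close>

definition peano_kernel :: "nat \<Rightarrow> real \<Rightarrow> real" where
  "peano_kernel m t = (-1) ^ (m-1) * exp_tail (m-1) (- t)"

text \<open>The first-order relation \<open>K' + K = t^(m-2) / (m-2)!\<close>, with right-hand side
  0 for \<open>m = 1\<close>. It lets one product rule suffice in the representation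
  formula.\<close>

lemma peano_kernel_deriv:
  assumes m: "m \<ge> 1"
  shows "(peano_kernel m has_real_derivative ((if m = 1 then 0 else t ^ (m-2) / fact (m-2)) - peano_kernel m t)) (at t)"
proof -
  have d: "(peano_kernel m has_real_derivative ((-1) ^ (m-1) * - exp_tail (m-1-1) (- t))) (at t)"
    unfolding peano_kernel_def[abs_def] by (rule DERIV_cmult[OF exp_tail_deriv_minus])
  have "(-1) ^ (m-1) * - exp_tail (m-1-1) (- t) = (if m = 1 then 0 else t ^ (m-2) / fact (m-2)) - peano_kernel m t"
  proof (cases "m = 1")
    case False
    then obtain l where l: "m = Suc (Suc l)" using m by (metis One_nat_def not0_implies_Suc not_one_le_zero)
    have "(-1) ^ l * (- t) ^ l = t ^ l" by (simp add: power_mult_distrib[symmetric])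
    then show ?thesis unfolding peano_kernel_def l using exp_tail_Suc[of l "- t"]
      by (simp add: algebra_simps)
  qed (simp add: peano_kernel_def)
  then show ?thesis using d by simp
qed

lemma peano_kernel_0: "m \<ge> 1 \<Longrightarrow> peano_kernel m 0 = (if m = 1 then 1 else 0)"
  by (auto simp: peano_kernel_def exp_tail_at_0)

lemma peano_kernel_continuous: "m \<ge> 1 \<Longrightarrow> continuous_on A (peano_kernel m)"
  using peano_kernel_deriv by (meson DERIV_isCont continuous_at_imp_continuous_on)

text \<open>Differentiating a Taylor sum with respect to its centre telescopes, and only the top
  term is left.\<close>

lemma taylor_sum_deriv:
  assumes "\<And>j. j < n \<Longrightarrow> (u j has_vector_derivative u (Suc j) y) (at y within S)"
  shows "((\<lambda>y. \<Sum>j<n. u j y * ((b - y) ^ j / fact j)) has_vector_derivative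
     (if n = 0 then 0 else u n y * ((b - y) ^ (n-1) / fact (n-1)) :: real)) (at y within S)"
  using assms
proof (induction n)
  case (Suc n)
  have p: "((\<lambda>y. (b - y) ^ n / fact n) has_vector_derivative (if n = 0 then 0 else - ((b - y) ^ (n-1) / fact (n-1)))) (at y within S)"
    unfolding has_real_derivative_iff_has_vector_derivative[symmetric]
  proof (cases n)
    case (Suc l)
    have "((\<lambda>y. (b - y) ^ Suc l / fact (Suc l)) has_real_derivative (- ((b - y) ^ l / fact l))) (at y within S)"
      by (rule derivative_eq_intros refl | simp add: fact_Suc field_simps del: of_nat_Suc)+
    then show "((\<lambda>y. (b - y) ^ n / fact n) has_real_derivative (if n = 0 then 0 else - ((b - y) ^ (n-1) / fact (n-1)))) (at y within S)"
      using Suc by (simp del: fact_Suc power_Suc)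
  qed simp
  have un: "(u n has_vector_derivative u (Suc n) y) (at y within S)" by (rule Suc.prems) simp
  have "((\<lambda>y. (\<Sum>j<n. u j y * ((b - y) ^ j / fact j)) + u n y * ((b - y) ^ n / fact n)) has_vector_derivative
     ((if n = 0 then 0 else u n y * ((b - y) ^ (n-1) / fact (n-1))) +
      (u n y * (if n = 0 then 0 else - ((b - y) ^ (n-1) / fact (n-1))) + u (Suc n) y * ((b - y) ^ n / fact n)))) (at y within S)"
    by (intro has_vector_derivative_add has_vector_derivative_mult un p Suc.IH Suc.prems) auto
  then show ?case by (cases "n = 0") simp_all
qed simp

text \<open>The element of the kernel of the seminorm that has the same derivatives at 0 as \<phi>
  up to order \<open>m-1\<close>.\<close>

definition taylor_part :: "nat \<Rightarrow> (real \<Rightarrow> real) \<Rightarrow> real \<Rightarrow> real" where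
  "taylor_part m \<phi> b = (\<Sum>j<m-1. (D01 ^^ j) \<phi> 0 * (b ^ j / fact j)) + (D01 ^^ (m-1)) \<phi> 0 * peano_kernel m b"

text \<open>An antiderivative of the integrand is the Taylor sum centred at \<open>y\<close> plus
  the derivative of order \<open>m-1\<close> times the kernel: it equals \<open>\<phi> b\<close> at
  \<open>y = b\<close> and \<open>taylor_part m \<phi> b\<close> at \<open>y = 0\<close>. The top
  derivative exists only almost everywhere, so the fundamental theorem for absolutely continuous
  functions is applied.\<close>

lemma peano_has_integral:
  assumes \<phi>: "\<phi> \<in> W_space m" and m: "m \<ge> 1" and b: "b \<in> {0..1}"
  shows "((\<lambda>y. peano_kernel m (b - y) * W_op m \<phi> y) has_integral (\<phi> b - taylor_part m \<phi> b)) {0..b}"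
proof -
  define u where "u j = (D01 ^^ j) \<phi>" for j
  obtain S where S: "negligible S" "\<And>x. x \<in> {0..1}-S \<Longrightarrow> (u (m-1) has_vector_derivative u m x) (at x within {0..1})"
    using W_spaceD(4)[OF \<phi> m] unfolding u_def by blast
  have sub: "{0..b} \<subseteq> {0..1}" using b by auto
  have ud: "(u j has_vector_derivative u (Suc j) x) (at x within {0..b})" if "j < m-1" "x \<in> {0..b}" for j x
    using has_vector_derivative_within_subset[OF W_spaceD(1)[OF \<phi> m that(1)] sub] that(2) sub
    by (auto simp: u_def)
  have uc: "continuous_on {0..b} (u j)" if "j \<le> m-1" for j
    using continuous_on_subset[OF W_space_continuous[OF \<phi> m that] sub] by (simp add: u_def)
  define F1 where "F1 y = (\<Sum>j<m-1. u j y * ((b - y) ^ j / fact j))" for y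
  define F2 where "F2 y = u (m-1) y * peano_kernel m (b - y)" for y
  have d1: "(F1 has_vector_derivative (if m - 1 = 0 then 0 else u (m-1) y * ((b - y) ^ (m-1-1) / fact (m-1-1)))) (at y within {0..b})"
    if "y \<in> {0..b}" for y
    unfolding F1_def by (rule taylor_sum_deriv) (use ud that in auto)
  have kd: "((\<lambda>y. peano_kernel m (b - y)) has_vector_derivative
      - ((if m = 1 then 0 else (b - y) ^ (m-2) / fact (m-2)) - peano_kernel m (b - y))) (at y within S')" for y S'
    unfolding has_real_derivative_iff_has_vector_derivative[symmetric]
    by (rule DERIV_chain'[where f="\<lambda>y. b - y", OF _ peano_kernel_deriv[OF m], THEN DERIV_cong])
       (auto intro!: derivative_eq_intros)
  have c1: "continuous_on {0..b} (\<lambda>y. if m - 1 = 0 then 0 else u (m-1) y * ((b - y) ^ (m-1-1) / fact (m-1-1)))"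
  proof (cases "m - 1 = 0")
    case True
    show ?thesis unfolding if_P[OF True] by (rule continuous_on_const)
  next
    case False
    show ?thesis unfolding if_not_P[OF False] by (intro continuous_intros uc) auto
  qed
  obtain L1 where L1: "\<And>x y. x \<in> {0..b} \<Longrightarrow> y \<in> {0..b} \<Longrightarrow> \<bar>F1 x - F1 y\<bar> \<le> L1 * \<bar>x - y\<bar>"
    by (rule C1_imp_lipschitz[OF d1 c1], assumption, rule that)
  have ck: "continuous_on A (\<lambda>y. peano_kernel m (b - y))" for A
    by (rule continuous_on_compose2[OF peano_kernel_continuous[OF m, of UNIV]]) (auto intro!: continuous_intros)
  have c2: "continuous_on {0..b} (\<lambda>y. - ((if m = 1 then 0 else (b - y) ^ (m-2) / fact (m-2)) - peano_kernel m (b - y)))"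
  proof (cases "m = 1")
    case True
    then show ?thesis using ck[of "{0..b}"] by simp
  next
    case False
    then show ?thesis by (auto intro!: continuous_intros ck)
  qed
  obtain L2 where L2: "\<And>x y. x \<in> {0..b} \<Longrightarrow> y \<in> {0..b} \<Longrightarrow> \<bar>peano_kernel m (b - x) - peano_kernel m (b - y)\<bar> \<le> L2 * \<bar>x - y\<bar>"
    by (rule C1_imp_lipschitz[OF kd c2]) (rule that)
  have AC: "AC_on 0 b (\<lambda>y. F1 y + F2 y)"
  proof (rule AC_on_add)
    show "AC_on 0 b F1" by (rule lipschitz_imp_AC_on[OF L1])
    have "AC_on 0 b (u (m-1))"
      using AC_on_subinterval[OF W_spaceD(2)[OF \<phi> m]] b by (auto simp: u_def)
    then show "AC_on 0 b F2" unfolding F2_def by (rule AC_on_mult_lipschitz[OF _ L2 ck])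
  qed
  have deriv: "((\<lambda>y. F1 y + F2 y) has_vector_derivative peano_kernel m (b - y) * W_op m \<phi> y) (at y within {0..b})"
    if y: "y \<in> {0..b} - S" for y
  proof -
    have "(u (m-1) has_vector_derivative u m y) (at y within {0..b})"
      using has_vector_derivative_within_subset[OF S(2) sub] y sub by auto
    from has_vector_derivative_mult[OF this kd]
    have "(F2 has_vector_derivative (u (m-1) y * - ((if m = 1 then 0 else (b - y) ^ (m-2) / fact (m-2)) - peano_kernel m (b - y))
       + u m y * peano_kernel m (b - y))) (at y within {0..b})" unfolding F2_def .
    from has_vector_derivative_add[OF d1 this] y
    have "((\<lambda>y. F1 y + F2 y) has_vector_derivative ((if m - 1 = 0 then 0 else u (m-1) y * ((b - y) ^ (m-1-1) / fact (m-1-1)))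
       + (u (m-1) y * - ((if m = 1 then 0 else (b - y) ^ (m-2) / fact (m-2)) - peano_kernel m (b - y))
       + u m y * peano_kernel m (b - y)))) (at y within {0..b})" by simp
    moreover have "m - 1 - 1 = m - 2" "m - 1 = 0 \<longleftrightarrow> m = 1" using m by auto
    ultimately show ?thesis
      by (cases "m = 1") (simp_all add: W_op_def u_def algebra_simps)
  qed
  have "((\<lambda>y. peano_kernel m (b - y) * W_op m \<phi> y) has_integral ((F1 b + F2 b) - (F1 0 + F2 0))) {0..b}"
    by (rule AC_on_fundamental_theorem[OF _ AC S(1) deriv]) (use b in auto)
  moreover have "F1 b + F2 b = \<phi> b"
  proof (cases "m = 1")
    case True
    then show ?thesis by (simp add: F1_def F2_def u_def peano_kernel_0)
  next
    case False
    then obtain l where l: "m - 1 = Suc l" using m by (metis One_nat_def Suc_pred le_antisym nat_less_le not0_implies_Suc diff_is_0_eq)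
    then have "F1 b = u 0 b" by (simp add: F1_def sum.lessThan_Suc_shift del: sum.lessThan_Suc)
    then show ?thesis using False m by (simp add: F2_def peano_kernel_0 u_def)
  qed
  moreover have "F1 0 + F2 0 = taylor_part m \<phi> b"
    by (simp add: F1_def F2_def taylor_part_def u_def)
  ultimately show ?thesis by simp
qed

lemma truncated_kernel_measurable:
  assumes m: "m \<ge> 1"
  shows "L2_01 (\<lambda>y. if y < b then peano_kernel m (b - y) else 0)"
proof -
  have ck: "continuous_on A (\<lambda>y. peano_kernel m (b - y))" for A
    by (rule continuous_on_compose2[OF peano_kernel_continuous[OF m, of UNIV]]) (auto intro!: continuous_intros)
  have "bounded ((\<lambda>y. peano_kernel m (b - y)) ` {0..1})"
    using ck compact_continuous_image compact_imp_bounded compact_Icc by blast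
  then obtain B where B: "\<And>x. x \<in> {0..1} \<Longrightarrow> \<bar>peano_kernel m (b - x)\<bar> \<le> B" "B > 0" unfolding bounded_pos by fastforce
  have "(\<lambda>y. peano_kernel m (b - y)) \<in> borel_measurable borel"
    using ck by (rule borel_measurable_continuous_onI)
  then have "(\<lambda>y. if y < b then peano_kernel m (b - y) else 0) \<in> borel_measurable borel"
    by measurable
  then have "(\<lambda>y. if y < b then peano_kernel m (b - y) else 0) \<in> borel_measurable (lebesgue_on {0..1})"
    by (intro measurable_restrict_space1 measurable_completion) simp
  then show ?thesis by (rule L2_01_bounded[of _ B]) (use B in auto)
qed

lemma peano_integral:
  assumes \<phi>: "\<phi> \<in> W_space m" and m: "m \<ge> 1" and b: "b \<in> {0..1}"
  shows "(LINT y|lebesgue_on {0..1}. (if y < b then peano_kernel m (b - y) else 0) * W_op m \<phi> y) = \<phi> b - taylor_part m \<phi> b"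
proof -
  let ?f = "\<lambda>y. (if y < b then peano_kernel m (b - y) else 0) * W_op m \<phi> y"
  have i: "integrable (lebesgue_on {0..1}) ?f"
    by (intro L2_01_mult_integrable truncated_kernel_measurable W_op_L2 m \<phi>)
  have "(?f has_integral (integral\<^sup>L (lebesgue_on {0..1}) ?f)) {0..1}"
    by (rule has_integral_integral_lebesgue_on[OF i]) simp
  moreover have "((\<lambda>y. if y \<in> {0..b} then peano_kernel m (b - y) * W_op m \<phi> y else 0) has_integral (\<phi> b - taylor_part m \<phi> b)) {0..1}"
    using peano_has_integral[OF assms] b by (subst has_integral_restrict) auto
  then have "(?f has_integral (\<phi> b - taylor_part m \<phi> b)) {0..1}"
    by (rule has_integral_spike[of "{b}", rotated 2]) auto
  ultimately show ?thesis by (rule has_integral_unique)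
qed

section \<open>Nodal functionals that vanish on the kernel, and their representers\<close>

definition annihilates_kernel :: "nat \<Rightarrow> real \<Rightarrow> nat \<Rightarrow> (nat \<Rightarrow> real) \<Rightarrow> bool" where
  "annihilates_kernel m h N c \<longleftrightarrow> (\<forall>\<alpha><m-1. (\<Sum>\<beta>=0..N. c \<beta> * (h * real \<beta>) ^ \<alpha>) = 0) \<and>
     (\<Sum>\<beta>=0..N. c \<beta> * exp (- (h * real \<beta>))) = 0"

text \<open>As a function of the node \<open>x\<close>, \<open>exp_tail (m-1) (y - x)\<close> is a
  combination of the powers \<open>x ^ i\<close> with \<open>i < m-1\<close> and of
  \<open>exp (- x)\<close>.\<close>

lemma annihilates_exp_tail:
  assumes c: "annihilates_kernel m h N c"
  shows "(\<Sum>\<beta>=0..N. c \<beta> * exp_tail (m-1) (y - h * real \<beta>)) = 0"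
proof -
  have e: "(\<Sum>\<beta>=0..N. c \<beta> * exp (y - h * real \<beta>)) = exp y * (\<Sum>\<beta>=0..N. c \<beta> * exp (- (h * real \<beta>)))"
    unfolding sum_distrib_left by (intro sum.cong refl) (simp add: exp_diff exp_minus field_simps)
  have p: "(\<Sum>\<beta>=0..N. c \<beta> * (y - h * real \<beta>) ^ k) = 0" if k: "k < m-1" for k
  proof -
    have "c \<beta> * (y - h * real \<beta>) ^ k = (\<Sum>i\<le>k. (real (k choose i) * y ^ (k-i) * (-1) ^ i) * (c \<beta> * (h * real \<beta>) ^ i))" for \<beta>
    proof -
      have "(- (h * real \<beta>) + y) ^ k = (\<Sum>i\<le>k. real (k choose i) * (- (h * real \<beta>)) ^ i * y ^ (k-i))"
        by (rule binomial_ring)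
      moreover have "(- (h * real \<beta>)) ^ i = (-1) ^ i * (h * real \<beta>) ^ i" for i by (rule power_minus)
      ultimately show ?thesis by (simp add: sum_distrib_left mult_ac)
    qed
    then have "(\<Sum>\<beta>=0..N. c \<beta> * (y - h * real \<beta>) ^ k)
       = (\<Sum>i\<le>k. (real (k choose i) * y ^ (k-i) * (-1) ^ i) * (\<Sum>\<beta>=0..N. c \<beta> * (h * real \<beta>) ^ i))"
      by (simp only: sum_distrib_left) (rule sum.swap)
    also have "\<dots> = 0" using c k by (intro sum.neutral) (auto simp: annihilates_kernel_def)
    finally show ?thesis .
  qed
  have "(\<Sum>\<beta>=0..N. c \<beta> * (\<Sum>k<m-1. (y - h * real \<beta>) ^ k / fact k))
      = (\<Sum>k<m-1. (\<Sum>\<beta>=0..N. c \<beta> * (y - h * real \<beta>) ^ k) / fact k)"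
    by (simp only: sum_distrib_left sum_divide_distrib times_divide_eq_right) (rule sum.swap)
  also have "\<dots> = 0" using p by simp
  finally show ?thesis using e c
    by (simp add: exp_tail_def right_diff_distrib sum_subtractf annihilates_kernel_def)
qed

lemma annihilates_taylor_part:
  assumes c: "annihilates_kernel m h N c"
  shows "(\<Sum>\<beta>=0..N. c \<beta> * taylor_part m \<phi> (h * real \<beta>)) = 0"
proof -
  have "(\<Sum>\<beta>=0..N. c \<beta> * (\<Sum>j<m-1. a j * ((h * real \<beta>) ^ j / fact j))) = 0" for a
  proof -
    have "(\<Sum>\<beta>=0..N. c \<beta> * (\<Sum>j<m-1. a j * ((h * real \<beta>) ^ j / fact j)))
      = (\<Sum>\<beta>=0..N. \<Sum>j<m-1. a j / fact j * (c \<beta> * (h * real \<beta>) ^ j))"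
      by (simp add: sum_distrib_left mult_ac)
    also have "\<dots> = (\<Sum>j<m-1. \<Sum>\<beta>=0..N. a j / fact j * (c \<beta> * (h * real \<beta>) ^ j))" by (rule sum.swap)
    also have "\<dots> = (\<Sum>j<m-1. a j / fact j * (\<Sum>\<beta>=0..N. c \<beta> * (h * real \<beta>) ^ j))"
      by (simp only: sum_distrib_left)
    also have "\<dots> = 0" using c by (intro sum.neutral) (auto simp: annihilates_kernel_def)
    finally show ?thesis .
  qed
  moreover have "(\<Sum>\<beta>=0..N. c \<beta> * (d * peano_kernel m (h * real \<beta>))) = 0" for d
  proof -
    have "(\<Sum>\<beta>=0..N. c \<beta> * (d * peano_kernel m (h * real \<beta>)))
      = d * (-1) ^ (m-1) * (\<Sum>\<beta>=0..N. c \<beta> * exp_tail (m-1) (0 - h * real \<beta>))"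
      by (simp add: peano_kernel_def sum_distrib_left mult_ac)
    then show ?thesis by (simp only: annihilates_exp_tail[OF c] mult_zero_right)
  qed
  ultimately show ?thesis by (simp add: taylor_part_def distrib_left sum.distrib)
qed

text \<open>Points of opposite sign are compared through 0, where the branch vanishes, using
  \<open>|x| + |y| = |x - y|\<close>. The interval \<open>[-1, 1]\<close> contains all differences
  of points of \<open>[0, 1]\<close>.\<close>

lemma psi_deriv_lipschitz:
  assumes j: "j \<le> 2*m-2"
  obtains L where "\<And>x y. x \<in> {-1..1} \<Longrightarrow> y \<in> {-1..1} \<Longrightarrow> \<bar>psi_deriv m j x - psi_deriv m j y\<bar> \<le> L * \<bar>x - y\<bar>"
proof -
  have d: "(psi_branch m j has_vector_derivative psi_branch m (Suc j) x) (at x within {-1..1})" for x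
    using psi_branch_deriv[of m j x] has_vector_derivative_at_within
    by (simp add: has_real_derivative_iff_has_vector_derivative) blast
  obtain L where L: "\<And>x y. x \<in> {-1..1} \<Longrightarrow> y \<in> {-1..1} \<Longrightarrow> \<bar>psi_branch m j x - psi_branch m j y\<bar> \<le> L * \<bar>x - y\<bar>"
    by (rule C1_imp_lipschitz[OF d continuous_on_psi_branch]) (rule that)
  have z: "psi_branch m j 0 = 0" by (rule psi_branch_at_0[OF j])
  have "\<bar>psi_deriv m j x - psi_deriv m j y\<bar> \<le> L * \<bar>x - y\<bar>" if x: "x \<in> {-1..1}" and y: "y \<in> {-1..1}" for x y
  proof (cases "x * y \<ge> 0")
    case True
    then have "sgn x = sgn y \<or> x = 0 \<or> y = 0"
      by (auto simp: zero_le_mult_iff sgn_if)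
    then show ?thesis
    proof (elim disjE)
      assume "sgn x = sgn y"
      then have "psi_deriv m j x - psi_deriv m j y = sgn y * (psi_branch m j x - psi_branch m j y)"
        by (simp add: psi_deriv_def algebra_simps)
      then have "\<bar>psi_deriv m j x - psi_deriv m j y\<bar> \<le> \<bar>psi_branch m j x - psi_branch m j y\<bar>"
        by (simp add: abs_mult abs_sgn_eq)
      then show ?thesis using L[OF x y] by linarith
    next
      assume "x = 0"
      then show ?thesis using L[OF x y] z by (auto simp: psi_deriv_def abs_mult abs_sgn_eq split: if_splits)
    next
      assume "y = 0"
      then show ?thesis using L[OF x y] z by (auto simp: psi_deriv_def abs_mult abs_sgn_eq split: if_splits)
    qed
  next
    case False
    have "\<bar>psi_deriv m j t\<bar> \<le> L * \<bar>t\<bar>" if "t \<in> {-1..1}" for t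
      using L[OF that, of 0] z by (auto simp: psi_deriv_def abs_mult abs_sgn_eq split: if_splits)
    from this[OF x] this[OF y] have "\<bar>psi_deriv m j x - psi_deriv m j y\<bar> \<le> L * (\<bar>x\<bar> + \<bar>y\<bar>)"
      by (simp add: distrib_left)
    also have "\<bar>x\<bar> + \<bar>y\<bar> = \<bar>x - y\<bar>" using False by (auto simp: not_le mult_less_0_iff)
    finally show ?thesis .
  qed
  then show thesis by (rule that)
qed

text \<open>The factor \<open>(-1) ^ m\<close> makes the image under \<open>d^m + d^(m-1)\<close> a
  combination of truncated \<open>peano_kernel\<close>s with coefficients \<open>c\<close> and no
  further sign.\<close>

definition representer :: "nat \<Rightarrow> real \<Rightarrow> nat \<Rightarrow> (nat \<Rightarrow> real) \<Rightarrow> real \<Rightarrow> real" where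
  "representer m h N c x = (-1) ^ m * (\<Sum>\<beta>=0..N. c \<beta> * \<psi> m (x - h * real \<beta>))"

lemma AC_on_cmult: "AC_on a b f \<Longrightarrow> AC_on a b (\<lambda>x. t * f x)"
proof -
  assume f: "AC_on a b f"
  have "AC_on a b (\<lambda>x. f x * t)" by (rule AC_on_mult_lipschitz[OF f, of _ 0]) auto
  then show ?thesis by (simp add: mult.commute)
qed

lemma AC_on_sum: "finite I \<Longrightarrow> (\<And>i. i \<in> I \<Longrightarrow> AC_on a b (f i)) \<Longrightarrow> AC_on a b (\<lambda>x. \<Sum>i\<in>I. f i x)"
proof (induction I rule: finite_induct)
  case empty
  then show ?case by (auto simp: AC_on_def intro: exI[of _ 1])
next
  case (insert i I)
  then show ?case by (simp add: AC_on_add)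
qed

lemma L2_01_sum: "finite I \<Longrightarrow> (\<And>i. i \<in> I \<Longrightarrow> L2_01 (f i)) \<Longrightarrow> L2_01 (\<lambda>x. \<Sum>i\<in>I. f i x)"
proof (induction I rule: finite_induct)
  case empty
  then show ?case by (simp add: L2_01_def)
next
  case (insert i I)
  then show ?case by (simp add: L2_01_add)
qed

text \<open>\<open>psi_branch_operator\<close> turns each term into \<open>sgn\<close> times half an
  exponential tail. Writing \<open>sgn\<close> as 1 minus twice the indicator of the left side, the
  untruncated part is annihilated by \<open>c\<close> and the truncated kernels remain.\<close>

lemma representer_W_space:
  assumes m: "m \<ge> 1" and N: "N \<ge> 1" and h: "h = 1 / real N" and c: "annihilates_kernel m h N c"
  shows "representer m h N c \<in> W_space m"
    and "AE x in lebesgue_on {0..1}. W_op m (representer m h N c) x = (\<Sum>\<beta>=0..N. c \<beta> * (if x < h * real \<beta> then peano_kernel m (h * real \<beta> - x) else 0))"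
proof -
  define u where "u j x = (-1) ^ m * (\<Sum>\<beta>=0..N. c \<beta> * psi_deriv m j (x - h * real \<beta>))" for j x
  define S where "S = (\<lambda>\<beta>. h * real \<beta>) ` {0..N}"
  have node: "h * real \<beta> \<in> {0..1}" if "\<beta> \<le> N" for \<beta>
    using that N by (simp add: h field_simps)
  have u0: "u 0 = representer m h N c" by (auto simp: u_def representer_def psi_deriv_0)
  have shift: "((\<lambda>x. psi_deriv m j (x - b)) has_vector_derivative psi_deriv m (Suc j) (x - b)) (at x within A)"
    if "x \<noteq> b \<or> Suc j \<le> 2*m-2" for j x b A
  proof -
    have "((\<lambda>x. psi_deriv m j (x - b)) has_real_derivative psi_deriv m (Suc j) (x - b)) (at x)"
      by (rule DERIV_chain'[where f="\<lambda>x. x - b", OF _ psi_deriv_has_derivative, THEN DERIV_cong])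
         (use that in \<open>auto intro!: derivative_eq_intros\<close>)
    then show ?thesis
      by (simp add: has_real_derivative_iff_has_vector_derivative has_vector_derivative_at_within)
  qed
  have d: "(u j has_vector_derivative u (Suc j) x) (at x within {0..1})" if "j < m-1" for j x
    unfolding u_def
    by (intro has_vector_derivative_mult_right has_vector_derivative_sum shift) (use that in auto)
  have n: "negligible S" unfolding S_def by (intro negligible_finite) auto
  have top: "(u (m-1) has_vector_derivative u m x) (at x within {0..1})" if x: "x \<in> {0..1} - S" for x
  proof -
    have mm: "m = Suc (m-1)" using m by simp
    have "(u (m-1) has_vector_derivative u (Suc (m-1)) x) (at x within {0..1})"
      unfolding u_def
      by (intro has_vector_derivative_mult_right has_vector_derivative_sum shift) (use x in \<open>auto simp: S_def\<close>)
    then show ?thesis using mm by simp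
  qed
  have AC: "AC_on 0 1 (u (m-1))"
    unfolding u_def
  proof (intro AC_on_cmult AC_on_sum)
    fix \<beta> assume "\<beta> \<in> {0..N}"
    then have b: "h * real \<beta> \<in> {0..1}" using node by simp
    obtain L where L: "\<And>x y. x \<in> {-1..1} \<Longrightarrow> y \<in> {-1..1} \<Longrightarrow> \<bar>psi_deriv m (m-1) x - psi_deriv m (m-1) y\<bar> \<le> L * \<bar>x - y\<bar>"
      by (rule psi_deriv_lipschitz[of "m-1" m]) (use m in \<open>auto intro: that\<close>)
    show "AC_on 0 1 (\<lambda>x. psi_deriv m (m-1) (x - h * real \<beta>))"
    proof (rule lipschitz_imp_AC_on[of _ _ _ L])
      fix x y :: real assume "x \<in> {0..1}" "y \<in> {0..1}"
      then show "\<bar>psi_deriv m (m-1) (x - h * real \<beta>) - psi_deriv m (m-1) (y - h * real \<beta>)\<bar> \<le> L * \<bar>x - y\<bar>"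
        using L[of "x - h * real \<beta>" "y - h * real \<beta>"] b by auto
    qed
  qed simp
  have L2: "L2_01 (u m)"
    unfolding u_def
  proof (intro L2_01_cmult L2_01_sum)
    fix \<beta>
    define f where "f x = psi_branch m m (x - h * real \<beta>)" for x
    have cf: "continuous_on A f" for A
      unfolding f_def by (rule continuous_on_compose2[OF continuous_on_psi_branch[of UNIV]]) (auto intro!: continuous_intros)
    have "bounded (f ` {0..1})" using cf compact_continuous_image compact_imp_bounded compact_Icc by blast
    then obtain B where B: "\<And>x. x \<in> {0..1} \<Longrightarrow> \<bar>f x\<bar> \<le> B" "B > 0" unfolding bounded_pos by fastforce
    have eq: "psi_deriv m m (x - h * real \<beta>) = (if x < h * real \<beta> then - f x else if x = h * real \<beta> then 0 else f x)" for x
      by (auto simp: psi_deriv_def f_def)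
    have "f \<in> borel_measurable borel" using cf by (rule borel_measurable_continuous_onI)
    then have "(\<lambda>x. if x < h * real \<beta> then - f x else if x = h * real \<beta> then 0 else f x) \<in> borel_measurable borel"
      by measurable
    then have "(\<lambda>x. if x < h * real \<beta> then - f x else if x = h * real \<beta> then 0 else f x) \<in> borel_measurable (lebesgue_on {0..1})"
      by (intro measurable_restrict_space1 measurable_completion) simp
    then show "L2_01 (\<lambda>x. psi_deriv m m (x - h * real \<beta>))"
      unfolding eq by (rule L2_01_bounded[of _ B]) (use B in auto)
  qed simp
  show "representer m h N c \<in> W_space m"
    using W_spaceI[of m u, OF m d n top AC L2] by (simp add: u0)
  have "AE x in lebesgue_on {0..1}. x \<notin> S"
    using n negligible_subset[OF n, of "{x \<in> {0..1}. \<not> x \<notin> S}"] by (subst AE_lebesgue_on_iff_negligible) auto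
  moreover have "AE x in lebesgue_on {0..1}. W_op m (u 0) x = u m x + u (m-1) x"
    by (rule W_op_AE[OF m d n top])
  ultimately show "AE x in lebesgue_on {0..1}. W_op m (representer m h N c) x = (\<Sum>\<beta>=0..N. c \<beta> * (if x < h * real \<beta> then peano_kernel m (h * real \<beta> - x) else 0))"
    unfolding u0
  proof eventually_elim
    case (elim x)
    define G where "G \<beta> = exp_tail (m-1) (x - h * real \<beta>)" for \<beta>
    have G0: "(\<Sum>\<beta>=0..N. c \<beta> * G \<beta>) = 0" unfolding G_def by (rule annihilates_exp_tail[OF c])
    have "u m x + u (m-1) x = (-1) ^ m * (\<Sum>\<beta>=0..N. c \<beta> * (sgn (x - h * real \<beta>) * (G \<beta> / 2)))"
      unfolding u_def psi_deriv_def distrib_left[symmetric] sum.distrib[symmetric]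
      by (simp only: G_def psi_branch_operator[OF m])
    also have "(\<Sum>\<beta>=0..N. c \<beta> * (sgn (x - h * real \<beta>) * (G \<beta> / 2)))
       = (\<Sum>\<beta>=0..N. c \<beta> * (G \<beta> / 2) - c \<beta> * (if x < h * real \<beta> then G \<beta> else 0))"
    proof (intro sum.cong refl)
      fix \<beta> assume "\<beta> \<in> {0..N}"
      then have "x \<noteq> h * real \<beta>" using elim(1) by (auto simp: S_def)
      then show "c \<beta> * (sgn (x - h * real \<beta>) * (G \<beta> / 2)) = c \<beta> * (G \<beta> / 2) - c \<beta> * (if x < h * real \<beta> then G \<beta> else 0)"
        by (auto simp: algebra_simps)
    qed
    also have "\<dots> = - (\<Sum>\<beta>=0..N. c \<beta> * (if x < h * real \<beta> then G \<beta> else 0))"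
    proof -
      have "(\<Sum>\<beta>=0..N. c \<beta> * (G \<beta> / 2)) = (\<Sum>\<beta>=0..N. c \<beta> * G \<beta>) / 2" by (simp add: sum_divide_distrib)
      then have "(\<Sum>\<beta>=0..N. c \<beta> * (G \<beta> / 2)) = 0" using G0 by simp
      then show ?thesis by (simp only: sum_subtractf diff_0)
    qed
    also have "(-1) ^ m * - (\<Sum>\<beta>=0..N. c \<beta> * (if x < h * real \<beta> then G \<beta> else 0))
       = (\<Sum>\<beta>=0..N. c \<beta> * (if x < h * real \<beta> then peano_kernel m (h * real \<beta> - x) else 0))"
    proof -
      obtain l where l: "m = Suc l" using m by (cases m) auto
      show ?thesis unfolding sum_negf[symmetric] sum_distrib_left
        by (intro sum.cong refl) (simp add: G_def peano_kernel_def l)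
    qed
    finally show ?case using elim(2) by simp
  qed
qed

text \<open>Peano's formula is summed over the nodes with the weights \<open>c\<close>; the Taylor
  parts lie in the kernel of the seminorm and drop out.\<close>

lemma representer_reproduces:
  assumes m: "m \<ge> 1" and N: "N \<ge> 1" and h: "h = 1 / real N" and c: "annihilates_kernel m h N c"
    and \<phi>: "\<phi> \<in> W_space m"
  shows "W_inner m (representer m h N c) \<phi> = (\<Sum>\<beta>=0..N. c \<beta> * \<phi> (h * real \<beta>))"
proof -
  note R = representer_W_space[OF m N h c]
  let ?k = "\<lambda>\<beta> x. if x < h * real \<beta> then peano_kernel m (h * real \<beta> - x) else 0"
  have node: "h * real \<beta> \<in> {0..1}" if "\<beta> \<le> N" for \<beta>
    using that N by (simp add: h field_simps)
  have i: "integrable (lebesgue_on {0..1}) (\<lambda>x. c \<beta> * (?k \<beta> x * W_op m \<phi> x))" for \<beta>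
    by (intro integrable_mult_right L2_01_mult_integrable truncated_kernel_measurable W_op_L2 m \<phi>)
  have "W_inner m (representer m h N c) \<phi> = (LINT x|lebesgue_on {0..1}. (\<Sum>\<beta>=0..N. c \<beta> * (?k \<beta> x * W_op m \<phi> x)))"
    unfolding W_inner_def
  proof (rule integral_cong_AE)
    show "(\<lambda>x. W_op m (representer m h N c) x * W_op m \<phi> x) \<in> borel_measurable (lebesgue_on {0..1})"
      using L2_01_mult_integrable[OF W_op_L2[OF R(1) m] W_op_L2[OF \<phi> m]] by auto
    show "(\<lambda>x. \<Sum>\<beta>=0..N. c \<beta> * (?k \<beta> x * W_op m \<phi> x)) \<in> borel_measurable (lebesgue_on {0..1})"
      by (intro borel_measurable_sum borel_measurable_integrable i)
    show "AE x in lebesgue_on {0..1}. W_op m (representer m h N c) x * W_op m \<phi> x = (\<Sum>\<beta>=0..N. c \<beta> * (?k \<beta> x * W_op m \<phi> x))"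
      using R(2) by eventually_elim (simp only: sum_distrib_right mult.assoc)
  qed
  also have "\<dots> = (\<Sum>\<beta>=0..N. c \<beta> * (LINT x|lebesgue_on {0..1}. ?k \<beta> x * W_op m \<phi> x))"
    by (subst Bochner_Integration.integral_sum) (use i in auto)
  also have "\<dots> = (\<Sum>\<beta>=0..N. c \<beta> * \<phi> (h * real \<beta>) - c \<beta> * taylor_part m \<phi> (h * real \<beta>))"
    by (intro sum.cong refl) (simp add: peano_integral[OF \<phi> m node] right_diff_distrib)
  also have "\<dots> = (\<Sum>\<beta>=0..N. c \<beta> * \<phi> (h * real \<beta>))"
    by (simp add: sum_subtractf annihilates_taylor_part[OF c])
  finally show ?thesis .
qed

text \<open>Finite-dimensional duality: a vector orthogonal to the common annihilator of finitely
  many vectors lies in their span. The induction splits off \<open>v n\<close> by means of one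
  \<open>c0\<close> that annihilates the earlier vectors but not \<open>v n\<close>.\<close>

lemma linear_combination_of_annihilator:
  fixes u :: "nat \<Rightarrow> real" and v :: "nat \<Rightarrow> nat \<Rightarrow> real"
  assumes "\<And>c. (\<forall>i<n. (\<Sum>\<beta>=0..N. c \<beta> * v i \<beta>) = 0) \<Longrightarrow> (\<Sum>\<beta>=0..N. c \<beta> * u \<beta>) = 0"
  shows "\<exists>a. \<forall>\<beta>\<le>N. u \<beta> = (\<Sum>i<n. a i * v i \<beta>)"
  using assms
proof (induction n arbitrary: u)
  case 0
  have "u \<beta> = 0" if "\<beta> \<le> N" for \<beta>
  proof -
    have "(\<Sum>\<gamma>=0..N. (if \<gamma> = \<beta> then 1 else 0) * u \<gamma>) = 0" by (rule 0) simp
    moreover have "(\<Sum>\<gamma>=0..N. (if \<gamma> = \<beta> then 1 else 0) * u \<gamma>) = (\<Sum>\<gamma>=0..N. if \<gamma> = \<beta> then u \<gamma> else 0)"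
      by (intro sum.cong refl) simp
    ultimately show ?thesis using that by simp
  qed
  then show ?case by simp
next
  case (Suc n)
  show ?case
  proof (cases "\<exists>c0. (\<forall>i<n. (\<Sum>\<beta>=0..N. c0 \<beta> * v i \<beta>) = 0) \<and> (\<Sum>\<beta>=0..N. c0 \<beta> * v n \<beta>) \<noteq> 0")
    case False
    have "\<exists>a. \<forall>\<beta>\<le>N. u \<beta> = (\<Sum>i<n. a i * v i \<beta>)"
    proof (rule Suc.IH)
      fix c assume "\<forall>i<n. (\<Sum>\<beta>=0..N. c \<beta> * v i \<beta>) = 0"
      then show "(\<Sum>\<beta>=0..N. c \<beta> * u \<beta>) = 0"
        using False by (intro Suc.prems) (auto simp: less_Suc_eq)
    qed
    then obtain a where "\<forall>\<beta>\<le>N. u \<beta> = (\<Sum>i<n. a i * v i \<beta>)" by blast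
    then show ?thesis by (intro exI[of _ "a(n := 0)"]) simp
  next
    case True
    then obtain c0 where c0: "\<forall>i<n. (\<Sum>\<beta>=0..N. c0 \<beta> * v i \<beta>) = 0" "(\<Sum>\<beta>=0..N. c0 \<beta> * v n \<beta>) \<noteq> 0" by blast
    define t where "t = (\<Sum>\<beta>=0..N. c0 \<beta> * u \<beta>) / (\<Sum>\<beta>=0..N. c0 \<beta> * v n \<beta>)"
    have "\<exists>a. \<forall>\<beta>\<le>N. u \<beta> - t * v n \<beta> = (\<Sum>i<n. a i * v i \<beta>)"
    proof (rule Suc.IH)
      fix c assume c: "\<forall>i<n. (\<Sum>\<beta>=0..N. c \<beta> * v i \<beta>) = 0"
      \<comment> \<open>Subtracting this multiple of \<open>c0\<close> makes \<open>c\<close>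
        annihilate \<open>v n\<close> as well.\<close>
      define s where "s = (\<Sum>\<beta>=0..N. c \<beta> * v n \<beta>) / (\<Sum>\<beta>=0..N. c0 \<beta> * v n \<beta>)"
      have lin: "(\<Sum>\<beta>=0..N. (c \<beta> - s * c0 \<beta>) * w \<beta>) = (\<Sum>\<beta>=0..N. c \<beta> * w \<beta>) - s * (\<Sum>\<beta>=0..N. c0 \<beta> * w \<beta>)" for w
        by (simp add: left_diff_distrib sum_subtractf sum_distrib_left mult.assoc)
      have "(\<Sum>\<beta>=0..N. (c \<beta> - s * c0 \<beta>) * u \<beta>) = 0"
      proof (rule Suc.prems)
        show "\<forall>i<Suc n. (\<Sum>\<beta>=0..N. (c \<beta> - s * c0 \<beta>) * v i \<beta>) = 0"
          unfolding lin using c c0 by (auto simp: less_Suc_eq s_def)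
      qed
      then have "(\<Sum>\<beta>=0..N. c \<beta> * u \<beta>) = s * (\<Sum>\<beta>=0..N. c0 \<beta> * u \<beta>)" unfolding lin by simp
      also have "\<dots> = t * (\<Sum>\<beta>=0..N. c \<beta> * v n \<beta>)" by (simp add: s_def t_def)
      finally show "(\<Sum>\<beta>=0..N. c \<beta> * (u \<beta> - t * v n \<beta>)) = 0"
        by (simp add: right_diff_distrib sum_subtractf sum_distrib_left mult_ac)
    qed
    then obtain a where a: "\<forall>\<beta>\<le>N. u \<beta> - t * v n \<beta> = (\<Sum>i<n. a i * v i \<beta>)" by blast
    have "u \<beta> = (\<Sum>i<Suc n. (a(n := t)) i * v i \<beta>)" if "\<beta> \<le> N" for \<beta>
      using a that by (simp add: algebra_simps)
    then show ?thesis by blast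
  qed
qed

section \<open>Necessity of the optimality system\<close>

text \<open>Homogeneity extends the bound from unit vectors to elements of positive seminorm. On an
  element of seminorm 0 the functional must vanish: adding multiples of it to a unit vector
  \<open>e\<close> keeps the seminorm 1, so a nonzero value would make the functional unbounded on
  unit vectors.\<close>

lemma error_norm_bound:
  assumes p: "weight_function p" and m: "m \<ge> 1" and fin: "error_norm m h N p C < \<infinity>"
  obtains M where "M \<ge> 0" "error_norm m h N p C = ereal M"
    "\<And>\<phi>. \<phi> \<in> W_space m \<Longrightarrow> \<bar>error_functional h N p C \<phi>\<bar> \<le> M * W_norm m \<phi>"
proof -
  let ?l = "error_functional h N p C"
  define \<phi>0 where "\<phi>0 = (\<lambda>x::real. 0 * x ^ 0 + (1 / W_norm m (\<lambda>x. x ^ (m-1))) * x ^ (m-1))"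
  have cont: "continuous_on {0..1} \<phi>" if "\<phi> \<in> W_space m" for \<phi>
    using W_space_continuous[OF that m, of 0] by simp
  have scale: "(\<lambda>x. t * \<phi> x) \<in> W_space m \<and> W_norm m (\<lambda>x. t * \<phi> x) = \<bar>t\<bar> * W_norm m \<phi>" if \<phi>: "\<phi> \<in> W_space m" for \<phi> t
  proof -
    have e: "(\<lambda>x. \<phi> x + (t - 1) * \<phi> x) = (\<lambda>x. t * \<phi> x)" by (auto simp: algebra_simps)
    have "(\<lambda>x. t * \<phi> x) \<in> W_space m" using W_space_lincomb(1)[OF \<phi> \<phi> m, of "t - 1"] unfolding e .
    moreover have "W_inner m (\<lambda>x. t * \<phi> x) (\<lambda>x. t * \<phi> x) = t\<^sup>2 * W_inner m \<phi> \<phi>"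
      using W_inner_square[OF \<phi> \<phi> m, of "t - 1"] unfolding e by (simp add: power2_eq_square algebra_simps)
    ultimately show ?thesis by (simp add: W_norm_eq real_sqrt_mult)
  qed
  have pos: "W_norm m (\<lambda>x. x ^ (m-1)) > 0" using W_space_power(3)[OF m] by (simp add: W_norm_eq)
  obtain e where e: "e \<in> W_space m" "W_norm m e = 1"
    using scale[OF W_space_power(1)[OF m], of "1 / W_norm m (\<lambda>x. x ^ (m-1))" "m-1"] pos by auto
  have ub: "ereal \<bar>?l \<phi>\<bar> \<le> error_norm m h N p C" if "\<phi> \<in> W_space m" "W_norm m \<phi> = 1" for \<phi>
    unfolding error_norm_def by (rule SUP_upper) (use that in auto)
  have "0 \<le> error_norm m h N p C" using ub[OF e] by (meson abs_ge_zero ereal_less_eq(5) order_trans)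
  then obtain M where M: "error_norm m h N p C = ereal M" "M \<ge> 0"
    using fin by (cases "error_norm m h N p C") auto
  have unit: "\<bar>?l \<phi>\<bar> \<le> M" if "\<phi> \<in> W_space m" "W_norm m \<phi> = 1" for \<phi>
    using ub[OF that] by (simp add: M(1))
  have "\<bar>?l \<phi>\<bar> \<le> M * W_norm m \<phi>" if \<phi>: "\<phi> \<in> W_space m" for \<phi>
  proof (cases "W_norm m \<phi> = 0")
    case False
    then have n: "W_norm m \<phi> > 0" using W_inner_nonneg[of m \<phi>] by (simp add: W_norm_eq less_le)
    then have "\<bar>?l (\<lambda>x. (1 / W_norm m \<phi>) * \<phi> x)\<bar> \<le> M"
      using scale[OF \<phi>, of "1 / W_norm m \<phi>"] by (intro unit) auto
    then show ?thesis using n by (simp only: error_functional_cmult abs_mult) (simp add: field_simps)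
  next
    case True
    then have z: "W_inner m \<phi> \<phi> = 0" by (simp add: W_norm_eq)
    have "?l \<phi> = 0"
    proof (rule ccontr)
      assume nz: "?l \<phi> \<noteq> 0"
      have b: "\<bar>?l e + t * ?l \<phi>\<bar> \<le> M" for t
      proof -
        have "W_inner m (\<lambda>x. e x + t * \<phi> x) (\<lambda>x. e x + t * \<phi> x) = W_inner m e e"
          using W_inner_square[OF e(1) \<phi> m] W_inner_null[OF e(1) \<phi> m z] z by simp
        then have "W_norm m (\<lambda>x. e x + t * \<phi> x) = 1" using e(2) by (simp add: W_norm_eq)
        then have "\<bar>?l (\<lambda>x. e x + t * \<phi> x)\<bar> \<le> M"
          by (intro unit W_space_lincomb(1)[OF e(1) \<phi> m])
        also have "?l (\<lambda>x. e x + t * \<phi> x) = ?l e + ?l (\<lambda>x. t * \<phi> x)"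
          by (intro error_functional_add[OF p] continuous_intros cont e \<phi>)
        finally show ?thesis by (simp only: error_functional_cmult)
      qed
      have "?l e + ((M + 1 - ?l e) / ?l \<phi>) * ?l \<phi> = M + 1" using nz by simp
      then show False using b[of "(M + 1 - ?l e) / ?l \<phi>"] M(2) by simp
    qed
    then show ?thesis using M(2) True by simp
  qed
  then show thesis using that M by blast
qed

lemma finite_error_norm_exact:
  assumes p: "weight_function p" and m: "m \<ge> 1" and fin: "error_norm m h N p C < \<infinity>"
  shows "\<And>\<alpha>. \<alpha> < m - 1 \<Longrightarrow> error_functional h N p C (\<lambda>x. x ^ \<alpha>) = 0"
    and "error_functional h N p C (\<lambda>x. exp (- x)) = 0"
proof -
  obtain M where M: "\<And>\<phi>. \<phi> \<in> W_space m \<Longrightarrow> \<bar>error_functional h N p C \<phi>\<bar> \<le> M * W_norm m \<phi>"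
    by (rule error_norm_bound[OF p m fin]) (rule that)
  show "error_functional h N p C (\<lambda>x. x ^ \<alpha>) = 0" if "\<alpha> < m - 1" for \<alpha>
    using M[OF W_space_power(1)[OF m, of \<alpha>]] W_space_power(2)[OF m that] by (simp add: W_norm_eq)
  show "error_functional h N p C (\<lambda>x. exp (- x)) = 0"
    using M[OF W_space_exp(1)[OF m]] W_space_exp(2)[OF m] by (simp add: W_norm_eq)
qed

text \<open>Subtracting from the functional its component along the representer of \<open>c\<close> reduces the norm
  unless that component vanishes.\<close>

lemma optimal_stationary:
  assumes p: "weight_function p" and m: "m \<ge> 1" and N: "N \<ge> 1" and h: "h = 1 / real N"
    and opt: "optimal_coefficients m h N p C" and c: "annihilates_kernel m h N c"
  shows "error_functional h N p C (representer m h N c) = 0"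
proof (rule ccontr)
  let ?l = "error_functional h N p C"
  define e where "e = representer m h N c"
  assume "error_functional h N p C (representer m h N c) \<noteq> 0"
  then have le: "?l e \<noteq> 0" by (simp add: e_def)
  have eW: "e \<in> W_space m" unfolding e_def by (rule representer_W_space[OF m N h c])
  have cont: "continuous_on {0..1} \<phi>" if "\<phi> \<in> W_space m" for \<phi>
    using W_space_continuous[OF that m, of 0] by simp
  have fin: "error_norm m h N p C < \<infinity>" using opt by (simp add: optimal_coefficients_def)
  obtain M where M: "M \<ge> 0" "error_norm m h N p C = ereal M"
    "\<And>\<phi>. \<phi> \<in> W_space m \<Longrightarrow> \<bar>?l \<phi>\<bar> \<le> M * W_norm m \<phi>"
    by (rule error_norm_bound[OF p m fin]) (rule that)
  have sq: "(?l \<phi>)\<^sup>2 \<le> M\<^sup>2 * W_inner m \<phi> \<phi>" if "\<phi> \<in> W_space m" for \<phi>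
  proof -
    have "(?l \<phi>)\<^sup>2 = \<bar>?l \<phi>\<bar>\<^sup>2" by simp
    also have "\<dots> \<le> (M * W_norm m \<phi>)\<^sup>2" using M(3)[OF that] by (intro power_mono) auto
    also have "\<dots> = M\<^sup>2 * W_inner m \<phi> \<phi>" using W_inner_nonneg by (simp add: W_norm_eq power_mult_distrib)
    finally show ?thesis .
  qed
  define n where "n = W_inner m e e"
  have n: "n > 0"
  proof (rule ccontr)
    assume "\<not> n > 0"
    then have "n = 0" using W_inner_nonneg[of m e] by (simp add: n_def)
    then show False using sq[OF eW] le by (simp add: n_def)
  qed
  define E where "E = ?l e"
  \<comment> \<open>By the reproducing property this change of coefficients subtracts
    \<open>E / n\<close> times the inner product with \<open>e\<close> from the error
    functional.\<close>
  define C' where "C' \<beta> = C \<beta> + (E / n) * c \<beta>" for \<beta>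
  \<comment> \<open>By Pythagoras, a bound for the squared norm once the component along
    \<open>e\<close>, of squared norm \<open>E^2 / n\<close>, has been removed.\<close>
  define M' where "M' = M\<^sup>2 - E\<^sup>2 / n"
  have M'0: "M' \<ge> 0" using sq[OF eW] n by (simp add: M'_def E_def n_def field_simps)
  have M'lt: "M' < M\<^sup>2" using n le by (simp add: M'_def E_def)
  have bound: "\<bar>error_functional h N p C' \<phi>\<bar> \<le> sqrt M'" if \<phi>: "\<phi> \<in> W_space m" and unit: "W_norm m \<phi> = 1" for \<phi>
  proof -
    define a where "a = W_inner m e \<phi>"
    define \<phi>' where "\<phi>' = (\<lambda>x. \<phi> x + (- a / n) * e x)"
    have \<phi>': "\<phi>' \<in> W_space m" unfolding \<phi>'_def by (rule W_space_lincomb[OF \<phi> eW m])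
    have "W_inner m \<phi> \<phi> = 1" using unit by (simp add: W_norm_eq)
    then have q: "W_inner m \<phi>' \<phi>' = 1 - a\<^sup>2 / n"
      using n W_inner_square[OF \<phi> eW m, of "- a / n"]
      by (simp add: \<phi>'_def W_inner_commute[of m \<phi> e] a_def[symmetric] n_def[symmetric] power2_eq_square field_simps)
    have orth: "W_inner m \<phi>' e = 0"
      unfolding \<phi>'_def using W_inner_lincomb[OF \<phi> eW eW m, of "- a / n"] n
      by (simp add: W_inner_commute[of m \<phi> e] a_def[symmetric] n_def[symmetric])
    define q where "q = W_inner m \<phi>' \<phi>'"
    have q0: "q \<ge> 0" "q \<le> 1" using W_inner_nonneg[of m \<phi>'] q n by (auto simp: q_def)
    define A where "A = ?l \<phi>'"
    have l': "error_functional h N p C' \<phi> = A"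
    proof -
      have "(\<Sum>\<beta>=0..N. C' \<beta> * \<phi> (h * real \<beta>)) = (\<Sum>\<beta>=0..N. C \<beta> * \<phi> (h * real \<beta>)) + (E / n) * (\<Sum>\<beta>=0..N. c \<beta> * \<phi> (h * real \<beta>))"
        by (simp add: C'_def distrib_right sum.distrib sum_distrib_left mult.assoc)
      then have "error_functional h N p C' \<phi> = ?l \<phi> - (E / n) * a"
        by (simp add: error_functional_def a_def e_def representer_reproduces[OF m N h c \<phi>])
      moreover have "A = ?l \<phi> + ?l (\<lambda>x. (- a / n) * e x)"
        unfolding A_def \<phi>'_def by (intro error_functional_add[OF p] continuous_intros cont \<phi> eW)
      ultimately show ?thesis by (simp only: error_functional_cmult E_def) simp
    qed
    have "A\<^sup>2 \<le> M' * q"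
    proof (cases "A = 0")
      case True
      then show ?thesis using M'0 q0 by simp
    next
      case False
      \<comment> \<open>The multiple of \<open>e\<close> that maximizes the ratio of
        \<open>(A + s E)^2\<close> to \<open>q + s^2 n\<close>, that is, the equality case of the
        Cauchy-Schwarz inequality.\<close>
      define s where "s = q * E / (A * n)"
      have "A + s * E = ?l (\<lambda>x. \<phi>' x + s * e x)"
        unfolding A_def E_def error_functional_cmult[symmetric]
        by (intro error_functional_add[OF p, symmetric] continuous_intros cont \<phi>' eW)
      then have "(A + s * E)\<^sup>2 \<le> M\<^sup>2 * W_inner m (\<lambda>x. \<phi>' x + s * e x) (\<lambda>x. \<phi>' x + s * e x)"
        using sq[OF W_space_lincomb(1)[OF \<phi>' eW m]] by simp
      also have "W_inner m (\<lambda>x. \<phi>' x + s * e x) (\<lambda>x. \<phi>' x + s * e x) = q + s\<^sup>2 * n"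
        unfolding W_inner_square[OF \<phi>' eW m] by (simp add: orth q_def n_def)
      finally have ineq: "(A + s * E)\<^sup>2 \<le> M\<^sup>2 * (q + s\<^sup>2 * n)" .
      define B where "B = A\<^sup>2 + q * E\<^sup>2 / n"
      have e1: "A + s * E = B / A" using False n by (simp add: s_def B_def field_simps power2_eq_square)
      have e2: "q + s\<^sup>2 * n = q * B / A\<^sup>2" using False n by (simp add: s_def B_def field_simps power2_eq_square)
      have "(B / A)\<^sup>2 * A\<^sup>2 \<le> M\<^sup>2 * (q * B / A\<^sup>2) * A\<^sup>2"
        using ineq unfolding e1 e2 by (rule mult_right_mono) simp
      then have "B\<^sup>2 \<le> M\<^sup>2 * q * B" using False by (simp add: power_divide)
      moreover have "B > 0" using False q0 n by (simp add: B_def add_pos_nonneg)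
      ultimately have "B \<le> M\<^sup>2 * q" by (simp add: power2_eq_square)
      then show ?thesis using n by (simp add: B_def M'_def field_simps)
    qed
    also have "\<dots> \<le> M' * 1" using q0 M'0 by (intro mult_left_mono) auto
    finally have "A\<^sup>2 \<le> M'" by simp
    then have "sqrt (A\<^sup>2) \<le> sqrt M'" by (rule real_sqrt_le_mono)
    then show ?thesis by (simp add: l')
  qed
  have "error_norm m h N p C' \<le> ereal (sqrt M')"
    unfolding error_norm_def by (rule SUP_least) (use bound in auto)
  moreover have "sqrt M' < M"
  proof -
    have "sqrt M' < sqrt (M\<^sup>2)" using M'lt by (rule real_sqrt_less_mono)
    then show ?thesis using M(1) by simp
  qed
  moreover have "error_norm m h N p C \<le> error_norm m h N p C'" using opt by (simp add: optimal_coefficients_def)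
  ultimately show False unfolding M(2)
    by (metis ereal_less_eq(3) linorder_not_less order_trans)
qed

text \<open>Evenness of \<open>\<psi> m\<close> identifies the error on a representer, up to sign,
  with the pairing of \<open>c\<close> and the defect of the nodal equations without
  \<open>R\<close> and \<open>d\<close>.\<close>

lemma error_functional_representer:
  assumes p: "weight_function p"
  shows "error_functional h N p C (representer m h N c)
    = (-1) ^ m * (\<Sum>\<beta>=0..N. c \<beta> * (fm m p (h * real \<beta>) - (\<Sum>\<gamma>=0..N. C \<gamma> * \<psi> m (h * real \<beta> - h * real \<gamma>))))"
proof -
  have cpsi: "continuous_on {0..1} (\<lambda>x. \<psi> m (x - b))" for b
    by (rule continuous_on_compose2[OF continuous_on_psi[of UNIV]]) (auto intro!: continuous_intros)
  have l: "error_functional h N p C (\<lambda>x. \<psi> m (x - b)) = fm m p b - (\<Sum>\<gamma>=0..N. C \<gamma> * \<psi> m (b - h * real \<gamma>))" for b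
  proof -
    have "\<psi> m (h * real \<gamma> - b) = \<psi> m (b - h * real \<gamma>)" for \<gamma>
      using psi_minus[of m "b - h * real \<gamma>"] by simp
    then show ?thesis by (simp add: error_functional_def fm_def)
  qed
  have "error_functional h N p C (representer m h N c)
     = (-1) ^ m * error_functional h N p C (\<lambda>x. \<Sum>\<beta>=0..N. c \<beta> * \<psi> m (x - h * real \<beta>))"
    unfolding representer_def[abs_def] by (rule error_functional_cmult)
  also have "error_functional h N p C (\<lambda>x. \<Sum>\<beta>=0..N. c \<beta> * \<psi> m (x - h * real \<beta>))
     = (\<Sum>\<beta>=0..N. error_functional h N p C (\<lambda>x. c \<beta> * \<psi> m (x - h * real \<beta>)))"
    by (rule error_functional_sum[OF p]) (auto intro!: continuous_intros cpsi)
  finally show ?thesis by (simp only: error_functional_cmult l)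
qed

text \<open>Stationarity makes the defect at the nodes orthogonal to every \<open>c\<close> that
  annihilates the kernel. By duality the defect is a combination of the nodal values of the kernel
  functions, whose coefficients are \<open>R\<close> and \<open>d\<close>; the moment conditions are
  exactness on the kernel.\<close>

theorem optimal_imp_optimality_system:
  assumes p: "weight_function p" and m: "m \<ge> 1" and N: "N \<ge> 1" and h: "h = 1 / real N"
    and opt: "optimal_coefficients m h N p C"
  shows "\<exists>R d. optimality_system m h N p C R d"
proof -
  have fin: "error_norm m h N p C < \<infinity>" using opt by (simp add: optimal_coefficients_def)
  note exact = finite_error_norm_exact[OF p m fin]
  define u where "u \<beta> = fm m p (h * real \<beta>) - (\<Sum>\<gamma>=0..N. C \<gamma> * \<psi> m (h * real \<beta> - h * real \<gamma>))" for \<beta>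
  define v where "v i \<beta> = (if i < m - 1 then (h * real \<beta>) ^ i else exp (- (h * real \<beta>)))" for i \<beta>
  have "\<exists>a. \<forall>\<beta>\<le>N. u \<beta> = (\<Sum>i<m. a i * v i \<beta>)"
  proof (rule linear_combination_of_annihilator)
    fix c assume c: "\<forall>i<m. (\<Sum>\<beta>=0..N. c \<beta> * v i \<beta>) = 0"
    have "annihilates_kernel m h N c"
      unfolding annihilates_kernel_def
    proof (intro conjI allI impI)
      fix \<alpha> assume "\<alpha> < m - 1"
      then show "(\<Sum>\<beta>=0..N. c \<beta> * (h * real \<beta>) ^ \<alpha>) = 0" using c[rule_format, of \<alpha>] by (simp add: v_def)
    next
      show "(\<Sum>\<beta>=0..N. c \<beta> * exp (- (h * real \<beta>))) = 0" using c[rule_format, of "m-1"] m by (simp add: v_def)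
    qed
    from optimal_stationary[OF p m N h opt this]
    show "(\<Sum>\<beta>=0..N. c \<beta> * u \<beta>) = 0"
      unfolding error_functional_representer[OF p] u_def by simp
  qed
  then obtain a where a: "\<And>\<beta>. \<beta> \<le> N \<Longrightarrow> u \<beta> = (\<Sum>i<m. a i * v i \<beta>)" by blast
  define R where "R = (\<Sum>i<m-1. monom (a i) i)"
  have R: "poly R x = (\<Sum>i<m-1. a i * x ^ i)" for x by (simp add: R_def poly_sum poly_monom)
  have "optimality_system m h N p C R (a (m-1))"
    unfolding optimality_system_def
  proof (intro conjI allI impI)
    fix i assume "m - 1 \<le> i"
    then show "coeff R i = 0" by (simp add: R_def coeff_sum)
  next
    fix \<beta> assume "\<beta> \<le> N"
    have "{..<m} = insert (m-1) {..<m-1}" using m by auto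
    then have "u \<beta> = a (m-1) * exp (- h * real \<beta>) + poly R (h * real \<beta>)"
      unfolding a[OF \<open>\<beta> \<le> N\<close>] R by (simp add: v_def)
    then show "(\<Sum>\<gamma>=0..N. C \<gamma> * \<psi> m (h * real \<beta> - h * real \<gamma>)) + poly R (h * real \<beta>) + a (m-1) * exp (- h * real \<beta>) = fm m p (h * real \<beta>)"
      by (simp add: u_def)
  next
    fix \<alpha> assume "\<alpha> < m - 1"
    then show "(\<Sum>\<gamma>=0..N. C \<gamma> * (h * real \<gamma>) ^ \<alpha>) = q m p \<alpha>"
      using exact(1)[of \<alpha>] by (simp add: q_def error_functional_def)
  next
    show "(\<Sum>\<gamma>=0..N. C \<gamma> * exp (- h * real \<gamma>)) = q m p (m-1)"
      using exact(2) by (simp add: q_def error_functional_def)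
  qed
  then show ?thesis by blast
qed

section \<open>The optimal coefficients\<close>

lemma moment_expansion:
  fixes C :: "nat \<Rightarrow> real"
  shows "(\<Sum>\<gamma>=0..N. C \<gamma> * ((t - h * real \<gamma>) ^ n / fact n))
    = (\<Sum>\<alpha>=0..n. t ^ (n-\<alpha>) * (-1) ^ \<alpha> / (fact (n-\<alpha>) * fact \<alpha>) * (\<Sum>\<gamma>=0..N. C \<gamma> * (h * real \<gamma>) ^ \<alpha>))"
proof -
  have "C \<gamma> * ((t - h * real \<gamma>) ^ n / fact n)
     = (\<Sum>\<alpha>=0..n. t ^ (n-\<alpha>) * (-1) ^ \<alpha> / (fact (n-\<alpha>) * fact \<alpha>) * (C \<gamma> * (h * real \<gamma>) ^ \<alpha>))" for \<gamma>
  proof -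
    have "(- (h * real \<gamma>) + t) ^ n = (\<Sum>\<alpha>\<le>n. real (n choose \<alpha>) * (- (h * real \<gamma>)) ^ \<alpha> * t ^ (n-\<alpha>))"
      by (rule binomial_ring)
    then have "C \<gamma> * ((t - h * real \<gamma>) ^ n / fact n)
       = (\<Sum>\<alpha>=0..n. C \<gamma> * (real (n choose \<alpha>) * (- (h * real \<gamma>)) ^ \<alpha> * t ^ (n-\<alpha>)) / fact n)"
      by (simp add: sum_distrib_left sum_divide_distrib atMost_atLeast0)
    also have "\<dots> = (\<Sum>\<alpha>=0..n. t ^ (n-\<alpha>) * (-1) ^ \<alpha> / (fact (n-\<alpha>) * fact \<alpha>) * (C \<gamma> * (h * real \<gamma>) ^ \<alpha>))"
    proof (intro sum.cong refl)
      fix \<alpha> assume "\<alpha> \<in> {0..n}"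
      then have "real (n choose \<alpha>) = fact n / (fact \<alpha> * fact (n-\<alpha>))" by (simp add: binomial_fact)
      moreover have "(- (h * real \<gamma>)) ^ \<alpha> = (-1) ^ \<alpha> * (h * real \<gamma>) ^ \<alpha>" by (rule power_minus)
      ultimately show "C \<gamma> * (real (n choose \<alpha>) * (- (h * real \<gamma>)) ^ \<alpha> * t ^ (n-\<alpha>)) / fact n
        = t ^ (n-\<alpha>) * (-1) ^ \<alpha> / (fact (n-\<alpha>) * fact \<alpha>) * (C \<gamma> * (h * real \<gamma>) ^ \<alpha>)"
        by (simp add: mult_ac)
    qed
    finally show ?thesis .
  qed
  then show ?thesis by (simp only: sum_distrib_left) (rule sum.swap)
qed

text \<open>For \<open>k < (m+1) div 2\<close> the exponent \<open>2*k-1\<close> is at most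
  \<open>m-2\<close>, so all moments involved are prescribed. From that index on the exponent
  reaches \<open>m-1\<close>, and the moments of order at least \<open>m-1\<close> are collected in
  \<open>Q_low\<close>.\<close>

lemma Q_high_plus_Q_low:
  assumes m: "m \<ge> 1" and mom: "\<And>\<alpha>. \<alpha> < m-1 \<Longrightarrow> (\<Sum>\<gamma>=0..N. C \<gamma> * (h * real \<gamma>) ^ \<alpha>) = q m p \<alpha>"
  shows "(\<Sum>\<gamma>=0..N. C \<gamma> * (\<Sum>k=1..m-1. (t - h * real \<gamma>) ^ (2*k-1) / fact (2*k-1))) / 2
     = Q_high m p t + Q_low m h N C t"
proof -
  define M where "M \<alpha> = (\<Sum>\<gamma>=0..N. C \<gamma> * (h * real \<gamma>) ^ \<alpha>)" for \<alpha>
  define c where "c k \<alpha> = t ^ (2*k-1-\<alpha>) * (-1) ^ \<alpha> / (fact (2*k-1-\<alpha>) * fact \<alpha>)" for k \<alpha>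
  have M: "M \<alpha> = q m p \<alpha>" if "\<alpha> < m-1" for \<alpha> using mom[OF that] by (simp add: M_def)
  have "(\<Sum>\<gamma>=0..N. C \<gamma> * (\<Sum>k=1..m-1. (t - h * real \<gamma>) ^ (2*k-1) / fact (2*k-1)))
     = (\<Sum>k=1..m-1. \<Sum>\<gamma>=0..N. C \<gamma> * ((t - h * real \<gamma>) ^ (2*k-1) / fact (2*k-1)))"
    by (simp only: sum_distrib_left) (rule sum.swap)
  also have "\<dots> = (\<Sum>k=1..m-1. \<Sum>\<alpha>=0..2*k-1. c k \<alpha> * M \<alpha>)"
    unfolding moment_expansion c_def M_def ..
  also have "\<dots> = (\<Sum>k\<in>{1..<(m+1) div 2} \<union> {(m+1) div 2..m-1}. \<Sum>\<alpha>=0..2*k-1. c k \<alpha> * M \<alpha>)"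
    by (rule sum.cong) (use m in auto)
  also have "\<dots> = (\<Sum>k\<in>{1..<(m+1) div 2}. \<Sum>\<alpha>=0..2*k-1. c k \<alpha> * M \<alpha>) + (\<Sum>k\<in>{(m+1) div 2..m-1}. \<Sum>\<alpha>=0..2*k-1. c k \<alpha> * M \<alpha>)"
    by (rule sum.union_disjoint) auto
  also have "(\<Sum>k\<in>{1..<(m+1) div 2}. \<Sum>\<alpha>=0..2*k-1. c k \<alpha> * M \<alpha>) = (\<Sum>k\<in>{1..<(m+1) div 2}. \<Sum>\<alpha>=0..2*k-1. c k \<alpha> * q m p \<alpha>)"
    by (intro sum.cong refl) (subst M, auto)
  also have "(\<Sum>k\<in>{(m+1) div 2..m-1}. \<Sum>\<alpha>=0..2*k-1. c k \<alpha> * M \<alpha>)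
     = (\<Sum>k\<in>{(m+1) div 2..m-1}. \<Sum>\<alpha><m-1. c k \<alpha> * q m p \<alpha>) + (\<Sum>k\<in>{(m+1) div 2..m-1}. \<Sum>\<alpha>=m-1..2*k-1. c k \<alpha> * M \<alpha>)"
    unfolding sum.distrib[symmetric]
  proof (intro sum.cong refl)
    fix k assume "k \<in> {(m+1) div 2..m-1}"
    then have "{0..2*k-1} = {..<m-1} \<union> {m-1..2*k-1}" by auto
    then have "(\<Sum>\<alpha>=0..2*k-1. c k \<alpha> * M \<alpha>) = (\<Sum>\<alpha>\<in>{..<m-1} \<union> {m-1..2*k-1}. c k \<alpha> * M \<alpha>)" by simp
    also have "\<dots> = (\<Sum>\<alpha><m-1. c k \<alpha> * M \<alpha>) + (\<Sum>\<alpha>=m-1..2*k-1. c k \<alpha> * M \<alpha>)"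
      by (rule sum.union_disjoint) auto
    finally show "(\<Sum>\<alpha>=0..2*k-1. c k \<alpha> * M \<alpha>) = (\<Sum>\<alpha><m-1. c k \<alpha> * q m p \<alpha>) + (\<Sum>\<alpha>=m-1..2*k-1. c k \<alpha> * M \<alpha>)"
      using M by simp
  qed
  finally have "(\<Sum>\<gamma>=0..N. C \<gamma> * (\<Sum>k=1..m-1. (t - h * real \<gamma>) ^ (2*k-1) / fact (2*k-1)))
     = (\<Sum>k\<in>{1..<(m+1) div 2}. \<Sum>\<alpha>=0..2*k-1. c k \<alpha> * q m p \<alpha>)
      + ((\<Sum>k\<in>{(m+1) div 2..m-1}. \<Sum>\<alpha><m-1. c k \<alpha> * q m p \<alpha>) + (\<Sum>k\<in>{(m+1) div 2..m-1}. \<Sum>\<alpha>=m-1..2*k-1. c k \<alpha> * M \<alpha>))" .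
  then show ?thesis unfolding Q_high_def Q_low_def c_def M_def by simp
qed

text \<open>The moment against \<open>exp (- x)\<close> is prescribed and becomes
  \<open>q m p (m-1)\<close>; the one against \<open>exp x\<close> is not, and survives as
  \<open>D_const\<close>.\<close>

lemma psi_branch_convolution:
  assumes m: "m \<ge> 1" and sys: "optimality_system m h N p C R d"
  shows "(\<Sum>\<gamma>=0..N. C \<gamma> * psi_branch m 0 (t - h * real \<gamma>))
     = exp t / 4 * q m p (m-1) - exp (- t) * D_const h N C - (Q_high m p t + Q_low m h N C t)"
proof -
  have mom: "\<And>\<alpha>. \<alpha> < m-1 \<Longrightarrow> (\<Sum>\<gamma>=0..N. C \<gamma> * (h * real \<gamma>) ^ \<alpha>) = q m p \<alpha>"
    and ex: "(\<Sum>\<gamma>=0..N. C \<gamma> * exp (- h * real \<gamma>)) = q m p (m-1)"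
    using sys by (auto simp: optimality_system_def)
  define S where "S \<gamma> = (\<Sum>k=1..m-1. (t - h * real \<gamma>) ^ (2*k-1) / fact (2*k-1))" for \<gamma>
  have "C \<gamma> * psi_branch m 0 (t - h * real \<gamma>)
    = exp t / 4 * (C \<gamma> * exp (- h * real \<gamma>)) - exp (- t) * (1/4 * (C \<gamma> * exp (h * real \<gamma>))) - (1/2) * (C \<gamma> * S \<gamma>)" for \<gamma>
  proof -
    have "exp (t - h * real \<gamma>) = exp t * exp (- h * real \<gamma>)" "exp (- (t - h * real \<gamma>)) = exp (- t) * exp (h * real \<gamma>)"
      by (simp_all flip: exp_add)
    then show ?thesis unfolding psi_branch_0 S_def[symmetric] by (simp add: field_simps)
  qed
  then have "(\<Sum>\<gamma>=0..N. C \<gamma> * psi_branch m 0 (t - h * real \<gamma>))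
     = exp t / 4 * (\<Sum>\<gamma>=0..N. C \<gamma> * exp (- h * real \<gamma>)) - exp (- t) * (1/4 * (\<Sum>\<gamma>=0..N. C \<gamma> * exp (h * real \<gamma>)))
      - (1/2) * (\<Sum>\<gamma>=0..N. C \<gamma> * S \<gamma>)"
    by (simp only: sum_subtractf sum_distrib_left)
  moreover have "(1/2) * (\<Sum>\<gamma>=0..N. C \<gamma> * S \<gamma>) = Q_high m p t + Q_low m h N C t"
    using Q_high_plus_Q_low[OF m mom, of t] by (simp add: S_def)
  ultimately show ?thesis by (simp only: ex D_const_def)
qed

section \<open>The optimality equations beyond the nodes: closed form and growth\<close>

definition extended_lhs :: "nat \<Rightarrow> real \<Rightarrow> nat \<Rightarrow> (nat \<Rightarrow> real) \<Rightarrow> real poly \<Rightarrow> real \<Rightarrow> real \<Rightarrow> real" where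
  "extended_lhs m h N C R d t = (\<Sum>\<gamma>=0..N. C \<gamma> * \<psi> m (t - h * real \<gamma>)) + poly R t + d * exp (- t)"

text \<open>Left of all nodes every argument of \<open>\<psi> m\<close> is negative, so
  \<open>\<psi> m\<close> is minus its branch throughout; \<open>n \<ge> 1\<close> makes the
  inequality strict.\<close>

lemma left_term_eq:
  assumes m: "m \<ge> 1" and h: "h > 0" and sys: "optimality_system m h N p C R d" and n: "n \<ge> 1"
  shows "left_term m h N p C R d n = extended_lhs m h N C R d (- h * real n) - fm m p (- h * real n)"
proof -
  let ?t = "- h * real n"
  have "\<psi> m (?t - h * real \<gamma>) = - psi_branch m 0 (?t - h * real \<gamma>)" for \<gamma>
  proof -
    have "0 < h * real n" "0 \<le> h * real \<gamma>" using h n by auto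
    then have "?t - h * real \<gamma> < 0" by simp
    then show ?thesis by (simp add: psi_eq)
  qed
  then have "(\<Sum>\<gamma>=0..N. C \<gamma> * \<psi> m (?t - h * real \<gamma>)) = - (\<Sum>\<gamma>=0..N. C \<gamma> * psi_branch m 0 (?t - h * real \<gamma>))"
    by (simp add: sum_negf)
  also have "\<dots> = - (exp ?t / 4 * q m p (m-1) - exp (- ?t) * D_const h N C - (Q_high m p ?t + Q_low m h N C ?t))"
    by (simp only: psi_branch_convolution[OF m sys])
  finally show ?thesis
    by (simp add: left_term_def extended_lhs_def Q_minus_def a_minus_def algebra_simps)
qed

text \<open>Right of all nodes \<open>\<psi> m\<close> is its branch throughout, so
  \<open>Q_low\<close> and \<open>D_const\<close> enter with the sign opposite to that on the
  left.\<close>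

lemma right_term_eq:
  assumes m: "m \<ge> 1" and h: "h > 0" and hN: "h * real N = 1" and sys: "optimality_system m h N p C R d" and n: "n \<ge> 1"
  shows "right_term m h N p C R d n = extended_lhs m h N C R d (1 + h * real n) - fm m p (1 + h * real n)"
proof -
  let ?t = "1 + h * real n"
  have "\<psi> m (?t - h * real \<gamma>) = psi_branch m 0 (?t - h * real \<gamma>)" if "\<gamma> \<in> {0..N}" for \<gamma>
  proof -
    have "h * real \<gamma> \<le> h * real N" using that h by (intro mult_left_mono) auto
    moreover have "0 < h * real n" using h n by auto
    ultimately have "?t - h * real \<gamma> > 0" using hN by linarith
    then show ?thesis by (simp add: psi_eq)
  qed
  then have "(\<Sum>\<gamma>=0..N. C \<gamma> * \<psi> m (?t - h * real \<gamma>)) = (\<Sum>\<gamma>=0..N. C \<gamma> * psi_branch m 0 (?t - h * real \<gamma>))"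
    by simp
  also have "\<dots> = exp ?t / 4 * q m p (m-1) - exp (- ?t) * D_const h N C - (Q_high m p ?t + Q_low m h N C ?t)"
    by (rule psi_branch_convolution[OF m sys])
  finally show ?thesis
    by (simp add: right_term_def extended_lhs_def Q_plus_def a_plus_def algebra_simps)
qed

text \<open>At \<open>t = h * \<gamma>\<close> this is growth of order
  \<open>exp (h * |\<gamma>|)\<close>, the hypothesis of \<open>growth_summable\<close>.\<close>

lemma fm_growth:
  assumes p: "weight_function p"
  obtains K where "\<And>t. \<bar>fm m p t\<bar> \<le> K * exp \<bar>t\<bar>"
proof -
  have pnn: "p x \<ge> 0" if "x \<in> {0..1}" for x using p that by (simp add: weight_function_def)
  define K where "K = (LINT x|lebesgue_on {0..1}. p x) * exp 1"
  have "\<bar>fm m p t\<bar> \<le> K * exp \<bar>t\<bar>" for t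
  proof -
    have "\<bar>LINT x|lebesgue_on {0..1}. p x * \<psi> m (x - t)\<bar> \<le> (LINT x|lebesgue_on {0..1}. p x * (exp 1 * exp \<bar>t\<bar>))"
    proof (rule integral_abs_bound_integral)
      have "continuous_on {0..1} (\<lambda>x. \<psi> m (x - t))"
        by (rule continuous_on_compose2[OF continuous_on_psi[of UNIV]]) (auto intro!: continuous_intros)
      then show "integrable (lebesgue_on {0..1}) (\<lambda>x. p x * \<psi> m (x - t))" by (rule weight_integrable[OF p])
      show "integrable (lebesgue_on {0..1}) (\<lambda>x. p x * (exp 1 * exp \<bar>t\<bar>))" by (rule weight_integrable[OF p]) simp
      fix x :: real assume "x \<in> space (lebesgue_on {0..1})"
      then have x: "x \<in> {0..1}" by simp
      have "\<bar>\<psi> m (x - t)\<bar> \<le> exp \<bar>x - t\<bar>" by (rule psi_bound)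
      also have "\<dots> \<le> exp (1 + \<bar>t\<bar>)" using x by auto
      finally have "\<bar>\<psi> m (x - t)\<bar> \<le> exp 1 * exp \<bar>t\<bar>" by (simp add: exp_add)
      then show "\<bar>p x * \<psi> m (x - t)\<bar> \<le> p x * (exp 1 * exp \<bar>t\<bar>)"
        using pnn[OF x] by (simp add: abs_mult mult_left_mono)
    qed
    then show ?thesis by (simp add: fm_def K_def mult.assoc)
  qed
  then show thesis by (rule that)
qed

lemma poly_growth:
  fixes R :: "real poly"
  obtains K where "\<And>t. \<bar>poly R t\<bar> \<le> K * exp \<bar>t\<bar>"
proof -
  define K where "K = (\<Sum>i\<le>degree R. \<bar>coeff R i\<bar> * fact i)"
  have pw: "\<bar>t\<bar> ^ i \<le> fact i * exp \<bar>t\<bar>" for t :: real and i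
  proof -
    obtain u where "exp \<bar>t\<bar> = (\<Sum>k<Suc i. \<bar>t\<bar> ^ k / fact k) + exp u / fact (Suc i) * \<bar>t\<bar> ^ Suc i"
      using Maclaurin_exp_le[of "\<bar>t\<bar>" "Suc i"] by blast
    moreover have "exp u / fact (Suc i) * \<bar>t\<bar> ^ Suc i \<ge> 0" by simp
    moreover have "(\<Sum>k<i. \<bar>t\<bar> ^ k / fact k) \<ge> 0" by (intro sum_nonneg) simp
    ultimately have "\<bar>t\<bar> ^ i / fact i \<le> exp \<bar>t\<bar>" by (simp del: fact_Suc power_Suc)
    then show ?thesis by (simp add: field_simps)
  qed
  have "\<bar>poly R t\<bar> \<le> K * exp \<bar>t\<bar>" for t
  proof -
    have "\<bar>poly R t\<bar> \<le> (\<Sum>i\<le>degree R. \<bar>coeff R i * t ^ i\<bar>)" unfolding poly_altdef by (rule sum_abs)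
    also have "\<dots> \<le> (\<Sum>i\<le>degree R. (\<bar>coeff R i\<bar> * fact i) * exp \<bar>t\<bar>)"
      by (intro sum_mono) (simp add: abs_mult power_abs mult.assoc mult_left_mono pw)
    also have "\<dots> = K * exp \<bar>t\<bar>" by (simp add: K_def sum_distrib_right)
    finally show ?thesis .
  qed
  then show thesis by (rule that)
qed

lemma extended_lhs_growth:
  assumes h: "h > 0"
  obtains K where "\<And>t. \<bar>extended_lhs m h N C R d t\<bar> \<le> K * exp \<bar>t\<bar>"
proof -
  obtain K where K: "\<And>t. \<bar>poly R t\<bar> \<le> K * exp \<bar>t\<bar>" by (rule poly_growth) (rule that)
  define K' where "K' = (\<Sum>\<gamma>=0..N. \<bar>C \<gamma>\<bar> * exp (h * real \<gamma>)) + K + \<bar>d\<bar>"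
  have "\<bar>extended_lhs m h N C R d t\<bar> \<le> K' * exp \<bar>t\<bar>" for t
  proof -
    have "\<bar>\<Sum>\<gamma>=0..N. C \<gamma> * \<psi> m (t - h * real \<gamma>)\<bar> \<le> (\<Sum>\<gamma>=0..N. \<bar>C \<gamma>\<bar> * exp (h * real \<gamma>) * exp \<bar>t\<bar>)"
    proof (rule order_trans[OF sum_abs sum_mono])
      fix \<gamma>
      have "\<bar>\<psi> m (t - h * real \<gamma>)\<bar> \<le> exp \<bar>t - h * real \<gamma>\<bar>" by (rule psi_bound)
      also have "\<dots> \<le> exp (h * real \<gamma> + \<bar>t\<bar>)"
      proof -
        have "0 \<le> h * real \<gamma>" using h by simp
        then have "\<bar>t - h * real \<gamma>\<bar> \<le> h * real \<gamma> + \<bar>t\<bar>" by linarith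
        then show ?thesis by simp
      qed
      finally show "\<bar>C \<gamma> * \<psi> m (t - h * real \<gamma>)\<bar> \<le> \<bar>C \<gamma>\<bar> * exp (h * real \<gamma>) * exp \<bar>t\<bar>"
        by (simp add: abs_mult exp_add mult.assoc mult_left_mono)
    qed
    moreover have "\<bar>d * exp (- t)\<bar> \<le> \<bar>d\<bar> * exp \<bar>t\<bar>" by (simp add: abs_mult mult_left_mono)
    ultimately have "\<bar>extended_lhs m h N C R d t\<bar> \<le> (\<Sum>\<gamma>=0..N. \<bar>C \<gamma>\<bar> * exp (h * real \<gamma>) * exp \<bar>t\<bar>) + K * exp \<bar>t\<bar> + \<bar>d\<bar> * exp \<bar>t\<bar>"
      using K[of t] unfolding extended_lhs_def by linarith
    then show ?thesis by (simp add: K'_def distrib_right sum_distrib_right)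
  qed
  then show thesis by (rule that)
qed

section \<open>The contribution of the two tails\<close>

context discrete_operator begin

lemma geometric_growth_summable:
  fixes B :: "nat \<Rightarrow> real"
  assumes k: "k \<in> {1..m-1}" and B: "\<And>n. n \<ge> 1 \<Longrightarrow> \<bar>B n\<bar> \<le> K * exp (h * real n)"
  shows "summable (\<lambda>n. norm (lam k ^ Suc n * of_real (B (Suc n))))"
proof (rule summable_comparison_test')
  define r where "r = cmod (lam k) * exp h"
  have "cmod (lam k) * exp h < exp (- h) * exp h" using inner[OF k] by simp
  then have r: "0 \<le> r" "r < 1" by (simp_all add: r_def flip: exp_add)
  then have "summable (\<lambda>n. r ^ n)" by (simp add: summable_geometric)
  then show "summable (\<lambda>n. K * r ^ Suc n)" by (intro summable_mult) (simp add: summable_mult)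
  fix n :: nat
  have "\<bar>B (Suc n)\<bar> \<le> K * exp h ^ Suc n"
    using B[of "Suc n"] by (simp only: exp_of_nat_mult[symmetric] mult.commute[of h])
  then have "cmod (lam k) ^ Suc n * \<bar>B (Suc n)\<bar> \<le> cmod (lam k) ^ Suc n * (K * exp h ^ Suc n)"
    by (rule mult_left_mono) simp
  then show "norm (norm (lam k ^ Suc n * of_real (B (Suc n)))) \<le> K * r ^ Suc n"
    by (simp only: norm_mult norm_power norm_of_real r_def power_mult_distrib real_norm_def abs_mult abs_idempotent power_abs abs_norm_cancel)
       (simp only: mult_ac)
qed

text \<open>The distances are \<open>b + n + 1\<close>, so each geometric part factors into
  \<open>lam k ^ b\<close> and the series in \<open>series_coeff\<close>. Distance 1 is attained
  only for \<open>b = n = 0\<close> and yields \<open>end_coeff\<close>; distance 0 does not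
  occur.\<close>

lemma tail_has_sum:
  fixes B :: "nat \<Rightarrow> real"
  assumes B: "\<And>n. n \<ge> 1 \<Longrightarrow> \<bar>B n\<bar> \<le> K * exp (h * real n)"
  shows "((\<lambda>n. D (int b + int (Suc n)) * of_real (B (Suc n))) has_sum
     ((\<Sum>k=1..m-1. series_coeff m h B (lam k) * lam k ^ b) + (if b = 0 then end_coeff m h B else 0))) UNIV"
proof -
  have Dn: "D (int b + int (Suc n)) = 1 / pl * (- 2 * of_real (exp h) * (if b + n = 0 then 1 else 0)
     + (\<Sum>k=1..m-1. A k / lam k * lam k ^ (b + Suc n)))" for n
  proof -
    have "\<bar>int b + int (Suc n)\<bar> = int (b + Suc n)" by simp
    moreover have "int (b + Suc n) = 1 \<longleftrightarrow> b + n = 0" by linarith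
    moreover have "int b + int (Suc n) \<noteq> 0" by simp
    ultimately show ?thesis unfolding D_formula by (simp only: nat_int if_False mult_zero_right add_0_right)
  qed
  have 1: "((\<lambda>n. if b + n = 0 then complex_of_real (B (Suc n)) else 0) has_sum (if b = 0 then of_real (B 1) else 0)) UNIV"
  proof -
    have "((\<lambda>n. if b + n = 0 then complex_of_real (B (Suc n)) else 0) has_sum (\<Sum>n\<in>{0}. if b + n = 0 then complex_of_real (B (Suc n)) else 0)) {0}"
      by (rule has_sum_finite) simp
    moreover have "(\<Sum>n\<in>{0}. if b + n = 0 then complex_of_real (B (Suc n)) else 0) = (if b = 0 then of_real (B 1) else 0)" by simp
    ultimately have "((\<lambda>n. if b + n = 0 then complex_of_real (B (Suc n)) else 0) has_sum (if b = 0 then of_real (B 1) else 0)) {0}" by (simp only:)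
    then show ?thesis by (rule has_sum_cong_neutral[THEN iffD1, rotated -1]) auto
  qed
  have 2: "((\<lambda>n. \<Sum>k=1..m-1. A k / lam k * lam k ^ b * (lam k ^ Suc n * of_real (B (Suc n)))) has_sum
     (\<Sum>k=1..m-1. A k / lam k * lam k ^ b * (\<Sum>n. lam k ^ Suc n * of_real (B (Suc n))))) UNIV"
  proof (intro has_sum_finite_sum has_sum_cmult_right finite_atLeastAtMost)
    fix k assume k: "k \<in> {1..m-1}"
    have s: "summable (\<lambda>n. norm (lam k ^ Suc n * of_real (B (Suc n))))"
      by (rule geometric_growth_summable[OF k B])
    show "((\<lambda>n. lam k ^ Suc n * of_real (B (Suc n))) has_sum (\<Sum>n. lam k ^ Suc n * of_real (B (Suc n)))) UNIV"
      by (rule norm_summable_imp_has_sum[OF s summable_sums[OF summable_norm_cancel[OF s]]])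
  qed
  have "((\<lambda>n. 1 / pl * (- 2 * of_real (exp h) * (if b + n = 0 then complex_of_real (B (Suc n)) else 0)
        + (\<Sum>k=1..m-1. A k / lam k * lam k ^ b * (lam k ^ Suc n * of_real (B (Suc n)))))) has_sum
     (1 / pl * (- 2 * of_real (exp h) * (if b = 0 then of_real (B 1) else 0)
        + (\<Sum>k=1..m-1. A k / lam k * lam k ^ b * (\<Sum>n. lam k ^ Suc n * of_real (B (Suc n))))))) UNIV"
    by (intro has_sum_cmult_right has_sum_add 1 2)
  moreover have "1 / pl * (- 2 * of_real (exp h) * (if b + n = 0 then complex_of_real (B (Suc n)) else 0)
        + (\<Sum>k=1..m-1. A k / lam k * lam k ^ b * (lam k ^ Suc n * of_real (B (Suc n)))))
      = D (int b + int (Suc n)) * of_real (B (Suc n))" for n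
  proof -
    have "(\<Sum>k=1..m-1. A k / lam k * lam k ^ b * (lam k ^ Suc n * of_real (B (Suc n))))
       = (\<Sum>k=1..m-1. A k / lam k * lam k ^ (b + Suc n)) * of_real (B (Suc n))"
      unfolding sum_distrib_right by (intro sum.cong refl) (simp only: power_add mult_ac)
    moreover have "(if b + n = 0 then complex_of_real (B (Suc n)) else 0) = (if b + n = 0 then 1 else 0) * of_real (B (Suc n))" by simp
    ultimately show ?thesis unfolding Dn by (simp only: ring_distribs mult.assoc)
  qed
  moreover have "1 / pl * (- 2 * of_real (exp h) * (if b = 0 then of_real (B 1) else 0)
        + (\<Sum>k=1..m-1. A k / lam k * lam k ^ b * (\<Sum>n. lam k ^ Suc n * of_real (B (Suc n)))))
     = (\<Sum>k=1..m-1. series_coeff m h B (lam k) * lam k ^ b) + (if b = 0 then end_coeff m h B else 0)"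
  proof -
    have "1 / pl * (\<Sum>k=1..m-1. A k / lam k * lam k ^ b * (\<Sum>n. lam k ^ Suc n * of_real (B (Suc n))))
       = (\<Sum>k=1..m-1. series_coeff m h B (lam k) * lam k ^ b)"
      unfolding sum_distrib_left series_coeff_def by (intro sum.cong refl) (simp add: mult_ac)
    moreover have "1 / pl * (- 2 * of_real (exp h) * (if b = 0 then of_real (B 1) else 0)) = (if b = 0 then end_coeff m h B else 0)"
      by (simp add: end_coeff_def)
    ultimately show ?thesis by (simp only: distrib_left add.commute)
  qed
  ultimately show ?thesis by (simp only:)
qed

text \<open>Each shifted \<open>\<psi> m\<close> contributes a unit at its own node. The polynomial
  part has powers below \<open>m-1 \<le> 2*m-2\<close> and is annihilated, as is
  \<open>exp (- x)\<close>.\<close>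

lemma extended_lhs_has_sum:
  assumes R: "\<And>i. i \<ge> m-1 \<Longrightarrow> coeff R i = 0" and \<beta>: "\<beta> \<le> N"
  shows "((\<lambda>\<gamma>. D (int \<beta> - \<gamma>) * of_real (extended_lhs m h N C R d (h * of_int \<gamma>))) has_sum of_real (C \<beta>)) UNIV"
proof -
  have "((\<lambda>\<gamma>. (\<Sum>\<delta>=0..N. of_real (C \<delta>) * (D (int \<beta> - \<gamma>) * of_real (\<psi> m (h * of_int \<gamma> - h * of_int (int \<delta>)))))
       + (\<Sum>i<m-1. of_real (coeff R i * h ^ i) * (D (int \<beta> - \<gamma>) * of_int \<gamma> ^ i))
       + of_real d * (D (int \<beta> - \<gamma>) * of_real (exp (- 1 * (h * of_int \<gamma>))))) has_sum
     ((\<Sum>\<delta>=0..N. of_real (C \<delta>) * (if int \<beta> = int \<delta> then 1 else 0)) + (\<Sum>i<m-1. of_real (coeff R i * h ^ i) * 0) + of_real d * 0)) UNIV"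
    by (intro has_sum_add has_sum_finite_sum has_sum_cmult_right has_sum_psi_shift has_sum_power has_sum_exp) auto
  moreover have "(\<Sum>\<delta>=0..N. complex_of_real (C \<delta>) * (if int \<beta> = int \<delta> then 1 else 0)) + (\<Sum>i<m-1. of_real (coeff R i * h ^ i) * 0) + of_real d * 0 = of_real (C \<beta>)"
  proof -
    have "(\<Sum>\<delta>=0..N. complex_of_real (C \<delta>) * (if int \<beta> = int \<delta> then 1 else 0)) = (\<Sum>\<delta>=0..N. if \<delta> = \<beta> then of_real (C \<beta>) else 0)"
      by (intro sum.cong refl) auto
    then show ?thesis using \<beta> by simp
  qed
  moreover have "(\<Sum>\<delta>=0..N. of_real (C \<delta>) * (D (int \<beta> - \<gamma>) * of_real (\<psi> m (h * of_int \<gamma> - h * of_int (int \<delta>)))))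
       + (\<Sum>i<m-1. of_real (coeff R i * h ^ i) * (D (int \<beta> - \<gamma>) * of_int \<gamma> ^ i))
       + of_real d * (D (int \<beta> - \<gamma>) * of_real (exp (- 1 * (h * of_int \<gamma>))))
     = D (int \<beta> - \<gamma>) * of_real (extended_lhs m h N C R d (h * of_int \<gamma>))" for \<gamma>
  proof -
    have "poly R x = (\<Sum>i<m-1. coeff R i * x ^ i)" for x
    proof -
      have "poly R x = (\<Sum>i\<le>degree R. coeff R i * x ^ i)" by (rule poly_altdef)
      also have "\<dots> = (\<Sum>i<m-1. coeff R i * x ^ i)"
        by (rule sum.mono_neutral_cong) (use R in \<open>auto simp: not_less coeff_eq_0 le_degree\<close>)
      finally show ?thesis .
    qed
    then have "complex_of_real (poly R (h * of_int \<gamma>)) = (\<Sum>i<m-1. of_real (coeff R i * h ^ i) * of_int \<gamma> ^ i)"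
      by (simp add: power_mult_distrib mult.assoc)
    then show ?thesis
      by (simp add: extended_lhs_def distrib_left sum_distrib_left mult_ac)
  qed
  ultimately show ?thesis by (simp only:)
qed

end

lemma has_sum_outside_interval:
  fixes g :: "int \<Rightarrow> complex"
  assumes zero: "\<And>n. n \<le> N \<Longrightarrow> g (int n) = 0"
    and l: "((\<lambda>n. g (- int (Suc n))) has_sum l) UNIV" and r: "((\<lambda>n. g (int (N + Suc n))) has_sum r) UNIV"
  shows "(g has_sum (r + l)) UNIV"
proof (rule has_sum_int_split[OF _ l])
  have "bij_betw (\<lambda>n. N + Suc n) UNIV {Suc N..}"
    by (rule bij_betw_byWitness[where f' = "\<lambda>n. n - Suc N"]) auto
  from has_sum_reindex_bij_betw[OF this, of "\<lambda>n. g (int n)" r] r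
  have "((\<lambda>n. g (int n)) has_sum r) {Suc N..}" by simp
  then show "((\<lambda>n. g (int n)) has_sum r) UNIV"
    by (rule has_sum_cong_neutral[THEN iffD1, rotated -1]) (use zero in auto)
qed

theorem theorem3:
  fixes m N :: nat and h :: real and p :: "real \<Rightarrow> real"
    and lam :: "nat \<Rightarrow> complex" and C :: "nat \<Rightarrow> real"
  assumes "m \<ge> 1" and "N \<ge> 1" and "h = 1 / real N"
    and "weight_function p"
    and "bij_betw lam {1..m-1} {z. poly (P_poly m h) z = 0 \<and> cmod z < 1}"
    and "optimal_coefficients m h N p C"
  shows "(\<exists>R d. optimality_system m h N p C R d) \<and>
    (\<forall>\<beta>. (\<lambda>\<gamma>. D_op m h lam (\<beta> - \<gamma>) * fm_disc m h p \<gamma>) summable_on UNIV) \<and>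
    (\<forall>R d. optimality_system m h N p C R d \<longrightarrow>
      (let L = left_term m h N p C R d;
           T = right_term m h N p C R d;
           a = end_coeff m h L;
           b = end_coeff m h T;
           ak = (\<lambda>k. series_coeff m h L (lam k));
           bk = (\<lambda>k. series_coeff m h T (lam k));
           Df = disc_conv (D_op m h lam) (fm_disc m h p)
       in (\<forall>k\<in>{1..m-1}. summable (\<lambda>\<gamma>. lam k ^ Suc \<gamma> * of_real (L (Suc \<gamma>))) \<and>
                         summable (\<lambda>\<gamma>. lam k ^ Suc \<gamma> * of_real (T (Suc \<gamma>)))) \<and>
          of_real (C 0) = Df 0 + a + (\<Sum>k=1..m-1. ak k + bk k * lam k ^ N) \<and>
          (\<forall>\<beta>\<in>{1..N-1}. of_real (C \<beta>) =
             Df (int \<beta>) + (\<Sum>k=1..m-1. ak k * lam k ^ \<beta> + bk k * lam k ^ (N - \<beta>))) \<and>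
          of_real (C N) = Df (int N) + b + (\<Sum>k=1..m-1. ak k * lam k ^ N + bk k)))"
proof -
  note m = assms(1) and N = assms(2) and h = assms(3) and p = assms(4) and opt = assms(6)
  have h0: "h > 0" and hN: "h * real N = 1" using N h by auto
  have fin: "error_norm m h N p C < \<infinity>" using opt by (simp add: optimal_coefficients_def)
  have "m \<le> 2 * N"
    by (rule exactness_bound[OF p N h finite_error_norm_exact[OF p m fin]])
  then have "real m * h \<le> real (2 * N) * h" using h0 by (intro mult_right_mono) auto
  then have mh: "real m * h \<le> 2" using hN by (simp add: mult.commute mult.left_commute)
  interpret discrete_operator m h lam
  proof
    show "cmod (lam k) < exp (- h)" if "k \<in> {1..m-1}" for k
    proof -
      have "poly (P_poly m h) (lam k) = 0" "cmod (lam k) < 1" using assms(5) that by (auto simp: bij_betw_def)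
      then show ?thesis by (rule P_poly_inner_roots[OF m h0 mh])
    qed
  qed (use m h0 assms(5) in auto)
  obtain Kf where Kf: "\<And>t. \<bar>fm m p t\<bar> \<le> Kf * exp \<bar>t\<bar>" by (rule fm_growth[OF p]) (rule that)
  have fsum: "(\<lambda>\<gamma>. D (\<beta> - \<gamma>) * fm_disc m h p \<gamma>) summable_on UNIV" for \<beta>
  proof (rule abs_summable_summable, rule growth_summable)
    fix \<gamma> :: int
    show "cmod (fm_disc m h p \<gamma>) \<le> Kf * exp (h * \<bar>of_int \<gamma>\<bar>)"
      using Kf[of "h * of_int \<gamma>"] h0 by (simp add: fm_disc_def abs_mult)
  qed
  define Df where "Df = disc_conv D (fm_disc m h p)"
  have Df: "((\<lambda>\<gamma>. D (\<beta> - \<gamma>) * fm_disc m h p \<gamma>) has_sum Df \<beta>) UNIV" for \<beta>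
    unfolding Df_def disc_conv_def by (rule has_sum_infsum[OF fsum])
  have main: "(\<forall>k\<in>{1..m-1}. summable (\<lambda>\<gamma>. lam k ^ Suc \<gamma> * of_real (left_term m h N p C R d (Suc \<gamma>))) \<and>
                         summable (\<lambda>\<gamma>. lam k ^ Suc \<gamma> * of_real (right_term m h N p C R d (Suc \<gamma>)))) \<and>
     (\<forall>\<beta>\<le>N. of_real (C \<beta>) = Df (int \<beta>)
        + ((\<Sum>k=1..m-1. series_coeff m h (right_term m h N p C R d) (lam k) * lam k ^ (N - \<beta>))
           + (if N - \<beta> = 0 then end_coeff m h (right_term m h N p C R d) else 0)
        + ((\<Sum>k=1..m-1. series_coeff m h (left_term m h N p C R d) (lam k) * lam k ^ \<beta>)
           + (if \<beta> = 0 then end_coeff m h (left_term m h N p C R d) else 0))))"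
    if sys: "optimality_system m h N p C R d" for R d
  proof -
    define L where "L = left_term m h N p C R d"
    define T where "T = right_term m h N p C R d"
    define u where "u = extended_lhs m h N C R d"
    obtain Ku where Ku: "\<And>t. \<bar>u t\<bar> \<le> Ku * exp \<bar>t\<bar>"
      unfolding u_def by (rule extended_lhs_growth[OF h0, where m=m and N=N and C=C and R=R and d=d]) (auto intro: that)
    have Leq: "L n = u (- h * real n) - fm m p (- h * real n)" if "n \<ge> 1" for n
      unfolding L_def u_def by (rule left_term_eq[OF m h0 sys that])
    have Teq: "T n = u (1 + h * real n) - fm m p (1 + h * real n)" if "n \<ge> 1" for n
      unfolding T_def u_def by (rule right_term_eq[OF m h0 hN sys that])
    have LB: "\<bar>L n\<bar> \<le> (Ku + Kf) * exp (h * real n)" if "n \<ge> 1" for n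
    proof -
      have "\<bar>- h * real n\<bar> = h * real n" using h0 by (simp add: abs_mult)
      then have "\<bar>u (- h * real n)\<bar> \<le> Ku * exp (h * real n)" "\<bar>fm m p (- h * real n)\<bar> \<le> Kf * exp (h * real n)"
        using Ku[of "- h * real n"] Kf[of "- h * real n"] by simp_all
      then show ?thesis unfolding Leq[OF that] distrib_right by linarith
    qed
    \<comment> \<open>The arguments on this side are \<open>1 + h * n\<close>, hence the additional
      factor \<open>exp 1\<close>.\<close>
    have TB: "\<bar>T n\<bar> \<le> ((Ku + Kf) * exp 1) * exp (h * real n)" if "n \<ge> 1" for n
    proof -
      have "\<bar>1 + h * real n\<bar> = 1 + h * real n" using h0 by simp
      then have "\<bar>u (1 + h * real n)\<bar> \<le> Ku * exp 1 * exp (h * real n)" "\<bar>fm m p (1 + h * real n)\<bar> \<le> Kf * exp 1 * exp (h * real n)"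
        using Ku[of "1 + h * real n"] Kf[of "1 + h * real n"] by (simp_all add: exp_add mult.assoc)
      then show ?thesis unfolding Teq[OF that] distrib_right by linarith
    qed
    have R: "\<And>i. i \<ge> m-1 \<Longrightarrow> coeff R i = 0" using sys by (simp add: optimality_system_def)
    have node: "u (h * real n) = fm m p (h * real n)" if "n \<le> N" for n
      using sys that by (simp add: optimality_system_def u_def extended_lhs_def)
    have "of_real (C \<beta>) - Df (int \<beta>) =
         ((\<Sum>k=1..m-1. series_coeff m h T (lam k) * lam k ^ (N - \<beta>)) + (if N - \<beta> = 0 then end_coeff m h T else 0))
       + ((\<Sum>k=1..m-1. series_coeff m h L (lam k) * lam k ^ \<beta>) + (if \<beta> = 0 then end_coeff m h L else 0))"
      if \<beta>: "\<beta> \<le> N" for \<beta>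
    proof -
      \<comment> \<open>Its sum is evaluated in two ways: as a difference of two known convolutions,
        and over the two tails, outside of which it vanishes.\<close>
      define g where "g \<gamma> = D (int \<beta> - \<gamma>) * of_real (u (h * of_int \<gamma>)) - D (int \<beta> - \<gamma>) * fm_disc m h p \<gamma>" for \<gamma>
      have g: "g \<gamma> = D (int \<beta> - \<gamma>) * of_real (u (h * of_int \<gamma>) - fm m p (h * of_int \<gamma>))" for \<gamma>
        by (simp add: g_def fm_disc_def right_diff_distrib)
      have "(g has_sum (of_real (C \<beta>) - Df (int \<beta>))) UNIV"
        unfolding g_def u_def by (intro has_sum_diff Df extended_lhs_has_sum R \<beta>)
      moreover have "(g has_sum (((\<Sum>k=1..m-1. series_coeff m h T (lam k) * lam k ^ (N - \<beta>)) + (if N - \<beta> = 0 then end_coeff m h T else 0))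
       + ((\<Sum>k=1..m-1. series_coeff m h L (lam k) * lam k ^ \<beta>) + (if \<beta> = 0 then end_coeff m h L else 0)))) UNIV"
      proof (rule has_sum_outside_interval)
        show "g (int n) = 0" if "n \<le> N" for n using node[OF that] by (simp add: g)
        have "g (- int (Suc n)) = D (int \<beta> + int (Suc n)) * of_real (L (Suc n))" for n
        proof -
          have "h * of_int (- int (Suc n)) = - h * real (Suc n)" by (simp add: algebra_simps)
          moreover have "int \<beta> - - int (Suc n) = int \<beta> + int (Suc n)" by simp
          moreover have "L (Suc n) = u (- h * real (Suc n)) - fm m p (- h * real (Suc n))" by (rule Leq) simp
          ultimately show ?thesis unfolding g by (simp only:)
        qed
        then show "((\<lambda>n. g (- int (Suc n))) has_sum
          ((\<Sum>k=1..m-1. series_coeff m h L (lam k) * lam k ^ \<beta>) + (if \<beta> = 0 then end_coeff m h L else 0))) UNIV"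
          by (simp only:) (rule tail_has_sum[OF LB])
        \<comment> \<open>Counted from the right end, the distance to \<beta> is
          \<open>N - \<beta>\<close> plus the position in the tail; evenness of \<open>D_m\<close>
          reduces this to the pattern of the left tail.\<close>
        have "g (int (N + Suc n)) = D (int (N - \<beta>) + int (Suc n)) * of_real (T (Suc n))" for n
        proof -
          have "h * of_int (int (N + Suc n)) = 1 + h * real (Suc n)" using hN by (simp add: distrib_left)
          moreover have "D (int \<beta> - int (N + Suc n)) = D (int (N - \<beta>) + int (Suc n))"
          proof -
            have "int \<beta> - int (N + Suc n) = - (int (N - \<beta>) + int (Suc n))" using \<beta> by (simp add: of_nat_diff)
            then show ?thesis by (simp only: D_even)
          qed
          moreover have "T (Suc n) = u (1 + h * real (Suc n)) - fm m p (1 + h * real (Suc n))" by (rule Teq) simp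
          ultimately show ?thesis unfolding g by (simp only:)
        qed
        then show "((\<lambda>n. g (int (N + Suc n))) has_sum
          ((\<Sum>k=1..m-1. series_coeff m h T (lam k) * lam k ^ (N - \<beta>)) + (if N - \<beta> = 0 then end_coeff m h T else 0))) UNIV"
          by (simp only:) (rule tail_has_sum[OF TB])
      qed
      ultimately show ?thesis by (rule has_sum_unique)
    qed
    moreover have "summable (\<lambda>\<gamma>. lam k ^ Suc \<gamma> * of_real (L (Suc \<gamma>)))" "summable (\<lambda>\<gamma>. lam k ^ Suc \<gamma> * of_real (T (Suc \<gamma>)))"
      if "k \<in> {1..m-1}" for k
      by (rule summable_norm_cancel, rule geometric_growth_summable[OF that], erule LB)
         (rule summable_norm_cancel, rule geometric_growth_summable[OF that], erule TB)
    ultimately show ?thesis unfolding L_def[symmetric] T_def[symmetric]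
      by (auto simp: diff_eq_eq add.commute)
  qed
  show ?thesis
  proof (intro conjI allI impI)
    show "\<exists>R d. optimality_system m h N p C R d"
      by (rule optimal_imp_optimality_system[OF p m N h opt])
    show "(\<lambda>\<gamma>. D (\<beta> - \<gamma>) * fm_disc m h p \<gamma>) summable_on UNIV" for \<beta> by (rule fsum)
    fix R d assume "optimality_system m h N p C R d"
    note M = main[OF this]
    have a0: "N - N = 0" "N \<noteq> 0" "N - 0 = N" using N by auto
    show "let L = left_term m h N p C R d;
           T = right_term m h N p C R d;
           a = end_coeff m h L;
           b = end_coeff m h T;
           ak = (\<lambda>k. series_coeff m h L (lam k));
           bk = (\<lambda>k. series_coeff m h T (lam k));
           Df = disc_conv (D_op m h lam) (fm_disc m h p)
       in (\<forall>k\<in>{1..m-1}. summable (\<lambda>\<gamma>. lam k ^ Suc \<gamma> * of_real (L (Suc \<gamma>))) \<and>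
                         summable (\<lambda>\<gamma>. lam k ^ Suc \<gamma> * of_real (T (Suc \<gamma>)))) \<and>
          of_real (C 0) = Df 0 + a + (\<Sum>k=1..m-1. ak k + bk k * lam k ^ N) \<and>
          (\<forall>\<beta>\<in>{1..N-1}. of_real (C \<beta>) =
             Df (int \<beta>) + (\<Sum>k=1..m-1. ak k * lam k ^ \<beta> + bk k * lam k ^ (N - \<beta>))) \<and>
          of_real (C N) = Df (int N) + b + (\<Sum>k=1..m-1. ak k * lam k ^ N + bk k)"
      unfolding Let_def Df_def[symmetric]
    proof (intro conjI)
      show "\<forall>k\<in>{1..m-1}. summable (\<lambda>\<gamma>. lam k ^ Suc \<gamma> * of_real (left_term m h N p C R d (Suc \<gamma>))) \<and>
                         summable (\<lambda>\<gamma>. lam k ^ Suc \<gamma> * of_real (right_term m h N p C R d (Suc \<gamma>)))"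
        by (rule M[THEN conjunct1])
      note M2 = M[THEN conjunct2, rule_format]
      show "of_real (C 0) = Df 0 + end_coeff m h (left_term m h N p C R d)
        + (\<Sum>k=1..m-1. series_coeff m h (left_term m h N p C R d) (lam k) + series_coeff m h (right_term m h N p C R d) (lam k) * lam k ^ N)"
        using M2[of 0] a0 by (simp add: sum.distrib)
      show "of_real (C N) = Df (int N) + end_coeff m h (right_term m h N p C R d)
        + (\<Sum>k=1..m-1. series_coeff m h (left_term m h N p C R d) (lam k) * lam k ^ N + series_coeff m h (right_term m h N p C R d) (lam k))"
        using M2[of N] a0 by (simp add: sum.distrib)
      show "\<forall>\<beta>\<in>{1..N-1}. of_real (C \<beta>) = Df (int \<beta>)
        + (\<Sum>k=1..m-1. series_coeff m h (left_term m h N p C R d) (lam k) * lam k ^ \<beta> + series_coeff m h (right_term m h N p C R d) (lam k) * lam k ^ (N - \<beta>))"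
      proof
        fix \<beta> assume "\<beta> \<in> {1..N-1}"
        then have "\<beta> \<le> N" "\<beta> \<noteq> 0" "N - \<beta> \<noteq> 0" by auto
        then show "of_real (C \<beta>) = Df (int \<beta>)
          + (\<Sum>k=1..m-1. series_coeff m h (left_term m h N p C R d) (lam k) * lam k ^ \<beta> + series_coeff m h (right_term m h N p C R d) (lam k) * lam k ^ (N - \<beta>))"
          using M2[of \<beta>] by (simp add: sum.distrib)
      qed
    qed
  qed
qed

end
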